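(* Let $\mathbf{MF}$ denote the category of filtered $\Phi$-modules over $K/K_*$. Then: 1. Let $0\to\boldsymbol V'\to\boldsymbol V\to\boldsymbol V''\to0$ be a short exact sequence in $\mathbf{MF}$. If two of the three terms are weakly admissible, then so is the third one. 2. Let $\boldsymbol T:\boldsymbol V'\to\boldsymbol V$ be a morphism in $\mathbf{MF}$. If $\boldsymbol V'$ and $\boldsymbol V$ are weakly admissible, then $\boldsymbol T$ is strict, and $\ker\boldsymbol T$ and $\operatorname{coker}\boldsymbol T$ are weakly admissible. 3. The full subcategory of $\mathbf{MF}$ consisting of weakly admissible objects is an abelian category.
   Context: **Fields.** $p$ is a prime, $k$ is an algebraic extension of $\mathbb{F}_p$, $K_0=\mathrm{Frac}\,W(k)$. $K_*$ is a finite extension of $K_0$ with residue field $k$ to which the Frobenius automorphism of $K_0$ extends as an automorphism $\sigma$ (fixed). $K$ is a complete discrete valuation field extending $K_*$ with perfect residue field of characteristic $p$. $\mathrm{ord}$ is the $p$-adic valuation with $\mathrm{ord}\,p=1$. **Filtered modules.** A filtered module over $K$ is a finite-dimensional $K$-vector space $V$ with a collection $\{F^iV\}_{i\in\mathbb{R}}$ of subspaces such that $F^jV\subseteq F^iV$ for all $j>i$, which is exhaustive ($\bigcup_{i\in\mathbb{R}} F^iV=V$) and separated ($\bigcap_{i\in\mathbb{R}} F^iV=0$). Morphisms are $K$-linear maps $T:V'\to V$ with $T(F^iV')\subseteq F^iV$ for all $i\in\mathbb{R}$; $T$ is strict if $T(F^iV')=T(V')\cap F^iV$ for all $i\in\mathbb{R}$.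 A sequence of filtered modules is exact if its maps are strict and the underlying sequence of vector spaces is exact. $\mathrm{gr}^iV=F^iV/\bigcup_{j>i}F^jV$; the Hodge-Tate weights of $V$ are the $i\in\mathbb{R}$ with $\mathrm{gr}^iV\neq0$, and $t_{\mathrm H}(V)=\sum_{i}i\cdot\dim_K\mathrm{gr}^iV$, the sum being over the Hodge-Tate weights. **$\Phi$-modules.** A $\Phi$-module over $K_*$ is a finite-dimensional $K_*$-vector space $V$ with a bijective $\sigma$-semilinear endomorphism $\phi$; morphisms are linear maps commuting with the $\phi$'s. $t_{\mathrm N}(V,\phi)=\mathrm{ord}\,\lambda$, where $(\det\phi)(v)=\lambda v$ for any nonzero $v\in\det V$. **Filtered $\Phi$-modules over $K/K_*$.** Objects are triples $\boldsymbol V=((V,\phi),(V_K,F^* ),\iota)$ with $(V,\phi)$ a $\Phi$-module over $K_*$, $(V_K,F^* )$ a filtered module over $K$ and $\iota:V_K\to K\otimes_{K_*}V$ a $K$-linear isomorphism. Morphisms $((V',\phi'),(V'_K,F^* ),\iota')\to((V,\phi),(V_K,F^* ),\iota)$ are pairs $(T,T_K)$ of a morphism $T:V'\to V$ of $\Phi$-modules and a morphism $T_K:V'_K\to V_K$ of filtered modules with $T_K=\iota^{-1}\circ(1\otimes T)\circ\iota'$; such a morphism is strict if $T_K$ is. A sequence is exact if the associated sequences of $\Phi$-modules and of filtered modules are exact. Kernels carry the subspace filtration and cokernels the quotient filtration. $t_{\mathrm N}(\boldsymbol V)=t_{\mathrm N}(V,\phi)$, $t_{\mathrm H}(\boldsymbol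 V)=t_{\mathrm H}(V_K,F^* )$. $\boldsymbol V$ is weakly admissible if $t_{\mathrm N}(\boldsymbol V')\ge t_{\mathrm H}(\boldsymbol V')$ for every subobject $\boldsymbol V'$ of $\boldsymbol V$ in $\mathbf{MF}$, with equality when $\boldsymbol V'=\boldsymbol V$.
   Formalization: Filtrations are additionally required to be left-continuous (F^i is the intersection of the F^j with j<i); without this, part 2 fails, since the identity on a rank-one slope-0 object can be a non-strict morphism of weakly admissible objects. *)

theory Defs
  imports "Jordan_Normal_Form.VS_Connect" "HOL-Algebra.AbelCoset" "HOL-Computational_Algebra.Polynomial"
begin

section \<open>Categories\<close>

record ('o, 'm) cat =
  Obj :: "'o set"
  Hom :: "'o \<Rightarrow> 'o \<Rightarrow> 'm set"
  Ide :: "'o \<Rightarrow> 'm"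
  Comp :: "'o \<Rightarrow> 'o \<Rightarrow> 'o \<Rightarrow> 'm \<Rightarrow> 'm \<Rightarrow> 'm"

text \<open>\<open>Comp C A B D g f\<close> is the composite \<open>g \<circ> f\<close> of \<open>f : A \<rightarrow> B\<close> and \<open>g : B \<rightarrow> D\<close>. The objects
  are passed along because an element of \<open>'m\<close> need not determine its source and target.\<close>

definition category :: "('o, 'm) cat \<Rightarrow> bool" where
  "category C \<longleftrightarrow>
     (\<forall>A\<in>Obj C. Ide C A \<in> Hom C A A) \<and>
     (\<forall>A\<in>Obj C. \<forall>B\<in>Obj C. \<forall>D\<in>Obj C. \<forall>f\<in>Hom C A B. \<forall>g\<in>Hom C B D.
        Comp C A B D g f \<in> Hom C A D) \<and>
     (\<forall>A\<in>Obj C. \<forall>B\<in>Obj C. \<forall>f\<in>Hom C A B.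
        Comp C A A B f (Ide C A) = f \<and> Comp C A B B (Ide C B) f = f) \<and>
     (\<forall>A\<in>Obj C. \<forall>B\<in>Obj C. \<forall>D\<in>Obj C. \<forall>E\<in>Obj C.
        \<forall>f\<in>Hom C A B. \<forall>g\<in>Hom C B D. \<forall>h\<in>Hom C D E.
        Comp C A D E h (Comp C A B D g f) = Comp C A B E (Comp C B D E h g) f)"

definition full_subcategory :: "('o, 'm) cat \<Rightarrow> ('o \<Rightarrow> bool) \<Rightarrow> ('o, 'm) cat" where
  "full_subcategory C P = C\<lparr>Obj := {A \<in> Obj C. P A}\<rparr>"

definition monomorphism :: "('o, 'm) cat \<Rightarrow> 'o \<Rightarrow> 'o \<Rightarrow> 'm \<Rightarrow> bool" where
  "monomorphism C A B f \<longleftrightarrow> f \<in> Hom C A B \<and>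
     (\<forall>X\<in>Obj C. \<forall>g\<in>Hom C X A. \<forall>h\<in>Hom C X A. Comp C X A B f g = Comp C X A B f h \<longrightarrow> g = h)"

definition epimorphism :: "('o, 'm) cat \<Rightarrow> 'o \<Rightarrow> 'o \<Rightarrow> 'm \<Rightarrow> bool" where
  "epimorphism C A B f \<longleftrightarrow> f \<in> Hom C A B \<and>
     (\<forall>X\<in>Obj C. \<forall>g\<in>Hom C B X. \<forall>h\<in>Hom C B X. Comp C A B X g f = Comp C A B X h f \<longrightarrow> g = h)"

definition subobject :: "('o, 'm) cat \<Rightarrow> 'o \<Rightarrow> 'o \<Rightarrow> bool" where
  "subobject C A B \<longleftrightarrow> A \<in> Obj C \<and> B \<in> Obj C \<and> (\<exists>f. monomorphism C A B f)"

definition zero_object :: "('o, 'm) cat \<Rightarrow> 'o \<Rightarrow> bool" where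
  "zero_object C Z \<longleftrightarrow> Z \<in> Obj C \<and>
     (\<forall>A\<in>Obj C. (\<exists>!f. f \<in> Hom C A Z) \<and> (\<exists>!f. f \<in> Hom C Z A))"

definition preadditive ::
  "('o, 'm) cat \<Rightarrow> ('o \<Rightarrow> 'o \<Rightarrow> 'm \<Rightarrow> 'm \<Rightarrow> 'm) \<Rightarrow> ('o \<Rightarrow> 'o \<Rightarrow> 'm) \<Rightarrow> bool" where
  "preadditive C pls z \<longleftrightarrow> category C \<and>
     (\<forall>A\<in>Obj C. \<forall>B\<in>Obj C. comm_group \<lparr>carrier = Hom C A B, mult = pls A B, one = z A B\<rparr>) \<and>
     (\<forall>A\<in>Obj C. \<forall>B\<in>Obj C. \<forall>D\<in>Obj C.
        (\<forall>f\<in>Hom C A B. \<forall>f'\<in>Hom C A B. \<forall>g\<in>Hom C B D.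
           Comp C A B D g (pls A B f f') = pls A D (Comp C A B D g f) (Comp C A B D g f')) \<and>
        (\<forall>f\<in>Hom C A B. \<forall>g\<in>Hom C B D. \<forall>g'\<in>Hom C B D.
           Comp C A B D (pls B D g g') f = pls A D (Comp C A B D g f) (Comp C A B D g' f)))"

definition biproduct ::
  "('o, 'm) cat \<Rightarrow> ('o \<Rightarrow> 'o \<Rightarrow> 'm \<Rightarrow> 'm \<Rightarrow> 'm) \<Rightarrow> 'o \<Rightarrow> 'o \<Rightarrow> 'o \<Rightarrow> 'm \<Rightarrow> 'm \<Rightarrow> 'm \<Rightarrow> 'm \<Rightarrow> bool" where
  "biproduct C pls A B P i1 i2 p1 p2 \<longleftrightarrow> P \<in> Obj C \<and>
     i1 \<in> Hom C A P \<and> i2 \<in> Hom C B P \<and> p1 \<in> Hom C P A \<and> p2 \<in> Hom C P B \<and>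
     Comp C A P A p1 i1 = Ide C A \<and> Comp C B P B p2 i2 = Ide C B \<and>
     pls P P (Comp C P A P i1 p1) (Comp C P B P i2 p2) = Ide C P"

definition is_kernel ::
  "('o, 'm) cat \<Rightarrow> ('o \<Rightarrow> 'o \<Rightarrow> 'm) \<Rightarrow> 'o \<Rightarrow> 'o \<Rightarrow> 'm \<Rightarrow> 'o \<Rightarrow> 'm \<Rightarrow> bool" where
  "is_kernel C z A B f N i \<longleftrightarrow> N \<in> Obj C \<and> i \<in> Hom C N A \<and> Comp C N A B f i = z N B \<and>
     (\<forall>X\<in>Obj C. \<forall>g\<in>Hom C X A. Comp C X A B f g = z X B \<longrightarrow>
        (\<exists>!h. h \<in> Hom C X N \<and> Comp C X N A i h = g))"

definition is_cokernel ::
  "('o, 'm) cat \<Rightarrow> ('o \<Rightarrow> 'o \<Rightarrow> 'm) \<Rightarrow> 'o \<Rightarrow> 'o \<Rightarrow> 'm \<Rightarrow> 'o \<Rightarrow> 'm \<Rightarrow> bool" where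
  "is_cokernel C z A B f Q q \<longleftrightarrow> Q \<in> Obj C \<and> q \<in> Hom C B Q \<and> Comp C A B Q q f = z A Q \<and>
     (\<forall>X\<in>Obj C. \<forall>g\<in>Hom C B X. Comp C A B X g f = z A X \<longrightarrow>
        (\<exists>!h. h \<in> Hom C Q X \<and> Comp C B Q X h q = g))"

definition abelian_category :: "('o, 'm) cat \<Rightarrow> bool" where
  "abelian_category C \<longleftrightarrow> (\<exists>pls z. preadditive C pls z \<and>
     (\<exists>Z. zero_object C Z) \<and>
     (\<forall>A\<in>Obj C. \<forall>B\<in>Obj C. \<exists>P i1 i2 p1 p2. biproduct C pls A B P i1 i2 p1 p2) \<and>
     (\<forall>A\<in>Obj C. \<forall>B\<in>Obj C. \<forall>f\<in>Hom C A B.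
        (\<exists>N i. is_kernel C z A B f N i) \<and> (\<exists>Q q. is_cokernel C z A B f Q q)) \<and>
     (\<forall>A\<in>Obj C. \<forall>B\<in>Obj C. \<forall>f. monomorphism C A B f \<longrightarrow>
        (\<exists>D\<in>Obj C. \<exists>g\<in>Hom C B D. is_kernel C z B D g A f)) \<and>
     (\<forall>A\<in>Obj C. \<forall>B\<in>Obj C. \<forall>f. epimorphism C A B f \<longrightarrow>
        (\<exists>D\<in>Obj C. \<exists>g\<in>Hom C D A. is_cokernel C z D A g B f)))"


section \<open>The base fields\<close>

text \<open>For a perfect field \<open>k\<close> of characteristic \<open>p\<close>, \<open>W(k)\<close> is taken in the form of the strict
  \<open>p\<close>-ring with residue ring \<open>k\<close> (Serre, Local Fields, Chapter II, Section 5): \<open>p\<close> is not a zero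
  divisor, the ring is separated and complete for the \<open>p\<close>-adic topology, and reduction modulo \<open>p\<close>
  is \<open>k\<close>. Here it sits inside its field of fractions \<open>'k0\<close>, and \<open>red\<close> is only relevant on \<open>W\<close>.\<close>

definition witt_ring :: "nat \<Rightarrow> 'k0::field set \<Rightarrow> ('k0 \<Rightarrow> 'k::field) \<Rightarrow> bool" where
  "witt_ring p W red \<longleftrightarrow>
     1 \<in> W \<and> (\<forall>a\<in>W. \<forall>b\<in>W. a - b \<in> W \<and> a * b \<in> W) \<and>
     red 1 = 1 \<and> (\<forall>a\<in>W. \<forall>b\<in>W. red (a + b) = red a + red b \<and> red (a * b) = red a * red b) \<and>
     red ` W = UNIV \<and> (\<forall>a\<in>W. red a = 0 \<longleftrightarrow> (\<exists>b\<in>W. a = of_nat p * b)) \<and>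
     (of_nat p :: 'k0) \<noteq> 0 \<and>
     (\<forall>a\<in>W. (\<forall>n. \<exists>b\<in>W. a = of_nat p ^ n * b) \<longrightarrow> a = 0) \<and>
     (\<forall>s. (\<forall>n. s n \<in> W) \<and> (\<forall>n. \<exists>b\<in>W. s (Suc n) - s n = of_nat p ^ n * b) \<longrightarrow>
        (\<exists>a\<in>W. \<forall>n. \<exists>b\<in>W. a - s n = of_nat p ^ n * b))"

definition is_fraction_field :: "'k0::field set \<Rightarrow> bool" where
  "is_fraction_field W \<longleftrightarrow> (\<forall>x. \<exists>a\<in>W. \<exists>b\<in>W. b \<noteq> 0 \<and> x = a / b)"

definition frobenius_automorphism ::
  "nat \<Rightarrow> 'k0::field set \<Rightarrow> ('k0 \<Rightarrow> 'k::field) \<Rightarrow> ('k0 \<Rightarrow> 'k0) \<Rightarrow> bool" where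
  "frobenius_automorphism p W red F \<longleftrightarrow>
     field_hom F \<and> bij F \<and> F ` W = W \<and> (\<forall>a\<in>W. red (F a) = red a ^ p)"

text \<open>A valuation is a real-valued function on the nonzero elements; its value at \<open>0\<close> is
  irrelevant and plays the role of infinity.\<close>

definition val_ring :: "('f::field \<Rightarrow> real) \<Rightarrow> 'f set" where
  "val_ring v = {x. x = 0 \<or> v x \<ge> 0}"

definition val_ideal :: "('f::field \<Rightarrow> real) \<Rightarrow> 'f set" where
  "val_ideal v = {x. x = 0 \<or> v x > 0}"

definition discrete_valuation :: "('f::field \<Rightarrow> real) \<Rightarrow> bool" where
  "discrete_valuation v \<longleftrightarrow>
     (\<forall>x y. x \<noteq> 0 \<and> y \<noteq> 0 \<longrightarrow> v (x * y) = v x + v y) \<and>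
     (\<forall>x y. x \<noteq> 0 \<and> y \<noteq> 0 \<and> x + y \<noteq> 0 \<longrightarrow> v (x + y) \<ge> min (v x) (v y)) \<and>
     (\<exists>u. u \<noteq> 0 \<and> v u > 0 \<and> (\<forall>x. x \<noteq> 0 \<longrightarrow> (\<exists>n::int. v x = of_int n * v u)))"

definition complete_valuation :: "('f::field \<Rightarrow> real) \<Rightarrow> bool" where
  "complete_valuation v \<longleftrightarrow>
     (\<forall>s::nat \<Rightarrow> 'f. (\<forall>c. \<exists>N. \<forall>m\<ge>N. \<forall>n\<ge>N. s m = s n \<or> v (s m - s n) > c) \<longrightarrow>
        (\<exists>l. \<forall>c. \<exists>N. \<forall>n\<ge>N. s n = l \<or> v (s n - l) > c))"

text \<open>The types \<open>'k\<close>, \<open>'k0\<close>, \<open>'s\<close>, \<open>'K\<close> are the fields \<open>k\<close>, \<open>K\<^sub>0\<close>, \<open>K\<^sub>*\<close>, \<open>K\<close>, and \<open>emb0\<close>, \<open>emb\<close> are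
  the embeddings of \<open>K\<^sub>0\<close> into \<open>K\<^sub>*\<close> and of \<open>K\<^sub>*\<close> into \<open>K\<close>. The valuation \<open>ord\<close> lives on \<open>K\<close>; on \<open>K\<^sub>*\<close>
  it is \<open>ord \<circ> emb\<close>. In \<open>k_algebraic\<close> the set \<open>\<int>\<close> is the image of the integers in \<open>k\<close>, that is, the
  prime field. By \<open>ord_W\<close> and \<open>ord_p\<close> the restriction of \<open>ord\<close> to \<open>K\<^sub>0\<close> is the \<open>p\<close>-adic
  valuation, and all residue fields have characteristic \<open>p\<close>. By \<open>residue_field_s\<close> the residue
  field extension of \<open>K\<^sub>*\<close> over \<open>K\<^sub>0\<close> is trivial.\<close>

locale padic_base =
  fixes p :: nat
    and W :: "'k0::field set"
    and red :: "'k0 \<Rightarrow> 'k::field"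
    and emb0 :: "'k0 \<Rightarrow> 's::field"
    and \<sigma> :: "'s \<Rightarrow> 's"
    and emb :: "'s \<Rightarrow> 'K::field"
    and ord :: "'K \<Rightarrow> real"
  assumes p_prime: "prime p"
    and char_k: "CHAR('k) = p"
    and k_algebraic: "\<forall>x::'k. \<exists>P::'k poly. P \<noteq> 0 \<and> (\<forall>i. coeff P i \<in> \<int>) \<and> poly P x = 0"
    and witt: "witt_ring p W red"
    and K0_frac: "is_fraction_field W"
    and emb0_hom: "field_hom emb0"
    and emb0_finite: "\<exists>B. finite B \<and> (\<forall>x. \<exists>c. x = (\<Sum>b\<in>B. emb0 (c b) * b))"
    and \<sigma>_aut: "field_hom \<sigma>" "bij \<sigma>"
    and \<sigma>_frobenius:
      "\<exists>F. frobenius_automorphism p W red F \<and> (\<forall>x. \<sigma> (emb0 x) = emb0 (F x))"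
    and emb_hom: "field_hom emb"
    and ord_discrete: "discrete_valuation ord"
    and ord_complete: "complete_valuation ord"
    and ord_W: "\<forall>a\<in>W. emb (emb0 a) \<in> val_ring ord"
    and ord_p: "ord (of_nat p) = 1"
    and residue_field_s:
      "\<forall>x. emb x \<in> val_ring ord \<longrightarrow> (\<exists>a\<in>W. emb (x - emb0 a) \<in> val_ideal ord)"
    and residue_field_K_perfect:
      "\<forall>x\<in>val_ring ord. \<exists>y\<in>val_ring ord. x - y ^ p \<in> val_ideal ord"


section \<open>Quotients and base change of vector spaces\<close>

text \<open>The fields \<open>mult\<close> and \<open>one\<close> of a module record are inherited from rings and have no meaning
  for modules; they are filled arbitrarily.\<close>

definition quot_module :: "('a, 'b) module \<Rightarrow> 'b set \<Rightarrow> ('a, 'b set) module" where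
  "quot_module M N = \<lparr>carrier = a_rcosets\<^bsub>M\<^esub> N, mult = (\<lambda>_ _. N), one = N, zero = N,
     add = set_add M, smult = (\<lambda>c A. \<Union>x\<in>A. N +>\<^bsub>M\<^esub> (c \<odot>\<^bsub>M\<^esub> x))\<rparr>"

definition free_module :: "'v set \<Rightarrow> ('K::field, 'v \<Rightarrow> 'K) module" where
  "free_module X = \<lparr>carrier = {f. finite {x. f x \<noteq> 0} \<and> {x. f x \<noteq> 0} \<subseteq> X},
     mult = (\<lambda>_ _ _. 0), one = (\<lambda>_. 0), zero = (\<lambda>_. 0),
     add = (\<lambda>f g x. f x + g x), smult = (\<lambda>c f x. c * f x)\<rparr>"

definition delta :: "'v \<Rightarrow> 'v \<Rightarrow> 'K::field" where
  "delta v = (\<lambda>x. if x = v then 1 else 0)"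

definition tensor_relations :: "('s::field \<Rightarrow> 'K::field) \<Rightarrow> ('s, 'v) module \<Rightarrow> ('v \<Rightarrow> 'K) set" where
  "tensor_relations e V = LinearCombinations.module.span class_ring (free_module (carrier V))
     ({(\<lambda>x. delta (u \<oplus>\<^bsub>V\<^esub> v) x - delta u x - delta v x) | u v. u \<in> carrier V \<and> v \<in> carrier V} \<union>
      {(\<lambda>x. delta (c \<odot>\<^bsub>V\<^esub> v) x - e c * delta v x) | c v. v \<in> carrier V})"

text \<open>\<open>base_change e V\<close> is \<open>K \<otimes>\<^bsub>K\<^sub>*\<^esub> V\<close>, where \<open>K\<close> is a \<open>K\<^sub>*\<close>-algebra via \<open>e\<close>: the free \<open>K\<close>-module on the
  symbols \<open>1 \<otimes> v\<close> modulo additivity and \<open>1 \<otimes> (c v) = e c \<otimes> v\<close>.\<close>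

definition base_change ::
  "('s::field \<Rightarrow> 'K::field) \<Rightarrow> ('s, 'v) module \<Rightarrow> ('K, ('v \<Rightarrow> 'K) set) module" where
  "base_change e V = quot_module (free_module (carrier V)) (tensor_relations e V)"

definition pure_tensor ::
  "('s::field \<Rightarrow> 'K::field) \<Rightarrow> ('s, 'v) module \<Rightarrow> 'K \<Rightarrow> 'v \<Rightarrow> ('v \<Rightarrow> 'K) set" where
  "pure_tensor e V c v =
     tensor_relations e V +>\<^bsub>free_module (carrier V)\<^esub> (\<lambda>x. c * delta v x)"

definition base_change_map ::
  "('s::field \<Rightarrow> 'K::field) \<Rightarrow> ('s, 'v) module \<Rightarrow> ('s, 'u) module \<Rightarrow> ('v \<Rightarrow> 'u) \<Rightarrow>
   ('v \<Rightarrow> 'K) set \<Rightarrow> ('u \<Rightarrow> 'K) set" where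
  "base_change_map e V U T = (THE g. g \<in> extensional (carrier (base_change e V)) \<and>
     linear_map class_ring (base_change e V) (base_change e U) g \<and>
     (\<forall>c. \<forall>v\<in>carrier V. g (pure_tensor e V c v) = pure_tensor e U c (T v)))"


section \<open>Filtered modules\<close>

text \<open>The last condition says that the filtration is left-continuous. Without it there are
  filtrations of nonzero spaces all of whose graded pieces vanish, such as \<open>F\<^sup>i = V\<close> for \<open>i < 0\<close>
  and \<open>F\<^sup>i = 0\<close> for \<open>i \<ge> 0\<close>. The identity from this one to the filtration with \<open>F\<^sup>i = V\<close> for \<open>i \<le> 0\<close>
  and \<open>F\<^sup>i = 0\<close> for \<open>i > 0\<close> would then be a non-strict morphism between weakly admissible objects
  when \<open>V\<close> has rank one and slope \<open>0\<close>.\<close>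

definition filtered_module :: "('K::field, 'w) module \<Rightarrow> (real \<Rightarrow> 'w set) \<Rightarrow> bool" where
  "filtered_module V F \<longleftrightarrow> vectorspace class_ring V \<and> vectorspace.fin_dim class_ring V \<and>
     (\<forall>i. subspace class_ring (F i) V) \<and>
     (\<forall>i j. i < j \<longrightarrow> F j \<subseteq> F i) \<and>
     (\<Union>i. F i) = carrier V \<and>
     (\<Inter>i. F i) = {\<zero>\<^bsub>V\<^esub>} \<and>
     (\<forall>i. F i = (\<Inter>j\<in>{..<i}. F j))"

definition gr :: "('K::field, 'w) module \<Rightarrow> (real \<Rightarrow> 'w set) \<Rightarrow> real \<Rightarrow> ('K, 'w set) module" where
  "gr V F i = quot_module (V\<lparr>carrier := F i\<rparr>) (\<Union>j\<in>{i<..}. F j)"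

definition hodge_tate_weights :: "('K::field, 'w) module \<Rightarrow> (real \<Rightarrow> 'w set) \<Rightarrow> real set" where
  "hodge_tate_weights V F = {i. carrier (gr V F i) \<noteq> {\<zero>\<^bsub>gr V F i\<^esub>}}"

definition t_H :: "('K::field, 'w) module \<Rightarrow> (real \<Rightarrow> 'w set) \<Rightarrow> real" where
  "t_H V F = (\<Sum>i\<in>hodge_tate_weights V F. i * real (vectorspace.dim class_ring (gr V F i)))"


section \<open>Phi-modules\<close>

definition phi_module :: "('s::field \<Rightarrow> 's) \<Rightarrow> ('s, 'v) module \<Rightarrow> ('v \<Rightarrow> 'v) \<Rightarrow> bool" where
  "phi_module \<sigma> V \<phi> \<longleftrightarrow> vectorspace class_ring V \<and> vectorspace.fin_dim class_ring V \<and>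
     bij_betw \<phi> (carrier V) (carrier V) \<and>
     (\<forall>u\<in>carrier V. \<forall>v\<in>carrier V. \<phi> (u \<oplus>\<^bsub>V\<^esub> v) = \<phi> u \<oplus>\<^bsub>V\<^esub> \<phi> v) \<and>
     (\<forall>c. \<forall>v\<in>carrier V. \<phi> (c \<odot>\<^bsub>V\<^esub> v) = \<sigma> c \<odot>\<^bsub>V\<^esub> \<phi> v)"

definition frames :: "('s::field, 'v) module \<Rightarrow> 'v list set" where
  "frames V = {xs. length xs = vectorspace.dim class_ring V \<and> set xs \<subseteq> carrier V}"

definition alternating_forms :: "('s::field, 'v) module \<Rightarrow> ('v list \<Rightarrow> 's) set" where
  "alternating_forms V = {\<omega>. \<forall>xs\<in>frames V. \<forall>i<length xs.
     (\<forall>c. \<forall>u\<in>carrier V. \<forall>v\<in>carrier V.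
        \<omega> (xs[i := (c \<odot>\<^bsub>V\<^esub> u) \<oplus>\<^bsub>V\<^esub> v]) = c * \<omega> (xs[i := u]) + \<omega> (xs[i := v])) \<and>
     (\<forall>j<length xs. j \<noteq> i \<and> xs ! i = xs ! j \<longrightarrow> \<omega> xs = 0)}"

text \<open>The top exterior power \<open>det V\<close> is the linear dual of the space of alternating forms of
  degree \<open>n = dim V\<close>, and \<open>wedge V xs\<close> is the vector \<open>x\<^sub>1 \<and> \<dots> \<and> x\<^sub>n\<close> in it. For \<open>n \<ge> 1\<close> every vector of
  \<open>det V\<close> has this form; for \<open>n = 0\<close> the empty wedge is the generator \<open>1\<close> of \<open>K\<^sub>*\<close>. In both cases
  \<open>det \<phi>\<close> maps \<open>x\<^sub>1 \<and> \<dots> \<and> x\<^sub>n\<close> to \<open>\<phi> x\<^sub>1 \<and> \<dots> \<and> \<phi> x\<^sub>n\<close>.\<close>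

definition wedge :: "('s::field, 'v) module \<Rightarrow> 'v list \<Rightarrow> ('v list \<Rightarrow> 's) \<Rightarrow> 's" where
  "wedge V xs = (\<lambda>\<omega>\<in>alternating_forms V. \<omega> xs)"

text \<open>The factor \<open>\<lambda>\<close> depends on the chosen vector of \<open>det V\<close>, but \<open>ord \<lambda>\<close> does not.\<close>

definition t_N :: "('s::field \<Rightarrow> real) \<Rightarrow> ('s, 'v) module \<Rightarrow> ('v \<Rightarrow> 'v) \<Rightarrow> real" where
  "t_N v V \<phi> = (THE r. \<exists>xs\<in>frames V. \<exists>l.
     wedge V xs \<noteq> (\<lambda>\<omega>\<in>alternating_forms V. 0) \<and>
     wedge V (map \<phi> xs) = (\<lambda>\<omega>\<in>alternating_forms V. l * wedge V xs \<omega>) \<and>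
     r = v l)"


section \<open>Filtered Phi-modules\<close>

record ('s, 'v, 'K, 'w) filt_phi =
  Sp :: "('s, 'v) module"
  Phi :: "'v \<Rightarrow> 'v"
  SpK :: "('K, 'w) module"
  Fil :: "real \<Rightarrow> 'w set"
  iota :: "'w \<Rightarrow> ('v \<Rightarrow> 'K) set"

definition filtered_phi_module ::
  "('s::field \<Rightarrow> 's) \<Rightarrow> ('s \<Rightarrow> 'K::field) \<Rightarrow> ('s, 'v, 'K, 'w) filt_phi \<Rightarrow> bool" where
  "filtered_phi_module \<sigma> e X \<longleftrightarrow>
     phi_module \<sigma> (Sp X) (Phi X) \<and> filtered_module (SpK X) (Fil X) \<and>
     linear_map class_ring (SpK X) (base_change e (Sp X)) (iota X) \<and>
     bij_betw (iota X) (carrier (SpK X)) (carrier (base_change e (Sp X)))"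

text \<open>Morphisms are pairs \<open>(T, T\<^sub>K)\<close>. The maps are made extensional so that equality of morphisms
  is equality on the carriers.\<close>

definition MF_hom ::
  "('s::field \<Rightarrow> 'K::field) \<Rightarrow> ('s, 'v, 'K, 'w) filt_phi \<Rightarrow> ('s, 'v, 'K, 'w) filt_phi \<Rightarrow>
   (('v \<Rightarrow> 'v) \<times> ('w \<Rightarrow> 'w)) set" where
  "MF_hom e X Y = {(T, TK).
     T \<in> extensional (carrier (Sp X)) \<and> linear_map class_ring (Sp X) (Sp Y) T \<and>
     (\<forall>v\<in>carrier (Sp X). T (Phi X v) = Phi Y (T v)) \<and>
     TK \<in> extensional (carrier (SpK X)) \<and> linear_map class_ring (SpK X) (SpK Y) TK \<and>
     (\<forall>i. TK ` Fil X i \<subseteq> Fil Y i) \<and>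
     (\<forall>w\<in>carrier (SpK X). TK w =
        inv_into (carrier (SpK Y)) (iota Y) (base_change_map e (Sp X) (Sp Y) T (iota X w)))}"

text \<open>The carriers of the underlying spaces are arbitrary subsets of the types \<open>'v\<close> and \<open>'w\<close>,
  with arbitrary operations on them.\<close>

definition MF ::
  "('s::field \<Rightarrow> 's) \<Rightarrow> ('s \<Rightarrow> 'K::field) \<Rightarrow>
   (('s, 'v, 'K, 'w) filt_phi, ('v \<Rightarrow> 'v) \<times> ('w \<Rightarrow> 'w)) cat" where
  "MF \<sigma> e = \<lparr>Obj = {X. filtered_phi_module \<sigma> e X}, Hom = MF_hom e,
     Ide = (\<lambda>X. (\<lambda>v\<in>carrier (Sp X). v, \<lambda>w\<in>carrier (SpK X). w)),
     Comp = (\<lambda>X Y Z g f. (compose (carrier (Sp X)) (fst g) (fst f),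
                           compose (carrier (SpK X)) (snd g) (snd f)))\<rparr>"

definition strict_hom ::
  "('s, 'v, 'K, 'w) filt_phi \<Rightarrow> ('s, 'v, 'K, 'w) filt_phi \<Rightarrow> ('v \<Rightarrow> 'v) \<times> ('w \<Rightarrow> 'w) \<Rightarrow> bool" where
  "strict_hom X Y T \<longleftrightarrow> (\<forall>i. snd T ` Fil X i = snd T ` carrier (SpK X) \<inter> Fil Y i)"

definition linear_short_exact ::
  "('a, 'b) module \<Rightarrow> ('a, 'b) module \<Rightarrow> ('a, 'b) module \<Rightarrow> ('b \<Rightarrow> 'b) \<Rightarrow> ('b \<Rightarrow> 'b) \<Rightarrow> bool" where
  "linear_short_exact V' V V'' S T \<longleftrightarrow>
     inj_on S (carrier V') \<and>
     S ` carrier V' = {v \<in> carrier V. T v = \<zero>\<^bsub>V''\<^esub>} \<and>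
     T ` carrier V = carrier V''"

definition MF_short_exact ::
  "('s::field \<Rightarrow> 's) \<Rightarrow> ('s \<Rightarrow> 'K::field) \<Rightarrow>
   ('s, 'v, 'K, 'w) filt_phi \<Rightarrow> ('s, 'v, 'K, 'w) filt_phi \<Rightarrow> ('s, 'v, 'K, 'w) filt_phi \<Rightarrow>
   ('v \<Rightarrow> 'v) \<times> ('w \<Rightarrow> 'w) \<Rightarrow> ('v \<Rightarrow> 'v) \<times> ('w \<Rightarrow> 'w) \<Rightarrow> bool" where
  "MF_short_exact \<sigma> e X' X X'' S T \<longleftrightarrow>
     X' \<in> Obj (MF \<sigma> e) \<and> X \<in> Obj (MF \<sigma> e) \<and> X'' \<in> Obj (MF \<sigma> e) \<and>
     S \<in> Hom (MF \<sigma> e) X' X \<and> T \<in> Hom (MF \<sigma> e) X X'' \<and>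
     linear_short_exact (Sp X') (Sp X) (Sp X'') (fst S) (fst T) \<and>
     linear_short_exact (SpK X') (SpK X) (SpK X'') (snd S) (snd T) \<and>
     strict_hom X' X S \<and> strict_hom X X'' T"

definition lin_ker :: "('a, 'b) module \<Rightarrow> ('a, 'b) module \<Rightarrow> ('b \<Rightarrow> 'b) \<Rightarrow> ('a, 'b) module" where
  "lin_ker V U T = V\<lparr>carrier := {v \<in> carrier V. T v = \<zero>\<^bsub>U\<^esub>}\<rparr>"

text \<open>The comparison map of the kernel is the one through which \<open>iota X\<close> factors along the
  injection \<open>K \<otimes> ker T \<rightarrow> K \<otimes> V\<close>; the one of the cokernel is induced from \<open>iota Y\<close>.\<close>

definition MF_ker ::
  "('s::field \<Rightarrow> 'K::field) \<Rightarrow> ('s, 'v, 'K, 'w) filt_phi \<Rightarrow> ('s, 'v, 'K, 'w) filt_phi \<Rightarrow>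
   ('v \<Rightarrow> 'v) \<times> ('w \<Rightarrow> 'w) \<Rightarrow> ('s, 'v, 'K, 'w) filt_phi" where
  "MF_ker e X Y T =
     (let N = lin_ker (Sp X) (Sp Y) (fst T); NK = lin_ker (SpK X) (SpK Y) (snd T) in
      \<lparr>Sp = N, Phi = Phi X, SpK = NK, Fil = (\<lambda>i. Fil X i \<inter> carrier NK),
       iota = (\<lambda>w. THE z. z \<in> carrier (base_change e N) \<and>
                 base_change_map e N (Sp X) (\<lambda>v. v) z = iota X w)\<rparr>)"

definition MF_coker ::
  "('s::field \<Rightarrow> 'K::field) \<Rightarrow> ('s, 'v, 'K, 'w) filt_phi \<Rightarrow> ('s, 'v, 'K, 'w) filt_phi \<Rightarrow>
   ('v \<Rightarrow> 'v) \<times> ('w \<Rightarrow> 'w) \<Rightarrow> ('s, 'v set, 'K, 'w set) filt_phi" where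
  "MF_coker e X Y T =
     (let I = fst T ` carrier (Sp X); IK = snd T ` carrier (SpK X);
          Q = quot_module (Sp Y) I; QK = quot_module (SpK Y) IK in
      \<lparr>Sp = Q, Phi = (\<lambda>A. Phi Y ` A), SpK = QK,
       Fil = (\<lambda>i. (\<lambda>w. IK +>\<^bsub>SpK Y\<^esub> w) ` Fil Y i),
       iota = (\<lambda>A. base_change_map e (Sp Y) Q (\<lambda>v. I +>\<^bsub>Sp Y\<^esub> v) (iota Y (SOME w. w \<in> A)))\<rparr>)"

definition weakly_admissible ::
  "('s::field \<Rightarrow> 's) \<Rightarrow> ('s \<Rightarrow> 'K::field) \<Rightarrow> ('K \<Rightarrow> real) \<Rightarrow> ('s, 'v, 'K, 'w) filt_phi \<Rightarrow> bool" where
  "weakly_admissible \<sigma> e ord X \<longleftrightarrow> X \<in> Obj (MF \<sigma> e) \<and>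
     (\<forall>X'. subobject (MF \<sigma> e) X' X \<longrightarrow>
        t_N (\<lambda>c. ord (e c)) (Sp X') (Phi X') \<ge> t_H (SpK X') (Fil X')) \<and>
     t_N (\<lambda>c. ord (e c)) (Sp X) (Phi X) = t_H (SpK X) (Fil X)"

end

theory Submission
  imports Defs
begin

text \<open>For a \<open>\<phi>\<close>-stable subspace \<open>U\<close> of \<open>V\<close>, with the induced filtration on \<open>K \<otimes> U\<close>, put
  \<open>\<delta>(U) = t\<^sub>N(U) - t\<^sub>H(U)\<close>. The Newton number is additive on short exact sequences of Phi-modules, by
  comparing determinants; it does not depend on the basis of the determinant line because \<open>\<sigma>\<close>
  preserves the valuation of \<open>K\<^sub>*\<close>. For a morphism
  \<open>T : V \<rightarrow> V'\<close>, a dimension count gives \<open>t\<^sub>H(U) \<le> t\<^sub>H(U \<inter> ker T) + t\<^sub>H(T U)\<close>, so that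
  \<open>\<delta>(U) \<ge> \<delta>(U \<inter> ker T) + \<delta>(T U)\<close>, with equality for \<open>U = V\<close> if and only if \<open>T\<close> is strict.

  An object is weakly admissible if and only if \<open>\<delta> \<ge> 0\<close> on all stable subspaces and \<open>\<delta>(V) = 0\<close>. A
  morphism \<open>T\<close> of weakly admissible objects has \<open>0 = \<delta>(V) \<ge> \<delta>(ker T) + \<delta>(im T) \<ge> 0\<close>. Hence it
  is strict, and its kernel, image and cokernel are weakly admissible; this is what makes the
  category abelian, since monomorphisms and epimorphisms are then the injective and surjective
  morphisms. The two-out-of-three property follows in the same way from the additivity of \<open>\<delta>\<close> in
  exact sequences.\<close>

section \<open>Linear algebra\<close>

text \<open>Base change is handled by counting: a semilinear map into a space of the same dimension
  whose image spans it is a model of K \<otimes> V, and the behaviour of kernels, images and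
  quotients after base change then follows from rank and nullity. The estimate for
  \<open>t\<^sub>H\<close> is partial summation. If e(i) is the defect of the dimensions at step i,
  the defect of \<open>t\<^sub>H\<close> is the sum of i (e(i) - e(i+)), the integral of the step
  function e, so it is nonnegative and vanishes only if e does; left-continuity makes the jumps
  determine e. The invariance of the valuation under \<sigma> is not assumed. Since
  \<open>K\<^sub>*\<close> is totally ramified over \<open>K\<^sub>0\<close>, its valuation ring is
  a finitely generated W-module, so its image under \<sigma> has values bounded below; powers of one
  element improve the bound to 0, and units together with their inverses give equality. Finally,
  cokernels and direct sums arise on set and product types while the category fixes its carrier
  types, so they have to be copied back along injections that keep the filtration.\<close>

abbreviation vsp :: "('a::field, 'v) module \<Rightarrow> bool" where
  "vsp V \<equiv> vectorspace class_ring V"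
abbreviation fd :: "('a::field, 'v) module \<Rightarrow> bool" where
  "fd V \<equiv> vectorspace.fin_dim class_ring V"
abbreviation vdim :: "('a::field, 'v) module \<Rightarrow> nat" where
  "vdim V \<equiv> vectorspace.dim class_ring V"
abbreviation sub :: "'v set \<Rightarrow> ('a::field, 'v) module \<Rightarrow> bool" where
  "sub U V \<equiv> subspace class_ring U V"
abbreviation lin :: "('a::field, 'v) module \<Rightarrow> ('a, 'w) module \<Rightarrow> ('v \<Rightarrow> 'w) \<Rightarrow> bool" where
  "lin V W T \<equiv> linear_map class_ring V W T"
abbreviation vspan :: "('a::field, 'v) module \<Rightarrow> 'v set \<Rightarrow> 'v set" where
  "vspan V S \<equiv> LinearCombinations.module.span class_ring V S"
abbreviation on :: "('a::field, 'v) module \<Rightarrow> 'v set \<Rightarrow> ('a, 'v) module" where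
  "on V U \<equiv> V\<lparr>carrier := U\<rparr>"
definition kern :: "('a::field, 'v) module \<Rightarrow> ('a, 'w) module \<Rightarrow> ('v \<Rightarrow> 'w) \<Rightarrow> 'v set" where
  "kern V W T = {v \<in> carrier V. T v = \<zero>\<^bsub>W\<^esub>}"

section \<open>Vector space arithmetic, subspaces and linear maps\<close>

context
  fixes V :: "('a::field, 'v) module"
  assumes V: "vsp V"
begin

interpretation vectorspace class_ring V by (rule V)

lemma vzero_closed: "\<zero>\<^bsub>V\<^esub> \<in> carrier V" by simp
lemma vadd_closed: "x \<in> carrier V \<Longrightarrow> y \<in> carrier V \<Longrightarrow> x \<oplus>\<^bsub>V\<^esub> y \<in> carrier V" by simp
lemma vsmult_closed: "x \<in> carrier V \<Longrightarrow> c \<odot>\<^bsub>V\<^esub> x \<in> carrier V" by simp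
lemma vneg_closed: "x \<in> carrier V \<Longrightarrow> \<ominus>\<^bsub>V\<^esub> x \<in> carrier V" by simp
lemma vminus_closed: "x \<in> carrier V \<Longrightarrow> y \<in> carrier V \<Longrightarrow> x \<ominus>\<^bsub>V\<^esub> y \<in> carrier V" by simp
lemma vadd_comm: "x \<in> carrier V \<Longrightarrow> y \<in> carrier V \<Longrightarrow> x \<oplus>\<^bsub>V\<^esub> y = y \<oplus>\<^bsub>V\<^esub> x"
  by (rule M.a_comm)
lemma vadd_assoc: "x \<in> carrier V \<Longrightarrow> y \<in> carrier V \<Longrightarrow> z \<in> carrier V \<Longrightarrow>
    (x \<oplus>\<^bsub>V\<^esub> y) \<oplus>\<^bsub>V\<^esub> z = x \<oplus>\<^bsub>V\<^esub> (y \<oplus>\<^bsub>V\<^esub> z)" by (rule M.a_assoc)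
lemma vadd_left_comm: "x \<in> carrier V \<Longrightarrow> y \<in> carrier V \<Longrightarrow> z \<in> carrier V \<Longrightarrow>
    x \<oplus>\<^bsub>V\<^esub> (y \<oplus>\<^bsub>V\<^esub> z) = y \<oplus>\<^bsub>V\<^esub> (x \<oplus>\<^bsub>V\<^esub> z)" by (rule M.a_lcomm)
lemma vadd_zero_left: "x \<in> carrier V \<Longrightarrow> \<zero>\<^bsub>V\<^esub> \<oplus>\<^bsub>V\<^esub> x = x" by simp
lemma vadd_zero_right: "x \<in> carrier V \<Longrightarrow> x \<oplus>\<^bsub>V\<^esub> \<zero>\<^bsub>V\<^esub> = x" by simp
lemma vneg_left: "x \<in> carrier V \<Longrightarrow> \<ominus>\<^bsub>V\<^esub> x \<oplus>\<^bsub>V\<^esub> x = \<zero>\<^bsub>V\<^esub>" by (rule M.l_neg)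
lemma vneg_right: "x \<in> carrier V \<Longrightarrow> x \<oplus>\<^bsub>V\<^esub> \<ominus>\<^bsub>V\<^esub> x = \<zero>\<^bsub>V\<^esub>" by (rule M.r_neg)
lemma vneg_eq_smult: "x \<in> carrier V \<Longrightarrow> \<ominus>\<^bsub>V\<^esub> x = (-1) \<odot>\<^bsub>V\<^esub> x"
  using smult_minus_1[of x] by (simp add: class_ring_simps)
lemma vminus_eq: "x \<in> carrier V \<Longrightarrow> y \<in> carrier V \<Longrightarrow> x \<ominus>\<^bsub>V\<^esub> y = x \<oplus>\<^bsub>V\<^esub> (-1) \<odot>\<^bsub>V\<^esub> y"
  by (simp add: a_minus_def vneg_eq_smult)
lemma vminus_eq_zero: "x \<in> carrier V \<Longrightarrow> y \<in> carrier V \<Longrightarrow> x \<ominus>\<^bsub>V\<^esub> y = \<zero>\<^bsub>V\<^esub> \<longleftrightarrow> x = y"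
  by simp
lemma vminus_add_cancel: "x \<in> carrier V \<Longrightarrow> y \<in> carrier V \<Longrightarrow> y \<oplus>\<^bsub>V\<^esub> (x \<ominus>\<^bsub>V\<^esub> y) = x"
  by (simp add: a_minus_def M.a_lcomm M.r_neg)
lemma vsmult_add: "x \<in> carrier V \<Longrightarrow> y \<in> carrier V \<Longrightarrow>
    c \<odot>\<^bsub>V\<^esub> (x \<oplus>\<^bsub>V\<^esub> y) = c \<odot>\<^bsub>V\<^esub> x \<oplus>\<^bsub>V\<^esub> c \<odot>\<^bsub>V\<^esub> y" by (simp add: smult_r_distr)
lemma vadd_smult: "x \<in> carrier V \<Longrightarrow> (c + d) \<odot>\<^bsub>V\<^esub> x = c \<odot>\<^bsub>V\<^esub> x \<oplus>\<^bsub>V\<^esub> d \<odot>\<^bsub>V\<^esub> x"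
  using smult_l_distr[of c d x] by simp
lemma vsmult_smult: "x \<in> carrier V \<Longrightarrow> c \<odot>\<^bsub>V\<^esub> (d \<odot>\<^bsub>V\<^esub> x) = (c * d) \<odot>\<^bsub>V\<^esub> x"
  using smult_assoc1[of c d x] by simp
lemma vsmult_one: "x \<in> carrier V \<Longrightarrow> 1 \<odot>\<^bsub>V\<^esub> x = x" using smult_one[of x] by simp
lemma vsmult_zero_left: "x \<in> carrier V \<Longrightarrow> 0 \<odot>\<^bsub>V\<^esub> x = \<zero>\<^bsub>V\<^esub>" using lmult_0[of x] by simp
lemma vsmult_zero_right: "c \<odot>\<^bsub>V\<^esub> \<zero>\<^bsub>V\<^esub> = \<zero>\<^bsub>V\<^esub>" by simp
lemma vadd_cancel_left: "x \<in> carrier V \<Longrightarrow> y \<in> carrier V \<Longrightarrow> z \<in> carrier V \<Longrightarrow>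
    x \<oplus>\<^bsub>V\<^esub> y = x \<oplus>\<^bsub>V\<^esub> z \<longleftrightarrow> y = z" by simp

end

lemmas vsp_closed = vzero_closed vadd_closed vsmult_closed vneg_closed vminus_closed
lemmas vsp_simps = vsp_closed vadd_zero_left vadd_zero_right vneg_left vneg_right vminus_eq_zero
  vminus_add_cancel vsmult_one vsmult_zero_left vsmult_zero_right vsmult_smult
lemmas vsp_ac = vadd_comm vadd_assoc vadd_left_comm

lemma vspI:
  fixes V :: "('a::field, 'v) module"
  assumes "\<zero>\<^bsub>V\<^esub> \<in> carrier V"
    and "\<And>x y. x \<in> carrier V \<Longrightarrow> y \<in> carrier V \<Longrightarrow> x \<oplus>\<^bsub>V\<^esub> y \<in> carrier V"
    and "\<And>c x. x \<in> carrier V \<Longrightarrow> c \<odot>\<^bsub>V\<^esub> x \<in> carrier V"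
    and "\<And>x y. x \<in> carrier V \<Longrightarrow> y \<in> carrier V \<Longrightarrow> x \<oplus>\<^bsub>V\<^esub> y = y \<oplus>\<^bsub>V\<^esub> x"
    and "\<And>x y z. x \<in> carrier V \<Longrightarrow> y \<in> carrier V \<Longrightarrow> z \<in> carrier V \<Longrightarrow>
      (x \<oplus>\<^bsub>V\<^esub> y) \<oplus>\<^bsub>V\<^esub> z = x \<oplus>\<^bsub>V\<^esub> (y \<oplus>\<^bsub>V\<^esub> z)"
    and "\<And>x. x \<in> carrier V \<Longrightarrow> x \<oplus>\<^bsub>V\<^esub> \<zero>\<^bsub>V\<^esub> = x"
    and "\<And>x. x \<in> carrier V \<Longrightarrow> x \<oplus>\<^bsub>V\<^esub> (-1) \<odot>\<^bsub>V\<^esub> x = \<zero>\<^bsub>V\<^esub>"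
    and "\<And>c x y. x \<in> carrier V \<Longrightarrow> y \<in> carrier V \<Longrightarrow>
      c \<odot>\<^bsub>V\<^esub> (x \<oplus>\<^bsub>V\<^esub> y) = c \<odot>\<^bsub>V\<^esub> x \<oplus>\<^bsub>V\<^esub> c \<odot>\<^bsub>V\<^esub> y"
    and "\<And>c d x. x \<in> carrier V \<Longrightarrow> (c + d) \<odot>\<^bsub>V\<^esub> x = c \<odot>\<^bsub>V\<^esub> x \<oplus>\<^bsub>V\<^esub> d \<odot>\<^bsub>V\<^esub> x"
    and "\<And>c d x. x \<in> carrier V \<Longrightarrow> (c * d) \<odot>\<^bsub>V\<^esub> x = c \<odot>\<^bsub>V\<^esub> (d \<odot>\<^bsub>V\<^esub> x)"
    and "\<And>x. x \<in> carrier V \<Longrightarrow> 1 \<odot>\<^bsub>V\<^esub> x = x"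
  shows "vsp V"
proof (rule vs_criteria[OF class_field])
  show "\<forall>v\<in>carrier V. \<exists>w\<in>carrier V. v \<oplus>\<^bsub>V\<^esub> w = \<zero>\<^bsub>V\<^esub>"
    using assms(3,7) by blast
  show "\<forall>v w. v \<in> carrier V \<and> w \<in> carrier V \<longrightarrow> v \<oplus>\<^bsub>V\<^esub> w = w \<oplus>\<^bsub>V\<^esub> v"
    using assms(4) by blast
  show "\<forall>v w x. v \<in> carrier V \<and> w \<in> carrier V \<and> x \<in> carrier V \<longrightarrow>
      (v \<oplus>\<^bsub>V\<^esub> w) \<oplus>\<^bsub>V\<^esub> x = v \<oplus>\<^bsub>V\<^esub> (w \<oplus>\<^bsub>V\<^esub> x)"
    using assms(5) by blast
qed (simp_all add: assms)

lemma sub_iff: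
  fixes V :: "('a::field, 'v) module"
  shows "sub U V \<longleftrightarrow> vsp V \<and> U \<subseteq> carrier V \<and> \<zero>\<^bsub>V\<^esub> \<in> U \<and>
    (\<forall>x\<in>U. \<forall>y\<in>U. x \<oplus>\<^bsub>V\<^esub> y \<in> U) \<and> (\<forall>c. \<forall>x\<in>U. c \<odot>\<^bsub>V\<^esub> x \<in> U)"
  by (auto simp: subspace_def submodule_def vectorspace_def)

lemma subI:
  fixes V :: "('a::field, 'v) module"
  assumes "vsp V" "U \<subseteq> carrier V" "\<zero>\<^bsub>V\<^esub> \<in> U" "\<And>x y. x \<in> U \<Longrightarrow> y \<in> U \<Longrightarrow> x \<oplus>\<^bsub>V\<^esub> y \<in> U"
    "\<And>c x. x \<in> U \<Longrightarrow> c \<odot>\<^bsub>V\<^esub> x \<in> U"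
  shows "sub U V"
  using assms by (auto simp: sub_iff)

lemma sub_vsp: "sub U V \<Longrightarrow> vsp V" and sub_subset: "sub U V \<Longrightarrow> U \<subseteq> carrier V"
  and sub_zero: "sub U V \<Longrightarrow> \<zero>\<^bsub>V\<^esub> \<in> U"
  and sub_add: "sub U V \<Longrightarrow> x \<in> U \<Longrightarrow> y \<in> U \<Longrightarrow> x \<oplus>\<^bsub>V\<^esub> y \<in> U"
  and sub_smult: "sub U V \<Longrightarrow> x \<in> U \<Longrightarrow> c \<odot>\<^bsub>V\<^esub> x \<in> U"
  for V :: "('a::field, 'v) module"
  by (auto simp: sub_iff)

lemma sub_closed: "sub U V \<Longrightarrow> x \<in> U \<Longrightarrow> x \<in> carrier V" for V :: "('a::field, 'v) module"
  by (auto simp: sub_iff)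

lemma vsp_on: "sub U V \<Longrightarrow> vsp (on V U)" for V :: "('a::field, 'v) module"
  using vectorspace.subspace_is_vs[OF sub_vsp] .

lemma sub_on_iff: "sub U V \<Longrightarrow> sub U' (on V U) \<longleftrightarrow> sub U' V \<and> U' \<subseteq> U"
  for V :: "('a::field, 'v) module"
  using vsp_on[of U V] by (auto simp: sub_iff)

lemma sub_carrier: "vsp V \<Longrightarrow> sub (carrier V) V" for V :: "('a::field, 'v) module"
  by (auto simp: sub_iff vsp_closed)

lemma sub_trivial: "vsp V \<Longrightarrow> sub {\<zero>\<^bsub>V\<^esub>} V" for V :: "('a::field, 'v) module"
  by (auto simp: sub_iff vsp_simps)

lemma sub_inter: "sub U V \<Longrightarrow> sub U' V \<Longrightarrow> sub (U \<inter> U') V" for V :: "('a::field, 'v) module"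
  by (auto simp: sub_iff)

lemma lin_iff:
  fixes V :: "('a::field, 'v) module"
  shows "lin V W T \<longleftrightarrow> vsp V \<and> vsp W \<and> (\<forall>x\<in>carrier V. T x \<in> carrier W) \<and>
    (\<forall>x\<in>carrier V. \<forall>y\<in>carrier V. T (x \<oplus>\<^bsub>V\<^esub> y) = T x \<oplus>\<^bsub>W\<^esub> T y) \<and>
    (\<forall>c. \<forall>x\<in>carrier V. T (c \<odot>\<^bsub>V\<^esub> x) = c \<odot>\<^bsub>W\<^esub> T x)"
  by (auto simp: linear_map_def mod_hom_def mod_hom_axioms_def LinearCombinations.module_hom_def vectorspace_def)

lemma linI:
  fixes V :: "('a::field, 'v) module"
  assumes "vsp V" "vsp W" "\<And>x. x \<in> carrier V \<Longrightarrow> T x \<in> carrier W"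
    "\<And>x y. x \<in> carrier V \<Longrightarrow> y \<in> carrier V \<Longrightarrow> T (x \<oplus>\<^bsub>V\<^esub> y) = T x \<oplus>\<^bsub>W\<^esub> T y"
    "\<And>c x. x \<in> carrier V \<Longrightarrow> T (c \<odot>\<^bsub>V\<^esub> x) = c \<odot>\<^bsub>W\<^esub> T x"
  shows "lin V W T"
  using assms by (auto simp: lin_iff)

lemma lin_dom: "lin V W T \<Longrightarrow> vsp V" and lin_cod: "lin V W T \<Longrightarrow> vsp W"
  and lin_closed: "lin V W T \<Longrightarrow> x \<in> carrier V \<Longrightarrow> T x \<in> carrier W"
  and lin_add: "lin V W T \<Longrightarrow> x \<in> carrier V \<Longrightarrow> y \<in> carrier V \<Longrightarrow> T (x \<oplus>\<^bsub>V\<^esub> y) = T x \<oplus>\<^bsub>W\<^esub> T y"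
  and lin_smult: "lin V W T \<Longrightarrow> x \<in> carrier V \<Longrightarrow> T (c \<odot>\<^bsub>V\<^esub> x) = c \<odot>\<^bsub>W\<^esub> T x"
  for V :: "('a::field, 'v) module"
  by (auto simp: lin_iff)

lemma lin_zero: "lin V W T \<Longrightarrow> T \<zero>\<^bsub>V\<^esub> = \<zero>\<^bsub>W\<^esub>" for V :: "('a::field, 'v) module"
  using lin_smult[of V W T "\<zero>\<^bsub>V\<^esub>" 0] by (simp add: lin_dom lin_cod vsp_simps lin_closed)

lemma lin_minus: "lin V W T \<Longrightarrow> x \<in> carrier V \<Longrightarrow> y \<in> carrier V \<Longrightarrow> T (x \<ominus>\<^bsub>V\<^esub> y) = T x \<ominus>\<^bsub>W\<^esub> T y"
  for V :: "('a::field, 'v) module"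
  by (simp add: vminus_eq lin_dom lin_cod lin_closed lin_add lin_smult vsp_closed)

lemma lin_cong:
  fixes V :: "('a::field, 'v) module"
  assumes "lin V W T" and "\<And>x. x \<in> carrier V \<Longrightarrow> T x = T' x"
  shows "lin V W T'"
  using assms(1) by (intro linI) (auto simp: lin_dom lin_cod vsp_closed lin_closed lin_add lin_smult
      simp flip: assms(2))

lemma lin_comp: "lin V W T \<Longrightarrow> lin W X S \<Longrightarrow> lin V X (\<lambda>x. S (T x))"
  for V :: "('a::field, 'v) module"
  by (auto simp: lin_iff)

lemma lin_id: "vsp V \<Longrightarrow> lin V V (\<lambda>x. x)" for V :: "('a::field, 'v) module"
  by (auto simp: lin_iff)

lemma lin_zero_map: "vsp V \<Longrightarrow> vsp W \<Longrightarrow> lin V W (\<lambda>x. \<zero>\<^bsub>W\<^esub>)" for V :: "('a::field, 'v) module"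
  by (auto simp: lin_iff vsp_simps)

lemma lin_restrict: "lin V W T \<Longrightarrow> sub U V \<Longrightarrow> sub X W \<Longrightarrow> T ` U \<subseteq> X \<Longrightarrow> lin (on V U) (on W X) T"
  for V :: "('a::field, 'v) module"
  by (intro linI vsp_on) (auto simp: lin_add lin_smult sub_closed)

lemma lin_restrict_dom: "lin V W T \<Longrightarrow> sub U V \<Longrightarrow> lin (on V U) W T"
  for V :: "('a::field, 'v) module"
  by (rule linI) (auto simp: lin_add lin_smult sub_closed vsp_on lin_cod lin_closed)

lemma lin_inv_into:
  fixes V :: "('a::field, 'v) module"
  assumes T: "lin V W T" and b: "bij_betw T (carrier V) (carrier W)"
  shows "lin W V (inv_into (carrier V) T)"
proof -
  have f: "T (inv_into (carrier V) T y) = y" "inv_into (carrier V) T y \<in> carrier V"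
    if "y \<in> carrier W" for y
    using that b by (auto simp: bij_betw_def f_inv_into_f inv_into_into)
  have inj: "x = y" if "x \<in> carrier V" "y \<in> carrier V" "T x = T y" for x y
    using that b by (auto simp: bij_betw_def inj_on_def)
  note vs = lin_dom[OF T] lin_cod[OF T]
  show ?thesis
    by (rule linI[OF vs(2) vs(1)]) (auto intro!: inj simp: f vs vsp_closed lin_add[OF T] lin_smult[OF T])
qed

lemma sub_image:
  fixes V :: "('a::field, 'v) module"
  assumes T: "lin V W T" and U: "sub U V"
  shows "sub (T ` U) W"
proof (rule subI)
  show "\<zero>\<^bsub>W\<^esub> \<in> T ` U" using imageI[OF sub_zero[OF U], of T] by (simp add: lin_zero[OF T])
  show "x \<oplus>\<^bsub>W\<^esub> y \<in> T ` U" if xy: "x \<in> T ` U" "y \<in> T ` U" for x y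
  proof -
    obtain u v where u: "u \<in> U" "v \<in> U" "x = T u" "y = T v" using xy by auto
    then have "x \<oplus>\<^bsub>W\<^esub> y = T (u \<oplus>\<^bsub>V\<^esub> v)" by (simp add: lin_add[OF T] sub_closed[OF U])
    then show ?thesis using u sub_add[OF U] by simp
  qed
  show "c \<odot>\<^bsub>W\<^esub> x \<in> T ` U" if x: "x \<in> T ` U" for c x
  proof -
    obtain u where u: "u \<in> U" "x = T u" using x by auto
    then have "c \<odot>\<^bsub>W\<^esub> x = T (c \<odot>\<^bsub>V\<^esub> u)" by (simp add: lin_smult[OF T] sub_closed[OF U])
    then show ?thesis using u sub_smult[OF U] by simp
  qed
qed (auto simp: lin_cod[OF T] lin_closed[OF T] sub_closed[OF U])

lemma sub_vimage: "lin V W T \<Longrightarrow> sub X W \<Longrightarrow> sub {v \<in> carrier V. T v \<in> X} V"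
  for V :: "('a::field, 'v) module"
  by (rule subI) (auto simp: lin_dom lin_cod vsp_closed lin_zero sub_zero lin_add sub_add lin_smult sub_smult)

lemma sub_kern: "lin V W T \<Longrightarrow> sub (kern V W T) V" for V :: "('a::field, 'v) module"
  using sub_vimage[OF _ sub_trivial, of V W T] by (simp add: lin_cod kern_def)

lemma lin_inj_iff: "lin V W T \<Longrightarrow> inj_on T (carrier V) \<longleftrightarrow> kern V W T = {\<zero>\<^bsub>V\<^esub>}"
  for V :: "('a::field, 'v) module"
proof
  assume T: "lin V W T"
  note z = lin_zero[OF T] vzero_closed[OF lin_dom[OF T]]
  show "kern V W T = {\<zero>\<^bsub>V\<^esub>}" if i: "inj_on T (carrier V)"
  proof -
    have "x = \<zero>\<^bsub>V\<^esub>" if "x \<in> carrier V" "T x = \<zero>\<^bsub>W\<^esub>" for x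
      using inj_onD[OF i, of x "\<zero>\<^bsub>V\<^esub>"] that z by metis
    then show ?thesis using z unfolding kern_def by blast
  qed
  show "inj_on T (carrier V)" if k: "kern V W T = {\<zero>\<^bsub>V\<^esub>}"
  proof (rule inj_onI)
    fix x y assume xy: "x \<in> carrier V" "y \<in> carrier V" "T x = T y"
    then have "x \<ominus>\<^bsub>V\<^esub> y \<in> kern V W T"
      by (simp add: kern_def lin_minus[OF T] vminus_closed[OF lin_dom[OF T]]
          vminus_eq_zero[OF lin_cod[OF T]] lin_closed[OF T])
    then show "x = y" using k xy vminus_eq_zero[OF lin_dom[OF T]] by simp
  qed
qed

lemma kern_minus_iff:
  "lin V W T \<Longrightarrow> x \<in> carrier V \<Longrightarrow> y \<in> carrier V \<Longrightarrow> x \<ominus>\<^bsub>V\<^esub> y \<in> kern V W T \<longleftrightarrow> T x = T y"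
  for V :: "('a::field, 'v) module"
  by (simp add: kern_def lin_minus lin_dom lin_cod lin_closed vsp_closed vminus_eq_zero)

lemma lin_inj_onI:
  "lin V W T \<Longrightarrow> (\<And>x. x \<in> carrier V \<Longrightarrow> T x = \<zero>\<^bsub>W\<^esub> \<Longrightarrow> x = \<zero>\<^bsub>V\<^esub>) \<Longrightarrow> inj_on T (carrier V)"
  for V :: "('a::field, 'v) module"
  by (subst lin_inj_iff) (auto simp: kern_def lin_dom vsp_closed lin_zero)

subsection \<open>Spans\<close>

lemma sub_span: "vsp V \<Longrightarrow> S \<subseteq> carrier V \<Longrightarrow> sub (vspan V S) V" for V :: "('a::field, 'v) module"
  using vectorspace.span_is_subspace by blast

lemma span_superset: "vsp V \<Longrightarrow> S \<subseteq> carrier V \<Longrightarrow> S \<subseteq> vspan V S" for V :: "('a::field, 'v) module"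
  by (simp add: LinearCombinations.module.in_own_span vectorspace.axioms(1))

lemma span_least: "sub U V \<Longrightarrow> S \<subseteq> U \<Longrightarrow> vspan V S \<subseteq> U" for V :: "('a::field, 'v) module"
  by (meson LinearCombinations.module.span_is_subset subspace_def vectorspace.axioms(1))

lemma span_sub: "sub U V \<Longrightarrow> vspan V U = U" for V :: "('a::field, 'v) module"
  by (simp add: span_least span_superset subset_antisym sub_subset sub_vsp)

lemma span_mono: "vsp V \<Longrightarrow> S \<subseteq> S' \<Longrightarrow> S' \<subseteq> carrier V \<Longrightarrow> vspan V S \<subseteq> vspan V S'"
  for V :: "('a::field, 'v) module"
  by (meson span_least span_superset sub_span subset_trans)

lemma span_on:
  fixes V :: "('a::field, 'v) module"
  assumes U: "sub U V" and S: "S \<subseteq> U"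
  shows "vspan (on V U) S = vspan V S"
proof -
  interpret vectorspace class_ring V by (rule sub_vsp[OF U])
  show ?thesis using span_li_not_depend(1)[OF S] U by (simp add: subspace_def)
qed

lemma span_image:
  fixes V :: "('a::field, 'v) module"
  assumes T: "lin V W T" and S: "S \<subseteq> carrier V"
  shows "T ` vspan V S = vspan W (T ` S)"
proof
  note vs = lin_dom[OF T] lin_cod[OF T]
  have TS: "T ` S \<subseteq> carrier W" using S lin_closed[OF T] by auto
  have "vspan V S \<subseteq> {v \<in> carrier V. T v \<in> vspan W (T ` S)}"
    using span_superset[OF vs(2) TS] S
    by (intro span_least sub_vimage[OF T] sub_span[OF vs(2) TS]) auto
  then show "T ` vspan V S \<subseteq> vspan W (T ` S)" by auto
  show "vspan W (T ` S) \<subseteq> T ` vspan V S"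
    using span_superset[OF vs(1) S]
    by (intro span_least sub_image[OF T] sub_span[OF vs(1) S]) auto
qed

text \<open>The equaliser of two linear maps is a subspace, so it contains the span of any set that
  it contains.\<close>

lemma lin_eq_on_span:
  fixes V :: "('a::field, 'v) module"
  assumes T: "lin V W T" and T': "lin V W T'" and S: "S \<subseteq> carrier V"
    and eq: "\<And>x. x \<in> S \<Longrightarrow> T x = T' x" and x: "x \<in> vspan V S"
  shows "T x = T' x"
proof -
  have "sub {v \<in> carrier V. T v = T' v} V"
    by (rule subI) (auto simp: vsp_closed lin_dom[OF T] lin_zero[OF T] lin_zero[OF T']
        lin_add[OF T] lin_add[OF T'] lin_smult[OF T] lin_smult[OF T'])
  then have "vspan V S \<subseteq> {v \<in> carrier V. T v = T' v}"
    by (rule span_least) (use S eq in auto)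
  with x show ?thesis by auto
qed

subsection \<open>Dimension\<close>

lemma fd_basis:
  fixes V :: "('a::field, 'v) module"
  assumes "vsp V" "fd V"
  obtains B where "finite B" "vectorspace.basis class_ring V B" "card B = vdim V"
  using vectorspace.finite_basis_exists[OF assms] vectorspace.dim_basis[OF assms(1)] by metis

text \<open>The dimension bounds the size of independent sets, so a maximal one among those
  containing \<open>A\<close> exists. It is maximal among all independent sets as well, hence a
  basis.\<close>

lemma indep_extend:
  fixes V :: "('a::field, 'v) module"
  assumes V: "vsp V" and fd: "fd V" and A: "A \<subseteq> carrier V"
    and li: "\<not> LinearCombinations.module.lin_dep class_ring V A"
  obtains B where "A \<subseteq> B" "finite B" "vectorspace.basis class_ring V B"
proof -
  interpret vectorspace class_ring V by (rule V)
  let ?P = "\<lambda>B. A \<subseteq> B \<and> B \<subseteq> carrier V \<and> lin_indpt B"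
  obtain B where B: "finite B" "maximal B ?P"
    using maximal_exists[of ?P dim A] li_le_dim[OF fd] A li by auto
  have "maximal B (\<lambda>S. S \<subseteq> carrier V \<and> lin_indpt S)"
    using B(2) unfolding maximal_def by (metis dual_order.trans)
  from max_li_is_basis[OF this] show ?thesis using that B unfolding maximal_def by metis
qed

text \<open>Independence does not depend on whether it is tested in \<open>U\<close> or in
  \<open>V\<close>. So \<open>vdim V\<close> bounds the independent subsets of \<open>U\<close>, and
  a maximal one is a basis of \<open>U\<close>; if it has \<open>vdim V\<close> elements, it is
  already a basis of \<open>V\<close>.\<close>

lemma fd_on:
  fixes V :: "('a::field, 'v) module"
  assumes fd: "fd V" and U: "sub U V"
  shows "fd (on V U)" "vdim (on V U) \<le> vdim V" "vdim (on V U) = vdim V \<Longrightarrow> U = carrier V"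
proof -
  note V = sub_vsp[OF U]
  interpret vectorspace class_ring V by (rule V)
  interpret S: vectorspace class_ring "on V U" by (rule vsp_on[OF U])
  have sm: "submodule class_ring U V" using U by (simp add: subspace_def)
  let ?P = "\<lambda>B. B \<subseteq> carrier (on V U) \<and> S.lin_indpt B"
  have li: "lin_indpt B" "B \<subseteq> carrier V" "B \<subseteq> U" if "?P B" for B
    using that span_li_not_depend(2)[OF _ sm, of B] sub_subset[OF U] by auto
  obtain B where B: "finite B" "maximal B ?P"
  proof -
    have "?P {}" by (auto simp: S.lin_dep_def)
    moreover have "finite B \<and> card B \<le> dim" if "?P B" for B using li[OF that] li_le_dim[OF fd] by blast
    ultimately show thesis using maximal_exists[of ?P dim "{}"] that by blast
  qed
  have b: "S.basis B" using S.max_li_is_basis[OF B(2)] .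
  show fdU: "fd (on V U)" using b B unfolding S.basis_def S.fin_dim_def by blast
  have d: "vdim (on V U) = card B" using S.dim_basis[OF B(1) b] .
  have PB: "?P B" using B(2) by (simp add: maximal_def)
  show "vdim (on V U) \<le> vdim V" using li_le_dim(2)[OF fd li(2,1)] PB d by simp
  assume "vdim (on V U) = vdim V"
  then have "basis B" using dim_li_is_basis[OF fd B(1) li(2,1)] PB d by simp
  then have "carrier V = span B" by (simp add: basis_def)
  also have "\<dots> \<subseteq> U" using span_is_subset[OF li(3) sm] PB by simp
  finally show "U = carrier V" using sub_subset[OF U] by simp
qed

lemma vdim_mono:
  fixes V :: "('a::field, 'v) module"
  assumes fd: "fd V" and U: "sub U V" and U': "sub U' V" and s: "U \<subseteq> U'"
  shows "vdim (on V U) \<le> vdim (on V U')" "vdim (on V U) = vdim (on V U') \<Longrightarrow> U = U'"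
  using fd_on(2,3)[OF fd_on(1)[OF fd U'], of U] U s by (auto simp: sub_on_iff[OF U'])

lemma rank_nullity:
  fixes V :: "('a::field, 'v) module"
  assumes T: "lin V W T" and fd: "fd V"
  shows "vdim V = vdim (on V (kern V W T)) + vdim (on W (T ` carrier V))" "fd (on W (T ` carrier V))"
proof -
  interpret linear_map class_ring V W T by (rule T)
  show "vdim V = vdim (on V (kern V W T)) + vdim (on W (T ` carrier V))"
    using rank_nullity[OF fd] by (simp add: im_def ker_def kern_def)
  have "lin V (on W (T ` carrier V)) T"
    by (rule linI) (auto simp: lin_dom[OF T] vsp_on[OF sub_image[OF T sub_carrier]])
  then interpret T: linear_map class_ring V "on W (T ` carrier V)" T .
  show "fd (on W (T ` carrier V))" using T.rank_nullity_main(2)[OF fd] by simp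
qed

lemma fd_surj: "lin V W T \<Longrightarrow> fd V \<Longrightarrow> T ` carrier V = carrier W \<Longrightarrow> fd W"
  for V :: "('a::field, 'v) module"
  using rank_nullity(2)[of V W T] by simp

text \<open>Restricting \<open>T\<close> to \<open>U\<close> replaces the kernel by its intersection
  with \<open>U\<close>. The dimension counts for filtrations and for base change take this
  form.\<close>

lemma rank_nullity_on:
  fixes V :: "('a::field, 'v) module"
  assumes T: "lin V W T" and fd: "fd V" and U: "sub U V"
  shows "vdim (on V U) = vdim (on V (U \<inter> kern V W T)) + vdim (on W (T ` U))"
proof -
  have e: "kern (on V U) W T = U \<inter> kern V W T" using sub_subset[OF U] by (auto simp: kern_def)
  show ?thesis
    using rank_nullity(1)[OF lin_restrict_dom[OF T U] fd_on(1)[OF fd U]] unfolding e by simp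
qed

lemma vdim_trivial: "vsp V \<Longrightarrow> vdim (on V {\<zero>\<^bsub>V\<^esub>}) = 0" for V :: "('a::field, 'v) module"
proof -
  assume V: "vsp V"
  interpret vectorspace class_ring "on V {\<zero>\<^bsub>V\<^esub>}" by (rule vsp_on[OF sub_trivial[OF V]])
  have "span {} = carrier (on V {\<zero>\<^bsub>V\<^esub>})" using span_empty by simp
  then have "basis {}" unfolding basis_def lin_dep_def by auto
  from dim_basis[OF _ this] show ?thesis by simp
qed

lemma vdim_inj:
  fixes V :: "('a::field, 'v) module"
  assumes T: "lin V W T" and fd: "fd V" and U: "sub U V" and inj: "inj_on T U"
  shows "vdim (on W (T ` U)) = vdim (on V U)"
proof -
  have "inj_on T (carrier (on V U))" using inj by simp
  then have "kern (on V U) W T = {\<zero>\<^bsub>V\<^esub>}" using lin_inj_iff[OF lin_restrict_dom[OF T U]] by simp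
  moreover have "kern (on V U) W T = U \<inter> kern V W T" using sub_subset[OF U] by (auto simp: kern_def)
  ultimately show ?thesis using rank_nullity_on[OF T fd U] vdim_trivial[OF sub_vsp[OF U]] by simp
qed

lemma vdim_bij: "lin V W T \<Longrightarrow> fd V \<Longrightarrow> bij_betw T (carrier V) (carrier W) \<Longrightarrow> vdim W = vdim V"
  for V :: "('a::field, 'v) module"
  using vdim_inj[of V W T "carrier V"] by (simp add: bij_betw_def sub_carrier lin_dom)

lemma vdim_zero_iff: "vsp V \<Longrightarrow> fd V \<Longrightarrow> vdim V = 0 \<longleftrightarrow> carrier V = {\<zero>\<^bsub>V\<^esub>}"
  for V :: "('a::field, 'v) module"
proof
  assume V: "vsp V" and fd: "fd V"
  show "carrier V = {\<zero>\<^bsub>V\<^esub>}" if "vdim V = 0"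
    using fd_on(3)[OF fd sub_trivial[OF V]] vdim_trivial[OF V] that by simp
  show "vdim V = 0" if c: "carrier V = {\<zero>\<^bsub>V\<^esub>}"
    using vdim_trivial[OF V] unfolding c[symmetric] by simp
qed

text \<open>The axioms are identities, so they pass through any surjection compatible with the
  operations. This provides the vector space structure both on quotients and on copies of a space
  along an injection.\<close>

lemma vsp_of_surj:
  fixes V :: "('a::field, 'v) module" and Q :: "('a, 'w) module"
  assumes V: "vsp V" and q: "q ` carrier V = carrier Q" and z: "\<zero>\<^bsub>Q\<^esub> = q \<zero>\<^bsub>V\<^esub>"
    and add: "\<And>x y. x \<in> carrier V \<Longrightarrow> y \<in> carrier V \<Longrightarrow> q (x \<oplus>\<^bsub>V\<^esub> y) = q x \<oplus>\<^bsub>Q\<^esub> q y"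
    and smult: "\<And>c x. x \<in> carrier V \<Longrightarrow> q (c \<odot>\<^bsub>V\<^esub> x) = c \<odot>\<^bsub>Q\<^esub> q x"
  shows "vsp Q" "lin V Q q"
proof -
  note s = add[symmetric] smult[symmetric] z q[symmetric] vsp_simps[OF V]
  show Q: "vsp Q"
  proof (rule vspI)
    show "\<zero>\<^bsub>Q\<^esub> \<in> carrier Q" by (simp add: s)
    show "x \<oplus>\<^bsub>Q\<^esub> y \<in> carrier Q" if "x \<in> carrier Q" "y \<in> carrier Q" for x y using that by (auto simp: s)
    show "c \<odot>\<^bsub>Q\<^esub> x \<in> carrier Q" if "x \<in> carrier Q" for c x using that by (auto simp: s)
    show "x \<oplus>\<^bsub>Q\<^esub> y = y \<oplus>\<^bsub>Q\<^esub> x" if "x \<in> carrier Q" "y \<in> carrier Q" for x y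
      using that by (auto simp: s vadd_comm[OF V])
    show "(x \<oplus>\<^bsub>Q\<^esub> y) \<oplus>\<^bsub>Q\<^esub> w = x \<oplus>\<^bsub>Q\<^esub> (y \<oplus>\<^bsub>Q\<^esub> w)"
      if "x \<in> carrier Q" "y \<in> carrier Q" "w \<in> carrier Q" for x y w
      using that by (auto simp: s vadd_assoc[OF V])
    show "x \<oplus>\<^bsub>Q\<^esub> \<zero>\<^bsub>Q\<^esub> = x" if "x \<in> carrier Q" for x using that by (auto simp: s)
    show "x \<oplus>\<^bsub>Q\<^esub> - 1 \<odot>\<^bsub>Q\<^esub> x = \<zero>\<^bsub>Q\<^esub>" if "x \<in> carrier Q" for x
      using that by (auto simp: s vneg_eq_smult[OF V, symmetric])
    show "c \<odot>\<^bsub>Q\<^esub> (x \<oplus>\<^bsub>Q\<^esub> y) = c \<odot>\<^bsub>Q\<^esub> x \<oplus>\<^bsub>Q\<^esub> c \<odot>\<^bsub>Q\<^esub> y"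
      if "x \<in> carrier Q" "y \<in> carrier Q" for c x y
      using that by (auto simp: s vsmult_add[OF V])
    show "(c + d) \<odot>\<^bsub>Q\<^esub> x = c \<odot>\<^bsub>Q\<^esub> x \<oplus>\<^bsub>Q\<^esub> d \<odot>\<^bsub>Q\<^esub> x" if "x \<in> carrier Q" for c d x
      using that by (auto simp: s vadd_smult[OF V])
    show "(c * d) \<odot>\<^bsub>Q\<^esub> x = c \<odot>\<^bsub>Q\<^esub> (d \<odot>\<^bsub>Q\<^esub> x)" if "x \<in> carrier Q" for c d x
      using that by (auto simp: s)
    show "1 \<odot>\<^bsub>Q\<^esub> x = x" if "x \<in> carrier Q" for x using that by (auto simp: s)
  qed
  show "lin V Q q" by (rule linI[OF V Q]) (use q in \<open>auto simp: add smult\<close>)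
qed

section \<open>Cosets and quotient spaces\<close>

lemma coset_eq_iff:
  fixes V :: "('a::field, 'v) module"
  assumes N: "sub N V" and x: "x \<in> carrier V" and y: "y \<in> carrier V"
  shows "N +>\<^bsub>V\<^esub> x = N +>\<^bsub>V\<^esub> y \<longleftrightarrow> x \<ominus>\<^bsub>V\<^esub> y \<in> N" "y \<in> N +>\<^bsub>V\<^esub> x \<longleftrightarrow> y \<ominus>\<^bsub>V\<^esub> x \<in> N"
proof -
  note V = sub_vsp[OF N]
  interpret vectorspace class_ring V by (rule V)
  have mem: "y \<in> N +>\<^bsub>V\<^esub> x \<longleftrightarrow> y \<ominus>\<^bsub>V\<^esub> x \<in> N" if xy: "x \<in> carrier V" "y \<in> carrier V" for x y
  proof
    assume "y \<in> N +>\<^bsub>V\<^esub> x"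
    then obtain n where n: "n \<in> N" "y = n \<oplus>\<^bsub>V\<^esub> x" by (auto simp: a_r_coset_def')
    then have "y \<ominus>\<^bsub>V\<^esub> x = n" using xy sub_closed[OF N]
      by (simp add: a_minus_def M.a_assoc M.r_neg)
    then show "y \<ominus>\<^bsub>V\<^esub> x \<in> N" using n by simp
  next
    assume "y \<ominus>\<^bsub>V\<^esub> x \<in> N"
    moreover have "y = (y \<ominus>\<^bsub>V\<^esub> x) \<oplus>\<^bsub>V\<^esub> x" using xy by (simp add: a_minus_def M.a_assoc M.l_neg)
    ultimately show "y \<in> N +>\<^bsub>V\<^esub> x" by (auto simp: a_r_coset_def')
  qed
  show "y \<in> N +>\<^bsub>V\<^esub> x \<longleftrightarrow> y \<ominus>\<^bsub>V\<^esub> x \<in> N" using mem x y by simp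
  have refl: "x \<in> N +>\<^bsub>V\<^esub> x" if "x \<in> carrier V" for x
    using mem[OF that that] that sub_zero[OF N] by (simp add: vminus_eq_zero[OF V, THEN iffD2])
  show "N +>\<^bsub>V\<^esub> x = N +>\<^bsub>V\<^esub> y \<longleftrightarrow> x \<ominus>\<^bsub>V\<^esub> y \<in> N"
  proof
    assume "N +>\<^bsub>V\<^esub> x = N +>\<^bsub>V\<^esub> y"
    then show "x \<ominus>\<^bsub>V\<^esub> y \<in> N" using mem[OF y x] refl[OF x] by simp
  next
    assume xy: "x \<ominus>\<^bsub>V\<^esub> y \<in> N"
    have cl: "z \<in> carrier V" if "z \<in> N +>\<^bsub>V\<^esub> w" "w \<in> carrier V" for z w
      using that sub_closed[OF N] by (auto simp: a_r_coset_def')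
    have "z \<ominus>\<^bsub>V\<^esub> x \<in> N \<longleftrightarrow> z \<ominus>\<^bsub>V\<^esub> y \<in> N" if z: "z \<in> carrier V" for z
    proof -
      have "z \<ominus>\<^bsub>V\<^esub> y = (z \<ominus>\<^bsub>V\<^esub> x) \<oplus>\<^bsub>V\<^esub> (x \<ominus>\<^bsub>V\<^esub> y)"
        using x y z by (simp add: a_minus_def M.a_assoc M.r_neg1)
      moreover have "z \<ominus>\<^bsub>V\<^esub> x = (z \<ominus>\<^bsub>V\<^esub> y) \<oplus>\<^bsub>V\<^esub> (y \<ominus>\<^bsub>V\<^esub> x)"
        using x y z by (simp add: a_minus_def M.a_assoc M.r_neg1)
      moreover have "y \<ominus>\<^bsub>V\<^esub> x = (-1) \<odot>\<^bsub>V\<^esub> (x \<ominus>\<^bsub>V\<^esub> y)"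
        using x y by (simp add: vneg_eq_smult[OF V, symmetric] a_minus_def M.minus_add M.a_ac)
      then have "y \<ominus>\<^bsub>V\<^esub> x \<in> N" using sub_smult[OF N xy] by metis
      ultimately show ?thesis using sub_add[OF N] xy by metis
    qed
    then show "N +>\<^bsub>V\<^esub> x = N +>\<^bsub>V\<^esub> y" using mem x y cl by blast
  qed
qed

lemma quot_module_proj:
  fixes V :: "('a::field, 'v) module"
  assumes N: "sub N V"
  defines "q \<equiv> \<lambda>x. N +>\<^bsub>V\<^esub> x"
  shows "vsp (quot_module V N)" "lin V (quot_module V N) q" "q ` carrier V = carrier (quot_module V N)"
    "kern V (quot_module V N) q = N"
    "\<And>x y. x \<in> carrier V \<Longrightarrow> y \<in> carrier V \<Longrightarrow> q x = q y \<longleftrightarrow> x \<ominus>\<^bsub>V\<^esub> y \<in> N"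
    "\<And>A x. A \<in> carrier (quot_module V N) \<Longrightarrow> x \<in> A \<Longrightarrow> x \<in> carrier V \<and> q x = A"
    "\<And>A. A \<in> carrier (quot_module V N) \<Longrightarrow> A \<noteq> {}"
proof -
  note V = sub_vsp[OF N]
  interpret vectorspace class_ring V by (rule V)
  have ad: "abelian_subgroup N V"
    using submodule_is_module[of N] N subspace_def
    by (intro abelian_subgroupI3 additive_subgroup.intro subgroup.intro)
      (auto simp: sub_iff M.a_group intro: M.abelian_group_axioms simp: vneg_eq_smult[OF V] a_inv_def[symmetric])
  show s: "q ` carrier V = carrier (quot_module V N)"
    by (auto simp: q_def quot_module_def A_RCOSETS_def')
  show e: "q x = q y \<longleftrightarrow> x \<ominus>\<^bsub>V\<^esub> y \<in> N" if "x \<in> carrier V" "y \<in> carrier V" for x y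
    unfolding q_def by (rule coset_eq_iff[OF N that])
  have z: "q \<zero>\<^bsub>V\<^esub> = N" unfolding q_def
    using sub_subset[OF N] by (auto simp: a_r_coset_def' subset_iff)
  \<comment> \<open>\<open>quot_module\<close> defines a scalar multiple of a coset as the union of
    the cosets of \<open>c y\<close> over all representatives \<open>y\<close>. These cosets all
    coincide, because two representatives differ by an element of \<open>N\<close>.\<close>
  have sm: "q (c \<odot>\<^bsub>V\<^esub> x) = c \<odot>\<^bsub>quot_module V N\<^esub> q x" if x: "x \<in> carrier V" for c x
  proof -
    have "q (c \<odot>\<^bsub>V\<^esub> y) = q (c \<odot>\<^bsub>V\<^esub> x)" if y: "y \<in> q x" for y
    proof -
      have yV: "y \<in> carrier V" using y x sub_closed[OF N] by (auto simp: q_def a_r_coset_def')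
      then have "y \<ominus>\<^bsub>V\<^esub> x \<in> N" using y coset_eq_iff(2)[OF N x] by (simp add: q_def)
      then have "c \<odot>\<^bsub>V\<^esub> (y \<ominus>\<^bsub>V\<^esub> x) \<in> N" by (rule sub_smult[OF N])
      moreover have "c \<odot>\<^bsub>V\<^esub> (y \<ominus>\<^bsub>V\<^esub> x) = c \<odot>\<^bsub>V\<^esub> y \<ominus>\<^bsub>V\<^esub> c \<odot>\<^bsub>V\<^esub> x"
        using x yV by (simp add: vminus_eq[OF V] vsmult_add[OF V] vsmult_smult[OF V] vsp_closed[OF V])
      ultimately show ?thesis using x yV by (simp add: e)
    qed
    moreover have "x \<in> q x" using coset_eq_iff(2)[OF N x x] x sub_zero[OF N]
      by (simp add: q_def vminus_eq_zero[OF V, THEN iffD2])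
    ultimately have "(\<Union>y\<in>q x. q (c \<odot>\<^bsub>V\<^esub> y)) = q (c \<odot>\<^bsub>V\<^esub> x)" by blast
    then show ?thesis by (simp add: quot_module_def q_def)
  qed
  have l: "vsp (quot_module V N)" "lin V (quot_module V N) q"
  proof -
    have zz: "\<zero>\<^bsub>quot_module V N\<^esub> = q \<zero>\<^bsub>V\<^esub>" by (simp add: z quot_module_def)
    have aa: "q (x \<oplus>\<^bsub>V\<^esub> y) = q x \<oplus>\<^bsub>quot_module V N\<^esub> q y" if "x \<in> carrier V" "y \<in> carrier V" for x y
      using abelian_subgroup.a_rcos_sum[OF ad that] by (simp add: q_def quot_module_def)
    show "vsp (quot_module V N)" "lin V (quot_module V N) q"
      by (rule vsp_of_surj[OF V s zz]; simp add: aa sm)+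
  qed
  then show "vsp (quot_module V N)" "lin V (quot_module V N) q" by auto
  show "kern V (quot_module V N) q = N"
  proof -
    have "q x = \<zero>\<^bsub>quot_module V N\<^esub> \<longleftrightarrow> x \<in> N" if x: "x \<in> carrier V" for x
    proof -
      have "q x = q \<zero>\<^bsub>V\<^esub> \<longleftrightarrow> x \<in> N"
        using e[OF x vzero_closed[OF V]] x by (simp add: vminus_eq[OF V] vsp_simps[OF V])
      then show ?thesis using z by (simp add: quot_module_def)
    qed
    then show ?thesis using sub_subset[OF N] by (auto simp: kern_def)
  qed
  show "x \<in> carrier V \<and> q x = A" if A: "A \<in> carrier (quot_module V N)" and x: "x \<in> A" for A x
  proof -
    obtain y where y: "y \<in> carrier V" "A = q y" using A s by auto
    have xV: "x \<in> carrier V" using x y sub_closed[OF N] by (auto simp: q_def a_r_coset_def')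
    then show ?thesis using x y e coset_eq_iff(2)[OF N y(1)] by (auto simp: q_def)
  qed
  show "A \<noteq> {}" if A: "A \<in> carrier (quot_module V N)" for A
  proof -
    obtain y where y: "y \<in> carrier V" "A = q y" using A s by auto
    then show ?thesis using sub_zero[OF N] by (auto simp: q_def a_r_coset_def')
  qed
qed

text \<open>Requiring the coefficient function to be extensional on \<open>B\<close> makes it
  unique, as the definite description demands.\<close>

definition coord :: "('a::field, 'v) module \<Rightarrow> 'v set \<Rightarrow> 'v \<Rightarrow> 'v \<Rightarrow> 'a" where
  "coord V B v = (THE a. a \<in> B \<rightarrow>\<^sub>E UNIV \<and> LinearCombinations.module.lincomb V a B = v)"

abbreviation vbasis :: "('a::field, 'v) module \<Rightarrow> 'v set \<Rightarrow> bool" where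
  "vbasis V B \<equiv> vectorspace.basis class_ring V B"

context
  fixes V :: "('a::field, 'v) module" and B :: "'v set"
  assumes V: "vsp V" and finB: "finite B" and B: "vbasis V B"
begin

interpretation vectorspace class_ring V by (rule V)

lemma BV: "B \<subseteq> carrier V" using B by (simp add: basis_def)

lemma coord_prop:
  assumes v: "v \<in> carrier V"
  shows "coord V B v \<in> B \<rightarrow>\<^sub>E UNIV" "lincomb (coord V B v) B = v"
proof -
  have "\<exists>!a. a \<in> B \<rightarrow>\<^sub>E UNIV \<and> lincomb a B = v"
    using basis_criterion[OF finB BV] B v by simp
  from theI'[OF this] show "coord V B v \<in> B \<rightarrow>\<^sub>E UNIV" "lincomb (coord V B v) B = v"
    by (auto simp: coord_def)
qed

lemma coord_lincomb:
  assumes b: "b \<in> B"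
  shows "coord V B (lincomb a B) b = a b"
proof -
  have cl: "lincomb a B \<in> carrier V" using lincomb_closed[OF BV] by simp
  have r: "lincomb (restrict a B) B = lincomb a B"
    by (rule lincomb_cong[OF refl BV]) auto
  have "\<exists>!a'. a' \<in> B \<rightarrow>\<^sub>E UNIV \<and> lincomb a' B = lincomb a B"
    using basis_criterion[OF finB BV] B cl by simp
  then have "coord V B (lincomb a B) = restrict a B"
    using coord_prop[OF cl] r by auto
  then show ?thesis using b by simp
qed

lemma coord_eqI: "b \<in> B \<Longrightarrow> v = lincomb a B \<Longrightarrow> coord V B v b = a b"
  using coord_lincomb by simp

lemma coord_add:
  assumes "x \<in> carrier V" "y \<in> carrier V" "b \<in> B"
  shows "coord V B (x \<oplus>\<^bsub>V\<^esub> y) b = coord V B x b + coord V B y b"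
  using assms lincomb_sum[OF finB BV, of "coord V B x" "coord V B y"]
  by (intro coord_eqI) (simp_all add: coord_prop)

lemma coord_smult:
  assumes "x \<in> carrier V" "b \<in> B"
  shows "coord V B (c \<odot>\<^bsub>V\<^esub> x) b = c * coord V B x b"
  using assms lincomb_smult[OF BV, of "coord V B x" c]
  by (intro coord_eqI) (simp_all add: coord_prop)

lemma coord_basis:
  assumes b: "b \<in> B" and b': "b' \<in> B"
  shows "coord V B b b' = (if b' = b then 1 else 0)"
proof (rule coord_eqI[OF b', of _ "\<lambda>x. if x = b then 1 else 0"])
  have "lincomb (\<lambda>x. if x = b then 1 else 0) B =
      (if b = b then 1 else 0) \<odot>\<^bsub>V\<^esub> b \<oplus>\<^bsub>V\<^esub> lincomb (\<lambda>x. if x = b then 1 else 0) (B - {b})"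
    by (rule lincomb_del2[OF finB BV _ b]) simp
  also have "lincomb (\<lambda>x. if x = b then 1 else 0) (B - {b}) = lincomb (\<lambda>x. 0) (B - {b})"
    by (rule lincomb_cong[OF refl]) (use BV in auto)
  also have "\<dots> = \<zero>\<^bsub>V\<^esub>" using lincomb_zero[of "B - {b}" "\<lambda>x. 0"] BV by auto
  finally show "b = lincomb (\<lambda>x. if x = b then 1 else 0) B" using b BV by (auto simp: smult_one[simplified] subset_iff)
qed

lemma lin_extension:
  fixes W :: "('a, 'w) module"
  assumes W: "vsp W" and f: "\<And>b. b \<in> B \<Longrightarrow> f b \<in> carrier W"
  shows "\<exists>g. lin V W g \<and> (\<forall>b\<in>B. g b = f b)"
proof -
  interpret W: vectorspace class_ring W by (rule W)
  define g where "g v = finsum W (\<lambda>b. coord V B v b \<odot>\<^bsub>W\<^esub> f b) B" for v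
  have l: "lin V W g"
  proof (rule linI[OF V W])
    show "g x \<in> carrier W" if "x \<in> carrier V" for x
      unfolding g_def by (rule W.M.finsum_closed) (use f in \<open>auto simp: vsp_closed[OF W]\<close>)
    show "g (x \<oplus>\<^bsub>V\<^esub> y) = g x \<oplus>\<^bsub>W\<^esub> g y" if xy: "x \<in> carrier V" "y \<in> carrier V" for x y
    proof -
      have "g (x \<oplus>\<^bsub>V\<^esub> y) = finsum W (\<lambda>b. coord V B x b \<odot>\<^bsub>W\<^esub> f b \<oplus>\<^bsub>W\<^esub> coord V B y b \<odot>\<^bsub>W\<^esub> f b) B"
        unfolding g_def
        by (rule W.M.finsum_cong'[OF refl]) (use xy f in \<open>auto simp: coord_add vadd_smult[OF W] vsp_closed[OF W]\<close>)
      also have "\<dots> = g x \<oplus>\<^bsub>W\<^esub> g y"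
        unfolding g_def by (rule W.M.finsum_addf) (use f in \<open>auto simp: vsp_closed[OF W]\<close>)
      finally show ?thesis .
    qed
    show "g (c \<odot>\<^bsub>V\<^esub> x) = c \<odot>\<^bsub>W\<^esub> g x" if x: "x \<in> carrier V" for c x
    proof -
      have "g (c \<odot>\<^bsub>V\<^esub> x) = finsum W (\<lambda>b. c \<odot>\<^bsub>W\<^esub> (coord V B x b \<odot>\<^bsub>W\<^esub> f b)) B"
        unfolding g_def
        by (rule W.M.finsum_cong'[OF refl]) (use x f in \<open>auto simp: coord_smult vsmult_smult[OF W] vsp_closed[OF W]\<close>)
      also have "\<dots> = c \<odot>\<^bsub>W\<^esub> g x"
        unfolding g_def by (rule W.finsum_smult[symmetric]) (use f in \<open>auto simp: vsp_closed[OF W]\<close>)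
      finally show ?thesis .
    qed
  qed
  moreover have "g b = f b" if b: "b \<in> B" for b
  proof -
    have "g b = finsum W (\<lambda>b'. if b = b' then f b' else \<zero>\<^bsub>W\<^esub>) B"
      unfolding g_def
      by (rule W.M.finsum_cong'[OF refl]) (use b f in \<open>auto simp: coord_basis vsp_simps[OF W]\<close>)
    also have "\<dots> = f b" using W.M.add.finprod_singleton[OF b finB, of f] f by simp
    finally show ?thesis .
  qed
  ultimately show ?thesis by blast
qed

end

subsection \<open>Semilinear maps and scalar extensions\<close>

definition semilin :: "('s::field \<Rightarrow> 'K::field) \<Rightarrow> ('s, 'v) module \<Rightarrow> ('K, 'w) module \<Rightarrow> ('v \<Rightarrow> 'w) \<Rightarrow> bool" where
  "semilin e V W j \<longleftrightarrow> vsp V \<and> vsp W \<and> (\<forall>x\<in>carrier V. j x \<in> carrier W) \<and>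
    (\<forall>x\<in>carrier V. \<forall>y\<in>carrier V. j (x \<oplus>\<^bsub>V\<^esub> y) = j x \<oplus>\<^bsub>W\<^esub> j y) \<and>
    (\<forall>c. \<forall>x\<in>carrier V. j (c \<odot>\<^bsub>V\<^esub> x) = e c \<odot>\<^bsub>W\<^esub> j x)"

lemma semilinI:
  assumes "vsp V" "vsp W" "\<And>x. x \<in> carrier V \<Longrightarrow> j x \<in> carrier W"
    "\<And>x y. x \<in> carrier V \<Longrightarrow> y \<in> carrier V \<Longrightarrow> j (x \<oplus>\<^bsub>V\<^esub> y) = j x \<oplus>\<^bsub>W\<^esub> j y"
    "\<And>c x. x \<in> carrier V \<Longrightarrow> j (c \<odot>\<^bsub>V\<^esub> x) = e c \<odot>\<^bsub>W\<^esub> j x"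
  shows "semilin e V W j"
  using assms by (auto simp: semilin_def)

lemma semilin_dom: "semilin e V W j \<Longrightarrow> vsp V" and semilin_cod: "semilin e V W j \<Longrightarrow> vsp W"
  and semilin_closed: "semilin e V W j \<Longrightarrow> x \<in> carrier V \<Longrightarrow> j x \<in> carrier W"
  and semilin_add: "semilin e V W j \<Longrightarrow> x \<in> carrier V \<Longrightarrow> y \<in> carrier V \<Longrightarrow> j (x \<oplus>\<^bsub>V\<^esub> y) = j x \<oplus>\<^bsub>W\<^esub> j y"
  and semilin_smult: "semilin e V W j \<Longrightarrow> x \<in> carrier V \<Longrightarrow> j (c \<odot>\<^bsub>V\<^esub> x) = e c \<odot>\<^bsub>W\<^esub> j x"
  by (auto simp: semilin_def)

lemma semilin_zero:
  assumes j: "semilin e V W j" shows "j \<zero>\<^bsub>V\<^esub> = \<zero>\<^bsub>W\<^esub>"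
proof -
  note vs = semilin_dom[OF j] semilin_cod[OF j]
  have "j \<zero>\<^bsub>V\<^esub> \<oplus>\<^bsub>W\<^esub> j \<zero>\<^bsub>V\<^esub> = j \<zero>\<^bsub>V\<^esub> \<oplus>\<^bsub>W\<^esub> \<zero>\<^bsub>W\<^esub>"
    using semilin_add[OF j, of "\<zero>\<^bsub>V\<^esub>" "\<zero>\<^bsub>V\<^esub>"] semilin_closed[OF j, of "\<zero>\<^bsub>V\<^esub>"]
    by (simp add: vsp_simps[OF vs(1)] vsp_simps[OF vs(2)])
  then show ?thesis
    using vadd_cancel_left[OF vs(2), of "j \<zero>\<^bsub>V\<^esub>" "j \<zero>\<^bsub>V\<^esub>" "\<zero>\<^bsub>W\<^esub>"]
      semilin_closed[OF j, of "\<zero>\<^bsub>V\<^esub>"] by (simp add: vsp_simps[OF vs(1)] vsp_simps[OF vs(2)])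
qed

lemma semilin_lin: "semilin e V W j \<Longrightarrow> lin W X T \<Longrightarrow> semilin e V X (\<lambda>v. T (j v))"
  by (rule semilinI) (auto simp: semilin_def lin_iff)

lemma lin_semilin: "lin U V T \<Longrightarrow> semilin e V W j \<Longrightarrow> semilin e U W (\<lambda>v. j (T v))"
  by (rule semilinI) (auto simp: semilin_def lin_iff)

lemma semilin_vimage: "semilin e V W j \<Longrightarrow> sub X W \<Longrightarrow> sub {v \<in> carrier V. j v \<in> X} V"
  by (rule subI) (auto simp: semilin_dom vsp_closed[OF semilin_dom] semilin_zero sub_zero semilin_add
      sub_add semilin_smult sub_smult)

lemma semilin_span:
  assumes j: "semilin e V W j" and S: "S \<subseteq> carrier V" and v: "v \<in> vspan V S"
  shows "j v \<in> vspan W (j ` S)"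
proof -
  have jS: "j ` S \<subseteq> carrier W" using S semilin_closed[OF j] by auto
  have "vspan V S \<subseteq> {v \<in> carrier V. j v \<in> vspan W (j ` S)}"
    using S span_superset[OF semilin_cod[OF j] jS]
    by (intro span_least semilin_vimage[OF j] sub_span[OF semilin_cod[OF j] jS]) auto
  with v show ?thesis by auto
qed

lemma semilin_eq_on_span:
  assumes j: "semilin e V W j" and j': "semilin e V W j'" and S: "S \<subseteq> carrier V"
    and eq: "\<And>x. x \<in> S \<Longrightarrow> j x = j' x" and x: "x \<in> vspan V S"
  shows "j x = j' x"
proof -
  have "sub {v \<in> carrier V. j v = j' v} V"
    by (rule subI) (auto simp: vsp_closed[OF semilin_dom[OF j]] semilin_dom[OF j] semilin_zero[OF j] semilin_zero[OF j']
        semilin_add[OF j] semilin_add[OF j'] semilin_smult[OF j] semilin_smult[OF j'])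
  then have "vspan V S \<subseteq> {v \<in> carrier V. j v = j' v}"
    by (rule span_least) (use S eq in auto)
  with x show ?thesis by auto
qed

text \<open>A model of K \<otimes> V that does not mention tensors: the spanning condition says that
  the induced map K \<otimes> V \<rightarrow> W is onto, and the equality of dimensions then makes
  it bijective. In this form the notion applies to \<open>base_change\<close>, to
  \<open>V\<^sub>K\<close>, and to subspaces and quotients of \<open>V\<^sub>K\<close>
  alike.\<close>

definition scalar_ext :: "('s::field \<Rightarrow> 'K::field) \<Rightarrow> ('s, 'v) module \<Rightarrow> ('K, 'w) module \<Rightarrow> ('v \<Rightarrow> 'w) \<Rightarrow> bool" where
  "scalar_ext e V W j \<longleftrightarrow> semilin e V W j \<and> fd V \<and> fd W \<and> vspan W (j ` carrier V) = carrier W \<and> vdim W = vdim V"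

lemma scalar_ext_semilin: "scalar_ext e V W j \<Longrightarrow> semilin e V W j"
  and scalar_ext_fd: "scalar_ext e V W j \<Longrightarrow> fd V" "scalar_ext e V W j \<Longrightarrow> fd W"
  and scalar_ext_span: "scalar_ext e V W j \<Longrightarrow> vspan W (j ` carrier V) = carrier W"
  and scalar_ext_dim: "scalar_ext e V W j \<Longrightarrow> vdim W = vdim V"
  by (auto simp: scalar_ext_def)

lemma basis_props:
  fixes V :: "('a::field, 'v) module"
  assumes V: "vsp V" and B: "vbasis V B"
  shows "B \<subseteq> carrier V" "vspan V B = carrier V" "\<not> LinearCombinations.module.lin_dep class_ring V B"
proof -
  interpret vectorspace class_ring V by (rule V)
  show "B \<subseteq> carrier V" "vspan V B = carrier V" "\<not> LinearCombinations.module.lin_dep class_ring V B"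
    using B by (auto simp: basis_def)
qed

text \<open>The image of \<open>B\<close> spans \<open>W\<close> and has at most
  \<open>vdim W\<close> elements, so it is a basis and no two elements of \<open>B\<close> can be
  identified.\<close>

lemma scalar_ext_basis:
  assumes j: "scalar_ext e V W j" and fB: "finite B" and B: "vbasis V B"
  shows "inj_on j B" "vbasis W (j ` B)"
proof -
  note s = scalar_ext_semilin[OF j]
  note vs = semilin_dom[OF s] semilin_cod[OF s]
  interpret V: vectorspace class_ring V by (rule vs(1))
  interpret W: vectorspace class_ring W by (rule vs(2))
  note BV = basis_props[OF vs(1) B]
  have jB: "j ` B \<subseteq> carrier W" using BV(1) semilin_closed[OF s] by auto
  have "j ` carrier V \<subseteq> vspan W (j ` B)" using semilin_span[OF s BV(1)] BV(2) by auto
  then have "carrier W \<subseteq> vspan W (j ` B)"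
    using span_least[OF sub_span[OF vs(2) jB]] scalar_ext_span[OF j] by auto
  then have gen: "W.gen_set (j ` B)" using sub_subset[OF sub_span[OF vs(2) jB]] by auto
  have d: "W.dim = card B" using scalar_ext_dim[OF j] V.dim_basis[OF fB B] by simp
  have le: "card (j ` B) \<le> card B" using fB by (rule card_image_le)
  show "vbasis W (j ` B)"
    by (rule W.dim_gen_is_basis) (use fB jB gen d le in auto)
  from W.dim_basis[OF _ this] fB d have "card (j ` B) = card B" by simp
  then show "inj_on j B" using fB by (rule eq_card_imp_inj_on[rotated])
qed

text \<open>This is the injectivity of K \<otimes> U \<rightarrow> K \<otimes> V in terms of spans.
  A basis of \<open>U\<close> extends to a basis of \<open>V\<close>, whose image is independent, so
  the span of the image of \<open>U\<close> has the dimension of \<open>U\<close>.\<close>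

lemma scalar_ext_on:
  assumes j: "scalar_ext e V W j" and U: "sub U V"
  shows "scalar_ext e (on V U) (on W (vspan W (j ` U))) j"
proof -
  note s = scalar_ext_semilin[OF j]
  note vs = semilin_dom[OF s] semilin_cod[OF s]
  have jU: "j ` U \<subseteq> carrier W" using sub_subset[OF U] semilin_closed[OF s] by auto
  note sp = sub_span[OF vs(2) jU]
  have fU: "fd (on V U)" by (rule fd_on(1)[OF scalar_ext_fd(1)[OF j] U])
  obtain C where C: "finite C" "vbasis (on V U) C" "card C = vdim (on V U)"
    using fd_basis[OF vsp_on[OF U] fU] .
  note bC = basis_props[OF vsp_on[OF U] C(2), simplified]
  interpret V: vectorspace class_ring V by (rule vs(1))
  interpret W: vectorspace class_ring W by (rule vs(2))
  interpret X: vectorspace class_ring "on W (vspan W (j ` U))" by (rule vsp_on[OF sp])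
  have smU: "submodule class_ring U V" using U by (simp add: subspace_def)
  have smX: "submodule class_ring (vspan W (j ` U)) W" using sp by (simp add: subspace_def)
  have CV: "C \<subseteq> carrier V" "V.lin_indpt C"
    using bC sub_subset[OF U] V.span_li_not_depend(2)[OF bC(1) smU] by auto
  obtain B where B: "C \<subseteq> B" "finite B" "vbasis V B"
    using indep_extend[OF vs(1) scalar_ext_fd(1)[OF j] CV] .
  note bB = scalar_ext_basis[OF j B(2,3)]
  have "W.lin_indpt (j ` B)" using basis_props(3)[OF vs(2) bB(2)] .
  then have li: "W.lin_indpt (j ` C)" using W.subset_li_is_li[of "j ` B" "j ` C"] B(1) by blast
  have jC: "j ` C \<subseteq> vspan W (j ` U)" using bC(1) span_superset[OF vs(2) jU] by blast
  have sU: "semilin e (on V U) (on W (vspan W (j ` U))) j"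
    by (rule semilinI) (use span_superset[OF vs(2) jU] in
        \<open>auto simp: vsp_on[OF U] vsp_on[OF sp] semilin_add[OF s] semilin_smult[OF s] sub_closed[OF U]\<close>)
  have "j ` U \<subseteq> vspan W (j ` C)"
    using semilin_span[OF s CV(1)] bC(2) span_on[OF U bC(1)] by auto
  moreover have jCW: "j ` C \<subseteq> carrier W" using jC sub_subset[OF sp] by blast
  ultimately have "vspan W (j ` U) \<subseteq> vspan W (j ` C)"
    by (intro span_least sub_span[OF vs(2) jCW])
  moreover have "vspan W (j ` C) \<subseteq> vspan W (j ` U)" by (rule span_least[OF sp jC])
  ultimately have e: "vspan W (j ` C) = vspan W (j ` U)" by simp
  have "vbasis (on W (vspan W (j ` U))) (j ` C)"
    unfolding X.basis_def using W.span_li_not_depend[OF jC smX] li jC e by simp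
  then have "vdim (on W (vspan W (j ` U))) = card (j ` C)" using X.dim_basis C(1) by blast
  also have "\<dots> = card C" using inj_on_subset[OF bB(1) B(1)] by (rule card_image)
  finally have d: "vdim (on W (vspan W (j ` U))) = vdim (on V U)" using C(3) by simp
  show ?thesis unfolding scalar_ext_def
    using sU fU fd_on(1)[OF scalar_ext_fd(2)[OF j] sp] d span_on[OF sp span_superset[OF vs(2) jU]] by simp
qed

text \<open>The universal property of the tensor product. The linear map is prescribed on the image
  of a basis; two semilinear maps that agree on a basis of \<open>V\<close> agree
  everywhere.\<close>

lemma scalar_ext_lift:
  assumes j: "scalar_ext e V W j" and f: "semilin e V M f"
  shows "\<exists>g. lin W M g \<and> (\<forall>v\<in>carrier V. g (j v) = f v)"
proof -
  note s = scalar_ext_semilin[OF j]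
  note vs = semilin_dom[OF s] semilin_cod[OF s] semilin_cod[OF f]
  obtain B where B: "finite B" "vbasis V B" using fd_basis[OF vs(1) scalar_ext_fd(1)[OF j]] .
  note bB = scalar_ext_basis[OF j B] and BV = basis_props[OF vs(1) B(2)]
  have "f (inv_into B j b) \<in> carrier M" if "b \<in> j ` B" for b
    using semilin_closed[OF f] BV(1) inv_into_into[OF that] by auto
  then obtain g where g: "lin W M g" "\<forall>b\<in>j ` B. g b = f (inv_into B j b)"
    using lin_extension[OF vs(2) finite_imageI[OF B(1)] bB(2) vs(3), of "\<lambda>b. f (inv_into B j b)"] by auto
  have "g (j v) = f v" if v: "v \<in> carrier V" for v
    by (rule semilin_eq_on_span[OF semilin_lin[OF s g(1)] f BV(1)]) (use g(2) bB(1) BV(2) v in auto)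
  then show ?thesis using g(1) by blast
qed

lemma scalar_ext_lin_eq:
  assumes j: "scalar_ext e V W j" and g: "lin W M g" "lin W M g'"
    and eq: "\<And>v. v \<in> carrier V \<Longrightarrow> g (j v) = g' (j v)" and w: "w \<in> carrier W"
  shows "g w = g' w"
  by (rule lin_eq_on_span[OF g, of "j ` carrier V"])
    (use eq w scalar_ext_span[OF j] semilin_closed[OF scalar_ext_semilin[OF j]] in auto)

lemma scalar_ext_iso:
  assumes j: "scalar_ext e V W j" and j': "scalar_ext e V W' j'"
  shows "\<exists>g. lin W W' g \<and> bij_betw g (carrier W) (carrier W') \<and> (\<forall>v\<in>carrier V. g (j v) = j' v)"
proof -
  obtain g where g: "lin W W' g" "\<forall>v\<in>carrier V. g (j v) = j' v"
    using scalar_ext_lift[OF j scalar_ext_semilin[OF j']] by auto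
  obtain h where h: "lin W' W h" "\<forall>v\<in>carrier V. h (j' v) = j v"
    using scalar_ext_lift[OF j' scalar_ext_semilin[OF j]] by auto
  have hg: "h (g w) = w" if "w \<in> carrier W" for w
    using scalar_ext_lin_eq[OF j lin_comp[OF g(1) h(1)] lin_id[OF lin_dom[OF g(1)]] _ that] g h by simp
  have gh: "g (h w) = w" if "w \<in> carrier W'" for w
    using scalar_ext_lin_eq[OF j' lin_comp[OF h(1) g(1)] lin_id[OF lin_dom[OF h(1)]] _ that] g h by simp
  have "bij_betw g (carrier W) (carrier W')"
    by (rule bij_betw_byWitness[where f' = h]) (use hg gh lin_closed[OF g(1)] lin_closed[OF h(1)] in auto)
  then show ?thesis using g by blast
qed

text \<open>Flatness by counting. The assertion on images is an identity of spans, and it makes one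
  inclusion between the kernels sufficient: rank and nullity over the two fields force equal
  dimensions.\<close>

lemma scalar_ext_image_kern:
  assumes j: "scalar_ext e V W j" and j': "scalar_ext e V' W' j'" and T: "lin V V' T" and TK: "lin W W' TK"
    and c: "\<And>v. v \<in> carrier V \<Longrightarrow> TK (j v) = j' (T v)" and U: "sub U V"
  shows "TK ` vspan W (j ` U) = vspan W' (j' ` T ` U)"
    "vspan W (j ` U) \<inter> kern W W' TK = vspan W (j ` (U \<inter> kern V V' T))"
proof -
  note s = scalar_ext_semilin[OF j] scalar_ext_semilin[OF j']
  note W = semilin_cod[OF s(1)]
  note fW = scalar_ext_fd(2)[OF j] and fV = scalar_ext_fd(1)[OF j]
  have jU: "j ` U \<subseteq> carrier W" using sub_subset[OF U] semilin_closed[OF s(1)] by auto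
  have "TK ` j ` U = j' ` T ` U" using c sub_subset[OF U] by (force simp: image_iff)
  then show im: "TK ` vspan W (j ` U) = vspan W' (j' ` T ` U)"
    using span_image[OF TK jU] by simp
  let ?N = "U \<inter> kern V V' T"
  have N: "sub ?N V" by (rule sub_inter[OF U sub_kern[OF T]])
  have jN: "j ` ?N \<subseteq> carrier W" using jU by auto
  note sU = sub_span[OF W jU] and sN = sub_span[OF W jN] and sk = sub_kern[OF TK]
  have "j ` ?N \<subseteq> kern W W' TK"
    using c semilin_zero[OF s(2)] semilin_closed[OF s(1)] by (auto simp: kern_def)
  then have le: "vspan W (j ` ?N) \<subseteq> vspan W (j ` U) \<inter> kern W W' TK"
    using span_least[OF sk] span_mono[OF W _ jU, of "j ` ?N"] by auto
  have d1: "vdim (on W (vspan W (j ` U))) = vdim (on V U)"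
    using scalar_ext_dim[OF scalar_ext_on[OF j U]] .
  have d2: "vdim (on W (vspan W (j ` ?N))) = vdim (on V ?N)"
    using scalar_ext_dim[OF scalar_ext_on[OF j N]] .
  have d3: "vdim (on W' (vspan W' (j' ` T ` U))) = vdim (on V' (T ` U))"
    using scalar_ext_dim[OF scalar_ext_on[OF j' sub_image[OF T U]]] .
  have r1: "vdim (on V U) = vdim (on V ?N) + vdim (on V' (T ` U))"
    by (rule rank_nullity_on[OF T fV U])
  have r2: "vdim (on W (vspan W (j ` U))) = vdim (on W (vspan W (j ` U) \<inter> kern W W' TK))
      + vdim (on W' (TK ` vspan W (j ` U)))"
    by (rule rank_nullity_on[OF TK fW sU])
  have "vdim (on W (vspan W (j ` ?N))) = vdim (on W (vspan W (j ` U) \<inter> kern W W' TK))"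
    using d1 d2 d3 r1 r2 im by simp
  from vdim_mono(2)[OF fW sN sub_inter[OF sU sk] le this]
  show "vspan W (j ` U) \<inter> kern W W' TK = vspan W (j ` ?N)" by simp
qed

subsection \<open>Base change\<close>

lemma carrier_free_module:
  "carrier (free_module X) = {f. finite {x. f x \<noteq> 0} \<and> {x. f x \<noteq> 0} \<subseteq> X}"
  "\<zero>\<^bsub>free_module X\<^esub> = (\<lambda>_. 0)" "f \<oplus>\<^bsub>free_module X\<^esub> g = (\<lambda>x. f x + g x)"
  "c \<odot>\<^bsub>free_module X\<^esub> f = (\<lambda>x. c * f x)"
  by (auto simp: free_module_def)

lemma vsp_free_module: "vsp (free_module X :: ('K::field, 'v \<Rightarrow> 'K) module)"
proof (rule vspI)
  fix f g :: "'v \<Rightarrow> 'K" assume fg: "f \<in> carrier (free_module X)" "g \<in> carrier (free_module X)"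
  have "{x. f x + g x \<noteq> 0} \<subseteq> {x. f x \<noteq> 0} \<union> {x. g x \<noteq> 0}" by auto
  then show "f \<oplus>\<^bsub>free_module X\<^esub> g \<in> carrier (free_module X)"
    using fg by (auto simp: carrier_free_module intro: finite_subset)
next
  fix c and f :: "'v \<Rightarrow> 'K" assume f: "f \<in> carrier (free_module X)"
  have "{x. c * f x \<noteq> 0} \<subseteq> {x. f x \<noteq> 0}" by auto
  then show "c \<odot>\<^bsub>free_module X\<^esub> f \<in> carrier (free_module X)"
    using f by (auto simp: carrier_free_module intro: finite_subset)
qed (auto simp: carrier_free_module algebra_simps)

lemma delta_free_module: "v \<in> X \<Longrightarrow> delta v \<in> carrier (free_module X)"
  by (auto simp: carrier_free_module delta_def)

lemma finsum_free_module:
  fixes f :: "'i \<Rightarrow> 'v \<Rightarrow> 'K::field"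
  assumes "finite A" "\<And>i. i \<in> A \<Longrightarrow> f i \<in> carrier (free_module X)"
  shows "finsum (free_module X) f A = (\<lambda>x. \<Sum>i\<in>A. f i x)"
proof -
  interpret vectorspace class_ring "free_module X :: ('K, 'v \<Rightarrow> 'K) module" by (rule vsp_free_module)
  show ?thesis using assms
  proof (induction A rule: finite_induct)
    case empty
    then show ?case by (simp add: carrier_free_module)
  next
    case (insert i A)
    have "finsum (free_module X) f (insert i A) = f i \<oplus>\<^bsub>free_module X\<^esub> finsum (free_module X) f A"
      by (rule M.finsum_insert) (use insert in auto)
    then show ?case using insert by (simp add: carrier_free_module)
  qed
qed

lemma delta_inj: "delta u = (delta v :: 'v \<Rightarrow> 'K::field) \<Longrightarrow> u = v"
  by (metis delta_def zero_neq_one)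

lemma free_module_dim:
  assumes B: "finite B"
  shows "fd (free_module B :: ('K::field, 'v \<Rightarrow> 'K) module)" "vdim (free_module B :: ('K, 'v \<Rightarrow> 'K) module) = card B"
proof -
  let ?F = "free_module B :: ('K, 'v \<Rightarrow> 'K) module" and ?D = "delta ` B :: ('v \<Rightarrow> 'K) set"
  interpret vectorspace class_ring ?F by (rule vsp_free_module)
  have D: "finite ?D" "?D \<subseteq> carrier ?F" using B delta_free_module by auto
  have inj: "inj_on (delta :: 'v \<Rightarrow> 'v \<Rightarrow> 'K) B" by (auto intro!: inj_onI dest: delta_inj)
  have lc: "lincomb a ?D = (\<lambda>x. if x \<in> B then a (delta x) else 0)" for a
  proof -
    have "lincomb a ?D = (\<lambda>x. \<Sum>d\<in>?D. (a d \<odot>\<^bsub>?F\<^esub> d) x)"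
      unfolding lincomb_def using D by (intro finsum_free_module) (auto simp: subset_iff)
    also have "\<dots> = (\<lambda>x. \<Sum>b\<in>B. if b = x then a (delta x) else 0)"
      unfolding sum.reindex[OF inj] by (intro ext sum.cong) (auto simp: carrier_free_module delta_def)
    also have "\<dots> = (\<lambda>x. if x \<in> B then a (delta x) else 0)" using B by (simp add: sum.delta')
    finally show ?thesis .
  qed
  have "basis ?D"
  proof (subst basis_criterion[OF D], intro allI impI)
    fix f assume f: "f \<in> carrier ?F"
    define a where "a = (\<lambda>d\<in>?D. f (inv_into B delta d))"
    show "\<exists>!a. a \<in> ?D \<rightarrow>\<^sub>E carrier class_ring \<and> lincomb a ?D = f"
    proof (rule ex1I[of _ a])
      show "a \<in> ?D \<rightarrow>\<^sub>E carrier class_ring \<and> lincomb a ?D = f"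
        using f inj unfolding lc by (auto simp: a_def carrier_free_module intro!: ext)
      fix a' assume a': "a' \<in> ?D \<rightarrow>\<^sub>E carrier class_ring \<and> lincomb a' ?D = f"
      show "a' = a"
      proof
        fix d show "a' d = a d"
        proof (cases "d \<in> ?D")
          case True
          then obtain b where b: "b \<in> B" "d = delta b" by auto
          have "f b = a' d" using a' b unfolding lc by (metis (mono_tags))
          then show ?thesis using b inj by (simp add: a_def)
        next
          case False
          then show ?thesis using a' unfolding a_def by (auto simp: PiE_def extensional_def)
        qed
      qed
    qed
  qed
  then show "fd ?F" "vdim ?F = card B"
    using dim_basis[OF D(1)] D card_image[OF inj] unfolding fin_dim_def basis_def by auto
qed

definition ten :: "('s::field \<Rightarrow> 'K::field) \<Rightarrow> ('s, 'v) module \<Rightarrow> 'v \<Rightarrow> ('v \<Rightarrow> 'K) set" where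
  "ten e V v = pure_tensor e V 1 v"

context
  fixes e :: "'s::field \<Rightarrow> 'K::field" and V :: "('s, 'v) module"
  assumes V: "vsp V"
begin

abbreviation "Fr \<equiv> free_module (carrier V) :: ('K, 'v \<Rightarrow> 'K) module"
abbreviation "Rel \<equiv> {(\<lambda>x. delta (u \<oplus>\<^bsub>V\<^esub> v) x - delta u x - delta v x) | u v. u \<in> carrier V \<and> v \<in> carrier V} \<union>
      {(\<lambda>x. delta (c \<odot>\<^bsub>V\<^esub> v) x - e c * delta v x) | c v. v \<in> carrier V} :: ('v \<Rightarrow> 'K) set"

lemma Rel_subset: "Rel \<subseteq> carrier Fr"
proof -
  have "(\<lambda>x. delta (u \<oplus>\<^bsub>V\<^esub> v) x - delta u x - delta v x :: 'K) \<in> carrier Fr"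
    if "u \<in> carrier V" "v \<in> carrier V" for u v
  proof -
    have "{x. delta (u \<oplus>\<^bsub>V\<^esub> v) x - delta u x - delta v x \<noteq> (0::'K)} \<subseteq> {u \<oplus>\<^bsub>V\<^esub> v, u, v}"
      by (auto simp: delta_def)
    moreover have "{u \<oplus>\<^bsub>V\<^esub> v, u, v} \<subseteq> carrier V" using that by (auto simp: vsp_closed[OF V])
    ultimately show ?thesis unfolding carrier_free_module
      by (auto intro: finite_subset)
  qed
  moreover have "(\<lambda>x. delta (c \<odot>\<^bsub>V\<^esub> v) x - e c * delta v x) \<in> carrier Fr" if "v \<in> carrier V" for c v
  proof -
    have "{x. delta (c \<odot>\<^bsub>V\<^esub> v) x - e c * delta v x \<noteq> 0} \<subseteq> {c \<odot>\<^bsub>V\<^esub> v, v}"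
      by (auto simp: delta_def)
    moreover have "{c \<odot>\<^bsub>V\<^esub> v, v} \<subseteq> carrier V" using that by (auto simp: vsp_closed[OF V])
    ultimately show ?thesis unfolding carrier_free_module
      by (auto intro: finite_subset)
  qed
  ultimately show ?thesis by blast
qed

lemma sub_tensor_relations: "sub (tensor_relations e V) Fr"
  unfolding tensor_relations_def by (rule sub_span[OF vsp_free_module Rel_subset])

lemma Rel_tensor_relations: "Rel \<subseteq> tensor_relations e V"
  unfolding tensor_relations_def by (rule span_superset[OF vsp_free_module Rel_subset])

abbreviation "BC \<equiv> base_change e V"
abbreviation "qq \<equiv> \<lambda>f. tensor_relations e V +>\<^bsub>Fr\<^esub> f"

lemma vsp_base_change: "vsp BC" and qq: "lin Fr BC qq" "qq ` carrier Fr = carrier BC"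
  "kern Fr BC qq = tensor_relations e V"
  unfolding base_change_def using quot_module_proj[OF sub_tensor_relations] by blast+

lemma qq_eq: "f \<in> carrier Fr \<Longrightarrow> g \<in> carrier Fr \<Longrightarrow> (\<lambda>x. f x - g x) \<in> tensor_relations e V \<Longrightarrow> qq f = qq g"
  using quot_module_proj(5)[OF sub_tensor_relations, of f g] vminus_eq[OF vsp_free_module, of f "carrier V" g]
  by (simp add: carrier_free_module)

lemma ten_eq: "ten e V v = qq (delta v)"
  by (simp add: ten_def pure_tensor_def)

lemma pure_tensor_eq: "v \<in> carrier V \<Longrightarrow> pure_tensor e V c v = c \<odot>\<^bsub>BC\<^esub> ten e V v"
  using lin_smult[OF qq(1) delta_free_module, of v c]
  by (simp add: pure_tensor_def ten_eq carrier_free_module)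

lemma semilin_ten: "semilin e V BC (ten e V)"
proof (rule semilinI[OF V vsp_base_change])
  show "ten e V x \<in> carrier BC" if "x \<in> carrier V" for x
    unfolding ten_eq by (rule lin_closed[OF qq(1) delta_free_module[OF that]])
  show "ten e V (x \<oplus>\<^bsub>V\<^esub> y) = ten e V x \<oplus>\<^bsub>BC\<^esub> ten e V y" if xy: "x \<in> carrier V" "y \<in> carrier V" for x y
  proof -
    have "ten e V (x \<oplus>\<^bsub>V\<^esub> y) = qq (delta x \<oplus>\<^bsub>Fr\<^esub> delta y)"
      unfolding ten_eq
    proof (rule qq_eq)
      have "(\<lambda>t. delta (x \<oplus>\<^bsub>V\<^esub> y) t - delta x t - delta y t) \<in> tensor_relations e V"
        using Rel_tensor_relations xy by blast
      then show "(\<lambda>t. delta (x \<oplus>\<^bsub>V\<^esub> y) t - (delta x \<oplus>\<^bsub>Fr\<^esub> delta y) t) \<in> tensor_relations e V"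
        by (simp add: carrier_free_module algebra_simps)
    qed (use xy in \<open>auto intro!: delta_free_module vsp_closed[OF vsp_free_module] vsp_closed[OF V]\<close>)
    then show ?thesis using lin_add[OF qq(1) delta_free_module[OF xy(1)] delta_free_module[OF xy(2)]]
      by (simp add: ten_eq)
  qed
  show "ten e V (c \<odot>\<^bsub>V\<^esub> x) = e c \<odot>\<^bsub>BC\<^esub> ten e V x" if x: "x \<in> carrier V" for c x
  proof -
    have "ten e V (c \<odot>\<^bsub>V\<^esub> x) = qq (e c \<odot>\<^bsub>Fr\<^esub> delta x)"
      unfolding ten_eq
    proof (rule qq_eq)
      have "(\<lambda>t. delta (c \<odot>\<^bsub>V\<^esub> x) t - e c * delta x t) \<in> tensor_relations e V"
        using Rel_tensor_relations x by blast
      then show "(\<lambda>t. delta (c \<odot>\<^bsub>V\<^esub> x) t - (e c \<odot>\<^bsub>Fr\<^esub> delta x) t) \<in> tensor_relations e V"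
        by (simp add: carrier_free_module)
    qed (use x in \<open>auto intro!: delta_free_module vsp_closed[OF vsp_free_module] vsp_closed[OF V]\<close>)
    then show ?thesis using lin_smult[OF qq(1) delta_free_module[OF x]] by (simp add: ten_eq)
  qed
qed

lemma span_deltas:
  assumes "f \<in> carrier Fr"
  shows "f \<in> vspan Fr (delta ` carrier V)"
proof -
  have D: "delta ` carrier V \<subseteq> carrier Fr" by (auto intro: delta_free_module)
  note s = sub_span[OF vsp_free_module D]
  have "f \<in> vspan Fr (delta ` carrier V)" if "finite S" "S = {x. f x \<noteq> 0}" "S \<subseteq> carrier V" for S f
    using that
  proof (induction S arbitrary: f rule: finite_induct)
    case empty
    then have "f = \<zero>\<^bsub>Fr\<^esub>" by (auto simp: carrier_free_module)
    then show ?case using sub_zero[OF s] by simp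
  next
    case (insert y S)
    have "f(y := 0) \<in> vspan Fr (delta ` carrier V)"
      by (rule insert.IH) (use insert in \<open>auto split: if_splits\<close>)
    moreover have "f y \<odot>\<^bsub>Fr\<^esub> delta y \<in> vspan Fr (delta ` carrier V)"
      using span_superset[OF vsp_free_module D] insert.prems by (intro sub_smult[OF s]) auto
    moreover have "f = f(y := 0) \<oplus>\<^bsub>Fr\<^esub> f y \<odot>\<^bsub>Fr\<^esub> delta y"
      by (auto simp: carrier_free_module delta_def)
    ultimately show ?case using sub_add[OF s] by metis
  qed
  then show ?thesis using assms by (auto simp: carrier_free_module)
qed

lemma span_ten: "vspan BC (ten e V ` carrier V) = carrier BC"
proof -
  have D: "delta ` carrier V \<subseteq> carrier Fr" by (auto intro: delta_free_module)
  have "vspan Fr (delta ` carrier V) = carrier Fr"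
    using span_deltas sub_subset[OF sub_span[OF vsp_free_module D]] by auto
  then show ?thesis
    using span_image[OF qq(1) D] qq(2) unfolding ten_eq image_image by simp
qed

text \<open>It has to be excluded that the relations collapse the quotient. On the free module over
  a basis \<open>B\<close> the projection is onto, because its image is a subspace containing the
  tensors of \<open>B\<close>, and it is injective, because the coordinate functionals
  \<open>\<Phi>\<close> vanish on all relations.\<close>

lemma scalar_ext_ten:
  assumes fd: "fd V" and e: "field_hom e"
  shows "scalar_ext e V BC (ten e V)"
proof -
  interpret e: field_hom e by (rule e)
  obtain B where B: "finite B" "vbasis V B" "card B = vdim V" using fd_basis[OF V fd] .
  note BV = basis_props[OF V B(2)]
  let ?FB = "free_module B :: ('K, 'v \<Rightarrow> 'K) module"
  \<comment> \<open>The coordinate at \<open>b\<close> of the tensor represented by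
    \<open>g\<close>, that is, the linear functional sending \<open>delta x\<close> to
    \<open>e (coord V B x b)\<close>.\<close>
  define \<Phi> where "\<Phi> g b = (\<Sum>x | g x \<noteq> 0. g x * e (coord V B x b))" for g :: "'v \<Rightarrow> 'K" and b
  have \<Phi>_sum: "\<Phi> g b = (\<Sum>x\<in>A. g x * e (coord V B x b))" if "finite A" "{x. g x \<noteq> 0} \<subseteq> A" for g b A
    unfolding \<Phi>_def by (rule sum.mono_neutral_left) (use that in auto)
  have fin: "finite {x. g x \<noteq> 0}" if "g \<in> carrier Fr" for g using that by (simp add: carrier_free_module)
  have add: "\<Phi> (\<lambda>x. f x + g x) b = \<Phi> f b + \<Phi> g b" if f: "finite {x. f x \<noteq> 0}" "finite {x. g x \<noteq> 0}" for f g b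
  proof -
    let ?A = "{x. f x \<noteq> 0} \<union> {x. g x \<noteq> 0}"
    have A: "finite ?A" using that by simp
    have "\<Phi> (\<lambda>x. f x + g x) b = (\<Sum>x\<in>?A. (f x + g x) * e (coord V B x b))"
      by (rule \<Phi>_sum[OF A]) auto
    moreover have "\<Phi> f b = (\<Sum>x\<in>?A. f x * e (coord V B x b))" by (rule \<Phi>_sum[OF A]) auto
    moreover have "\<Phi> g b = (\<Sum>x\<in>?A. g x * e (coord V B x b))" by (rule \<Phi>_sum[OF A]) auto
    ultimately show ?thesis by (simp add: sum.distrib algebra_simps)
  qed
  have smult: "\<Phi> (\<lambda>x. c * f x) b = c * \<Phi> f b" if f: "finite {x. f x \<noteq> 0}" for c f b
  proof -
    have "\<Phi> (\<lambda>x. c * f x) b = (\<Sum>x | f x \<noteq> 0. (c * f x) * e (coord V B x b))"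
      by (rule \<Phi>_sum[OF f]) auto
    then show ?thesis unfolding \<Phi>_def by (simp add: sum_distrib_left algebra_simps)
  qed
  have fd_delta: "finite {x. delta v x \<noteq> (0::'K)}" for v :: 'v by (simp add: delta_def)
  have \<Phi>_delta: "\<Phi> (delta v) b = e (coord V B v b)" for v b
    using \<Phi>_sum[of "{v}" "delta v" b] by (simp add: delta_def)
  have minus: "\<Phi> (\<lambda>x. f x - g x) b = \<Phi> f b - \<Phi> g b" if "finite {x. f x \<noteq> 0}" "finite {x. g x \<noteq> 0}" for f g b
  proof -
    have f': "finite {x. (-1) * g x \<noteq> 0}" using that(2) by simp
    show ?thesis using add[OF that(1) f', of b] smult[OF that(2), of "-1" b] by simp
  qed
  have ker: "sub {f \<in> carrier Fr. \<forall>b\<in>B. \<Phi> f b = 0} Fr"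
  proof (rule subI[OF vsp_free_module])
    show "\<zero>\<^bsub>Fr\<^esub> \<in> {f \<in> carrier Fr. \<forall>b\<in>B. \<Phi> f b = 0}"
      using vzero_closed[OF vsp_free_module, of "carrier V"] by (simp add: carrier_free_module \<Phi>_def)
    show "f \<oplus>\<^bsub>Fr\<^esub> g \<in> {f \<in> carrier Fr. \<forall>b\<in>B. \<Phi> f b = 0}"
      if "f \<in> {f \<in> carrier Fr. \<forall>b\<in>B. \<Phi> f b = 0}" "g \<in> {f \<in> carrier Fr. \<forall>b\<in>B. \<Phi> f b = 0}" for f g
      using that vadd_closed[OF vsp_free_module, of f "carrier V" g] add[OF fin fin, of f g]
      unfolding mem_Collect_eq carrier_free_module(3) by simp
    show "c \<odot>\<^bsub>Fr\<^esub> f \<in> {f \<in> carrier Fr. \<forall>b\<in>B. \<Phi> f b = 0}"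
      if "f \<in> {f \<in> carrier Fr. \<forall>b\<in>B. \<Phi> f b = 0}" for c f
      using that vsmult_closed[OF vsp_free_module, of f "carrier V" c] smult[OF fin, of f c]
      unfolding mem_Collect_eq carrier_free_module(4) by simp
  qed auto
  have "tensor_relations e V \<subseteq> {f \<in> carrier Fr. \<forall>b\<in>B. \<Phi> f b = 0}"
    unfolding tensor_relations_def
  proof (rule span_least[OF ker])
    have 1: "\<Phi> (\<lambda>x. delta (u \<oplus>\<^bsub>V\<^esub> v) x - delta u x - delta v x) b = 0"
      if "u \<in> carrier V" "v \<in> carrier V" "b \<in> B" for u v b
    proof -
      have "finite {x. delta (u \<oplus>\<^bsub>V\<^esub> v) x - delta u x \<noteq> (0::'K)}"
        by (rule finite_subset[of _ "{u \<oplus>\<^bsub>V\<^esub> v, u}"]) (auto simp: delta_def)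
      then show ?thesis using that
        by (simp add: minus fd_delta \<Phi>_delta coord_add[OF V B(1,2)] e.hom_add)
    qed
    have 2: "\<Phi> (\<lambda>x. delta (c \<odot>\<^bsub>V\<^esub> v) x - e c * delta v x) b = 0"
      if "v \<in> carrier V" "b \<in> B" for c v b
    proof -
      have "finite {x. e c * delta v x \<noteq> (0::'K)}"
        by (rule finite_subset[of _ "{v}"]) (auto simp: delta_def)
      then show ?thesis using that
        by (simp add: minus fd_delta smult \<Phi>_delta coord_smult[OF V B(1,2)] e.hom_mult)
    qed
    show "Rel \<subseteq> {f \<in> carrier Fr. \<forall>b\<in>B. \<Phi> f b = 0}"
      using Rel_subset 1 2 by blast
  qed
  then have rel0: "\<Phi> f b = 0" if "f \<in> tensor_relations e V" "b \<in> B" for f b using that by auto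
  have FBF: "carrier ?FB \<subseteq> carrier Fr" using BV(1) by (auto simp: carrier_free_module)
  have lB: "lin ?FB BC qq"
  proof (rule linI[OF vsp_free_module vsp_base_change])
    fix x y c assume x: "x \<in> carrier ?FB"
    then have xF: "x \<in> carrier Fr" using FBF by blast
    show "qq x \<in> carrier BC" by (rule lin_closed[OF qq(1) xF])
    show "qq (c \<odot>\<^bsub>?FB\<^esub> x) = c \<odot>\<^bsub>BC\<^esub> qq x"
      using lin_smult[OF qq(1) xF, of c] unfolding carrier_free_module(4) .
    assume "y \<in> carrier ?FB"
    then have yF: "y \<in> carrier Fr" using FBF by blast
    show "qq (x \<oplus>\<^bsub>?FB\<^esub> y) = qq x \<oplus>\<^bsub>BC\<^esub> qq y"
      using lin_add[OF qq(1) xF yF] unfolding carrier_free_module(3) .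
  qed
  have "inj_on qq (carrier ?FB)"
  proof (rule lin_inj_onI[OF lB])
    fix h assume h: "h \<in> carrier ?FB" "qq h = \<zero>\<^bsub>BC\<^esub>"
    then have rel: "h \<in> tensor_relations e V" using FBF qq(3) by (auto simp: kern_def)
    \<comment> \<open>On functions supported in \<open>B\<close> the functional at \<open>b\<close>
      is evaluation at \<open>b\<close>, since the coordinates of basis vectors are 0 or 1.\<close>
    have "h b = 0" if b: "b \<in> B" for b
    proof -
      have "\<Phi> h b = (\<Sum>x\<in>B. h x * e (coord V B x b))"
        by (rule \<Phi>_sum[OF B(1)]) (use h in \<open>auto simp: carrier_free_module\<close>)
      also have "\<dots> = (\<Sum>x\<in>B. if b = x then h x else 0)"
        by (rule sum.cong) (auto simp: coord_basis[OF V B(1,2)] b)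
      also have "\<dots> = h b" using b B(1) by simp
      finally show ?thesis using rel0[OF rel b] by simp
    qed
    then show "h = \<zero>\<^bsub>?FB\<^esub>" using h by (auto simp: carrier_free_module)
  qed
  moreover have "qq ` carrier ?FB = carrier BC"
  proof -
    note im = sub_image[OF lB sub_carrier[OF vsp_free_module]]
    have "B \<subseteq> {v \<in> carrier V. ten e V v \<in> qq ` carrier ?FB}"
      using BV(1) by (auto simp: ten_eq intro!: imageI delta_free_module)
    from span_least[OF semilin_vimage[OF semilin_ten im] this]
    have "ten e V ` carrier V \<subseteq> qq ` carrier ?FB" using BV(2) by auto
    from span_least[OF im this] show ?thesis using span_ten sub_subset[OF im] by auto
  qed
  ultimately have bij: "bij_betw qq (carrier ?FB) (carrier BC)" by (simp add: bij_betw_def)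
  show ?thesis unfolding scalar_ext_def
    using semilin_ten fd span_ten vdim_bij[OF lB free_module_dim(1)[OF B(1)] bij]
      fd_surj[OF lB free_module_dim(1)[OF B(1)]] bij free_module_dim(2)[OF B(1)] B(3)
    by (auto simp: bij_betw_def)
qed

end

text \<open>The definite description is justified by the universal property, which gives existence,
  and by the fact that the tensors \<open>1 \<otimes> v\<close> span, which gives uniqueness on the
  carrier; extensionality fixes the values outside it.\<close>

lemma base_change_map_props:
  fixes V :: "('s::field, 'v) module" and U :: "('s, 'u) module" and e :: "'s \<Rightarrow> 'K::field"
  assumes T: "lin V U T" and e: "field_hom e" and fV: "fd V"
  shows "lin (base_change e V) (base_change e U) (base_change_map e V U T)"
    "v \<in> carrier V \<Longrightarrow> base_change_map e V U T (ten e V v) = ten e U (T v)"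
proof -
  let ?B = "base_change e V" and ?C = "base_change e U"
  let ?P = "\<lambda>g. g \<in> extensional (carrier ?B) \<and> lin ?B ?C g \<and>
    (\<forall>c. \<forall>v\<in>carrier V. g (pure_tensor e V c v) = pure_tensor e U c (T v))"
  note vs = lin_dom[OF T] lin_cod[OF T]
  note j = scalar_ext_ten[OF vs(1) fV e]
  have cl: "pure_tensor e V c v \<in> carrier ?B" if "v \<in> carrier V" for c v
    using that by (simp add: pure_tensor_eq[OF vs(1)] vsp_closed[OF vsp_base_change[OF vs(1)]]
        semilin_closed[OF semilin_ten[OF vs(1)]])
  obtain g where g: "lin ?B ?C g" "\<forall>v\<in>carrier V. g (ten e V v) = ten e U (T v)"
    using scalar_ext_lift[OF j lin_semilin[OF T semilin_ten[OF vs(2)]]] by auto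
  have "?P (restrict g (carrier ?B))"
  proof (intro conjI allI ballI)
    show "lin ?B ?C (restrict g (carrier ?B))" by (rule lin_cong[OF g(1)]) simp
    show "restrict g (carrier ?B) (pure_tensor e V c v) = pure_tensor e U c (T v)" if v: "v \<in> carrier V" for c v
      using g(2) v cl[OF v] lin_closed[OF T v]
      by (simp add: pure_tensor_eq[OF vs(1)] pure_tensor_eq[OF vs(2)] lin_smult[OF g(1)]
        semilin_closed[OF semilin_ten[OF vs(1)]])
  qed simp
  moreover have "h = h'" if h: "?P h" "?P h'" for h h'
  proof (rule extensionalityI[of _ "carrier ?B"])
    fix x assume x: "x \<in> carrier ?B"
    show "h x = h' x"
      by (rule scalar_ext_lin_eq[OF j _ _ _ x, of ?C]) (use h in \<open>auto simp: ten_def\<close>)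
  qed (use h in auto)
  ultimately have "\<exists>!g. ?P g" by blast
  then have P: "?P (base_change_map e V U T)" unfolding base_change_map_def by (rule theI')
  then show "lin ?B ?C (base_change_map e V U T)" by blast
  show "base_change_map e V U T (ten e V v) = ten e U (T v)" if "v \<in> carrier V"
    using P that by (simp add: ten_def)
qed

section \<open>Determinants and the Newton number\<close>

definition obasis :: "('a::field, 'v) module \<Rightarrow> 'v list \<Rightarrow> bool" where
  "obasis V bs \<longleftrightarrow> distinct bs \<and> vbasis V (set bs)"

lemma obasis_exists:
  assumes "vsp V" "fd V" obtains bs where "obasis V bs"
  using fd_basis[OF assms] finite_distinct_list unfolding obasis_def by metis

lemma obasis_length: "vsp V \<Longrightarrow> obasis V bs \<Longrightarrow> length bs = vdim V"
  using vectorspace.dim_basis[of class_ring V "set bs"] by (auto simp: obasis_def distinct_card)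

lemma obasis_frames: "vsp V \<Longrightarrow> obasis V bs \<Longrightarrow> bs \<in> frames V"
  using basis_props(1)[of V "set bs"] obasis_length[of V bs] by (auto simp: frames_def obasis_def)

lemma frames_update: "xs \<in> frames V \<Longrightarrow> v \<in> carrier V \<Longrightarrow> xs[i := v] \<in> frames V"
  by (auto simp: frames_def dest: set_update_subset_insert[THEN subsetD])

lemma frames_nth: "xs \<in> frames V \<Longrightarrow> i < vdim V \<Longrightarrow> xs ! i \<in> carrier V"
  by (auto simp: frames_def)

lemma frames_length: "xs \<in> frames V \<Longrightarrow> length xs = vdim V"
  by (auto simp: frames_def)

section \<open>Alternating forms of top degree\<close>

lemma alternating_formsI:
  assumes "\<And>xs i c u v. xs \<in> frames V \<Longrightarrow> i < vdim V \<Longrightarrow> u \<in> carrier V \<Longrightarrow> v \<in> carrier V \<Longrightarrow>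
      \<omega> (xs[i := (c \<odot>\<^bsub>V\<^esub> u) \<oplus>\<^bsub>V\<^esub> v]) = c * \<omega> (xs[i := u]) + \<omega> (xs[i := v])"
    and "\<And>xs i j. xs \<in> frames V \<Longrightarrow> i < vdim V \<Longrightarrow> j < vdim V \<Longrightarrow> i \<noteq> j \<Longrightarrow> xs ! i = xs ! j \<Longrightarrow> \<omega> xs = 0"
  shows "\<omega> \<in> alternating_forms V"
  using assms unfolding alternating_forms_def by (auto simp: frames_length)

context
  fixes V :: "('a::field, 'v) module" and \<omega> :: "'v list \<Rightarrow> 'a"
  assumes V: "vsp V" and \<omega>: "\<omega> \<in> alternating_forms V"
begin

lemma alt_linear: "xs \<in> frames V \<Longrightarrow> i < vdim V \<Longrightarrow> u \<in> carrier V \<Longrightarrow> v \<in> carrier V \<Longrightarrow>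
      \<omega> (xs[i := (c \<odot>\<^bsub>V\<^esub> u) \<oplus>\<^bsub>V\<^esub> v]) = c * \<omega> (xs[i := u]) + \<omega> (xs[i := v])"
  and alt_eq: "xs \<in> frames V \<Longrightarrow> i < vdim V \<Longrightarrow> j < vdim V \<Longrightarrow> i \<noteq> j \<Longrightarrow> xs ! i = xs ! j \<Longrightarrow> \<omega> xs = 0"
  using \<omega> unfolding alternating_forms_def by (auto simp: frames_length)

lemma alt_zero: "xs \<in> frames V \<Longrightarrow> i < vdim V \<Longrightarrow> \<omega> (xs[i := \<zero>\<^bsub>V\<^esub>]) = 0"
  using alt_linear[of xs i "\<zero>\<^bsub>V\<^esub>" "\<zero>\<^bsub>V\<^esub>" "-1"] by (simp add: vsp_simps[OF V])

lemma alt_add: "xs \<in> frames V \<Longrightarrow> i < vdim V \<Longrightarrow> u \<in> carrier V \<Longrightarrow> v \<in> carrier V \<Longrightarrow>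
    \<omega> (xs[i := u \<oplus>\<^bsub>V\<^esub> v]) = \<omega> (xs[i := u]) + \<omega> (xs[i := v])"
  using alt_linear[of xs i u v 1] by (simp add: vsp_simps[OF V])

lemma alt_smult: "xs \<in> frames V \<Longrightarrow> i < vdim V \<Longrightarrow> u \<in> carrier V \<Longrightarrow>
    \<omega> (xs[i := c \<odot>\<^bsub>V\<^esub> u]) = c * \<omega> (xs[i := u])"
  using alt_linear[of xs i u "\<zero>\<^bsub>V\<^esub>" c] by (simp add: vsp_simps[OF V] alt_zero)

text \<open>With this subspace, the vanishing of a form in one slot only has to be checked on
  generators.\<close>

lemma alt_vanishing_sub:
  assumes "xs \<in> frames V" "i < vdim V"
  shows "sub {v \<in> carrier V. \<omega> (xs[i := v]) = 0} V"
  by (rule subI[OF V]) (use assms in \<open>auto simp: vsp_closed[OF V] alt_zero alt_add alt_smult\<close>)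

text \<open>Put the sum of the two entries into both slots. Alternation kills this value and the two
  diagonal terms of its expansion, so the two mixed terms add up to 0.\<close>

lemma alt_swap:
  assumes xs: "xs \<in> frames V" and ij: "i < vdim V" "j < vdim V" "i \<noteq> j"
  shows "\<omega> (xs[i := xs ! j, j := xs ! i]) = - \<omega> xs"
proof -
  define f where "f a b = \<omega> (xs[i := a, j := b])" for a b
  let ?a = "xs ! i" and ?b = "xs ! j"
  have c: "?a \<in> carrier V" "?b \<in> carrier V" using frames_nth[OF xs] ij by auto
  have c2: "?a \<oplus>\<^bsub>V\<^esub> ?b \<in> carrier V" using c by (simp add: vsp_closed[OF V])
  have l: "length xs = vdim V" by (rule frames_length[OF xs])
  have diag: "f u u = 0" if "u \<in> carrier V" for u
    unfolding f_def
    by (rule alt_eq[of _ i j]) (use that ij xs l in \<open>auto intro!: frames_update\<close>)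
  have add2: "f u (v \<oplus>\<^bsub>V\<^esub> w) = f u v + f u w" if "u \<in> carrier V" "v \<in> carrier V" "w \<in> carrier V" for u v w
    unfolding f_def by (rule alt_add) (use that ij xs in \<open>auto intro!: frames_update\<close>)
  have add1: "f (v \<oplus>\<^bsub>V\<^esub> w) u = f v u + f w u" if "u \<in> carrier V" "v \<in> carrier V" "w \<in> carrier V" for u v w
    unfolding f_def list_update_swap[OF ij(3)]
    by (rule alt_add) (use that ij xs in \<open>auto intro!: frames_update\<close>)
  have "0 = f (?a \<oplus>\<^bsub>V\<^esub> ?b) (?a \<oplus>\<^bsub>V\<^esub> ?b)" using diag[OF c2] by simp
  also have "\<dots> = (f ?a ?a + f ?b ?a) + (f ?a ?b + f ?b ?b)" using c c2 by (simp add: add1 add2)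
  also have "\<dots> = f ?a ?b + f ?b ?a" using c by (simp add: diag)
  finally have "f ?b ?a = - f ?a ?b" by (metis add.commute add_eq_0_iff)
  then show ?thesis by (simp add: f_def)
qed

text \<open>This bounds the space of forms by dimension one. Rearrangements of \<open>bs\<close> are
  settled by transpositions, and arbitrary tuples by replacing one entry at a time by basis
  vectors.\<close>

lemma alt_vanish:
  assumes bs: "obasis V bs" and z: "\<omega> bs = 0" and xs: "xs \<in> frames V"
  shows "\<omega> xs = 0"
proof -
  let ?n = "vdim V"
  have bs_props: "distinct bs" "set bs \<subseteq> carrier V" "vspan V (set bs) = carrier V" "length bs = ?n"
    using bs basis_props[OF V] obasis_length[OF V bs] by (auto simp: obasis_def)
  \<comment> \<open>Downward induction on the length \<open>k\<close> of the common prefix with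
    \<open>bs\<close>: one swap brings \<open>bs ! k\<close> to position \<open>k\<close> and only
    changes the sign.\<close>
  have perm: "\<omega> ys = 0" if "k \<le> ?n" "distinct ys" "set ys = set bs" "take k ys = take k bs" for k ys
    using that
  proof (induction k arbitrary: ys rule: inc_induct)
    case base
    then have "ys = bs" using bs_props(1,4) by (metis distinct_card order_refl take_all)
    then show ?case using z by simp
  next
    case (step k)
    have l: "length ys = ?n" using step.prems bs_props by (metis distinct_card)
    have ysf: "ys \<in> frames V" using l step.prems bs_props by (simp add: frames_def)
    obtain m where m: "m < ?n" "ys ! m = bs ! k"
      using step.hyps step.prems(2) bs_props(4) l by (metis in_set_conv_nth)
    have "\<not> m < k"
    proof
      assume "m < k"
      then have "bs ! m = bs ! k" using step.prems(3) m by (metis nth_take)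
      then show False using \<open>m < k\<close> step.hyps bs_props by (simp add: nth_eq_iff_index_eq)
    qed
    show ?case
    proof (cases "m = k")
      case True
      then have "take (Suc k) ys = take (Suc k) bs"
        using step m l bs_props(4) by (simp add: take_Suc_conv_app_nth)
      then show ?thesis using step by blast
    next
      case False
      let ?ys = "ys[k := ys ! m, m := ys ! k]"
      have "take (Suc k) ?ys = take (Suc k) bs"
        using step m l bs_props(4) False \<open>\<not> m < k\<close> by (simp add: take_Suc_conv_app_nth take_update_cancel)
      moreover have "distinct ?ys" "set ?ys = set bs"
        using step.prems(1,2) step.hyps m(1) l by (simp_all add: distinct_swap set_swap)
      ultimately have "\<omega> ?ys = 0" using step.IH by blast
      then show ?thesis using alt_swap[OF ysf, of k m] step.hyps m False by simp
    qed
  qed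
  \<comment> \<open>Induction on the number \<open>k\<close> of leading entries that may be
    arbitrary vectors. The vectors giving 0 in slot \<open>k\<close> form a subspace that contains
    the basis. For \<open>k = 0\<close> the tuple either repeats an entry or rearranges
    \<open>bs\<close>.\<close>
  have "\<omega> ys = 0" if "ys \<in> frames V" "set (drop k ys) \<subseteq> set bs" "k \<le> ?n" for k ys
    using that
  proof (induction k arbitrary: ys)
    case 0
    have l: "length ys = ?n" using 0 by (simp add: frames_def)
    show ?case
    proof (cases "distinct ys")
      case True
      have "set ys = set bs"
        by (rule card_subset_eq) (use 0 l True bs_props in \<open>auto simp: distinct_card\<close>)
      then show ?thesis using perm[of 0 ys] True by simp
    next
      case False
      then obtain i j where "i < ?n" "j < ?n" "i \<noteq> j" "ys ! i = ys ! j"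
        unfolding distinct_conv_nth l by blast
      then show ?thesis using alt_eq 0 by blast
    qed
  next
    case (Suc k)
    have l: "length ys = ?n" using Suc.prems by (simp add: frames_def)
    have k: "k < ?n" using Suc.prems by simp
    have "set bs \<subseteq> {v \<in> carrier V. \<omega> (ys[k := v]) = 0}"
    proof
      fix b assume b: "b \<in> set bs"
      have "drop k (ys[k := b]) = b # drop (Suc k) ys"
        using k l by (simp add: Cons_nth_drop_Suc[symmetric] drop_update_cancel)
      then have "\<omega> (ys[k := b]) = 0"
        using Suc.prems b bs_props by (intro Suc.IH frames_update) auto
      then show "b \<in> {v \<in> carrier V. \<omega> (ys[k := v]) = 0}" using b bs_props by auto
    qed
    from span_least[OF alt_vanishing_sub[OF Suc.prems(1) k] this]
    have "\<omega> (ys[k := ys ! k]) = 0" using bs_props(3) frames_nth[OF Suc.prems(1) k] by auto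
    then show ?case by simp
  qed
  from this[OF xs, of ?n] show ?thesis using frames_length[OF xs] by simp
qed

end

lemma alt_diff:
  assumes "\<omega> \<in> alternating_forms V" "\<omega>' \<in> alternating_forms V"
  shows "(\<lambda>xs. \<omega> xs - c * \<omega>' xs) \<in> alternating_forms V"
  using assms unfolding alternating_forms_def by (auto simp: algebra_simps)

text \<open>The form \<open>\<omega>\<close> minus \<open>\<omega> bs\<close> times
  \<open>\<omega>0\<close> vanishes on the basis \<open>bs\<close>, hence everywhere.\<close>

lemma alt_unique:
  assumes V: "vsp V" and bs: "obasis V bs" and \<omega>: "\<omega> \<in> alternating_forms V"
    and \<omega>0: "\<omega>0 \<in> alternating_forms V" "\<omega>0 bs = 1" and xs: "xs \<in> frames V"
  shows "\<omega> xs = \<omega> bs * \<omega>0 xs"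
  using alt_vanish[OF V alt_diff[OF \<omega> \<omega>0(1), of "\<omega> bs"] bs _ xs] \<omega>0(2) by simp

text \<open>The form is the determinant of the coordinate matrix. Linearity is read off the Leibniz
  formula, each product containing exactly one factor from the row that varies.\<close>

lemma alt_exists:
  assumes V: "vsp V" and bs: "obasis V bs"
  shows "\<exists>\<omega>\<in>alternating_forms V. \<omega> bs = 1"
proof -
  let ?n = "vdim V"
  define M where "M xs = mat ?n ?n (\<lambda>(i, j). coord V (set bs) (xs ! i) (bs ! j))" for xs
  define \<omega> where "\<omega> xs = det (M xs)" for xs
  have B: "finite (set bs)" "vbasis V (set bs)" "distinct bs" "length bs = ?n"
    using bs obasis_length[OF V bs] by (auto simp: obasis_def)
  have M: "M xs \<in> carrier_mat ?n ?n" for xs by (simp add: M_def)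
  have \<omega>_sum: "\<omega> xs = (\<Sum>p | p permutes {0..<?n}. signof p * (\<Prod>i\<in>{0..<?n}. coord V (set bs) (xs ! i) (bs ! p i)))" for xs
    unfolding \<omega>_def det_def'[OF M]
    by (intro sum.cong refl arg_cong2[where f = "(*)"] prod.cong)
      (auto simp: M_def dest: permutes_in_image)
  have "\<omega> \<in> alternating_forms V"
  proof (rule alternating_formsI)
    fix xs i c u v assume xs: "xs \<in> frames V" and i: "i < ?n" and uv: "u \<in> carrier V" "v \<in> carrier V"
    have l: "length xs = ?n" by (rule frames_length[OF xs])
    have split: "(\<Prod>k\<in>{0..<?n}. coord V (set bs) (xs[i := w] ! k) (bs ! p k)) =
        coord V (set bs) w (bs ! p i) * (\<Prod>k\<in>{0..<?n} - {i}. coord V (set bs) (xs ! k) (bs ! p k))" for w p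
      using i l by (subst prod.remove[of _ i]) (auto intro!: prod.cong)
    have "coord V (set bs) (c \<odot>\<^bsub>V\<^esub> u \<oplus>\<^bsub>V\<^esub> v) (bs ! p i) =
        c * coord V (set bs) u (bs ! p i) + coord V (set bs) v (bs ! p i)" if "p permutes {0..<?n}" for p
    proof -
      have "bs ! p i \<in> set bs" using permutes_in_image[OF that] i B(4) by simp
      then show ?thesis using uv
        by (simp add: coord_add[OF V B(1,2)] coord_smult[OF V B(1,2)] vsp_closed[OF V])
    qed
    then show "\<omega> (xs[i := (c \<odot>\<^bsub>V\<^esub> u) \<oplus>\<^bsub>V\<^esub> v]) = c * \<omega> (xs[i := u]) + \<omega> (xs[i := v])"
      unfolding \<omega>_sum split sum_distrib_left sum.distrib[symmetric]
      by (intro sum.cong refl) (simp add: algebra_simps)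
  next
    fix xs i j assume "xs \<in> frames V" "i < ?n" "j < ?n" "i \<noteq> j" "xs ! i = xs ! j"
    then show "\<omega> xs = 0" unfolding \<omega>_def
      by (intro det_identical_rows[OF M, of i j]) (auto simp: M_def intro!: eq_vecI)
  qed
  moreover have "M bs = 1\<^sub>m ?n"
    by (rule eq_matI) (use B in \<open>auto simp: M_def coord_basis[OF V B(1,2)] nth_eq_iff_index_eq\<close>)
  then have "\<omega> bs = 1" by (simp add: \<omega>_def)
  ultimately show ?thesis by blast
qed

text \<open>The properties of \<sigma> and of the valuation on which the Newton number rests.
  Invariance under \<sigma> makes its value independent of the chosen generator of the determinant
  line.\<close>

locale norm_inv =
  fixes \<sigma> :: "'s::field \<Rightarrow> 's" and v :: "'s \<Rightarrow> real"
  assumes \<sigma>: "field_hom \<sigma>" "bij \<sigma>"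
    and v_mult: "\<And>x y. x \<noteq> 0 \<Longrightarrow> y \<noteq> 0 \<Longrightarrow> v (x * y) = v x + v y"
    and v_\<sigma>: "\<And>x. x \<noteq> 0 \<Longrightarrow> v (\<sigma> x) = v x"
begin

interpretation \<sigma>: field_hom \<sigma> by (rule \<sigma>)

lemma \<sigma>_zero_iff: "\<sigma> x = 0 \<longleftrightarrow> x = 0" by simp

lemma v_divide: "x \<noteq> 0 \<Longrightarrow> y \<noteq> 0 \<Longrightarrow> v (x / y) = v x - v y"
  using v_mult[of "x / y" y] by simp

lemma phi_frames: "phi_module \<sigma> V \<phi> \<Longrightarrow> xs \<in> frames V \<Longrightarrow> map \<phi> xs \<in> frames V"
  by (auto simp: frames_def phi_module_def bij_betw_def)

text \<open>The composite of \<open>\<omega>\<close> with \<open>\<phi>\<close> is only semilinear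
  in each slot. Applying the inverse \<open>\<tau>\<close> of \<open>\<sigma>\<close> to its values
  makes it an alternating form, hence a multiple of \<open>\<omega>\<close>. Evaluation at the
  preimages of \<open>bs\<close> under \<open>\<phi>\<close> shows that the factor is not 0.\<close>

lemma phi_det:
  assumes P: "phi_module \<sigma> V \<phi>" and bs: "obasis V bs"
    and \<omega>: "\<omega> \<in> alternating_forms V" "\<omega> bs = 1" and xs: "xs \<in> frames V"
  shows "\<omega> (map \<phi> xs) = \<omega> (map \<phi> bs) * \<sigma> (\<omega> xs)" "\<omega> (map \<phi> bs) \<noteq> 0"
proof -
  have V: "vsp V" and cl: "\<And>x. x \<in> carrier V \<Longrightarrow> \<phi> x \<in> carrier V" and bij: "bij_betw \<phi> (carrier V) (carrier V)"
    and add: "\<And>x y. x \<in> carrier V \<Longrightarrow> y \<in> carrier V \<Longrightarrow> \<phi> (x \<oplus>\<^bsub>V\<^esub> y) = \<phi> x \<oplus>\<^bsub>V\<^esub> \<phi> y"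
    and smult: "\<And>c x. x \<in> carrier V \<Longrightarrow> \<phi> (c \<odot>\<^bsub>V\<^esub> x) = \<sigma> c \<odot>\<^bsub>V\<^esub> \<phi> x"
    using P by (auto simp: phi_module_def bij_betw_def)
  define \<tau> where "\<tau> = inv_into UNIV \<sigma>"
  have s\<tau>: "\<sigma> (\<tau> x) = x" and \<tau>s: "\<tau> (\<sigma> x) = x" for x
    using \<sigma>(2) by (auto simp: \<tau>_def bij_def surj_f_inv_f)
  have \<tau>_lin: "\<tau> (\<sigma> c * a + b) = c * \<tau> a + \<tau> b" for a b c
    using \<tau>s[of "c * \<tau> a + \<tau> b"] by (simp add: \<sigma>.hom_add \<sigma>.hom_mult s\<tau>)
  have "(\<lambda>xs. \<tau> (\<omega> (map \<phi> xs))) \<in> alternating_forms V"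
  proof (rule alternating_formsI)
    fix xs i c u w assume xs: "xs \<in> frames V" and i: "i < vdim V" and uv: "u \<in> carrier V" "w \<in> carrier V"
    show "\<tau> (\<omega> (map \<phi> (xs[i := (c \<odot>\<^bsub>V\<^esub> u) \<oplus>\<^bsub>V\<^esub> w]))) =
      c * \<tau> (\<omega> (map \<phi> (xs[i := u]))) + \<tau> (\<omega> (map \<phi> (xs[i := w])))"
      using alt_linear[OF V \<omega>(1) phi_frames[OF P xs] i cl[OF uv(1)] cl[OF uv(2)], of "\<sigma> c"] uv
      by (simp add: map_update add smult vsp_closed[OF V] \<tau>_lin)
  next
    fix xs i j assume *: "xs \<in> frames V" "i < vdim V" "j < vdim V" "i \<noteq> j" "xs ! i = xs ! j"
    then have "\<omega> (map \<phi> xs) = 0"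
      using alt_eq[OF V \<omega>(1) phi_frames[OF P *(1)] *(2-4)] by (simp add: frames_length)
    then show "\<tau> (\<omega> (map \<phi> xs)) = 0" using \<tau>s[of 0] by simp
  qed
  note uniq = alt_unique[OF V bs this \<omega>]
  have eq: "\<omega> (map \<phi> xs) = \<omega> (map \<phi> bs) * \<sigma> (\<omega> xs)" if xs: "xs \<in> frames V" for xs
  proof -
    have "\<sigma> (\<tau> (\<omega> (map \<phi> xs))) = \<sigma> (\<tau> (\<omega> (map \<phi> bs)) * \<omega> xs)" using uniq[OF xs] by simp
    then show ?thesis by (simp add: s\<tau> \<sigma>.hom_mult)
  qed
  show "\<omega> (map \<phi> xs) = \<omega> (map \<phi> bs) * \<sigma> (\<omega> xs)" by (rule eq[OF xs])
  let ?ys = "map (inv_into (carrier V) \<phi>) bs"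
  have bsf: "bs \<in> frames V" by (rule obasis_frames[OF V bs])
  have im: "\<phi> ` carrier V = carrier V" using bij by (simp add: bij_betw_def)
  have "map \<phi> ?ys = bs"
    using bsf im by (auto simp: frames_def f_inv_into_f subset_iff intro!: map_idI)
  moreover have "?ys \<in> frames V" using bsf im by (auto simp: frames_def intro!: inv_into_into)
  ultimately have "1 = \<omega> (map \<phi> bs) * \<sigma> (\<omega> ?ys)" using eq[of ?ys] \<omega>(2) by simp
  then show "\<omega> (map \<phi> bs) \<noteq> 0" by auto
qed

text \<open>Another frame \<open>xs\<close> replaces the factor \<open>d\<close> by \<open>d\<close>
  times \<open>\<sigma> a / a\<close> with \<open>a = \<omega> xs\<close>. The valuations of
  \<open>\<sigma> a\<close> and \<open>a\<close> cancel, so the definite description in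
  \<open>t_N\<close> has a unique solution.\<close>

lemma t_N_eq:
  assumes P: "phi_module \<sigma> V \<phi>" and bs: "obasis V bs"
    and \<omega>: "\<omega> \<in> alternating_forms V" "\<omega> bs = 1"
  shows "t_N v V \<phi> = v (\<omega> (map \<phi> bs))"
proof -
  have V: "vsp V" using P by (simp add: phi_module_def)
  let ?d = "\<omega> (map \<phi> bs)"
  have bsf: "bs \<in> frames V" by (rule obasis_frames[OF V bs])
  have w1: "wedge V xs \<noteq> (\<lambda>\<omega>\<in>alternating_forms V. 0) \<longleftrightarrow> (\<exists>\<omega>\<in>alternating_forms V. \<omega> xs \<noteq> 0)" for xs
    by (auto simp: wedge_def fun_eq_iff)
  have w2: "wedge V (map \<phi> xs) = (\<lambda>\<omega>\<in>alternating_forms V. l * wedge V xs \<omega>) \<longleftrightarrow>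
      (\<forall>\<omega>\<in>alternating_forms V. \<omega> (map \<phi> xs) = l * \<omega> xs)" for xs l
    by (auto simp: wedge_def fun_eq_iff)
  show ?thesis unfolding t_N_def w1 w2
  proof (rule the_equality)
    have "\<omega>' (map \<phi> bs) = ?d * \<omega>' bs" if "\<omega>' \<in> alternating_forms V" for \<omega>'
      using alt_unique[OF V bs that \<omega> phi_frames[OF P bsf]] by simp
    then show "\<exists>xs\<in>frames V. \<exists>l. (\<exists>\<omega>\<in>alternating_forms V. \<omega> xs \<noteq> 0) \<and>
        (\<forall>\<omega>\<in>alternating_forms V. \<omega> (map \<phi> xs) = l * \<omega> xs) \<and> v ?d = v l"
      using bsf \<omega> by (intro bexI[of _ bs] exI[of _ ?d] conjI bexI[of _ \<omega>]) auto
    fix r assume "\<exists>xs\<in>frames V. \<exists>l. (\<exists>\<omega>\<in>alternating_forms V. \<omega> xs \<noteq> 0) \<and>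
        (\<forall>\<omega>\<in>alternating_forms V. \<omega> (map \<phi> xs) = l * \<omega> xs) \<and> r = v l"
    then obtain xs l \<omega>' where *: "xs \<in> frames V" "\<omega>' \<in> alternating_forms V" "\<omega>' xs \<noteq> 0"
      "\<omega> (map \<phi> xs) = l * \<omega> xs" "r = v l" using \<omega>(1) by blast
    have nz: "\<omega> xs \<noteq> 0" using alt_unique[OF V bs *(2) \<omega> *(1)] *(3) by auto
    then have "l = ?d * \<sigma> (\<omega> xs) / \<omega> xs" using *(4) phi_det(1)[OF P bs \<omega> *(1)] by simp
    then show "r = v ?d"
      using *(5) nz phi_det(2)[OF P bs \<omega> *(1)] by (simp add: v_divide v_mult v_\<sigma>)
  qed
qed


text \<open>In a basis consisting of \<open>S us\<close> and lifts of \<open>qs\<close> the matrix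
  of \<open>\<phi>V\<close> is block triangular. In terms of forms: freezing the arguments of
  \<open>\<omega>\<close> that come from \<open>Q\<close>, or those that come from \<open>U\<close>,
  leaves forms \<open>\<alpha>\<close> and \<open>\<beta>\<close> on the smaller spaces, and the
  uniqueness of such forms yields the two factors of the determinant.\<close>

lemma t_N_exact:
  fixes U V Q :: "('s, _) module"
  assumes PU: "phi_module \<sigma> U \<phi>U" and PV: "phi_module \<sigma> V \<phi>V" and PQ: "phi_module \<sigma> Q \<phi>Q"
    and S: "lin U V S" "inj_on S (carrier U)" "S ` carrier U = kern V Q T"
    and T: "lin V Q T" "T ` carrier V = carrier Q"
    and cS: "\<And>x. x \<in> carrier U \<Longrightarrow> S (\<phi>U x) = \<phi>V (S x)"
    and cT: "\<And>x. x \<in> carrier V \<Longrightarrow> T (\<phi>V x) = \<phi>Q (T x)"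
  shows "t_N v V \<phi>V = t_N v U \<phi>U + t_N v Q \<phi>Q"
proof -
  have vs: "vsp U" "vsp V" "vsp Q" and fds: "fd U" "fd V" "fd Q"
    using PU PV PQ by (auto simp: phi_module_def)
  have \<phi>cl: "\<phi>V x \<in> carrier V" if "x \<in> carrier V" for x
    using PV that by (auto simp: phi_module_def bij_betw_def)
  have \<phi>Qcl: "\<phi>Q x \<in> carrier Q" if "x \<in> carrier Q" for x
    using PQ that by (auto simp: phi_module_def bij_betw_def)
  obtain us where us: "obasis U us" using obasis_exists[OF vs(1) fds(1)] .
  obtain qs where qs: "obasis Q qs" using obasis_exists[OF vs(3) fds(3)] .
  have lus: "length us = vdim U" and lqs: "length qs = vdim Q"
    using obasis_length vs us qs by auto
  have Bq: "finite (set qs)" "vbasis Q (set qs)" "set qs \<subseteq> carrier Q" "vspan Q (set qs) = carrier Q"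
    using qs basis_props[OF vs(3)] by (auto simp: obasis_def)
  have Bu: "set us \<subseteq> carrier U" "vspan U (set us) = carrier U"
    using us basis_props[OF vs(1)] by (auto simp: obasis_def)
  have "inv_into (carrier V) T q \<in> carrier V" if "q \<in> set qs" for q
    using that Bq(3) T(2) by (intro inv_into_into) auto
  \<comment> \<open>A linear section of \<open>T\<close>. Its values on \<open>qs\<close> complete
    the image of \<open>us\<close> to a basis of \<open>V\<close>.\<close>
  then obtain g where g: "lin Q V g" "\<forall>q\<in>set qs. g q = inv_into (carrier V) T q"
    using lin_extension[OF vs(3) Bq(1,2) vs(2), of "inv_into (carrier V) T"] by auto
  have Tg: "T (g q) = q" if q: "q \<in> carrier Q" for q
  proof (rule lin_eq_on_span[OF lin_comp[OF g(1) T(1)] lin_id[OF vs(3)] Bq(3)])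
    show "T (g x) = x" if "x \<in> set qs" for x
      using that g(2) Bq(3) T(2) by (simp add: f_inv_into_f subset_iff)
  qed (use q Bq(4) in simp)
  let ?Su = "map S us" and ?bs = "map S us @ map g qs"
  have dim: "vdim V = vdim U + vdim Q"
    using rank_nullity(1)[OF T(1) fds(2)] vdim_inj[OF S(1) fds(1) sub_carrier[OF vs(1)] S(2)]
    by (simp add: S(3) T(2))
  have SuV: "set ?Su \<subseteq> carrier V" using Bu lin_closed[OF S(1)] by auto
  have spanS: "vspan V (set ?Su) = kern V Q T"
    using span_image[OF S(1) Bu(1)] Bu(2) S(3) by simp
  have bsV: "set ?bs \<subseteq> carrier V" using SuV Bq(3) lin_closed[OF g(1)] by auto
  have gen: "vspan V (set ?bs) = carrier V"
  proof
    note sb = sub_span[OF vs(2) bsV]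
    show "vspan V (set ?bs) \<subseteq> carrier V" by (rule sub_subset[OF sb])
    show "carrier V \<subseteq> vspan V (set ?bs)"
    proof
      fix x assume x: "x \<in> carrier V"
      let ?y = "g (T x)"
      have Tx: "T x \<in> carrier Q" by (rule lin_closed[OF T(1) x])
      have y: "?y \<in> carrier V" by (rule lin_closed[OF g(1) Tx])
      have "?y \<in> vspan V (g ` set qs)" using span_image[OF g(1) Bq(3)] Bq(4) Tx by auto
      then have y': "?y \<in> vspan V (set ?bs)"
        using span_mono[OF vs(2) _ bsV, of "g ` set qs"] by auto
      have "x \<ominus>\<^bsub>V\<^esub> ?y \<in> vspan V (set ?Su)"
        unfolding spanS using kern_minus_iff[OF T(1) x y] Tg[OF Tx] by simp
      then have "x \<ominus>\<^bsub>V\<^esub> ?y \<in> vspan V (set ?bs)"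
        using span_mono[OF vs(2) _ bsV, of "set ?Su"] by auto
      from sub_add[OF sb y' this] show "x \<in> vspan V (set ?bs)"
        by (simp add: vminus_add_cancel[OF vs(2) x y])
    qed
  qed
  have lbs: "length ?bs = vdim V" by (simp add: lus lqs dim)
  have bs: "obasis V ?bs"
  proof -
    have "vdim V \<le> card (set ?bs)"
      using vectorspace.gen_ge_dim[OF vs(2) _ bsV gen] by simp
    then have c: "card (set ?bs) = length ?bs" using card_length[of ?bs] lbs by simp
    then show ?thesis unfolding obasis_def
      using vectorspace.dim_gen_is_basis[OF vs(2) _ bsV gen] lbs by (simp only: card_distinct) simp
  qed
  obtain \<omega> where \<omega>: "\<omega> \<in> alternating_forms V" "\<omega> ?bs = 1" using alt_exists[OF vs(2) bs] by auto
  obtain \<omega>U where \<omega>U: "\<omega>U \<in> alternating_forms U" "\<omega>U us = 1" using alt_exists[OF vs(1) us] by auto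
  obtain \<omega>Q where \<omega>Q: "\<omega>Q \<in> alternating_forms Q" "\<omega>Q qs = 1" using alt_exists[OF vs(3) qs] by auto
  let ?Y = "map \<phi>V (map g qs)"
  have Y: "set ?Y \<subseteq> carrier V" "length ?Y = vdim Q"
    using Bq(3) lin_closed[OF g(1)] \<phi>cl lqs by auto
  have fr: "map S xs @ ys \<in> frames V" if "xs \<in> frames U" "set ys \<subseteq> carrier V" "length ys = vdim Q" for xs ys
    using that lin_closed[OF S(1)] dim by (auto simp: frames_def)
  have usf: "us \<in> frames U" and qsf: "qs \<in> frames Q" using obasis_frames vs us qs by auto
  \<comment> \<open>The arguments from \<open>Q\<close> are frozen at their images under
    \<open>\<phi>V\<close>, so that \<open>\<alpha>\<close> only sees the action on
    \<open>U\<close>.\<close>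
  define \<alpha> where "\<alpha> xs = \<omega> (map S xs @ ?Y)" for xs
  have \<alpha>: "\<alpha> \<in> alternating_forms U"
  proof (rule alternating_formsI)
    fix xs i c x y assume xs: "xs \<in> frames U" and i: "i < vdim U" and xy: "x \<in> carrier U" "y \<in> carrier U"
    then show "\<alpha> (xs[i := (c \<odot>\<^bsub>U\<^esub> x) \<oplus>\<^bsub>U\<^esub> y]) = c * \<alpha> (xs[i := x]) + \<alpha> (xs[i := y])"
      using alt_linear[OF vs(2) \<omega>(1) fr[OF xs Y] _ lin_closed[OF S(1) xy(1)] lin_closed[OF S(1) xy(2)], of i c]
        frames_length[OF xs]
      by (simp add: \<alpha>_def dim map_update lin_add[OF S(1)] lin_smult[OF S(1)] vsp_closed[OF vs(1)] list_update_append)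
  next
    fix xs i j assume *: "xs \<in> frames U" "i < vdim U" "j < vdim U" "i \<noteq> j" "xs ! i = xs ! j"
    then show "\<alpha> xs = 0"
      using alt_eq[OF vs(2) \<omega>(1) fr[OF *(1) Y], of i j] frames_length[OF *(1)]
      by (simp add: \<alpha>_def dim nth_append)
  qed
  define \<beta> where "\<beta> ys = \<omega> (?Su @ map g ys)" for ys
  have gf: "set (map g ys) \<subseteq> carrier V" "length (map g ys) = vdim Q" if "ys \<in> frames Q" for ys
    using that lin_closed[OF g(1)] by (auto simp: frames_def)
  have \<beta>: "\<beta> \<in> alternating_forms Q"
  proof (rule alternating_formsI)
    fix xs i c x y assume xs: "xs \<in> frames Q" and i: "i < vdim Q" and xy: "x \<in> carrier Q" "y \<in> carrier Q"
    then show "\<beta> (xs[i := (c \<odot>\<^bsub>Q\<^esub> x) \<oplus>\<^bsub>Q\<^esub> y]) = c * \<beta> (xs[i := x]) + \<beta> (xs[i := y])"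
      using alt_linear[OF vs(2) \<omega>(1) fr[OF usf gf[OF xs]] _ lin_closed[OF g(1) xy(1)] lin_closed[OF g(1) xy(2)], of "vdim U + i" c]
        frames_length[OF xs]
      by (simp add: \<beta>_def dim map_update lin_add[OF g(1)] lin_smult[OF g(1)] vsp_closed[OF vs(3)] list_update_append lus)
  next
    fix xs i j assume *: "xs \<in> frames Q" "i < vdim Q" "j < vdim Q" "i \<noteq> j" "xs ! i = xs ! j"
    then show "\<beta> xs = 0"
      using alt_eq[OF vs(2) \<omega>(1) fr[OF usf gf[OF *(1)]], of "vdim U + i" "vdim U + j"] frames_length[OF *(1)]
      by (simp add: \<beta>_def dim nth_append lus)
  qed
  \<comment> \<open>Next to a basis of \<open>U\<close>, the form \<open>\<omega>\<close> only depends on the images of the other arguments in \<open>Q\<close>.\<close>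
  have mod_kern: "\<omega> (?Su @ ys) = \<omega> (?Su @ zs)"
    if ys: "set ys \<subseteq> carrier V" "length ys = vdim Q" and zs: "set zs \<subseteq> carrier V" "length zs = vdim Q"
      and eq: "map T ys = map T zs" for ys zs
  proof -
    \<comment> \<open>The entries of \<open>ys\<close> are exchanged for those of \<open>zs\<close>
      one at a time. Their difference lies in the kernel, the span of \<open>?Su\<close>, where the
      form vanishes because an argument is repeated.\<close>
    have "\<omega> (?Su @ ys) = \<omega> (?Su @ take k zs @ drop k ys)" if "k \<le> vdim Q" for k
      using that
    proof (induction k)
      case (Suc k)
      let ?xs = "?Su @ take k zs @ drop k ys"
      let ?i = "vdim U + k"
      have sub1: "set (take k zs) \<subseteq> carrier V" "set (drop k ys) \<subseteq> carrier V"
        using ys zs set_take_subset[of k zs] set_drop_subset[of k ys] by auto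
      have xs: "?xs \<in> frames V"
        using fr[OF usf, of "take k zs @ drop k ys"] sub1 ys zs Suc.prems by simp
      have i: "?i < vdim V" using Suc.prems dim by simp
      have k: "k < length ys" "k < length zs" using Suc.prems ys zs by auto
      have yz: "ys ! k \<in> carrier V" "zs ! k \<in> carrier V" "T (ys ! k) = T (zs ! k)"
        using k ys(1) zs(1) eq by (auto simp: subset_iff dest: arg_cong[where f = "\<lambda>l. l ! k"])
      have upd: "?xs[?i := w] = ?Su @ take k zs @ w # drop (Suc k) ys" for w
        using k lus by (simp add: list_update_append Cons_nth_drop_Suc[symmetric])
      have "set ?Su \<subseteq> {w \<in> carrier V. \<omega> (?xs[?i := w]) = 0}"
      proof
        fix w assume w: "w \<in> set ?Su"
        then obtain m where m: "m < length ?Su" "?Su ! m = w" by (auto simp: in_set_conv_nth)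
        have wV: "w \<in> carrier V" using w SuV by auto
        have "\<omega> (?xs[?i := w]) = 0"
          by (rule alt_eq[OF vs(2) \<omega>(1) frames_update[OF xs wV], of m ?i])
            (use m lus dim i k frames_length[OF xs] in \<open>auto simp: nth_append\<close>)
        then show "w \<in> {w \<in> carrier V. \<omega> (?xs[?i := w]) = 0}" using wV by simp
      qed
      from span_least[OF alt_vanishing_sub[OF vs(2) \<omega>(1) xs i] this]
      have "\<omega> (?xs[?i := ys ! k \<ominus>\<^bsub>V\<^esub> zs ! k]) = 0"
        unfolding spanS using kern_minus_iff[OF T(1) yz(1,2)] yz(3) by auto
      then have "\<omega> (?xs[?i := zs ! k \<oplus>\<^bsub>V\<^esub> (ys ! k \<ominus>\<^bsub>V\<^esub> zs ! k)]) = \<omega> (?xs[?i := zs ! k])"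
        using alt_add[OF vs(2) \<omega>(1) xs i yz(2) vminus_closed[OF vs(2) yz(1,2)]] by simp
      then have "\<omega> (?xs[?i := ys ! k]) = \<omega> (?xs[?i := zs ! k])"
        by (simp add: vminus_add_cancel[OF vs(2) yz(1,2)])
      then have "\<omega> ?xs = \<omega> (?Su @ take (Suc k) zs @ drop (Suc k) ys)"
        using k unfolding upd by (simp add: Cons_nth_drop_Suc take_Suc_conv_app_nth)
      then show ?case using Suc by simp
    qed simp
    from this[of "vdim Q"] show ?thesis using ys zs by simp
  qed
  have "\<omega> (map \<phi>V ?bs) = \<alpha> (map \<phi>U us)"
    using Bu cS by (simp add: \<alpha>_def subset_iff cong: map_cong)
  also have "\<dots> = \<alpha> us * \<omega>U (map \<phi>U us)"
    by (rule alt_unique[OF vs(1) us \<alpha> \<omega>U phi_frames[OF PU usf]])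
  \<comment> \<open>The vectors \<open>\<phi>V (g q)\<close> and \<open>g (\<phi>Q q)\<close> have
    the same image in \<open>Q\<close>, although the section \<open>g\<close> need not commute with
    the Frobenius maps.\<close>
  also have "\<alpha> us = \<beta> (map \<phi>Q qs)"
    unfolding \<alpha>_def \<beta>_def
  proof (rule mod_kern[OF Y gf[OF phi_frames[OF PQ qsf]]])
    show "map T ?Y = map T (map g (map \<phi>Q qs))"
      using Bq(3) lin_closed[OF g(1)] Tg cT \<phi>Qcl by (auto simp: subset_iff)
  qed
  also have "\<dots> = \<omega>Q (map \<phi>Q qs)"
    using alt_unique[OF vs(3) qs \<beta> \<omega>Q phi_frames[OF PQ qsf]] \<omega>(2) by (simp add: \<beta>_def)
  finally have e: "\<omega> (map \<phi>V ?bs) = \<omega>Q (map \<phi>Q qs) * \<omega>U (map \<phi>U us)" .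
  show ?thesis
    unfolding t_N_eq[OF PV bs \<omega>] t_N_eq[OF PU us \<omega>U] t_N_eq[OF PQ qs \<omega>Q] e
    using v_mult phi_det(2)[OF PU us \<omega>U usf] phi_det(2)[OF PQ qs \<omega>Q qsf] by simp
qed

end

section \<open>Filtrations and Hodge-Tate weights\<close>

text \<open>Here \<open>e\<close> is a left-continuous step function with bounded support whose
  jumps occur just after points of \<open>S\<close>, and \<open>ep i\<close> is its value
  immediately to the right of \<open>i\<close>. By partial summation the sum is the integral of
  \<open>e\<close>. A nonnegative function of this kind has integral 0 only if it vanishes.\<close>

lemma step_function_sum:
  fixes S :: "real set" and e ep :: "real \<Rightarrow> real"
  assumes "finite S" and "\<And>x. e x \<ge> 0"
    and "\<And>x y. x < y \<Longrightarrow> S \<inter> {x..<y} = {} \<Longrightarrow> e x = e y"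
    and "\<And>i y. i \<in> S \<Longrightarrow> i < y \<Longrightarrow> S \<inter> {i<..<y} = {} \<Longrightarrow> ep i = e y"
    and "\<And>x. x \<le> a \<Longrightarrow> e x = 0" and "\<And>x. x \<ge> b \<Longrightarrow> e x = 0"
  shows "(\<Sum>i\<in>S. i * (e i - ep i)) \<ge> 0 \<and> ((\<Sum>i\<in>S. i * (e i - ep i)) = 0 \<longrightarrow> (\<forall>x. e x = 0))"
  using assms
proof (induction S arbitrary: e ep rule: finite_linorder_max_induct)
  case empty
  \<comment> \<open>Subtracting 1 gives a point that is strictly to the left of \<open>x\<close> and
    below \<open>a\<close>, where \<open>e\<close> is known to vanish; without jumps nothing changes
    on the way to \<open>x\<close>.\<close>
  have "e x = 0" for x
    using empty(2)[of "min a x - 1" x] empty(4)[of "min a x - 1"] by simp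
  then show ?case by simp
next
  case (insert m S)
  have right: "e x = 0" if "x > m" for x
  proof -
    have "insert m S \<inter> {x..<max b x + 1} = {}" using that insert.hyps by force
    then show ?thesis using insert.prems(2)[of x "max b x + 1"] insert.prems(5)[of "max b x + 1"] by simp
  qed
  have epm: "ep m = 0"
  proof -
    have "insert m S \<inter> {m<..<m + 1} = {}" using insert.hyps by force
    then show ?thesis using insert.prems(3)[of m "m + 1"] right[of "m + 1"] by simp
  qed
  show ?case
  proof (cases "S = {}")
    case True
    have "e x = 0" if "x \<le> m" for x
    proof -
      have "insert m S \<inter> {min a x - 1..<x} = {}" using that True by auto
      then show ?thesis using insert.prems(2)[of "min a x - 1" x] insert.prems(4)[of "min a x - 1"] by simp
    qed
    then have "e x = 0" for x using right[of x] by (cases "x \<le> m") auto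
    then show ?thesis using True epm by simp
  next
    case False
    define m' where "m' = Max S"
    have m': "m' \<in> S" "\<And>x. x \<in> S \<Longrightarrow> x \<le> m'" "m' < m"
      using False insert.hyps by (auto simp: m'_def)
    \<comment> \<open>The last step is cut off: \<open>e'\<close> vanishes beyond the largest point
      \<open>m'\<close> of \<open>S\<close>. The sum loses exactly \<open>(m - m') * e m\<close>,
      the area over the interval from \<open>m'\<close> to \<open>m\<close>.\<close>
    define e' where "e' x = (if x > m' then 0 else e x)" for x
    define ep' where "ep' i = (if i = m' then 0 else ep i)" for i
    have IH: "(\<Sum>i\<in>S. i * (e' i - ep' i)) \<ge> 0 \<and> ((\<Sum>i\<in>S. i * (e' i - ep' i)) = 0 \<longrightarrow> (\<forall>x. e' x = 0))"
    proof (rule insert.IH)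
      show "e' x \<ge> 0" for x using insert.prems(1) by (simp add: e'_def)
      show "e' x = e' y" if xy: "x < y" "S \<inter> {x..<y} = {}" for x y
      proof (cases "x > m'")
        case True
        then show ?thesis using xy by (simp add: e'_def)
      next
        case False
        have y: "y \<le> m'"
        proof (rule ccontr)
          assume "\<not> y \<le> m'"
          then have "m' \<in> S \<inter> {x..<y}" using False m'(1) by simp
          then show False using xy(2) by simp
        qed
        have "insert m S \<inter> {x..<y} = {}" using xy(2) y m'(3) by auto
        then show ?thesis using insert.prems(2)[OF xy(1)] False y by (simp add: e'_def)
      qed
      show "ep' i = e' y" if i: "i \<in> S" "i < y" "S \<inter> {i<..<y} = {}" for i y
      proof (cases "i = m'")
        case True
        then show ?thesis using i by (simp add: e'_def ep'_def)
      next
        case False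
        then have "i < m'" using m'(2)[OF i(1)] by simp
        have y: "y \<le> m'"
        proof (rule ccontr)
          assume "\<not> y \<le> m'"
          then have "m' \<in> S \<inter> {i<..<y}" using \<open>i < m'\<close> m'(1) by simp
          then show False using i(3) by simp
        qed
        have "insert m S \<inter> {i<..<y} = {}" using i(3) y m'(3) by auto
        then show ?thesis using insert.prems(3)[of i y] i False y by (simp add: e'_def ep'_def)
      qed
      show "e' x = 0" if "x \<le> a" for x using that insert.prems(4) by (simp add: e'_def)
      show "e' x = 0" if "x \<ge> b" for x using that insert.prems(5) by (simp add: e'_def)
    qed
    have "insert m S \<inter> {m'<..<m} = {}" using m'(2) by force
    then have epm': "ep m' = e m" using insert.prems(3)[of m' m] m' by simp
    have fin: "finite S" "m \<notin> S" using insert.hyps by auto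
    have "(\<Sum>i\<in>S. i * (e' i - ep' i)) = m' * e m' + (\<Sum>i\<in>S - {m'}. i * (e i - ep i))"
    proof -
      have "(\<Sum>i\<in>S - {m'}. i * (e' i - ep' i)) = (\<Sum>i\<in>S - {m'}. i * (e i - ep i))"
      proof (rule sum.cong[OF refl])
        fix i assume "i \<in> S - {m'}"
        then have "i \<le> m'" "i \<noteq> m'" using m'(2) by auto
        then show "i * (e' i - ep' i) = i * (e i - ep i)" by (simp add: e'_def ep'_def)
      qed
      then show ?thesis
        using sum.remove[OF fin(1) m'(1), of "\<lambda>i. i * (e' i - ep' i)"] by (simp add: e'_def ep'_def)
    qed
    moreover have "(\<Sum>i\<in>S. i * (e i - ep i)) = m' * (e m' - e m) + (\<Sum>i\<in>S - {m'}. i * (e i - ep i))"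
      using sum.remove[OF fin(1) m'(1), of "\<lambda>i. i * (e i - ep i)"] epm' by simp
    ultimately have eq: "(\<Sum>i\<in>insert m S. i * (e i - ep i)) = (m - m') * e m + (\<Sum>i\<in>S. i * (e' i - ep' i))"
      using fin epm by (simp add: algebra_simps)
    have nn: "(m - m') * e m \<ge> 0" using m'(3) insert.prems(1) by simp
    show ?thesis
    proof (intro conjI impI allI)
      show "0 \<le> (\<Sum>i\<in>insert m S. i * (e i - ep i))"
        unfolding eq using nn conjunct1[OF IH] by (rule add_nonneg_nonneg)
      fix x assume "(\<Sum>i\<in>insert m S. i * (e i - ep i)) = 0"
      then have "(m - m') * e m = 0 \<and> (\<Sum>i\<in>S. i * (e' i - ep' i)) = 0"
        unfolding eq using add_nonneg_eq_0_iff[OF nn conjunct1[OF IH]] by blast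
      then have z: "(m - m') * e m = 0" "\<forall>x. e' x = 0" using conjunct2[OF IH] by blast+
      then have em: "e m = 0" using m'(3) by simp
      consider "x \<le> m'" | "m' < x" "x < m" | "x = m" | "m < x" by linarith
      then show "e x = 0"
      proof cases
        case 1
        then show ?thesis using spec[OF z(2), of x] by (simp add: e'_def)
      next
        case 2
        have "insert m S \<inter> {x..<m} = {}" using 2 by (auto dest!: m'(2))
        then show ?thesis using insert.prems(2)[OF 2(2)] em by simp
      qed (use em right in auto)
    qed
  qed
qed

section \<open>A single filtration: attained limits, weights and jumps\<close>

context
  fixes V :: "('K::field, 'w) module" and F :: "real \<Rightarrow> 'w set"
  assumes fm: "filtered_module V F"
begin

lemma fm_vsp: "vsp V" and fm_fd: "fd V" and fm_sub: "sub (F i) V"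
  and fm_anti: "i \<le> j \<Longrightarrow> F j \<subseteq> F i" and fm_Union: "(\<Union>i. F i) = carrier V"
  and fm_Inter: "(\<Inter>i. F i) = {\<zero>\<^bsub>V\<^esub>}" and fm_left: "F i = (\<Inter>j\<in>{..<i}. F j)"
proof -
  note f = fm[unfolded filtered_module_def]
  show "vsp V" using f by (elim conjE) assumption
  show "fd V" using f by (elim conjE) assumption
  show "(\<Union>i. F i) = carrier V" using f by (elim conjE) assumption
  show "(\<Inter>i. F i) = {\<zero>\<^bsub>V\<^esub>}" using f by (elim conjE) assumption
  show "sub (F i) V" using f by (elim conjE) (erule spec)
  show "F i = (\<Inter>j\<in>{..<i}. F j)" using f by (elim conjE) (erule spec)
  have "\<forall>i j. i < j \<longrightarrow> F j \<subseteq> F i" using f by (elim conjE) assumption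
  then show "F j \<subseteq> F i" if "i \<le> j" using that by (cases "i = j") auto
qed

lemma fm_le: "vdim (on V (F i)) \<le> vdim V"
  by (rule fd_on(2)[OF fm_fd fm_sub])

text \<open>The dimensions are bounded, so some step has the largest one. The steps form a chain, in
  which a step of largest dimension contains the others.\<close>

lemma fm_max: assumes "I \<noteq> {}" shows "\<exists>j\<in>I. \<forall>k\<in>I. F k \<subseteq> F j"
proof -
  let ?D = "(\<lambda>i. vdim (on V (F i))) ` I"
  have "finite ?D" using fm_le by (auto intro: finite_subset[of _ "{..vdim V}"])
  then have "Max ?D \<in> ?D" using assms by (intro Max_in) auto
  then obtain j where j: "j \<in> I" "Max ?D = vdim (on V (F j))" by auto
  have "F k \<subseteq> F j" if k: "k \<in> I" for k
  proof (cases "j \<le> k")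
    case True
    then show ?thesis by (rule fm_anti)
  next
    case False
    have "vdim (on V (F k)) \<le> vdim (on V (F j))"
      unfolding j(2)[symmetric] using \<open>finite ?D\<close> k by (intro Max_ge) auto
    moreover have "vdim (on V (F j)) \<le> vdim (on V (F k))"
      using False by (intro vdim_mono(1)[OF fm_fd fm_sub fm_sub] fm_anti) auto
    ultimately have "F j = F k"
      using False by (intro vdim_mono(2)[OF fm_fd fm_sub fm_sub] fm_anti) auto
    then show ?thesis by simp
  qed
  then show ?thesis using j(1) by auto
qed

lemma fm_min: assumes "I \<noteq> {}" shows "\<exists>j\<in>I. \<forall>k\<in>I. F j \<subseteq> F k"
proof -
  let ?D = "(\<lambda>i. vdim (on V (F i))) ` I"
  have "finite ?D" using fm_le by (auto intro: finite_subset[of _ "{..vdim V}"])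
  then have "Min ?D \<in> ?D" using assms by (intro Min_in) auto
  then obtain j where j: "j \<in> I" "Min ?D = vdim (on V (F j))" by auto
  have "F j \<subseteq> F k" if k: "k \<in> I" for k
  proof (cases "k \<le> j")
    case True
    then show ?thesis by (rule fm_anti)
  next
    case False
    have "vdim (on V (F j)) \<le> vdim (on V (F k))"
      unfolding j(2)[symmetric] using \<open>finite ?D\<close> k by (intro Min_le) auto
    moreover have "vdim (on V (F k)) \<le> vdim (on V (F j))"
      using False by (intro vdim_mono(1)[OF fm_fd fm_sub fm_sub] fm_anti) auto
    ultimately have "F k = F j"
      using False by (intro vdim_mono(2)[OF fm_fd fm_sub fm_sub] fm_anti) auto
    then show ?thesis by simp
  qed
  then show ?thesis using j(1) by auto
qed

lemma fm_right_attained: "\<exists>j>i. (\<Union>k\<in>{i<..}. F k) = F j"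
proof -
  have "i + 1 \<in> {i<..}" by simp
  then have "{i<..} \<noteq> {}" by blast
  from fm_max[OF this] obtain j where j: "i < j" "\<And>k. i < k \<Longrightarrow> F k \<subseteq> F j" by auto
  then have "(\<Union>k\<in>{i<..}. F k) = F j" by blast
  then show ?thesis using j(1) by blast
qed

text \<open>Left-continuity expresses the value at \<open>i\<close> as an intersection, and by
  finite dimension the intersection is attained. So the filtration is constant on an interval ending
  at \<open>i\<close>.\<close>

lemma fm_left_attained: "\<exists>j<i. F i = F j"
proof -
  have "i - 1 \<in> {..<i}" by simp
  then have "{..<i} \<noteq> {}" by blast
  from fm_min[OF this] obtain j where j: "j < i" "\<And>k. k < i \<Longrightarrow> F j \<subseteq> F k" by auto
  then have "(\<Inter>k\<in>{..<i}. F k) = F j" by blast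
  then show ?thesis using j(1) unfolding fm_left[of i] by blast
qed

lemma fm_left_end: "\<exists>a. \<forall>i\<le>a. F i = carrier V"
proof -
  obtain j where j: "\<forall>k. F k \<subseteq> F j" using fm_max[of UNIV] by auto
  then have "F j = carrier V" using fm_Union by blast
  then have "F i = carrier V" if "i \<le> j" for i
    using fm_anti[OF that] sub_subset[OF fm_sub, of i] by blast
  then show ?thesis by blast
qed

lemma fm_right_end: "\<exists>b. \<forall>i\<ge>b. F i = {\<zero>\<^bsub>V\<^esub>}"
proof -
  obtain j where j: "\<forall>k. F j \<subseteq> F k" using fm_min[of UNIV] by auto
  then have "F j = {\<zero>\<^bsub>V\<^esub>}" using fm_Inter by blast
  then have "F i = {\<zero>\<^bsub>V\<^esub>}" if "i \<ge> j" for i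
    using fm_anti[OF that] sub_zero[OF fm_sub, of i] by blast
  then show ?thesis by blast
qed

text \<open>The right-hand limit of the filtration at \<open>i\<close>, the denominator of the
  graded piece.\<close>

definition Fp where "Fp i = (\<Union>k\<in>{i<..}. F k)"

lemma Fp_attained: "\<exists>j>i. Fp i = F j"
  unfolding Fp_def by (rule fm_right_attained)

lemma Fp_superset: "i < k \<Longrightarrow> F k \<subseteq> Fp i"
  unfolding Fp_def by (rule UN_upper) simp

lemma Fp_sub: "sub (Fp i) V" and Fp_subset: "Fp i \<subseteq> F i"
proof -
  show "sub (Fp i) V" using fm_right_attained[of i] fm_sub unfolding Fp_def by auto
  show "Fp i \<subseteq> F i" using fm_anti[OF less_imp_le, of i] unfolding Fp_def by blast
qed

lemma gr_dim:
  shows "vdim (gr V F i) = vdim (on V (F i)) - vdim (on V (Fp i))"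
    "i \<in> hodge_tate_weights V F \<longleftrightarrow> Fp i \<noteq> F i"
proof -
  let ?M = "on V (F i)"
  have g: "gr V F i = quot_module ?M (Fp i)" by (simp add: gr_def Fp_def)
  have N: "sub (Fp i) ?M" using sub_on_iff[OF fm_sub] Fp_sub Fp_subset by simp
  note q = quot_module_proj[OF N]
  have fM: "fd ?M" by (rule fd_on(1)[OF fm_fd fm_sub])
  have r: "vdim ?M = vdim (on V (Fp i)) + vdim (gr V F i)"
    using rank_nullity(1)[OF q(2) fM] unfolding q(3) q(4) g by simp
  then show "vdim (gr V F i) = vdim (on V (F i)) - vdim (on V (Fp i))" by simp
  have "fd (gr V F i)" unfolding g by (rule fd_surj[OF q(2) fM q(3)])
  then have "i \<in> hodge_tate_weights V F \<longleftrightarrow> vdim (gr V F i) \<noteq> 0"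
    using vdim_zero_iff[of "gr V F i"] q(1) by (simp add: hodge_tate_weights_def g)
  also have "\<dots> \<longleftrightarrow> Fp i \<noteq> F i"
  proof
    show "Fp i \<noteq> F i" if "vdim (gr V F i) \<noteq> 0"
    proof
      assume "Fp i = F i"
      then show False using r that by simp
    qed
    show "vdim (gr V F i) \<noteq> 0" if "Fp i \<noteq> F i"
      using that r vdim_mono(2)[OF fm_fd Fp_sub fm_sub Fp_subset, of i] by fastforce
  qed
  finally show "i \<in> hodge_tate_weights V F \<longleftrightarrow> Fp i \<noteq> F i" .
qed

text \<open>The dimension drops strictly to the right of each weight, so the weights are told apart
  by dimensions between 0 and \<open>vdim V\<close>.\<close>

lemma finite_hodge_tate_weights: "finite (hodge_tate_weights V F)"
proof (rule inj_on_finite)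
  let ?d = "\<lambda>i. vdim (on V (F i))"
  show "?d ` hodge_tate_weights V F \<subseteq> {..vdim V}" using fm_le by auto
  have less: "?d j < ?d i" if "i \<in> hodge_tate_weights V F" "i < j" for i j
  proof -
    have "F j \<subseteq> Fp i" using that by (auto simp: Fp_def)
    moreover have "Fp i \<noteq> F i" using that gr_dim by simp
    ultimately have "F j \<noteq> F i" "F j \<subseteq> F i" using Fp_subset by blast+
    then show ?thesis
      using vdim_mono[OF fm_fd fm_sub fm_sub, of j i] by (metis le_neq_implies_less)
  qed
  show "inj_on ?d (hodge_tate_weights V F)"
    by (rule inj_onI) (metis less less_irrefl linorder_less_linear)
qed simp

text \<open>An index outside the weights contributes 0. The freedom to enlarge the index set allows
  the sums of several filtrations to be compared term by term.\<close>

lemma t_H_eq: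
  assumes S: "finite S" "hodge_tate_weights V F \<subseteq> S"
  shows "t_H V F = (\<Sum>i\<in>S. i * (real (vdim (on V (F i))) - real (vdim (on V (Fp i)))))"
proof -
  have le: "vdim (on V (Fp i)) \<le> vdim (on V (F i))" for i
    by (rule vdim_mono(1)[OF fm_fd Fp_sub fm_sub Fp_subset])
  have "t_H V F = (\<Sum>i\<in>hodge_tate_weights V F. i * (real (vdim (on V (F i))) - real (vdim (on V (Fp i)))))"
    unfolding t_H_def by (simp add: gr_dim of_nat_diff le)
  also have "\<dots> = (\<Sum>i\<in>S. i * (real (vdim (on V (F i))) - real (vdim (on V (Fp i)))))"
    by (rule sum.mono_neutral_left) (use S gr_dim(2) in auto)
  finally show ?thesis .
qed

text \<open>If the value changed, consider the supremum \<open>s\<close> of the points between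
  \<open>x\<close> and \<open>y\<close> at which it is still \<open>F x\<close>. Left-continuity
  gives \<open>F s = F x\<close>, and as \<open>s\<close> is not a weight the value persists to the
  right of \<open>s\<close>, contradicting the supremum.\<close>

lemma fm_constant:
  assumes xy: "x < y" and no: "hodge_tate_weights V F \<inter> {x..<y} = {}"
  shows "F x = F y"
proof (rule ccontr)
  assume ne: "F x \<noteq> F y"
  define Z where "Z = {z. x \<le> z \<and> z \<le> y \<and> F z = F x}"
  define s where "s = Sup Z"
  have Z: "x \<in> Z" "bdd_above Z" using xy by (auto simp: Z_def intro!: bdd_aboveI[of _ y])
  have s: "x \<le> s" "s \<le> y"
    unfolding s_def using Z by (auto intro!: cSup_upper cSup_least simp: Z_def)
  have "F x \<subseteq> F j" if js: "j < s" for j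
  proof -
    have "Z \<noteq> {}" using Z(1) by blast
    then obtain z where z: "z \<in> Z" "j < z" using js less_cSup_iff[OF _ Z(2), of j] by (auto simp: s_def)
    then have "F z \<subseteq> F j" by (intro fm_anti) simp
    then show ?thesis using z by (simp add: Z_def)
  qed
  then have "F x \<subseteq> F s" using fm_left[of s] by auto
  then have Fs: "F s = F x" using fm_anti[OF s(1)] by auto
  then have sy: "s < y" using ne s(2) by (cases "s = y") auto
  then have "s \<notin> hodge_tate_weights V F" using no s(1) by auto
  then have "Fp s = F s" using gr_dim(2) by simp
  then obtain j where j: "j > s" "F j = F s" using fm_right_attained[of s] by (auto simp: Fp_def)
  have "F (min j y) = F x"
    using fm_anti[of s "min j y"] fm_anti[of "min j y" j] j sy Fs by auto
  then have "min j y \<in> Z" using j sy s by (auto simp: Z_def)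
  then have "min j y \<le> s" unfolding s_def using Z(2) by (rule cSup_upper)
  then show False using j sy by auto
qed

lemma Fp_constant:
  assumes iy: "i < y" and no: "hodge_tate_weights V F \<inter> {i<..<y} = {}"
  shows "Fp i = F y"
proof -
  have "F k \<subseteq> F y" if k: "i < k" for k
  proof (cases "k < y")
    case True
    then show ?thesis using fm_constant[of k y] no k by force
  next
    case False
    then show ?thesis by (intro fm_anti) simp
  qed
  then show ?thesis using iy by (auto simp: Fp_def)
qed

end

text \<open>The defect \<open>e\<close> of the dimensions is a nonnegative step function. It
  vanishes far to the left by \<open>tot\<close>, and far to the right because all steps are 0
  there. The difference of the two sides is its integral.\<close>

lemma t_H_subadditive:
  assumes V: "filtered_module V F" and V0: "filtered_module V0 F0" and V1: "filtered_module V1 F1"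
    and tot: "vdim V = vdim V0 + vdim V1"
    and le: "\<And>i. vdim (on V (F i)) \<le> vdim (on V0 (F0 i)) + vdim (on V1 (F1 i))"
  shows "t_H V F \<le> t_H V0 F0 + t_H V1 F1"
    "t_H V F = t_H V0 F0 + t_H V1 F1 \<longleftrightarrow> (\<forall>i. vdim (on V (F i)) = vdim (on V0 (F0 i)) + vdim (on V1 (F1 i)))"
proof -
  define S where "S = hodge_tate_weights V F \<union> hodge_tate_weights V0 F0 \<union> hodge_tate_weights V1 F1"
  have S: "finite S" using V V0 V1 by (simp add: S_def finite_hodge_tate_weights)
  define e where "e i = real (vdim (on V0 (F0 i))) + real (vdim (on V1 (F1 i))) - real (vdim (on V (F i)))" for i
  define ep where "ep i = real (vdim (on V0 (Fp F0 i))) + real (vdim (on V1 (Fp F1 i))) - real (vdim (on V (Fp F i)))" for i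
  have sum: "(\<Sum>i\<in>S. i * (e i - ep i)) = t_H V0 F0 + t_H V1 F1 - t_H V F"
  proof -
    have "hodge_tate_weights V F \<subseteq> S" "hodge_tate_weights V0 F0 \<subseteq> S" "hodge_tate_weights V1 F1 \<subseteq> S"
      by (auto simp: S_def)
    note t = t_H_eq[OF V S this(1)] t_H_eq[OF V0 S this(2)] t_H_eq[OF V1 S this(3)]
    show ?thesis unfolding t sum.distrib[symmetric] sum_subtractf[symmetric]
      by (rule sum.cong[OF refl]) (simp add: e_def ep_def algebra_simps)
  qed
  obtain a a0 a1 where a: "\<And>i. i \<le> a \<Longrightarrow> F i = carrier V" "\<And>i. i \<le> a0 \<Longrightarrow> F0 i = carrier V0"
    "\<And>i. i \<le> a1 \<Longrightarrow> F1 i = carrier V1"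
    using fm_left_end[OF V] fm_left_end[OF V0] fm_left_end[OF V1] by metis
  obtain b b0 b1 where b: "\<And>i. i \<ge> b \<Longrightarrow> F i = {\<zero>\<^bsub>V\<^esub>}" "\<And>i. i \<ge> b0 \<Longrightarrow> F0 i = {\<zero>\<^bsub>V0\<^esub>}"
    "\<And>i. i \<ge> b1 \<Longrightarrow> F1 i = {\<zero>\<^bsub>V1\<^esub>}"
    using fm_right_end[OF V] fm_right_end[OF V0] fm_right_end[OF V1] by metis
  have "(\<Sum>i\<in>S. i * (e i - ep i)) \<ge> 0 \<and> ((\<Sum>i\<in>S. i * (e i - ep i)) = 0 \<longrightarrow> (\<forall>x. e x = 0))"
  proof (rule step_function_sum[OF S, where a = "min a (min a0 a1)" and b = "max b (max b0 b1)"])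
    show "e x \<ge> 0" for x using le[of x] by (simp add: e_def)
    show "e x = e y" if xy: "x < y" "S \<inter> {x..<y} = {}" for x y
    proof -
      have "F x = F y" "F0 x = F0 y" "F1 x = F1 y"
        using xy by (auto intro!: fm_constant[OF V] fm_constant[OF V0] fm_constant[OF V1] simp: S_def)
      then show ?thesis by (simp add: e_def)
    qed
    show "ep i = e y" if iy: "i < y" "S \<inter> {i<..<y} = {}" for i y
    proof -
      have "Fp F i = F y" "Fp F0 i = F0 y" "Fp F1 i = F1 y"
        using iy by (auto intro!: Fp_constant[OF V] Fp_constant[OF V0] Fp_constant[OF V1] simp: S_def)
      then show ?thesis by (simp add: e_def ep_def)
    qed
    show "e x = 0" if "x \<le> min a (min a0 a1)" for x using that a tot by (simp add: e_def)
    show "e x = 0" if "x \<ge> max b (max b0 b1)" for x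
      using that b by (simp add: e_def vdim_trivial fm_vsp[OF V] fm_vsp[OF V0] fm_vsp[OF V1])
  qed
  note J = this[unfolded sum]
  show "t_H V F \<le> t_H V0 F0 + t_H V1 F1" using J by simp
  show "t_H V F = t_H V0 F0 + t_H V1 F1 \<longleftrightarrow> (\<forall>i. vdim (on V (F i)) = vdim (on V0 (F0 i)) + vdim (on V1 (F1 i)))"
  proof
    assume "t_H V F = t_H V0 F0 + t_H V1 F1"
    then have "e i = 0" for i using J by simp
    then have "real (vdim (on V (F i))) = real (vdim (on V0 (F0 i)) + vdim (on V1 (F1 i)))" for i
      by (simp add: e_def)
    then show "\<forall>i. vdim (on V (F i)) = vdim (on V0 (F0 i)) + vdim (on V1 (F1 i))"
      by (simp only: of_nat_eq_iff simp_thms)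
  next
    assume *: "\<forall>i. vdim (on V (F i)) = vdim (on V0 (F0 i)) + vdim (on V1 (F1 i))"
    \<comment> \<open>Equality of dimensions passes to the right-hand limits, because a single point
      \<open>k\<close> close enough to \<open>i\<close> computes all three limits.\<close>
    have p: "vdim (on V (Fp F i)) = vdim (on V0 (Fp F0 i)) + vdim (on V1 (Fp F1 i))" for i
    proof -
      obtain j where j: "j > i" "Fp F i = F j" using Fp_attained[OF V] by metis
      obtain j0 where j0: "j0 > i" "Fp F0 i = F0 j0" using Fp_attained[OF V0] by metis
      obtain j1 where j1: "j1 > i" "Fp F1 i = F1 j1" using Fp_attained[OF V1] by metis
      define k where "k = min j (min j0 j1)"
      have k: "i < k" "k \<le> j" "k \<le> j0" "k \<le> j1" using j(1) j0(1) j1(1) by (auto simp: k_def)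
      note le = Fp_superset[OF V k(1)] Fp_superset[OF V0 k(1)] Fp_superset[OF V1 k(1)]
      have "F k = Fp F i" using le(1) fm_anti[OF V k(2)] unfolding j(2) by (rule subset_antisym)
      moreover have "F0 k = Fp F0 i" using le(2) fm_anti[OF V0 k(3)] unfolding j0(2) by (rule subset_antisym)
      moreover have "F1 k = Fp F1 i" using le(3) fm_anti[OF V1 k(4)] unfolding j1(2) by (rule subset_antisym)
      ultimately show ?thesis using spec[OF *, of k] by simp
    qed
    have "e i = 0" "ep i = 0" for i using * p by (auto simp: e_def ep_def)
    then show "t_H V F = t_H V0 F0 + t_H V1 F1" using sum by simp
  qed
qed

lemma filtered_moduleI:
  fixes V :: "('K::field, 'w) module"
  assumes "vsp V" "fd V" "\<And>i. sub (F i) V" "\<And>i j. i < j \<Longrightarrow> F j \<subseteq> F i" "(\<Union>i. F i) = carrier V"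
    "(\<Inter>i. F i) = {\<zero>\<^bsub>V\<^esub>}" "\<And>i. F i = (\<Inter>j\<in>{..<i}. F j)"
  shows "filtered_module V F"
  unfolding filtered_module_def
  by (intro conjI allI impI; (rule assms | assumption)+)

lemma filtered_module_on:
  assumes V: "filtered_module V F" and X: "sub X V"
  shows "filtered_module (on V X) (\<lambda>i. F i \<inter> X)"
proof -
  show ?thesis
  proof (rule filtered_moduleI[OF vsp_on[OF X] fd_on(1)[OF fm_fd[OF V] X]])
    show "F i \<inter> X = (\<Inter>j\<in>{..<i}. F j \<inter> X)" for i
    proof -
      have "i - 1 \<in> {..<i}" by simp
      then have "{..<i} \<noteq> {}" by blast
      then have "(\<Inter>j\<in>{..<i}. F j \<inter> X) = (\<Inter>j\<in>{..<i}. F j) \<inter> X" by blast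
      then show ?thesis by (simp only: fm_left[OF V, of i, symmetric])
    qed
    show "sub (F i \<inter> X) (on V X)" for i
      using sub_on_iff[OF X] sub_inter[OF fm_sub[OF V] X] by blast
    show "F j \<inter> X \<subseteq> F i \<inter> X" if "i < j" for i j using fm_anti[OF V less_imp_le[OF that]] by blast
    show "(\<Union>i. F i \<inter> X) = carrier (on V X)" using fm_Union[OF V] sub_subset[OF X] by auto
    show "(\<Inter>i. F i \<inter> X) = {\<zero>\<^bsub>on V X\<^esub>}" using fm_Inter[OF V] sub_zero[OF X] by auto
  qed
qed

lemma filtered_module_image:
  assumes V: "filtered_module V F" and q: "lin V Q q" "q ` carrier V = carrier Q"
  shows "filtered_module Q (\<lambda>i. q ` F i)"
proof -
  \<comment> \<open>Images do not commute with intersections in general. Here the intersection is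
    already attained at some \<open>j < i\<close>.\<close>
  have l: "q ` F i = (\<Inter>j\<in>{..<i}. q ` F j)" for i
  proof
    show "q ` F i \<subseteq> (\<Inter>j\<in>{..<i}. q ` F j)" using fm_anti[OF V, of _ i]
      by (intro INT_greatest image_mono) simp
    show "(\<Inter>j\<in>{..<i}. q ` F j) \<subseteq> q ` F i" using fm_left_attained[OF V, of i] by auto
  qed
  have z: "(\<Inter>i. q ` F i) = {\<zero>\<^bsub>Q\<^esub>}"
  proof
    obtain b where "F b = {\<zero>\<^bsub>V\<^esub>}" using fm_right_end[OF V] by auto
    then have "q ` F b = {\<zero>\<^bsub>Q\<^esub>}" by (simp add: lin_zero[OF q(1)])
    then show "(\<Inter>i. q ` F i) \<subseteq> {\<zero>\<^bsub>Q\<^esub>}" by auto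
    show "{\<zero>\<^bsub>Q\<^esub>} \<subseteq> (\<Inter>i. q ` F i)" using sub_zero[OF sub_image[OF q(1) fm_sub[OF V]]] by auto
  qed
  have u: "(\<Union>i. q ` F i) = carrier Q" using fm_Union[OF V] q(2) by (metis image_UN)
  show ?thesis
    by (rule filtered_moduleI[OF lin_cod[OF q(1)] fd_surj[OF q(1) fm_fd[OF V] q(2)] sub_image[OF q(1) fm_sub[OF V]] _ u z l])
      (intro image_mono fm_anti[OF V] less_imp_le)
qed

section \<open>The valuation of the base field is invariant under the Frobenius\<close>

lemma hom_of_nat_field: "field_hom h \<Longrightarrow> h (of_nat n) = of_nat n"
proof (induction n)
  case 0
  then interpret field_hom h by simp
  show ?case by simp
next
  case (Suc n)
  then interpret field_hom h by simp
  show ?case using Suc by (simp add: hom_add)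
qed

context padic_base
begin

interpretation emb0: field_hom emb0 by (rule emb0_hom)
interpretation emb: field_hom emb by (rule emb_hom)
interpretation \<sigma>: field_hom \<sigma> by (rule \<sigma>_aut)

definition v :: "'s \<Rightarrow> real" where "v c = ord (emb c)"

definition oK :: "'s set" where "oK = {x. x = 0 \<or> v x \<ge> 0}"

abbreviation pp :: 's where "pp \<equiv> of_nat p"

lemma v_mult: "x \<noteq> 0 \<Longrightarrow> y \<noteq> 0 \<Longrightarrow> v (x * y) = v x + v y"
  using ord_discrete by (simp add: v_def discrete_valuation_def emb.hom_mult)

lemma v_add: "x \<noteq> 0 \<Longrightarrow> y \<noteq> 0 \<Longrightarrow> x + y \<noteq> 0 \<Longrightarrow> v (x + y) \<ge> min (v x) (v y)"
proof -
  assume *: "x \<noteq> 0" "y \<noteq> 0" "x + y \<noteq> 0"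
  then have "emb (x + y) \<noteq> 0" "emb x \<noteq> 0" "emb y \<noteq> 0" by auto
  then have "emb x \<noteq> 0" "emb y \<noteq> 0" "emb x + emb y \<noteq> 0" by (auto simp: emb.hom_add)
  then show ?thesis using ord_discrete by (simp add: v_def discrete_valuation_def emb.hom_add)
qed

lemma v_one: "v 1 = 0" using v_mult[of 1 1] by simp

lemma v_power: "x \<noteq> 0 \<Longrightarrow> v (x ^ n) = real n * v x"
  by (induction n) (simp_all add: v_one v_mult algebra_simps)

lemma v_divide: "x \<noteq> 0 \<Longrightarrow> y \<noteq> 0 \<Longrightarrow> v (x / y) = v x - v y"
  using v_mult[of "x / y" y] by simp

lemma v_minus_one: "v (-1) = 0" using v_mult[of "-1" "-1"] v_one by simp

text \<open>The disjunction expresses an inequality in which 0 has infinite value.\<close>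

lemma v_bound_add: "x = 0 \<or> v x \<ge> c \<Longrightarrow> y = 0 \<or> v y \<ge> c \<Longrightarrow> x + y = 0 \<or> v (x + y) \<ge> c"
  using v_add[of x y] by (cases "x = 0"; cases "y = 0"; cases "x + y = 0") auto

lemma v_bound_sum: "finite A \<Longrightarrow> (\<And>i. i \<in> A \<Longrightarrow> f i = 0 \<or> v (f i) \<ge> c) \<Longrightarrow> sum f A = 0 \<or> v (sum f A) \<ge> c"
  by (induction A rule: finite_induct) (simp_all add: v_bound_add)

lemma oK_mult: "x \<in> oK \<Longrightarrow> y \<in> oK \<Longrightarrow> x * y \<in> oK"
  by (cases "x = 0"; cases "y = 0") (auto simp: oK_def v_mult)

lemma oK_add: "x \<in> oK \<Longrightarrow> y \<in> oK \<Longrightarrow> x + y \<in> oK"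
  using v_bound_add[of x 0 y] by (simp add: oK_def)

lemma oK_minus: "x \<in> oK \<Longrightarrow> y \<in> oK \<Longrightarrow> x - y \<in> oK"
  using oK_add[of x "-1 * y"] oK_mult[of "-1" y] by (simp add: oK_def v_minus_one)

lemma oK_power: "x \<in> oK \<Longrightarrow> x ^ n \<in> oK"
  by (induction n) (simp_all add: oK_mult, simp add: oK_def v_one)

lemma oK_sum: "finite A \<Longrightarrow> (\<And>i. i \<in> A \<Longrightarrow> f i \<in> oK) \<Longrightarrow> sum f A \<in> oK"
  using v_bound_sum[of A f 0] by (simp add: oK_def)

section \<open>Closure and completeness of W\<close>

lemma W_closed: "1 \<in> W" "0 \<in> W" "a \<in> W \<Longrightarrow> b \<in> W \<Longrightarrow> a - b \<in> W" "a \<in> W \<Longrightarrow> b \<in> W \<Longrightarrow> a * b \<in> W"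
  "a \<in> W \<Longrightarrow> b \<in> W \<Longrightarrow> a + b \<in> W" "(of_nat n :: 'k0) \<in> W" "a \<in> W \<Longrightarrow> a ^ n \<in> W"
proof -
  have "\<forall>a\<in>W. \<forall>b\<in>W. a - b \<in> W \<and> a * b \<in> W"
    using witt unfolding witt_ring_def by (elim conjE) assumption
  then show m: "a \<in> W \<Longrightarrow> b \<in> W \<Longrightarrow> a - b \<in> W" and t: "a \<in> W \<Longrightarrow> b \<in> W \<Longrightarrow> a * b \<in> W" for a b
    by blast+
  show 1: "1 \<in> W" using witt unfolding witt_ring_def by (elim conjE) assumption
  show 0: "0 \<in> W" using m[OF 1 1] by simp
  have add: "a + b \<in> W" if "a \<in> W" "b \<in> W" for a b
    using m[OF that(1) m[OF 0 that(2)]] by simp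
  show "a + b \<in> W" if "a \<in> W" "b \<in> W" using add that .
  show "(of_nat n :: 'k0) \<in> W" by (induction n) (simp_all add: 0 1 add)
  show "a ^ n \<in> W" if "a \<in> W" by (induction n) (simp_all add: 1 t that)
qed

lemma W_sum: "finite A \<Longrightarrow> (\<And>i. i \<in> A \<Longrightarrow> f i \<in> W) \<Longrightarrow> sum f A \<in> W"
  by (induction A rule: finite_induct) (simp_all add: W_closed)

lemma W_complete:
  assumes "\<And>n. s n \<in> W" "\<And>n. \<exists>b\<in>W. s (Suc n) - s n = of_nat p ^ n * b"
  shows "\<exists>a\<in>W. \<forall>n. \<exists>b\<in>W. a - s n = of_nat p ^ n * b"
proof -
  have "\<forall>s. (\<forall>n. s n \<in> W) \<and> (\<forall>n. \<exists>b\<in>W. s (Suc n) - s n = of_nat p ^ n * b) \<longrightarrow>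
        (\<exists>a\<in>W. \<forall>n. \<exists>b\<in>W. a - s n = of_nat p ^ n * b)"
    using witt unfolding witt_ring_def by (elim conjE) assumption
  then show ?thesis using assms by (elim allE[of _ s]) simp
qed

lemma emb0_W: "a \<in> W \<Longrightarrow> emb0 a \<in> oK"
  using ord_W by (auto simp: oK_def v_def val_ring_def)

lemma emb0_pp: "emb0 (of_nat p) = pp" by (rule hom_of_nat_field[OF emb0_hom])

lemma pp: "pp \<noteq> 0" "v pp = 1"
proof -
  have "(of_nat p :: 'k0) \<noteq> 0" using witt unfolding witt_ring_def by (elim conjE) assumption
  then show "pp \<noteq> 0" using emb0_pp by (metis emb0.hom_0_iff)
  show "v pp = 1" using ord_p hom_of_nat_field[OF emb_hom] by (simp add: v_def)
qed

lemma \<sigma>_divide: "\<sigma> (x / y) = \<sigma> x / \<sigma> y"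
proof (cases "y = 0")
  case False
  then have "\<sigma> (x / y) * \<sigma> y = \<sigma> x" by (simp flip: \<sigma>.hom_mult)
  then show ?thesis using False by (simp add: nonzero_eq_divide_eq)
qed simp

lemma \<sigma>_pp: "\<sigma> pp = pp" by (rule hom_of_nat_field[OF \<sigma>_aut(1)])

lemma v_discrete: "\<exists>d>0. \<forall>x. x \<noteq> 0 \<longrightarrow> (\<exists>n::int. v x = of_int n * d)"
proof -
  obtain u where "ord u > 0" "\<forall>x. x \<noteq> 0 \<longrightarrow> (\<exists>n::int. ord x = of_int n * ord u)"
    using ord_discrete unfolding discrete_valuation_def by auto
  then show ?thesis unfolding v_def by (intro exI[of _ "ord u"]) auto
qed

text \<open>The values on \<open>K\<^sub>*\<close> lie among the integer multiples of the step
  \<open>d\<close> of the valuation on K, so there is a least positive one. The value of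
  \<open>pp\<close> shows that positive values occur.\<close>

lemma uniformizer: "\<exists>\<pi>. \<pi> \<noteq> 0 \<and> v \<pi> > 0 \<and> (\<forall>y. y \<noteq> 0 \<longrightarrow> v y > 0 \<longrightarrow> v y \<ge> v \<pi>)"
proof -
  obtain d where d: "d > 0" "\<And>x. x \<noteq> 0 \<Longrightarrow> \<exists>n::int. v x = of_int n * d" using v_discrete by auto
  have nat: "\<exists>n::nat. n > 0 \<and> v x = real n * d" if x: "x \<noteq> 0" "v x > 0" for x
  proof -
    obtain n :: int where n: "v x = of_int n * d" using d(2)[OF x(1)] by auto
    then have "n > 0" using x(2) d(1) by (simp add: zero_less_mult_iff)
    then show ?thesis using n by (intro exI[of _ "nat n"]) simp
  qed
  let ?P = "\<lambda>n::nat. n > 0 \<and> (\<exists>x. x \<noteq> 0 \<and> v x = real n * d)"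
  obtain n where "n > 0" "v pp = real n * d" using nat[OF pp(1)] pp(2) by auto
  then have "?P n" using pp(1) by blast
  then have "\<exists>n. ?P n" by blast
  from LeastI_ex[OF this] obtain \<pi> where \<pi>: "(LEAST n. ?P n) > 0" "\<pi> \<noteq> 0" "v \<pi> = real (LEAST n. ?P n) * d" by blast
  have "v y \<ge> v \<pi>" if y: "y \<noteq> 0" "v y > 0" for y
  proof -
    obtain n :: nat where n: "n > 0" "v y = real n * d" using nat[OF y] by auto
    then have "(LEAST n. ?P n) \<le> n" using y(1) by (intro Least_le) auto
    then show ?thesis using n(2) \<pi>(3) d(1) by (simp add: mult_right_mono)
  qed
  moreover have "v \<pi> > 0" using \<pi> d(1) by simp
  ultimately show ?thesis using \<pi>(2) by blast
qed

text \<open>The extension of \<open>K\<^sub>*\<close> over \<open>K\<^sub>0\<close> is totally ramified, so \<open>1, \<pi>, \<dots>, \<pi>\<^bsup>e-1\<^esup>\<close> generate the valuation ring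
  modulo \<open>p\<close> over \<open>W\<close>, and by completeness of \<open>W\<close> they generate it.\<close>

lemma oK_generated: "\<exists>\<pi> (N::nat). \<pi> \<noteq> 0 \<and> (\<forall>x\<in>oK. \<exists>a. (\<forall>i. a i \<in> W) \<and> x = (\<Sum>i<N. emb0 (a i) * \<pi> ^ i))"
proof -
  obtain \<pi> where \<pi>: "\<pi> \<noteq> 0" "v \<pi> > 0" "\<And>y. y \<noteq> 0 \<Longrightarrow> v y > 0 \<Longrightarrow> v y \<ge> v \<pi>"
    using uniformizer by auto
  have \<pi>O: "\<pi> ^ i \<in> oK" for i using \<pi>(2) by (intro oK_power) (simp add: oK_def)
  \<comment> \<open>This \<open>N\<close> makes \<open>\<pi> ^ N\<close> divisible by
    \<open>p\<close> in the valuation ring.\<close>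
  obtain N :: nat where N: "real N * v \<pi> \<ge> 1"
    using reals_Archimedean3[OF \<pi>(2), rule_format, of 1] by (meson less_imp_le)
  \<comment> \<open>This is where total ramification enters: W already surjects onto the residue
    field, so an integral element is congruent to one of W, and by minimality of
    \<open>v \<pi>\<close> the difference is divisible by \<open>\<pi>\<close>.\<close>
  have step: "\<exists>a y. a \<in> W \<and> y \<in> oK \<and> x = emb0 a + \<pi> * y" if x: "x \<in> oK" for x
  proof -
    have "emb x \<in> val_ring ord" using x by (auto simp: oK_def val_ring_def v_def)
    then obtain a where a: "a \<in> W" "emb (x - emb0 a) \<in> val_ideal ord" using residue_field_s by auto
    let ?y = "(x - emb0 a) / \<pi>"
    have "?y \<in> oK"
    proof (cases "x - emb0 a = 0")
      case True
      then show ?thesis by (simp add: oK_def)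
    next
      case False
      then have "v (x - emb0 a) > 0" using a(2) by (simp add: val_ideal_def v_def)
      then have "v (x - emb0 a) \<ge> v \<pi>" using \<pi>(3) False by blast
      then show ?thesis using v_divide[OF False \<pi>(1)] by (simp add: oK_def)
    qed
    moreover have "x = emb0 a + \<pi> * ?y" using \<pi>(1) by simp
    ultimately show ?thesis using a(1) by blast
  qed
  have expand: "\<exists>a y. (\<forall>i. a i \<in> W) \<and> y \<in> oK \<and> x = (\<Sum>i<k. emb0 (a i) * \<pi> ^ i) + \<pi> ^ k * y" if x: "x \<in> oK" for x k
  proof (induction k)
    case 0
    show ?case by (rule exI[of _ "\<lambda>_. 0"], rule exI[of _ x]) (simp add: x W_closed)
  next
    case (Suc k)
    then obtain a y where a: "\<forall>i. a i \<in> W" "y \<in> oK" "x = (\<Sum>i<k. emb0 (a i) * \<pi> ^ i) + \<pi> ^ k * y" by blast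
    obtain b z where b: "b \<in> W" "z \<in> oK" "y = emb0 b + \<pi> * z" using step[OF a(2)] by blast
    show ?case
      by (rule exI[of _ "a(k := b)"], rule exI[of _ z]) (use a b in \<open>simp add: algebra_simps\<close>)
  qed
  have step2: "\<exists>a y. (\<forall>i. a i \<in> W) \<and> y \<in> oK \<and> x = (\<Sum>i<N. emb0 (a i) * \<pi> ^ i) + pp * y" if x: "x \<in> oK" for x
  proof -
    obtain a y where a: "\<forall>i. a i \<in> W" "y \<in> oK" "x = (\<Sum>i<N. emb0 (a i) * \<pi> ^ i) + \<pi> ^ N * y"
      using expand[OF x, of N] by blast
    have "\<pi> ^ N / pp \<in> oK" using N by (simp add: oK_def v_divide pp \<pi>(1) v_power)
    then have "\<pi> ^ N / pp * y \<in> oK" using a(2) by (rule oK_mult)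
    moreover have "x = (\<Sum>i<N. emb0 (a i) * \<pi> ^ i) + pp * (\<pi> ^ N / pp * y)" using a(3) pp by simp
    ultimately show ?thesis using a(1) by blast
  qed
  obtain A Y where AY: "\<And>x. x \<in> oK \<Longrightarrow> (\<forall>i. A x i \<in> W) \<and> Y x \<in> oK \<and>
      x = (\<Sum>i<N. emb0 (A x i) * \<pi> ^ i) + pp * Y x" using step2 by metis
  have "\<exists>a. (\<forall>i. a i \<in> W) \<and> x = (\<Sum>i<N. emb0 (a i) * \<pi> ^ i)" if x: "x \<in> oK" for x
  proof -
    \<comment> \<open>\<open>X n\<close> is the remainder left after \<open>n\<close> reductions:
      \<open>x\<close> is the combination of the powers of \<open>\<pi>\<close> with coefficients
      \<open>s i n\<close>, plus \<open>pp ^ n * X n\<close>.\<close>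
    define X where "X n = (Y ^^ n) x" for n
    have X: "X n \<in> oK" for n by (induction n) (simp_all add: X_def x AY)
    have X0: "X 0 = x" by (simp add: X_def)
    have XS: "X n = (\<Sum>i<N. emb0 (A (X n) i) * \<pi> ^ i) + pp * X (Suc n)" for n
      using AY[OF X, of n] by (simp add: X_def)
    define s where "s i n = (\<Sum>j<n. of_nat p ^ j * A (X j) i)" for i n
    have sW: "s i n \<in> W" for i n unfolding s_def using AY[OF X] by (intro W_sum) (simp_all add: W_closed)
    have partial: "x = (\<Sum>i<N. emb0 (s i n) * \<pi> ^ i) + pp ^ n * X n" for n
    proof (induction n)
      case 0
      show ?case by (simp add: s_def X0)
    next
      case (Suc n)
      have e: "emb0 (s i (Suc n)) = emb0 (s i n) + pp ^ n * emb0 (A (X n) i)" for i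
        by (simp add: s_def emb0.hom_add emb0.hom_mult emb0.hom_power emb0_pp)
      have "pp ^ n * X n = (\<Sum>i<N. pp ^ n * emb0 (A (X n) i) * \<pi> ^ i) + pp ^ Suc n * X (Suc n)"
        by (subst XS) (simp add: algebra_simps sum_distrib_left)
      then show ?case
        by (subst Suc) (simp add: e algebra_simps sum.distrib)
    qed
    have "\<exists>a\<in>W. \<forall>n. \<exists>b\<in>W. a - s i n = of_nat p ^ n * b" for i
    proof (rule W_complete[OF sW])
      show "\<exists>b\<in>W. s i (Suc n) - s i n = of_nat p ^ n * b" for n
        using AY[OF X, of n] by (intro bexI[of _ "A (X n) i"]) (simp_all add: s_def)
    qed
    then obtain a where a: "\<And>i. a i \<in> W" "\<And>i n. \<exists>b\<in>W. a i - s i n = of_nat p ^ n * b" by metis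
    define D where "D = x - (\<Sum>i<N. emb0 (a i) * \<pi> ^ i)"
    have "D = 0"
    proof (rule ccontr)
      assume D: "D \<noteq> 0"
      \<comment> \<open>Both \<open>x\<close> and the limit combination agree with the partial sum
        modulo \<open>pp ^ n\<close>, so \<open>D\<close> is divisible by every power of
        \<open>pp\<close>.\<close>
      have "v D \<ge> real n" for n
      proof -
        have "\<forall>i. \<exists>b. b \<in> W \<and> a i - s i n = of_nat p ^ n * b" using a(2) by blast
        from choice[OF this] obtain b where b: "\<And>i. b i \<in> W" "\<And>i. a i - s i n = of_nat p ^ n * b i"
          by blast
        have ea: "emb0 (a i) = emb0 (s i n) + pp ^ n * emb0 (b i)" for i
        proof -
          have "a i = s i n + of_nat p ^ n * b i" using b(2)[of i] by (simp add: algebra_simps)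
          then show ?thesis by (simp add: emb0.hom_add emb0.hom_mult emb0.hom_power emb0_pp)
        qed
        let ?z = "X n - (\<Sum>i<N. emb0 (b i) * \<pi> ^ i)"
        have z: "?z \<in> oK"
          by (intro oK_minus X oK_sum oK_mult emb0_W b(1) \<pi>O) simp
        have Dz: "D = pp ^ n * ?z"
          unfolding D_def ea
          by (subst partial[of n]) (simp add: algebra_simps sum.distrib sum_distrib_left)
        then have "?z \<noteq> 0" using D by auto
        then have "v D = real n + v ?z" unfolding Dz by (simp add: v_mult v_power pp)
        then show ?thesis using z \<open>?z \<noteq> 0\<close> by (simp add: oK_def)
      qed
      then show False using reals_Archimedean2[of "v D"] by (meson not_less)
    qed
    then show ?thesis using a(1) by (intro exI[of _ a]) (simp add: D_def)
  qed
  then show ?thesis using \<pi>(1) by blast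
qed

text \<open>The Frobenius preserves W. So after applying \<open>\<sigma>\<close> to a combination of
  powers of \<open>\<pi>\<close> over W, only the values of finitely many powers of
  \<open>\<sigma> \<pi>\<close> matter, whatever the coefficients are.\<close>

lemma v_\<sigma>_bounded: "\<exists>M. \<forall>x\<in>oK. \<sigma> x = 0 \<or> v (\<sigma> x) \<ge> M"
proof -
  obtain \<pi> and N :: nat where \<pi>: "\<pi> \<noteq> 0"
    "\<And>x. x \<in> oK \<Longrightarrow> \<exists>a. (\<forall>i. a i \<in> W) \<and> x = (\<Sum>i<N. emb0 (a i) * \<pi> ^ i)"
    using oK_generated by blast
  obtain F where F: "frobenius_automorphism p W red F" "\<And>x. \<sigma> (emb0 x) = emb0 (F x)"
    using \<sigma>_frobenius by auto
  have FW: "F a \<in> W" if "a \<in> W" for a using F(1) that by (auto simp: frobenius_automorphism_def)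
  \<comment> \<open>The sign of \<open>v (\<sigma> \<pi>)\<close> is not known at this point, hence
    the absolute value.\<close>
  define M where "M = - (real N * \<bar>v (\<sigma> \<pi>)\<bar>)"
  have \<sigma>\<pi>: "\<sigma> \<pi> \<noteq> 0" using \<pi>(1) by simp
  have "\<sigma> x = 0 \<or> v (\<sigma> x) \<ge> M" if x: "x \<in> oK" for x
  proof -
    obtain a where a: "\<forall>i. a i \<in> W" "x = (\<Sum>i<N. emb0 (a i) * \<pi> ^ i)" using \<pi>(2)[OF x] by auto
    have "\<sigma> x = (\<Sum>i<N. emb0 (F (a i)) * \<sigma> \<pi> ^ i)"
      unfolding a(2) by (simp add: \<sigma>.hom_sum \<sigma>.hom_mult \<sigma>.hom_power F(2))
    moreover have "emb0 (F (a i)) * \<sigma> \<pi> ^ i = 0 \<or> v (emb0 (F (a i)) * \<sigma> \<pi> ^ i) \<ge> M" if i: "i < N" for i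
    proof (cases "emb0 (F (a i)) = 0")
      case False
      then have "v (emb0 (F (a i))) \<ge> 0" using emb0_W[OF FW] a(1) by (auto simp: oK_def)
      moreover have "real i * \<bar>v (\<sigma> \<pi>)\<bar> \<le> real N * \<bar>v (\<sigma> \<pi>)\<bar>" using i by (intro mult_right_mono) auto
      moreover have "real i * v (\<sigma> \<pi>) \<ge> - (real i * \<bar>v (\<sigma> \<pi>)\<bar>)"
        using mult_left_mono[of "- \<bar>v (\<sigma> \<pi>)\<bar>" "v (\<sigma> \<pi>)" "real i"] by simp
      ultimately show ?thesis using v_mult[OF False, of "\<sigma> \<pi> ^ i"] \<sigma>\<pi> by (simp add: v_power M_def)
    qed simp
    ultimately show ?thesis using v_bound_sum[of "{..<N}" "\<lambda>i. emb0 (F (a i)) * \<sigma> \<pi> ^ i" M] by simp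
  qed
  then show ?thesis by blast
qed

text \<open>All powers of \<open>x\<close> are integral. If \<open>v (\<sigma> x)\<close> were
  negative, the values of their images would tend to minus infinity and violate the uniform
  bound.\<close>

lemma v_\<sigma>_nonneg:
  assumes x: "x \<noteq> 0" "v x \<ge> 0" shows "v (\<sigma> x) \<ge> 0"
proof (rule ccontr)
  assume neg: "\<not> v (\<sigma> x) \<ge> 0"
  obtain M where M: "\<And>x. x \<in> oK \<Longrightarrow> \<sigma> x = 0 \<or> v (\<sigma> x) \<ge> M" using v_\<sigma>_bounded by blast
  have sx: "\<sigma> x \<noteq> 0" using x(1) by simp
  have ge: "real n * v (\<sigma> x) \<ge> M" for n
    using M[OF oK_power[of x n]] x sx by (simp add: oK_def \<sigma>.hom_power v_power)
  obtain n :: nat where "- M < real n * (- v (\<sigma> x))"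
    using reals_Archimedean3[of "- v (\<sigma> x)", rule_format, of "- M"] neg by auto
  then have "real n * v (\<sigma> x) < M" by simp
  then show False using ge[of n] by simp
qed

text \<open>A unit and its inverse both keep nonnegative values under \<open>\<sigma>\<close>, so a
  unit keeps the value 0. A general element is reduced to a unit by comparing a power of it with a
  power of \<open>pp\<close>, which \<open>\<sigma>\<close> fixes.\<close>

lemma v_\<sigma>: assumes x: "x \<noteq> 0" shows "v (\<sigma> x) = v x"
proof -
  obtain d where d: "d > 0" "\<And>x. x \<noteq> 0 \<Longrightarrow> \<exists>n::int. v x = of_int n * d" using v_discrete by auto
  have nat: "\<exists>n::nat. v x = real n * d" if x: "x \<noteq> 0" "v x \<ge> 0" for x
  proof -
    obtain n :: int where n: "v x = of_int n * d" using d(2)[OF x(1)] by auto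
    then have "n \<ge> 0" using x(2) d(1) by (simp add: zero_le_mult_iff)
    then show ?thesis using n by (intro exI[of _ "nat n"]) simp
  qed
  obtain k :: nat where k: "1 = real k * d" using nat[of pp] pp by auto
  have pos: "v (\<sigma> x) = v x" if x: "x \<noteq> 0" "v x \<ge> 0" for x
  proof -
    obtain n :: nat where n: "v x = real n * d" using nat[OF x] by auto
    \<comment> \<open>As \<open>v pp = k d\<close> and \<open>v x = n d\<close>, the elements
      \<open>x ^ k\<close> and \<open>pp ^ n\<close> have the same value, and \<open>z\<close> is a
      unit.\<close>
    define z where "z = x ^ k / pp ^ n"
    have z: "z \<noteq> 0" using x pp by (simp add: z_def)
    have "v z = real k * v x - real n" using x pp by (simp add: z_def v_divide v_power)
    then have vz: "v z = 0" using k n by (metis diff_self mult.commute mult.left_commute mult.right_neutral)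
    have "v (1 / z) = 0" using z vz by (simp add: v_divide v_one)
    then have "v (\<sigma> (1 / z)) \<ge> 0" using z by (intro v_\<sigma>_nonneg) auto
    moreover have "\<sigma> (1 / z) = 1 / \<sigma> z" by (simp add: \<sigma>_divide)
    moreover have "v (\<sigma> z) \<ge> 0" using z vz by (intro v_\<sigma>_nonneg) auto
    ultimately have "v (\<sigma> z) = 0" using z by (simp add: v_divide v_one)
    moreover have "\<sigma> z = \<sigma> x ^ k / pp ^ n"
      by (simp add: z_def \<sigma>_divide \<sigma>.hom_power \<sigma>_pp)
    ultimately have "real k * v (\<sigma> x) = real n" using x pp by (simp add: v_divide v_power)
    then have "real k * v (\<sigma> x) = real k * v x" using k n by (metis mult.commute mult.left_commute mult.right_neutral)
    moreover have "k \<noteq> 0" using k by (cases k) auto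
    ultimately show ?thesis by simp
  qed
  show ?thesis
  proof (cases "v x \<ge> 0")
    case False
    then have "v (\<sigma> (1 / x)) = v (1 / x)" using x by (intro pos) (simp_all add: v_divide v_one)
    then show ?thesis using x by (simp add: \<sigma>_divide v_divide v_one)
  qed (use pos x in auto)
qed

lemma norm_inv_v: "norm_inv \<sigma> (\<lambda>c. ord (emb c))"
proof -
  have "(\<lambda>c. ord (emb c)) = v" by (simp add: fun_eq_iff v_def)
  then show ?thesis using norm_inv.intro[OF \<sigma>_aut v_mult v_\<sigma>] by simp
qed

end

section \<open>Filtered Phi-modules\<close>

lemma scalar_ext_bij:
  assumes j: "scalar_ext e V W j" and g: "lin W M g" and b: "bij_betw g (carrier W) (carrier M)"
  shows "scalar_ext e V M (\<lambda>v. g (j v))"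
proof -
  have im: "g ` carrier W = carrier M" using b by (simp add: bij_betw_def)
  have jW: "j ` carrier V \<subseteq> carrier W" using semilin_closed[OF scalar_ext_semilin[OF j]] by auto
  have "vspan M ((\<lambda>v. g (j v)) ` carrier V) = carrier M"
    using span_image[OF g jW] scalar_ext_span[OF j] im by (simp add: image_image)
  then show ?thesis
    unfolding scalar_ext_def
    using semilin_lin[OF scalar_ext_semilin[OF j] g] scalar_ext_fd[OF j] scalar_ext_dim[OF j]
      fd_surj[OF g scalar_ext_fd(2)[OF j] im] vdim_bij[OF g scalar_ext_fd(2)[OF j] b] by simp
qed

text \<open>From here on the arithmetic of the base enters only through \<open>norm_inv\<close> and
  the homomorphism \<open>e\<close>; that the fields are infinite appears as a separate hypothesis
  where direct sums need it.\<close>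

locale mf_base = norm_inv \<sigma> "\<lambda>c. ord (e c)"
  for \<sigma> :: "'s::field \<Rightarrow> 's" and e :: "'s \<Rightarrow> 'K::field" and ord :: "'K \<Rightarrow> real" +
  assumes e: "field_hom e"
begin

abbreviation obj :: "('s, 'v, 'K, 'w) filt_phi \<Rightarrow> bool" where
  "obj X \<equiv> filtered_phi_module \<sigma> e X"

text \<open>\<open>jm\<close> is the map \<open>v \<mapsto> 1 \<otimes> v\<close> seen inside \<open>V\<^sub>K\<close>; it carries the same information as \<open>iota\<close>.\<close>

definition jm :: "('s, 'v, 'K, 'w) filt_phi \<Rightarrow> 'v \<Rightarrow> 'w" where
  "jm X v = inv_into (carrier (SpK X)) (iota X) (ten e (Sp X) v)"

lemma obj_phi: "obj X \<Longrightarrow> phi_module \<sigma> (Sp X) (Phi X)"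
  and obj_fil: "obj X \<Longrightarrow> filtered_module (SpK X) (Fil X)"
  and obj_iota: "obj X \<Longrightarrow> lin (SpK X) (base_change e (Sp X)) (iota X)"
    "obj X \<Longrightarrow> bij_betw (iota X) (carrier (SpK X)) (carrier (base_change e (Sp X)))"
  by (auto simp: filtered_phi_module_def)

lemma obj_vsp: "obj X \<Longrightarrow> vsp (Sp X)" "obj X \<Longrightarrow> vsp (SpK X)"
  and obj_fd: "obj X \<Longrightarrow> fd (Sp X)" "obj X \<Longrightarrow> fd (SpK X)"
  using obj_phi fm_vsp[OF obj_fil] fm_fd[OF obj_fil] by (auto simp: phi_module_def)

lemma obj_phi_props:
  assumes "obj X"
  shows "x \<in> carrier (Sp X) \<Longrightarrow> Phi X x \<in> carrier (Sp X)" "Phi X ` carrier (Sp X) = carrier (Sp X)"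
    "inj_on (Phi X) (carrier (Sp X))"
    "x \<in> carrier (Sp X) \<Longrightarrow> y \<in> carrier (Sp X) \<Longrightarrow> Phi X (x \<oplus>\<^bsub>Sp X\<^esub> y) = Phi X x \<oplus>\<^bsub>Sp X\<^esub> Phi X y"
    "x \<in> carrier (Sp X) \<Longrightarrow> Phi X (c \<odot>\<^bsub>Sp X\<^esub> x) = \<sigma> c \<odot>\<^bsub>Sp X\<^esub> Phi X x"
  using obj_phi[OF assms] by (auto simp: phi_module_def bij_betw_def)

lemma jm_scalar_ext:
  assumes X: "obj X" shows "scalar_ext e (Sp X) (SpK X) (jm X)"
  unfolding jm_def
  by (rule scalar_ext_bij[OF scalar_ext_ten[OF obj_vsp(1)[OF X] obj_fd(1)[OF X] e]
    lin_inv_into[OF obj_iota[OF X]] bij_betw_inv_into[OF obj_iota(2)[OF X]]])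

lemmas jm_semilin = scalar_ext_semilin[OF jm_scalar_ext]

lemma jm_closed: "obj X \<Longrightarrow> v \<in> carrier (Sp X) \<Longrightarrow> jm X v \<in> carrier (SpK X)"
  by (rule semilin_closed[OF jm_semilin])

lemma iota_jm:
  assumes X: "obj X" and v: "v \<in> carrier (Sp X)" shows "iota X (jm X v) = ten e (Sp X) v"
proof -
  have "ten e (Sp X) v \<in> carrier (base_change e (Sp X))"
    by (rule semilin_closed[OF semilin_ten[OF obj_vsp(1)[OF X]] v])
  then show ?thesis using obj_iota(2)[OF X] by (simp add: jm_def f_inv_into_f bij_betw_def)
qed

text \<open>Morphisms without the extensionality of \<open>MF_hom\<close>, and between objects whose
  carrier types may differ, as cokernels and direct sums require. The comparison condition is stated
  on the image of \<open>jm\<close> instead of through \<open>base_change_map\<close>.\<close>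

definition mor :: "('s, 'v, 'K, 'w) filt_phi \<Rightarrow> ('s, 'v2, 'K, 'w2) filt_phi \<Rightarrow> ('v \<Rightarrow> 'v2) \<Rightarrow> ('w \<Rightarrow> 'w2) \<Rightarrow> bool" where
  "mor X Y T TK \<longleftrightarrow> lin (Sp X) (Sp Y) T \<and> (\<forall>v\<in>carrier (Sp X). T (Phi X v) = Phi Y (T v)) \<and>
    lin (SpK X) (SpK Y) TK \<and> (\<forall>i. TK ` Fil X i \<subseteq> Fil Y i) \<and>
    (\<forall>v\<in>carrier (Sp X). TK (jm X v) = jm Y (T v))"

lemma morI:
  assumes "lin (Sp X) (Sp Y) T" "\<And>v. v \<in> carrier (Sp X) \<Longrightarrow> T (Phi X v) = Phi Y (T v)"
    "lin (SpK X) (SpK Y) TK" "\<And>i. TK ` Fil X i \<subseteq> Fil Y i"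
    "\<And>v. v \<in> carrier (Sp X) \<Longrightarrow> TK (jm X v) = jm Y (T v)"
  shows "mor X Y T TK"
  using assms by (auto simp: mor_def)

lemma mor_lin: "mor X Y T TK \<Longrightarrow> lin (Sp X) (Sp Y) T" and mor_linK: "mor X Y T TK \<Longrightarrow> lin (SpK X) (SpK Y) TK"
  and mor_phi: "mor X Y T TK \<Longrightarrow> v \<in> carrier (Sp X) \<Longrightarrow> T (Phi X v) = Phi Y (T v)"
  and mor_fil: "mor X Y T TK \<Longrightarrow> TK ` Fil X i \<subseteq> Fil Y i"
  and mor_jm: "mor X Y T TK \<Longrightarrow> v \<in> carrier (Sp X) \<Longrightarrow> TK (jm X v) = jm Y (T v)"
  by (auto simp: mor_def)

text \<open>Both \<open>TK\<close> and the map \<open>R\<close> prescribed by the comparison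
  isomorphisms are linear, and the image of \<open>jm\<close> spans the source, so it is enough to
  compare them there.\<close>

lemma MF_hom_iff:
  assumes X: "obj X" and Y: "obj Y"
  shows "(T, TK) \<in> MF_hom e X Y \<longleftrightarrow>
    T \<in> extensional (carrier (Sp X)) \<and> TK \<in> extensional (carrier (SpK X)) \<and> mor X Y T TK"
proof -
  define R where "R w = inv_into (carrier (SpK Y)) (iota Y) (base_change_map e (Sp X) (Sp Y) T (iota X w))" for w
  have "(\<forall>w\<in>carrier (SpK X). TK w = R w) \<longleftrightarrow> (\<forall>v\<in>carrier (Sp X). TK (jm X v) = jm Y (T v))"
    if T: "lin (Sp X) (Sp Y) T" and TK: "lin (SpK X) (SpK Y) TK"
  proof -
    note b = base_change_map_props[OF T e obj_fd(1)[OF X]]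
    have R: "lin (SpK X) (SpK Y) R"
      unfolding R_def
      by (rule lin_comp[OF lin_comp[OF obj_iota(1)[OF X] b(1)] lin_inv_into[OF obj_iota[OF Y]]])
    have Rj: "R (jm X v) = jm Y (T v)" if "v \<in> carrier (Sp X)" for v
      using that by (simp add: R_def iota_jm[OF X] b(2) jm_def[of Y])
    show ?thesis
    proof
      assume "\<forall>w\<in>carrier (SpK X). TK w = R w"
      then show "\<forall>v\<in>carrier (Sp X). TK (jm X v) = jm Y (T v)" using Rj jm_closed[OF X] by simp
    next
      assume a: "\<forall>v\<in>carrier (Sp X). TK (jm X v) = jm Y (T v)"
      show "\<forall>w\<in>carrier (SpK X). TK w = R w"
        using scalar_ext_lin_eq[OF jm_scalar_ext[OF X] TK R] a Rj by simp
    qed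
  qed
  then show ?thesis unfolding MF_hom_def mor_def R_def by auto
qed

lemma mor_comp: "mor X Y T TK \<Longrightarrow> mor Y Z S SK \<Longrightarrow> mor X Z (\<lambda>v. S (T v)) (\<lambda>w. SK (TK w))"
proof (rule morI)
  assume T: "mor X Y T TK" and S: "mor Y Z S SK"
  show "lin (Sp X) (Sp Z) (\<lambda>v. S (T v))" by (rule lin_comp[OF mor_lin[OF T] mor_lin[OF S]])
  show "lin (SpK X) (SpK Z) (\<lambda>v. SK (TK v))" by (rule lin_comp[OF mor_linK[OF T] mor_linK[OF S]])
  show "S (T (Phi X v)) = Phi Z (S (T v))" "SK (TK (jm X v)) = jm Z (S (T v))" if "v \<in> carrier (Sp X)" for v
    using that lin_closed[OF mor_lin[OF T]] by (simp_all add: mor_phi[OF T] mor_phi[OF S] mor_jm[OF T] mor_jm[OF S])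
  show "(\<lambda>w. SK (TK w)) ` Fil X i \<subseteq> Fil Z i" for i using mor_fil[OF T] mor_fil[OF S] by fastforce
qed

lemma mor_id: "obj X \<Longrightarrow> mor X X (\<lambda>v. v) (\<lambda>w. w)"
  by (rule morI) (auto simp: lin_id obj_vsp)

lemma mor_cong:
  assumes m: "mor X Y T TK" and X: "obj X" and T: "\<And>v. v \<in> carrier (Sp X) \<Longrightarrow> T v = T' v"
    and TK: "\<And>w. w \<in> carrier (SpK X) \<Longrightarrow> TK w = TK' w"
  shows "mor X Y T' TK'"
proof (rule morI)
  show "lin (Sp X) (Sp Y) T'" by (rule lin_cong[OF mor_lin[OF m] T])
  show "lin (SpK X) (SpK Y) TK'" by (rule lin_cong[OF mor_linK[OF m] TK])
  show "T' (Phi X v) = Phi Y (T' v)" "TK' (jm X v) = jm Y (T' v)" if "v \<in> carrier (Sp X)" for v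
    using that mor_phi[OF m that] mor_jm[OF m that] T TK obj_phi_props(1)[OF X that] jm_closed[OF X that] by auto
  show "TK' ` Fil X i \<subseteq> Fil Y i" for i
    using mor_fil[OF m, of i] TK sub_subset[OF fm_sub[OF obj_fil[OF X], of i]] by (auto simp: image_subset_iff subset_iff)
qed

text \<open>The choice of \<open>iota\<close> is only meaningful if \<open>W\<close> is the scalar extension of \<open>V\<close> along \<open>j\<close>; in that
  case \<open>jm\<close> of the result is \<open>j\<close>.\<close>

definition mk :: "('s, 'v) module \<Rightarrow> ('v \<Rightarrow> 'v) \<Rightarrow> ('K, 'w) module \<Rightarrow> (real \<Rightarrow> 'w set) \<Rightarrow> ('v \<Rightarrow> 'w) \<Rightarrow> ('s, 'v, 'K, 'w) filt_phi" where
  "mk V \<phi> W F j = \<lparr>Sp = V, Phi = \<phi>, SpK = W, Fil = F,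
    iota = (SOME g. lin W (base_change e V) g \<and> bij_betw g (carrier W) (carrier (base_change e V)) \<and>
      (\<forall>v\<in>carrier V. g (j v) = ten e V v))\<rparr>"

lemma mk_simps [simp]: "Sp (mk V \<phi> W F j) = V" "Phi (mk V \<phi> W F j) = \<phi>" "SpK (mk V \<phi> W F j) = W" "Fil (mk V \<phi> W F j) = F"
  by (simp_all add: mk_def)

lemma jm_eqI:
  assumes X: "obj X" and "w \<in> carrier (SpK X)" "iota X w = ten e (Sp X) v"
  shows "jm X v = w"
  using assms(2,3) obj_iota(2)[OF X] unfolding jm_def by (metis bij_betw_def inv_into_f_f)

lemma mk_obj:
  assumes P: "phi_module \<sigma> V \<phi>" and F: "filtered_module W F" and j: "scalar_ext e V W j"
  shows "obj (mk V \<phi> W F j)" "v \<in> carrier V \<Longrightarrow> jm (mk V \<phi> W F j) v = j v"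
proof -
  have V: "vsp V" "fd V" using P by (auto simp: phi_module_def)
  let ?X = "mk V \<phi> W F j"
  have "lin W (base_change e V) (iota ?X) \<and> bij_betw (iota ?X) (carrier W) (carrier (base_change e V)) \<and>
      (\<forall>v\<in>carrier V. iota ?X (j v) = ten e V v)"
    using someI_ex[OF scalar_ext_iso[OF j scalar_ext_ten[OF V e]]] by (simp add: mk_def)
  then have i: "lin W (base_change e V) (iota ?X)" "bij_betw (iota ?X) (carrier W) (carrier (base_change e V))"
      "\<And>v. v \<in> carrier V \<Longrightarrow> iota ?X (j v) = ten e V v" by auto
  show o: "obj ?X" unfolding filtered_phi_module_def using P F i by simp
  show "v \<in> carrier V \<Longrightarrow> jm ?X v = j v"
    by (rule jm_eqI[OF o]) (use i(3) semilin_closed[OF scalar_ext_semilin[OF j]] in auto)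
qed

section \<open>Stable subspaces and the number \<delta>\<close>

definition stab :: "('s, 'v, 'K, 'w) filt_phi \<Rightarrow> 'v set \<Rightarrow> bool" where
  "stab X U \<longleftrightarrow> sub U (Sp X) \<and> Phi X ` U = U"

text \<open>\<open>uk X U\<close> is \<open>K \<otimes> U\<close> as a subspace of \<open>V\<^sub>K\<close>, and \<open>dl X U\<close> is the number \<open>\<delta>(U)\<close>.\<close>

definition uk :: "('s, 'v, 'K, 'w) filt_phi \<Rightarrow> 'v set \<Rightarrow> 'w set" where
  "uk X U = vspan (SpK X) (jm X ` U)"

definition dl :: "('s, 'v, 'K, 'w) filt_phi \<Rightarrow> 'v set \<Rightarrow> real" where
  "dl X U = t_N (\<lambda>c. ord (e c)) (on (Sp X) U) (Phi X) - t_H (on (SpK X) (uk X U)) (\<lambda>i. Fil X i \<inter> uk X U)"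

lemma stab_sub: "stab X U \<Longrightarrow> sub U (Sp X)" and stab_phi: "stab X U \<Longrightarrow> Phi X ` U = U"
  by (auto simp: stab_def)

lemma jm_image: "obj X \<Longrightarrow> sub U (Sp X) \<Longrightarrow> jm X ` U \<subseteq> carrier (SpK X)"
  using jm_closed sub_closed by fastforce

lemma sub_uk: "obj X \<Longrightarrow> sub U (Sp X) \<Longrightarrow> sub (uk X U) (SpK X)"
  unfolding uk_def by (rule sub_span[OF obj_vsp(2) jm_image])

lemma jm_uk: "obj X \<Longrightarrow> sub U (Sp X) \<Longrightarrow> v \<in> U \<Longrightarrow> jm X v \<in> uk X U"
  unfolding uk_def using span_superset[OF obj_vsp(2) jm_image] by blast

lemma uk_mono: "obj X \<Longrightarrow> sub U (Sp X) \<Longrightarrow> sub U' (Sp X) \<Longrightarrow> U \<subseteq> U' \<Longrightarrow> uk X U \<subseteq> uk X U'"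
  unfolding uk_def by (rule span_mono[OF obj_vsp(2) _ jm_image]) auto

lemma uk_carrier: "obj X \<Longrightarrow> uk X (carrier (Sp X)) = carrier (SpK X)"
  unfolding uk_def by (rule scalar_ext_span[OF jm_scalar_ext])

lemma uk_trivial:
  assumes X: "obj X" shows "uk X {\<zero>\<^bsub>Sp X\<^esub>} = {\<zero>\<^bsub>SpK X\<^esub>}"
  using span_sub[OF sub_trivial[OF obj_vsp(2)[OF X]]] semilin_zero[OF jm_semilin[OF X]] by (simp add: uk_def)

lemma phi_module_on: assumes X: "obj X" and U: "stab X U" shows "phi_module \<sigma> (on (Sp X) U) (Phi X)"
  unfolding phi_module_def
  using vsp_on[OF stab_sub[OF U]] fd_on(1)[OF obj_fd(1)[OF X] stab_sub[OF U]] stab_phi[OF U]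
    inj_on_subset[OF obj_phi_props(3)[OF X] sub_subset[OF stab_sub[OF U]]] obj_phi_props(4,5)[OF X]
    sub_closed[OF stab_sub[OF U]] by (auto simp: bij_betw_def)

definition restr :: "('s, 'v, 'K, 'w) filt_phi \<Rightarrow> 'v set \<Rightarrow> ('s, 'v, 'K, 'w) filt_phi" where
  "restr X U = mk (on (Sp X) U) (Phi X) (on (SpK X) (uk X U)) (\<lambda>i. Fil X i \<inter> uk X U) (jm X)"

lemma restr_obj:
  assumes X: "obj X" and U: "stab X U"
  shows "obj (restr X U)" "v \<in> U \<Longrightarrow> jm (restr X U) v = jm X v"
proof -
  note s = stab_sub[OF U]
  note m = mk_obj[OF phi_module_on[OF X U] filtered_module_on[OF obj_fil[OF X] sub_uk[OF X s]]
      scalar_ext_on[OF jm_scalar_ext[OF X] s, folded uk_def]]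
  show "obj (restr X U)" "v \<in> U \<Longrightarrow> jm (restr X U) v = jm X v"
    unfolding restr_def using m by auto
qed

lemma restr_mor: "obj X \<Longrightarrow> stab X U \<Longrightarrow> mor (restr X U) X (\<lambda>v. v) (\<lambda>w. w)"
  by (rule morI) (auto simp: restr_def[of X U] restr_obj(2)[unfolded restr_def]
    intro!: lin_restrict_dom[OF lin_id] obj_vsp stab_sub sub_uk)

text \<open>By injectivity of \<open>Phi Y\<close>, the vector \<open>Phi X x\<close> lies in the
  kernel only if \<open>x\<close> does. This makes \<open>Phi X\<close> map the intersection onto
  itself and not merely into itself.\<close>

lemma stab_kern:
  assumes X: "obj X" and Y: "obj Y" and T: "mor X Y T TK" and U: "stab X U"
  shows "stab X (U \<inter> kern (Sp X) (Sp Y) T)" "stab Y (T ` U)"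
proof -
  note l = mor_lin[OF T]
  show "stab Y (T ` U)" unfolding stab_def
  proof
    show "sub (T ` U) (Sp Y)" by (rule sub_image[OF l stab_sub[OF U]])
    have "Phi Y ` T ` U = T ` Phi X ` U"
      unfolding image_image by (rule image_cong) (use mor_phi[OF T] sub_closed[OF stab_sub[OF U]] in auto)
    then show "Phi Y ` T ` U = T ` U" by (simp add: stab_phi[OF U])
  qed
  have zero: "Phi Y y = \<zero>\<^bsub>Sp Y\<^esub> \<longleftrightarrow> y = \<zero>\<^bsub>Sp Y\<^esub>" if y: "y \<in> carrier (Sp Y)" for y
  proof -
    have "Phi Y \<zero>\<^bsub>Sp Y\<^esub> = \<zero>\<^bsub>Sp Y\<^esub>"
      using obj_phi_props(5)[OF Y, of "\<zero>\<^bsub>Sp Y\<^esub>" 0] obj_phi_props(1)[OF Y, of "\<zero>\<^bsub>Sp Y\<^esub>"]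
      by (simp add: vsp_simps[OF obj_vsp(1)[OF Y]] \<sigma>_zero_iff[THEN iffD2])
    then show ?thesis using inj_onD[OF obj_phi_props(3)[OF Y] _ y vzero_closed[OF obj_vsp(1)[OF Y]]] by metis
  qed
  have k: "Phi X x \<in> kern (Sp X) (Sp Y) T \<longleftrightarrow> x \<in> kern (Sp X) (Sp Y) T" if x: "x \<in> carrier (Sp X)" for x
    using obj_phi_props(1)[OF X x] x mor_phi[OF T x] zero[OF lin_closed[OF l x]] by (simp add: kern_def)
  show "stab X (U \<inter> kern (Sp X) (Sp Y) T)" unfolding stab_def
  proof
    show "sub (U \<inter> kern (Sp X) (Sp Y) T) (Sp X)" by (rule sub_inter[OF stab_sub[OF U] sub_kern[OF l]])
    show "Phi X ` (U \<inter> kern (Sp X) (Sp Y) T) = U \<inter> kern (Sp X) (Sp Y) T"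
    proof
      show "Phi X ` (U \<inter> kern (Sp X) (Sp Y) T) \<subseteq> U \<inter> kern (Sp X) (Sp Y) T"
        using k sub_closed[OF stab_sub[OF U]] stab_phi[OF U] by blast
      show "U \<inter> kern (Sp X) (Sp Y) T \<subseteq> Phi X ` (U \<inter> kern (Sp X) (Sp Y) T)"
      proof
        fix x assume x: "x \<in> U \<inter> kern (Sp X) (Sp Y) T"
        then obtain y where "y \<in> U" "x = Phi X y" using stab_phi[OF U] by blast
        then show "x \<in> Phi X ` (U \<inter> kern (Sp X) (Sp Y) T)"
          using x k[of y] sub_closed[OF stab_sub[OF U]] by blast
      qed
    qed
  qed
qed

lemma stab_carrier: "obj X \<Longrightarrow> stab X (carrier (Sp X))"
  using obj_phi_props(2) sub_carrier[OF obj_vsp(1)] by (auto simp: stab_def)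

lemma stab_vimage:
  assumes X: "obj X" and Y: "obj Y" and T: "mor X Y T TK" and P: "stab Y P"
  shows "stab X {v \<in> carrier (Sp X). T v \<in> P}"
proof -
  note l = mor_lin[OF T]
  have k: "Phi Y y \<in> P \<longleftrightarrow> y \<in> P" if "y \<in> carrier (Sp Y)" for y
    using inj_on_image_mem_iff[OF obj_phi_props(3)[OF Y] that sub_subset[OF stab_sub[OF P]]] stab_phi[OF P] by simp
  have k': "T (Phi X x) \<in> P \<longleftrightarrow> T x \<in> P" if "x \<in> carrier (Sp X)" for x
    using mor_phi[OF T that] k[OF lin_closed[OF l that]] by simp
  show ?thesis unfolding stab_def
  proof
    show "sub {v \<in> carrier (Sp X). T v \<in> P} (Sp X)" by (rule sub_vimage[OF l stab_sub[OF P]])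
    show "Phi X ` {v \<in> carrier (Sp X). T v \<in> P} = {v \<in> carrier (Sp X). T v \<in> P}"
    proof
      show "Phi X ` {v \<in> carrier (Sp X). T v \<in> P} \<subseteq> {v \<in> carrier (Sp X). T v \<in> P}"
        using k' obj_phi_props(1)[OF X] by auto
      show "{v \<in> carrier (Sp X). T v \<in> P} \<subseteq> Phi X ` {v \<in> carrier (Sp X). T v \<in> P}"
      proof
        fix x assume x: "x \<in> {v \<in> carrier (Sp X). T v \<in> P}"
        then obtain y where "y \<in> carrier (Sp X)" "x = Phi X y" using obj_phi_props(2)[OF X] by blast
        then show "x \<in> Phi X ` {v \<in> carrier (Sp X). T v \<in> P}" using x k' by blast
      qed
    qed
  qed
qed

lemma mor_uk:
  assumes X: "obj X" and Y: "obj Y" and T: "mor X Y T TK" and U: "sub U (Sp X)"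
  shows "TK ` uk X U = uk Y (T ` U)"
    "uk X U \<inter> kern (SpK X) (SpK Y) TK = uk X (U \<inter> kern (Sp X) (Sp Y) T)"
  unfolding uk_def
  using scalar_ext_image_kern[OF jm_scalar_ext[OF X] jm_scalar_ext[OF Y] mor_lin[OF T] mor_linK[OF T] mor_jm[OF T] U]
  by auto

lemma mor_kernK:
  assumes X: "obj X" and Y: "obj Y" and T: "mor X Y T TK"
  shows "kern (SpK X) (SpK Y) TK = uk X (kern (Sp X) (Sp Y) T)"
    "TK ` carrier (SpK X) = uk Y (T ` carrier (Sp X))"
proof -
  have "carrier (SpK X) \<inter> kern (SpK X) (SpK Y) TK = kern (SpK X) (SpK Y) TK"
    "carrier (Sp X) \<inter> kern (Sp X) (Sp Y) T = kern (Sp X) (Sp Y) T" by (auto simp: kern_def)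
  then show "kern (SpK X) (SpK Y) TK = uk X (kern (Sp X) (Sp Y) T)"
    "TK ` carrier (SpK X) = uk Y (T ` carrier (Sp X))"
    using mor_uk[OF X Y T sub_carrier[OF obj_vsp(1)[OF X]]] uk_carrier[OF X] by auto
qed

text \<open>The key estimate: passing to a kernel and an image can only decrease \<open>t\<^sub>N - t\<^sub>H\<close>, and the defect
  measures the failure of strictness.\<close>

lemma dl_ker_im:
  assumes X: "obj X" and Y: "obj Y" and T: "mor X Y T TK" and U: "stab X U"
  shows "dl X (U \<inter> kern (Sp X) (Sp Y) T) + dl Y (T ` U) \<le> dl X U"
    "dl X (U \<inter> kern (Sp X) (Sp Y) T) + dl Y (T ` U) = dl X U \<longleftrightarrow>
      (\<forall>i. TK ` (Fil X i \<inter> uk X U) = Fil Y i \<inter> uk Y (T ` U))"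
proof -
  let ?U0 = "U \<inter> kern (Sp X) (Sp Y) T" and ?U1 = "T ` U"
  note st = stab_kern[OF X Y T U]
  note s = stab_sub[OF U] stab_sub[OF st(1)] stab_sub[OF st(2)]
  note l = mor_lin[OF T] and lK = mor_linK[OF T]
  \<comment> \<open>The Newton number is exactly additive along 0 \<rightarrow> U \<inter> ker T
    \<rightarrow> U \<rightarrow> T U \<rightarrow> 0, so any defect comes from the filtrations
    alone.\<close>
  have tN: "t_N (\<lambda>c. ord (e c)) (on (Sp X) U) (Phi X) =
      t_N (\<lambda>c. ord (e c)) (on (Sp X) ?U0) (Phi X) + t_N (\<lambda>c. ord (e c)) (on (Sp Y) ?U1) (Phi Y)"
  proof (rule t_N_exact[OF phi_module_on[OF X st(1)] phi_module_on[OF X U] phi_module_on[OF Y st(2)], of "\<lambda>x. x" T])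
    show "lin (on (Sp X) ?U0) (on (Sp X) U) (\<lambda>x. x)"
      by (rule lin_restrict[OF lin_id[OF obj_vsp(1)[OF X]] s(2) s(1)]) auto
    show "(\<lambda>x. x) ` carrier (on (Sp X) ?U0) = kern (on (Sp X) U) (on (Sp Y) ?U1) T"
      using sub_closed[OF s(1)] by (auto simp: kern_def)
    show "lin (on (Sp X) U) (on (Sp Y) ?U1) T" by (rule lin_restrict[OF l s(1) s(3)]) auto
  qed (use mor_phi[OF T] sub_closed[OF s(1)] in auto)
  note k = sub_uk[OF X s(1)] sub_uk[OF X s(2)] sub_uk[OF Y s(3)]
  note fX = obj_fil[OF X] and fY = obj_fil[OF Y]
  note fdX = obj_fd(2)[OF X] and fdY = obj_fd(2)[OF Y]
  \<comment> \<open>Rank and nullity in each filtration step. The last term belongs to the image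
    filtration on K \<otimes> T U, which may be smaller than the filtration induced from
    \<open>Y\<close>.\<close>
  have r: "vdim (on (SpK X) (Fil X i \<inter> uk X U)) =
      vdim (on (SpK X) (Fil X i \<inter> uk X ?U0)) + vdim (on (SpK Y) (TK ` (Fil X i \<inter> uk X U)))" for i
    using rank_nullity_on[OF lK fdX sub_inter[OF fm_sub[OF fX] k(1)], of i]
    by (simp add: Int_assoc mor_uk(2)[OF X Y T s(1)])
  have r': "vdim (on (SpK X) (uk X U)) = vdim (on (SpK X) (uk X ?U0)) + vdim (on (SpK Y) (uk Y ?U1))"
    using rank_nullity_on[OF lK fdX k(1)] by (simp add: mor_uk[OF X Y T s(1)])
  have sub: "TK ` (Fil X i \<inter> uk X U) \<subseteq> Fil Y i \<inter> uk Y ?U1" for i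
    using mor_fil[OF T, of i] mor_uk(1)[OF X Y T s(1)] by blast
  note subs = sub_image[OF lK sub_inter[OF fm_sub[OF fX] k(1)]] sub_inter[OF fm_sub[OF fY] k(3)]
  have le: "vdim (on (SpK Y) (TK ` (Fil X i \<inter> uk X U))) \<le> vdim (on (SpK Y) (Fil Y i \<inter> uk Y ?U1))"
    and eq: "vdim (on (SpK Y) (TK ` (Fil X i \<inter> uk X U))) = vdim (on (SpK Y) (Fil Y i \<inter> uk Y ?U1)) \<longleftrightarrow>
      TK ` (Fil X i \<inter> uk X U) = Fil Y i \<inter> uk Y ?U1" for i
    using vdim_mono[OF fdY subs sub, of i] by auto
  have *: "t_H (on (SpK X) (uk X U)) (\<lambda>i. Fil X i \<inter> uk X U) \<le>
      t_H (on (SpK X) (uk X ?U0)) (\<lambda>i. Fil X i \<inter> uk X ?U0) + t_H (on (SpK Y) (uk Y ?U1)) (\<lambda>i. Fil Y i \<inter> uk Y ?U1)"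
    "t_H (on (SpK X) (uk X U)) (\<lambda>i. Fil X i \<inter> uk X U) =
      t_H (on (SpK X) (uk X ?U0)) (\<lambda>i. Fil X i \<inter> uk X ?U0) + t_H (on (SpK Y) (uk Y ?U1)) (\<lambda>i. Fil Y i \<inter> uk Y ?U1)
     \<longleftrightarrow> (\<forall>i. TK ` (Fil X i \<inter> uk X U) = Fil Y i \<inter> uk Y ?U1)"
    using t_H_subadditive[OF filtered_module_on[OF fX k(1)] filtered_module_on[OF fX k(2)]
        filtered_module_on[OF fY k(3)]] r' r le eq by auto
  show "dl X ?U0 + dl Y ?U1 \<le> dl X U" using * tN by (simp add: dl_def)
  show "dl X ?U0 + dl Y ?U1 = dl X U \<longleftrightarrow> (\<forall>i. TK ` (Fil X i \<inter> uk X U) = Fil Y i \<inter> uk Y ?U1)"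
    unfolding *(2)[symmetric] dl_def tN by linarith
qed

text \<open>The identity is strict with kernel 0, so for it the equality case reads \<delta>(0) +
  \<delta>(V) = \<delta>(V).\<close>

lemma dl_trivial:
  assumes X: "obj X" shows "dl X {\<zero>\<^bsub>Sp X\<^esub>} = 0"
proof -
  have "carrier (Sp X) \<inter> kern (Sp X) (Sp X) (\<lambda>v. v) = {\<zero>\<^bsub>Sp X\<^esub>}"
    using vzero_closed[OF obj_vsp(1)[OF X]] by (auto simp: kern_def)
  then show ?thesis using dl_ker_im(2)[OF X X mor_id[OF X] stab_carrier[OF X]] by simp
qed

text \<open>An injective morphism identifies \<open>U\<close> with its image as Phi-modules, but the
  filtration induced from the target may be larger, which raises \<open>t\<^sub>H\<close> and lowers
  \<delta>.\<close>

lemma dl_inj: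
  assumes X: "obj X" and Y: "obj Y" and T: "mor X Y T TK" and U: "stab X U"
    and inj: "inj_on T (carrier (Sp X))"
  shows "dl Y (T ` U) \<le> dl X U"
    "dl Y (T ` U) = dl X U \<longleftrightarrow> (\<forall>i. TK ` (Fil X i \<inter> uk X U) = Fil Y i \<inter> uk Y (T ` U))"
proof -
  have "U \<inter> kern (Sp X) (Sp Y) T = {\<zero>\<^bsub>Sp X\<^esub>}"
    using lin_inj_iff[OF mor_lin[OF T]] inj sub_zero[OF stab_sub[OF U]] by auto
  then show "dl Y (T ` U) \<le> dl X U"
    "dl Y (T ` U) = dl X U \<longleftrightarrow> (\<forall>i. TK ` (Fil X i \<inter> uk X U) = Fil Y i \<inter> uk Y (T ` U))"
    using dl_ker_im[OF X Y T U] dl_trivial[OF X] by auto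
qed

lemma mor_injK:
  assumes X: "obj X" and Y: "obj Y" and T: "mor X Y T TK" and inj: "inj_on T (carrier (Sp X))"
  shows "inj_on TK (carrier (SpK X))"
  using mor_kernK(1)[OF X Y T] lin_inj_iff[OF mor_lin[OF T]] inj lin_inj_iff[OF mor_linK[OF T]] uk_trivial[OF X]
  by simp

lemma mor_surjK:
  assumes X: "obj X" and Y: "obj Y" and T: "mor X Y T TK" and surj: "T ` carrier (Sp X) = carrier (Sp Y)"
  shows "TK ` carrier (SpK X) = carrier (SpK Y)"
  using mor_kernK(2)[OF X Y T] surj uk_carrier[OF Y] by simp

lemma dl_carrier:
  assumes X: "obj X"
  shows "dl X (carrier (Sp X)) = t_N (\<lambda>c. ord (e c)) (Sp X) (Phi X) - t_H (SpK X) (Fil X)"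
proof -
  have "(\<lambda>i. Fil X i \<inter> carrier (SpK X)) = Fil X" using sub_subset[OF fm_sub[OF obj_fil[OF X]]] by blast
  then show ?thesis by (simp add: dl_def uk_carrier[OF X])
qed

end

text \<open>This serves quotients and, with an injective \<open>q\<close>, copies of a Phi-module on
  another carrier. That \<open>\<phi>\<close> maps the kernel onto itself is what makes the induced
  map \<open>\<psi>\<close> injective.\<close>

lemma phi_module_quot:
  assumes P: "phi_module \<sigma> V \<phi>" and q: "lin V Q q" "q ` carrier V = carrier Q"
    and \<psi>: "\<And>x. x \<in> carrier V \<Longrightarrow> \<psi> (q x) = q (\<phi> x)" and k: "\<phi> ` kern V Q q = kern V Q q"
  shows "phi_module \<sigma> Q \<psi>"
proof -
  have V: "vsp V" "fd V" and bij: "bij_betw \<phi> (carrier V) (carrier V)"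
    and add: "\<And>x y. x \<in> carrier V \<Longrightarrow> y \<in> carrier V \<Longrightarrow> \<phi> (x \<oplus>\<^bsub>V\<^esub> y) = \<phi> x \<oplus>\<^bsub>V\<^esub> \<phi> y"
    and smult: "\<And>c x. x \<in> carrier V \<Longrightarrow> \<phi> (c \<odot>\<^bsub>V\<^esub> x) = \<sigma> c \<odot>\<^bsub>V\<^esub> \<phi> x"
    using P by (auto simp: phi_module_def)
  have im: "\<phi> ` carrier V = carrier V" and inj: "inj_on \<phi> (carrier V)" using bij by (auto simp: bij_betw_def)
  have cl: "\<phi> x \<in> carrier V" if "x \<in> carrier V" for x using im that by blast
  note Q = lin_cod[OF q(1)]
  have rep: "\<exists>x\<in>carrier V. A = q x" if "A \<in> carrier Q" for A using that q(2) by blast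
  have "\<psi> ` carrier Q = carrier Q"
  proof -
    have "\<psi> ` q ` carrier V = q ` \<phi> ` carrier V" unfolding image_image by (rule image_cong) (simp_all add: \<psi>)
    then show ?thesis using q(2) im by simp
  qed
  moreover have "inj_on \<psi> (carrier Q)"
  proof (rule inj_onI)
    fix A B assume A: "A \<in> carrier Q" and B: "B \<in> carrier Q" and eq: "\<psi> A = \<psi> B"
    obtain x y where xy: "x \<in> carrier V" "A = q x" "y \<in> carrier V" "B = q y" using rep[OF A] rep[OF B] by blast
    have d: "x \<ominus>\<^bsub>V\<^esub> y \<in> carrier V" by (rule vminus_closed[OF V(1) xy(1,3)])
    have "\<phi> x = \<phi> y \<oplus>\<^bsub>V\<^esub> \<phi> (x \<ominus>\<^bsub>V\<^esub> y)"
      using add[OF xy(3) d] vminus_add_cancel[OF V(1) xy(1,3)] by simp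
    then have "q (\<phi> y) \<oplus>\<^bsub>Q\<^esub> q (\<phi> (x \<ominus>\<^bsub>V\<^esub> y)) = q (\<phi> y) \<oplus>\<^bsub>Q\<^esub> \<zero>\<^bsub>Q\<^esub>"
      using eq xy lin_add[OF q(1) cl cl] d lin_closed[OF q(1) cl] by (simp add: \<psi> vadd_zero_right[OF Q])
    then have "q (\<phi> (x \<ominus>\<^bsub>V\<^esub> y)) = \<zero>\<^bsub>Q\<^esub>"
      using vadd_cancel_left[OF Q] lin_closed[OF q(1) cl] xy d vzero_closed[OF Q] by simp
    then have "\<phi> (x \<ominus>\<^bsub>V\<^esub> y) \<in> \<phi> ` kern V Q q" unfolding k using cl[OF d] by (simp add: kern_def)
    then have "x \<ominus>\<^bsub>V\<^esub> y \<in> kern V Q q"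
      using inj_on_image_mem_iff[OF inj d] by (auto simp: kern_def)
    then show "A = B" using kern_minus_iff[OF q(1) xy(1,3)] xy by simp
  qed
  moreover have "\<psi> (A \<oplus>\<^bsub>Q\<^esub> B) = \<psi> A \<oplus>\<^bsub>Q\<^esub> \<psi> B" if A: "A \<in> carrier Q" and B: "B \<in> carrier Q" for A B
  proof -
    obtain x y where xy: "x \<in> carrier V" "A = q x" "y \<in> carrier V" "B = q y" using rep[OF A] rep[OF B] by blast
    then show ?thesis
      by (simp add: lin_add[OF q(1), symmetric] \<psi> vadd_closed[OF V(1)] add cl)
  qed
  moreover have "\<psi> (c \<odot>\<^bsub>Q\<^esub> A) = \<sigma> c \<odot>\<^bsub>Q\<^esub> \<psi> A" if A: "A \<in> carrier Q" for c A
  proof -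
    obtain x where x: "x \<in> carrier V" "A = q x" using rep[OF A] by blast
    then show ?thesis
      by (simp add: lin_smult[OF q(1), symmetric] \<psi> vsmult_closed[OF V(1)] smult cl)
  qed
  ultimately show ?thesis
    using Q fd_surj[OF q(1) V(2) q(2)] by (simp add: phi_module_def bij_betw_def)
qed

lemma image_vimage_in: "P \<subseteq> T ` A \<Longrightarrow> T ` {v \<in> A. T v \<in> P} = P"
  by blast

text \<open>Spanning passes to quotients, and the dimensions over the two fields agree for the
  quotient because they do for the whole space and for the kernel.\<close>

lemma scalar_ext_quot:
  assumes j: "scalar_ext e V W j" and q: "lin V Q q" "q ` carrier V = carrier Q"
    and qK: "lin W QK qK" "qK ` carrier W = carrier QK"
    and k: "kern W QK qK = vspan W (j ` kern V Q q)"
    and c: "\<And>v. v \<in> carrier V \<Longrightarrow> j' (q v) = qK (j v)"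
  shows "scalar_ext e Q QK j'"
proof -
  note s = scalar_ext_semilin[OF j]
  note jc = semilin_closed[OF s]
  have rep: "\<exists>x\<in>carrier V. A = q x" if "A \<in> carrier Q" for A using that q(2) by blast
  have jW: "j ` carrier V \<subseteq> carrier W" using jc by auto
  have sl: "semilin e Q QK j'"
  proof (rule semilinI[OF lin_cod[OF q(1)] lin_cod[OF qK(1)]])
    show "j' A \<in> carrier QK" if "A \<in> carrier Q" for A
      using rep[OF that] c lin_closed[OF qK(1) jc] by auto
    show "j' (A \<oplus>\<^bsub>Q\<^esub> B) = j' A \<oplus>\<^bsub>QK\<^esub> j' B" if A: "A \<in> carrier Q" and B: "B \<in> carrier Q" for A B
    proof -
      obtain x y where xy: "x \<in> carrier V" "A = q x" "y \<in> carrier V" "B = q y" using rep[OF A] rep[OF B] by blast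
      then show ?thesis
        by (simp add: lin_add[OF q(1), symmetric] c vadd_closed[OF lin_dom[OF q(1)]] semilin_add[OF s] lin_add[OF qK(1)] jc)
    qed
    show "j' (a \<odot>\<^bsub>Q\<^esub> A) = e a \<odot>\<^bsub>QK\<^esub> j' A" if A: "A \<in> carrier Q" for a A
    proof -
      obtain x where x: "x \<in> carrier V" "A = q x" using rep[OF A] by blast
      then show ?thesis
        by (simp add: lin_smult[OF q(1), symmetric] c vsmult_closed[OF lin_dom[OF q(1)]] semilin_smult[OF s] lin_smult[OF qK(1)] jc)
    qed
  qed
  have "j' ` carrier Q = qK ` j ` carrier V"
    unfolding q(2)[symmetric] image_image by (rule image_cong) (simp_all add: c)
  then have span: "vspan QK (j' ` carrier Q) = carrier QK"
    using span_image[OF qK(1) jW] scalar_ext_span[OF j] qK(2) by simp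
  have "vdim (on W (kern W QK qK)) = vdim (on V (kern V Q q))"
    unfolding k by (rule scalar_ext_dim[OF scalar_ext_on[OF j sub_kern[OF q(1)]]])
  then have "vdim QK = vdim Q"
    using rank_nullity(1)[OF q(1) scalar_ext_fd(1)[OF j]] rank_nullity(1)[OF qK(1) scalar_ext_fd(2)[OF j]]
      scalar_ext_dim[OF j] q(2) qK(2) by simp
  then show ?thesis unfolding scalar_ext_def
    using sl span fd_surj[OF q(1) scalar_ext_fd(1)[OF j] q(2)] fd_surj[OF qK(1) scalar_ext_fd(2)[OF j] qK(2)] by simp
qed

context mf_base
begin

text \<open>Bijectivity of \<open>iota\<close> follows from the other data: on the image of
  \<open>j\<close>, hence everywhere, it agrees with the isomorphism between two scalar extensions
  of the same space.\<close>

lemma objI: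
  assumes P: "phi_module \<sigma> (Sp X) (Phi X)" and F: "filtered_module (SpK X) (Fil X)"
    and j: "scalar_ext e (Sp X) (SpK X) j" and i: "lin (SpK X) (base_change e (Sp X)) (iota X)"
    and ij: "\<And>v. v \<in> carrier (Sp X) \<Longrightarrow> iota X (j v) = ten e (Sp X) v"
  shows "obj X" "v \<in> carrier (Sp X) \<Longrightarrow> jm X v = j v"
proof -
  have V: "vsp (Sp X)" "fd (Sp X)" using P by (auto simp: phi_module_def)
  obtain g where g: "lin (SpK X) (base_change e (Sp X)) g" "bij_betw g (carrier (SpK X)) (carrier (base_change e (Sp X)))"
    "\<forall>v\<in>carrier (Sp X). g (j v) = ten e (Sp X) v"
    using scalar_ext_iso[OF j scalar_ext_ten[OF V e]] by blast
  have "g w = iota X w" if "w \<in> carrier (SpK X)" for w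
    by (rule scalar_ext_lin_eq[OF j g(1) i _ that]) (use g(3) ij in simp)
  then have "bij_betw (iota X) (carrier (SpK X)) (carrier (base_change e (Sp X)))"
    using g(2) bij_betw_cong by blast
  then show o: "obj X" unfolding filtered_phi_module_def using P F i by blast
  show "v \<in> carrier (Sp X) \<Longrightarrow> jm X v = j v"
    by (rule jm_eqI[OF o]) (use ij semilin_closed[OF scalar_ext_semilin[OF j]] in auto)
qed

lemma mor_zero: "obj X \<Longrightarrow> obj Y \<Longrightarrow> mor X Y (\<lambda>v. \<zero>\<^bsub>Sp Y\<^esub>) (\<lambda>w. \<zero>\<^bsub>SpK Y\<^esub>)"
proof (rule morI)
  assume X: "obj X" and Y: "obj Y"
  show "lin (Sp X) (Sp Y) (\<lambda>v. \<zero>\<^bsub>Sp Y\<^esub>)" by (rule lin_zero_map[OF obj_vsp(1)[OF X] obj_vsp(1)[OF Y]])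
  show "lin (SpK X) (SpK Y) (\<lambda>v. \<zero>\<^bsub>SpK Y\<^esub>)" by (rule lin_zero_map[OF obj_vsp(2)[OF X] obj_vsp(2)[OF Y]])
  show "(\<lambda>w. \<zero>\<^bsub>SpK Y\<^esub>) ` Fil X i \<subseteq> Fil Y i" for i using sub_zero[OF fm_sub[OF obj_fil[OF Y]]] by auto
  show "\<zero>\<^bsub>SpK Y\<^esub> = jm Y \<zero>\<^bsub>Sp Y\<^esub>" using semilin_zero[OF jm_semilin[OF Y]] by simp
  show "\<zero>\<^bsub>Sp Y\<^esub> = Phi Y \<zero>\<^bsub>Sp Y\<^esub>"
    using obj_phi_props(5)[OF Y, of "\<zero>\<^bsub>Sp Y\<^esub>" 0] obj_phi_props(1)[OF Y, of "\<zero>\<^bsub>Sp Y\<^esub>"]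
    by (simp add: vsp_simps[OF obj_vsp(1)[OF Y]] \<sigma>_zero_iff[THEN iffD2])
qed

section \<open>Passage between the category and the relation \<open>mor\<close>\<close>

lemma MF_simps:
  "Obj (full_subcategory (MF \<sigma> e) P) = {X. obj X \<and> P X}" "Obj (MF \<sigma> e) = {X. obj X}"
  "Hom (full_subcategory (MF \<sigma> e) P) = MF_hom e" "Hom (MF \<sigma> e) = MF_hom e"
  "Ide (full_subcategory (MF \<sigma> e) P) X = (\<lambda>v\<in>carrier (Sp X). v, \<lambda>w\<in>carrier (SpK X). w)"
  "Comp (full_subcategory (MF \<sigma> e) P) X Y Z g f =
    (compose (carrier (Sp X)) (fst g) (fst f), compose (carrier (SpK X)) (snd g) (snd f))"
  "full_subcategory (MF \<sigma> e) (\<lambda>_. True) = MF \<sigma> e"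
  by (auto simp: MF_def full_subcategory_def)

definition rmor where "rmor X T TK = (restrict T (carrier (Sp X)), restrict TK (carrier (SpK X)))"

lemma rmor_hom:
  assumes "obj X" "obj Y" "mor X Y T TK" shows "rmor X T TK \<in> MF_hom e X Y"
  unfolding rmor_def MF_hom_iff[OF assms(1,2)] using mor_cong[OF assms(3,1)] by auto

lemma hom_mor: "obj X \<Longrightarrow> obj Y \<Longrightarrow> f \<in> MF_hom e X Y \<Longrightarrow> mor X Y (fst f) (snd f)"
  using MF_hom_iff[of X Y "fst f" "snd f"] by simp

lemma hom_eqI:
  assumes "obj X" "obj Y" "f \<in> MF_hom e X Y" "g \<in> MF_hom e X Y"
    and "\<And>v. v \<in> carrier (Sp X) \<Longrightarrow> fst f v = fst g v" "\<And>w. w \<in> carrier (SpK X) \<Longrightarrow> snd f w = snd g w"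
  shows "f = g"
  using assms MF_hom_iff[of X Y "fst f" "snd f"] MF_hom_iff[of X Y "fst g" "snd g"]
  by (intro prod_eqI) (auto intro: extensionalityI)

text \<open>The image of \<open>jm\<close> spans \<open>V\<^sub>K\<close>, and there the second
  component of a morphism is prescribed by the first.\<close>

lemma hom_eqI':
  assumes X: "obj X" and Y: "obj Y" and f: "f \<in> MF_hom e X Y" and g: "g \<in> MF_hom e X Y"
    and eq: "\<And>v. v \<in> carrier (Sp X) \<Longrightarrow> fst f v = fst g v"
  shows "f = g"
proof (rule hom_eqI[OF X Y f g eq])
  note m = hom_mor[OF X Y f] hom_mor[OF X Y g]
  show "snd f w = snd g w" if "w \<in> carrier (SpK X)" for w
    by (rule scalar_ext_lin_eq[OF jm_scalar_ext[OF X] mor_linK[OF m(1)] mor_linK[OF m(2)] _ that])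
      (simp add: mor_jm[OF m(1)] mor_jm[OF m(2)] eq)
qed

lemma inj_monomorphism:
  assumes X: "obj X" and Y: "obj Y" and f: "f \<in> MF_hom e X Y" and inj: "inj_on (fst f) (carrier (Sp X))"
  shows "monomorphism (full_subcategory (MF \<sigma> e) P) X Y f"
  unfolding monomorphism_def MF_simps
proof (intro conjI ballI impI f)
  fix Z g h assume Z: "Z \<in> {X. obj X \<and> P X}" and gh: "g \<in> MF_hom e Z X" "h \<in> MF_hom e Z X"
    and eq: "(compose (carrier (Sp Z)) (fst f) (fst g), compose (carrier (SpK Z)) (snd f) (snd g)) =
      (compose (carrier (Sp Z)) (fst f) (fst h), compose (carrier (SpK Z)) (snd f) (snd h))"
  then have oZ: "obj Z" by simp
  note m = hom_mor[OF oZ X gh(1)] hom_mor[OF oZ X gh(2)]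
  show "g = h"
  proof (rule hom_eqI'[OF oZ X gh])
    fix v assume v: "v \<in> carrier (Sp Z)"
    have "compose (carrier (Sp Z)) (fst f) (fst g) v = compose (carrier (Sp Z)) (fst f) (fst h) v" using eq by simp
    then have "fst f (fst g v) = fst f (fst h v)" using v by (simp add: compose_def)
    then show "fst g v = fst h v"
      using inj_onD[OF inj] lin_closed[OF mor_lin[OF m(1)] v] lin_closed[OF mor_lin[OF m(2)] v] by blast
  qed
qed

text \<open>The inclusion of the kernel and the zero map become equal after composition with
  \<open>f\<close>. Cancelling \<open>f\<close> uses the kernel as a test object, so the property
  \<open>P\<close> that cuts out the full subcategory must hold for it.\<close>

lemma monomorphism_inj:
  assumes X: "obj X" and Y: "obj Y" and f: "monomorphism (full_subcategory (MF \<sigma> e) P) X Y f"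
    and P: "P (restr X (kern (Sp X) (Sp Y) (fst f)))"
  shows "inj_on (fst f) (carrier (Sp X))"
proof -
  have fh: "f \<in> MF_hom e X Y" using f by (simp add: monomorphism_def MF_simps)
  note m = hom_mor[OF X Y fh]
  define N where "N = kern (Sp X) (Sp Y) (fst f)"
  have "carrier (Sp X) \<inter> kern (Sp X) (Sp Y) (fst f) = N" by (auto simp: N_def kern_def)
  then have N: "stab X N" using stab_kern(1)[OF X Y m stab_carrier[OF X]] by simp
  define Z where "Z = restr X N"
  have Z: "obj Z" unfolding Z_def by (rule restr_obj(1)[OF X N])
  have sZ: "carrier (Sp Z) = N" by (simp add: Z_def restr_def)
  define i where "i = rmor Z (\<lambda>v. v) (\<lambda>w. w)"
  define z where "z = rmor Z (\<lambda>v. \<zero>\<^bsub>Sp X\<^esub>) (\<lambda>w. \<zero>\<^bsub>SpK X\<^esub>)"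
  have ih: "i \<in> MF_hom e Z X" unfolding i_def
    by (rule rmor_hom[OF Z X]) (simp add: Z_def restr_mor[OF X N])
  have zh: "z \<in> MF_hom e Z X" unfolding z_def by (rule rmor_hom[OF Z X mor_zero[OF Z X]])
  have "(compose (carrier (Sp Z)) (fst f) (fst i), compose (carrier (SpK Z)) (snd f) (snd i)) =
    (compose (carrier (Sp Z)) (fst f) (fst z), compose (carrier (SpK Z)) (snd f) (snd z))"
  proof -
    have a: "fst f v = fst f \<zero>\<^bsub>Sp X\<^esub>" if "v \<in> N" for v
      using that lin_zero[OF mor_lin[OF m]] by (simp add: N_def kern_def)
    have b: "snd f w = snd f \<zero>\<^bsub>SpK X\<^esub>" if "w \<in> carrier (SpK Z)" for w
    proof -
      have "w \<in> kern (SpK X) (SpK Y) (snd f)"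
        using that mor_kernK(1)[OF X Y m] by (simp add: Z_def restr_def N_def)
      then show ?thesis using lin_zero[OF mor_linK[OF m]] by (simp add: kern_def)
    qed
    show ?thesis using a b sZ by (auto simp: compose_def i_def z_def rmor_def fun_eq_iff)
  qed
  moreover have "Z \<in> {X. obj X \<and> P X}" using Z P by (simp add: Z_def N_def)
  ultimately have "i = z"
    using f ih zh unfolding monomorphism_def MF_simps by blast
  then have "v = \<zero>\<^bsub>Sp X\<^esub>" if "v \<in> N" for v
    using that sZ by (auto simp: i_def z_def rmor_def fun_eq_iff split: if_splits)
  then show ?thesis
    by (intro lin_inj_onI[OF mor_lin[OF m]]) (auto simp: N_def kern_def)
qed

abbreviation wa :: "('s, 'v, 'K, 'w) filt_phi \<Rightarrow> bool" where
  "wa X \<equiv> weakly_admissible \<sigma> e ord X"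

text \<open>Up to an isomorphism on the level of Phi-modules, which can only increase \<open>t\<^sub>N - t\<^sub>H\<close>, the
  subobjects are the stable subspaces with the induced filtration.\<close>

lemma wa_iff: "wa X \<longleftrightarrow> obj X \<and> dl X (carrier (Sp X)) = 0 \<and> (\<forall>U. stab X U \<longrightarrow> dl X U \<ge> 0)"
proof (cases "obj X")
  case X: True
  have "dl X U \<ge> 0" if w: "wa X" and U: "stab X U" for U
  proof -
    note o = restr_obj(1)[OF X U]
    have "rmor (restr X U) (\<lambda>v. v) (\<lambda>w. w) \<in> MF_hom e (restr X U) X"
      by (rule rmor_hom[OF o X restr_mor[OF X U]])
    then have "monomorphism (full_subcategory (MF \<sigma> e) (\<lambda>_. True)) (restr X U) X (rmor (restr X U) (\<lambda>v. v) (\<lambda>w. w))"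
      by (rule inj_monomorphism[OF o X]) (auto simp: rmor_def inj_on_def)
    then have "subobject (MF \<sigma> e) (restr X U) X"
      using o X unfolding subobject_def MF_simps by blast
    then have "t_N (\<lambda>c. ord (e c)) (Sp (restr X U)) (Phi (restr X U)) \<ge> t_H (SpK (restr X U)) (Fil (restr X U))"
      using w unfolding weakly_admissible_def by blast
    then show ?thesis by (simp add: restr_def dl_def)
  qed
  moreover have "t_N (\<lambda>c. ord (e c)) (Sp A) (Phi A) \<ge> t_H (SpK A) (Fil A)"
    if d: "\<forall>U. stab X U \<longrightarrow> dl X U \<ge> 0" and A: "subobject (MF \<sigma> e) A X" for A
  proof -
    obtain f where oA: "obj A" and f: "monomorphism (full_subcategory (MF \<sigma> e) (\<lambda>_. True)) A X f"
      using A unfolding subobject_def MF_simps by blast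
    have "f \<in> MF_hom e A X" using f by (simp add: monomorphism_def MF_simps)
    note m = hom_mor[OF oA X this]
    have inj: "inj_on (fst f) (carrier (Sp A))" by (rule monomorphism_inj[OF oA X f TrueI])
    have "0 \<le> dl X (fst f ` carrier (Sp A))" using d stab_kern(2)[OF oA X m stab_carrier[OF oA]] by blast
    also have "\<dots> \<le> dl A (carrier (Sp A))" by (rule dl_inj(1)[OF oA X m stab_carrier[OF oA] inj])
    finally show ?thesis by (simp add: dl_carrier[OF oA])
  qed
  ultimately show ?thesis
    using X dl_carrier[OF X] unfolding weakly_admissible_def MF_simps by auto
qed (simp add: weakly_admissible_def MF_simps)

lemma wa_obj: "wa X \<Longrightarrow> obj X" and wa_zero: "wa X \<Longrightarrow> dl X (carrier (Sp X)) = 0"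
  and wa_nonneg: "wa X \<Longrightarrow> stab X U \<Longrightarrow> dl X U \<ge> 0"
  using wa_iff by auto

text \<open>A version of \<open>strict_hom\<close> for objects whose carrier types may differ; its
  argument is the map on \<open>V\<^sub>K\<close> alone.\<close>

definition mstrict :: "('s, 'v, 'K, 'w) filt_phi \<Rightarrow> ('s, 'v2, 'K, 'w2) filt_phi \<Rightarrow> ('w \<Rightarrow> 'w2) \<Rightarrow> bool" where
  "mstrict X Y TK \<longleftrightarrow> (\<forall>i. TK ` Fil X i = TK ` carrier (SpK X) \<inter> Fil Y i)"

text \<open>Injectivity and strictness together say that the filtration of \<open>A\<close> is
  induced from \<open>X\<close>, and every subspace inherits this.\<close>

lemma dl_embed:
  assumes A: "obj A" and X: "obj X" and T: "mor A X T TK" and inj: "inj_on T (carrier (Sp A))"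
    and s: "mstrict A X TK" and U: "stab A U"
  shows "dl A U = dl X (T ` U)"
proof -
  note injK = mor_injK[OF A X T inj]
  have "TK ` (Fil A i \<inter> uk A U) = Fil X i \<inter> uk X (T ` U)" for i
  proof
    show "TK ` (Fil A i \<inter> uk A U) \<subseteq> Fil X i \<inter> uk X (T ` U)"
      using mor_fil[OF T, of i] mor_uk(1)[OF A X T stab_sub[OF U]] by blast
    show "Fil X i \<inter> uk X (T ` U) \<subseteq> TK ` (Fil A i \<inter> uk A U)"
    proof
      fix y assume y: "y \<in> Fil X i \<inter> uk X (T ` U)"
      then obtain w where w: "w \<in> uk A U" "y = TK w" using mor_uk(1)[OF A X T stab_sub[OF U]] by blast
      have wA: "w \<in> carrier (SpK A)" by (rule sub_closed[OF sub_uk[OF A stab_sub[OF U]] w(1)])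
      then have "y \<in> TK ` Fil A i" using y w s unfolding mstrict_def by blast
      then obtain w' where w': "w' \<in> Fil A i" "y = TK w'" by blast
      then have "w = w'" using inj_onD[OF injK _ wA sub_closed[OF fm_sub[OF obj_fil[OF A]] w'(1)]] w by simp
      then show "y \<in> TK ` (Fil A i \<inter> uk A U)" using w w' by blast
    qed
  qed
  then show ?thesis using dl_inj(2)[OF A X T U inj] by simp
qed

text \<open>A strict surjection stays strict on the full preimage of \<open>P\<close>: a lift within
  a filtration step differs from a lift in the preimage by an element of the kernel, which the
  preimage contains. So the equality case of \<open>dl_ker_im\<close> applies.\<close>

lemma dl_quot:
  assumes X: "obj X" and Q: "obj Q" and T: "mor X Q T TK" and surj: "T ` carrier (Sp X) = carrier (Sp Q)"
    and s: "mstrict X Q TK" and P: "stab Q P"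
  shows "dl X {v \<in> carrier (Sp X). T v \<in> P} = dl X (kern (Sp X) (Sp Q) T) + dl Q P"
proof -
  let ?U = "{v \<in> carrier (Sp X). T v \<in> P}"
  have U: "stab X ?U" by (rule stab_vimage[OF X Q T P])
  have TU: "T ` ?U = P" by (rule image_vimage_in) (simp add: surj sub_subset[OF stab_sub[OF P]])
  have kU: "kern (Sp X) (Sp Q) T \<subseteq> ?U" using sub_zero[OF stab_sub[OF P]] by (auto simp: kern_def)
  note surjK = mor_surjK[OF X Q T surj]
  note uU = sub_uk[OF X stab_sub[OF U]]
  have kK: "kern (SpK X) (SpK Q) TK \<subseteq> uk X ?U"
    unfolding mor_kernK(1)[OF X Q T] by (rule uk_mono[OF X sub_kern[OF mor_lin[OF T]] stab_sub[OF U] kU])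
  have "TK ` (Fil X i \<inter> uk X ?U) = Fil Q i \<inter> uk Q (T ` ?U)" for i
  proof
    show "TK ` (Fil X i \<inter> uk X ?U) \<subseteq> Fil Q i \<inter> uk Q (T ` ?U)"
      using mor_fil[OF T, of i] mor_uk(1)[OF X Q T stab_sub[OF U]] by blast
    show "Fil Q i \<inter> uk Q (T ` ?U) \<subseteq> TK ` (Fil X i \<inter> uk X ?U)"
    proof
      fix y assume y: "y \<in> Fil Q i \<inter> uk Q (T ` ?U)"
      then obtain w where w: "w \<in> uk X ?U" "y = TK w" using mor_uk(1)[OF X Q T stab_sub[OF U]] by blast
      have wX: "w \<in> carrier (SpK X)" by (rule sub_closed[OF uU w(1)])
      then have "y \<in> TK ` Fil X i" using y w s unfolding mstrict_def by blast
      then obtain x where x: "x \<in> Fil X i" "y = TK x" by blast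
      have xX: "x \<in> carrier (SpK X)" by (rule sub_closed[OF fm_sub[OF obj_fil[OF X]] x(1)])
      have "TK x = TK w" using x w by simp
      then have "x \<ominus>\<^bsub>SpK X\<^esub> w \<in> uk X ?U" using kK kern_minus_iff[OF mor_linK[OF T] xX wX] by blast
      from sub_add[OF uU w(1) this] have "x \<in> uk X ?U"
        by (simp add: vminus_add_cancel[OF obj_vsp(2)[OF X] xX wX])
      then show "y \<in> TK ` (Fil X i \<inter> uk X ?U)" using x by blast
    qed
  qed
  moreover have "?U \<inter> kern (Sp X) (Sp Q) T = kern (Sp X) (Sp Q) T" using kU by blast
  ultimately show ?thesis using dl_ker_im(2)[OF X Q T U] TU by simp
qed

lemma dl_quot_carrier:
  assumes X: "obj X" and Q: "obj Q" and T: "mor X Q T TK" and surj: "T ` carrier (Sp X) = carrier (Sp Q)"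
    and s: "mstrict X Q TK"
  shows "dl X (carrier (Sp X)) = dl X (kern (Sp X) (Sp Q) T) + dl Q (carrier (Sp Q))"
proof -
  have "{v \<in> carrier (Sp X). T v \<in> carrier (Sp Q)} = carrier (Sp X)" using surj by blast
  then show ?thesis using dl_quot[OF assms stab_carrier[OF Q]] by simp
qed

text \<open>The stable subspaces of \<open>A\<close> are stable subspaces of \<open>X\<close> with
  the same \<delta>, so nonnegativity is inherited and only the total value is a condition.\<close>

lemma wa_embed:
  assumes w: "wa X" and A: "obj A" and T: "mor A X T TK" and inj: "inj_on T (carrier (Sp A))"
    and s: "mstrict A X TK" and z: "dl X (T ` carrier (Sp A)) = 0"
  shows "wa A"
  unfolding wa_iff
  using A dl_embed[OF A wa_obj[OF w] T inj s] stab_carrier[OF A] z wa_nonneg[OF w stab_kern(2)[OF A wa_obj[OF w] T]]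
  by auto

text \<open>For a stable subspace of the quotient, \<delta> is that of its preimage minus that of
  the kernel, and the latter is 0.\<close>

lemma wa_quot:
  assumes w: "wa X" and Q: "obj Q" and T: "mor X Q T TK" and surj: "T ` carrier (Sp X) = carrier (Sp Q)"
    and s: "mstrict X Q TK" and z: "dl X (kern (Sp X) (Sp Q) T) = 0"
  shows "wa Q"
  unfolding wa_iff
proof (intro conjI allI impI Q)
  note X = wa_obj[OF w]
  show "dl Q (carrier (Sp Q)) = 0" using dl_quot_carrier[OF X Q T surj s] wa_zero[OF w] z by simp
  show "0 \<le> dl Q P" if P: "stab Q P" for P
    using dl_quot[OF X Q T surj s P] wa_nonneg[OF w stab_vimage[OF X Q T P]] z by simp
qed

text \<open>A stable subspace \<open>U\<close> of the middle term need not give a strict sequence,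
  but only the inequality is wanted: \<delta>(U) is at least the sum of the contributions from
  \<open>A\<close> and from \<open>Q\<close>.\<close>

lemma wa_ext:
  assumes X: "obj X" and wA: "wa A" and wQ: "wa Q"
    and S: "mor A X S SK" "inj_on S (carrier (Sp A))" "mstrict A X SK"
    and T: "mor X Q T TK" "T ` carrier (Sp X) = carrier (Sp Q)" "mstrict X Q TK"
    and ex: "S ` carrier (Sp A) = kern (Sp X) (Sp Q) T"
  shows "wa X"
  unfolding wa_iff
proof (intro conjI allI impI X)
  note A = wa_obj[OF wA] and Q = wa_obj[OF wQ]
  show "dl X (carrier (Sp X)) = 0"
    using dl_quot_carrier[OF X Q T] dl_embed[OF A X S stab_carrier[OF A]] wa_zero[OF wA] wa_zero[OF wQ] ex by simp
  show "0 \<le> dl X U" if U: "stab X U" for U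
  proof -
    let ?N = "U \<inter> kern (Sp X) (Sp Q) T"
    \<comment> \<open>The part of \<open>U\<close> that comes from \<open>A\<close>, taken back to
      \<open>A\<close>, where weak admissibility can be applied.\<close>
    let ?M = "{a \<in> carrier (Sp A). S a \<in> ?N}"
    note st = stab_kern[OF X Q T(1) U]
    have M: "stab A ?M" by (rule stab_vimage[OF A X S(1) st(1)])
    have "S ` ?M = ?N" by (rule image_vimage_in) (simp add: ex)
    then have "0 \<le> dl X ?N" using dl_embed[OF A X S M] wa_nonneg[OF wA M] by simp
    moreover have "0 \<le> dl Q (T ` U)" by (rule wa_nonneg[OF wQ st(2)])
    ultimately show ?thesis using dl_ker_im(1)[OF X Q T(1) U] by simp
  qed
qed

lemma wa_mor:
  assumes wX: "wa X" and wY: "wa Y" and T: "mor X Y T TK"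
  shows "mstrict X Y TK" "dl X (kern (Sp X) (Sp Y) T) = 0" "dl Y (T ` carrier (Sp X)) = 0"
proof -
  note X = wa_obj[OF wX] and Y = wa_obj[OF wY]
  note c = stab_carrier[OF X]
  have i: "carrier (Sp X) \<inter> kern (Sp X) (Sp Y) T = kern (Sp X) (Sp Y) T" by (auto simp: kern_def)
  note st = stab_kern[OF X Y T c, unfolded i]
  note d = dl_ker_im[OF X Y T c, unfolded i wa_zero[OF wX]]
  have nn: "dl X (kern (Sp X) (Sp Y) T) \<ge> 0" "dl Y (T ` carrier (Sp X)) \<ge> 0"
    using wa_nonneg[OF wX st(1)] wa_nonneg[OF wY st(2)] by auto
  show "dl X (kern (Sp X) (Sp Y) T) = 0" "dl Y (T ` carrier (Sp X)) = 0" using nn d(1) by linarith+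
  then have *: "\<forall>i. TK ` (Fil X i \<inter> uk X (carrier (Sp X))) = Fil Y i \<inter> uk Y (T ` carrier (Sp X))"
    using d(2) by simp
  have "Fil X i \<inter> carrier (SpK X) = Fil X i" for i using sub_subset[OF fm_sub[OF obj_fil[OF X]]] by blast
  then show "mstrict X Y TK"
    using * unfolding mstrict_def uk_carrier[OF X] mor_kernK(2)[OF X Y T, symmetric] by (simp add: Int_commute)
qed

end

section \<open>Kernels, cokernels and direct sums\<close>

context mf_base
begin

text \<open>\<open>MF_ker\<close> gives \<open>iota\<close> by a definite description. The value
  exists by the map \<open>g\<close> from the universal property of the scalar extension
  \<open>NK\<close> of \<open>N\<close>, and it is unique because K \<otimes> N \<rightarrow> K
  \<otimes> V is injective.\<close>

lemma MF_ker_props: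
  assumes X: "obj X" and Y: "obj Y" and m: "mor X Y (fst T) (snd T)"
  defines "K \<equiv> MF_ker e X Y T"
  shows "obj K" "carrier (Sp K) = kern (Sp X) (Sp Y) (fst T)" "mor K X (\<lambda>v. v) (\<lambda>w. w)" "mstrict K X (\<lambda>w. w)"
proof -
  define N where "N = kern (Sp X) (Sp Y) (fst T)"
  define NK where "NK = kern (SpK X) (SpK Y) (snd T)"
  have lk: "lin_ker V U h = on V (kern V U h)" for V :: "('k::field, 'z) module" and U h
    by (simp add: lin_ker_def kern_def)
  have K: "Sp K = on (Sp X) N" "Phi K = Phi X" "SpK K = on (SpK X) NK" "Fil K = (\<lambda>i. Fil X i \<inter> NK)"
    "iota K = (\<lambda>w. THE z. z \<in> carrier (base_change e (on (Sp X) N)) \<and>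
       base_change_map e (on (Sp X) N) (Sp X) (\<lambda>v. v) z = iota X w)"
    by (simp_all add: K_def MF_ker_def Let_def lk N_def NK_def)
  have "carrier (Sp X) \<inter> kern (Sp X) (Sp Y) (fst T) = N" by (auto simp: N_def kern_def)
  then have st: "stab X N" using stab_kern(1)[OF X Y m stab_carrier[OF X]] by simp
  note s = stab_sub[OF st]
  have NK: "NK = uk X N" unfolding NK_def N_def by (rule mor_kernK(1)[OF X Y m])
  note sNK = sub_uk[OF X s, folded NK]
  have P: "phi_module \<sigma> (Sp K) (Phi K)" unfolding K by (rule phi_module_on[OF X st])
  have F: "filtered_module (SpK K) (Fil K)" unfolding K by (rule filtered_module_on[OF obj_fil[OF X] sNK])
  have j: "scalar_ext e (Sp K) (SpK K) (jm X)"
    unfolding K NK uk_def by (rule scalar_ext_on[OF jm_scalar_ext[OF X] s])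
  have VN: "vsp (on (Sp X) N)" "fd (on (Sp X) N)" using P by (auto simp: phi_module_def K)
  note jN = scalar_ext_ten[OF VN e]
  note jX = scalar_ext_ten[OF obj_vsp(1)[OF X] obj_fd(1)[OF X] e]
  have incl: "lin (on (Sp X) N) (Sp X) (\<lambda>v. v)" by (rule lin_restrict_dom[OF lin_id[OF obj_vsp(1)[OF X]] s])
  let ?b = "base_change_map e (on (Sp X) N) (Sp X) (\<lambda>v. v)"
  note b = base_change_map_props[OF incl e VN(2)]
  \<comment> \<open>Base change commutes with kernels, and the inclusion of \<open>N\<close> has
    kernel 0.\<close>
  have kb: "kern (base_change e (on (Sp X) N)) (base_change e (Sp X)) ?b = {\<zero>\<^bsub>base_change e (on (Sp X) N)\<^esub>}"
  proof -
    have c: "carrier (base_change e (on (Sp X) N)) \<inter> kern (base_change e (on (Sp X) N)) (base_change e (Sp X)) ?b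
        = kern (base_change e (on (Sp X) N)) (base_change e (Sp X)) ?b" by (auto simp: kern_def)
    have k0: "carrier (on (Sp X) N) \<inter> kern (on (Sp X) N) (Sp X) (\<lambda>v. v) = {\<zero>\<^bsub>on (Sp X) N\<^esub>}"
      using sub_zero[OF s] by (auto simp: kern_def)
    have "kern (base_change e (on (Sp X) N)) (base_change e (Sp X)) ?b =
        vspan (base_change e (on (Sp X) N)) (ten e (on (Sp X) N) ` {\<zero>\<^bsub>on (Sp X) N\<^esub>})"
      using scalar_ext_image_kern(2)[OF jN jX incl b(1) _ sub_carrier[OF VN(1)]] b(2)
      unfolding scalar_ext_span[OF jN] c k0 by blast
    also have "\<dots> = {\<zero>\<^bsub>base_change e (on (Sp X) N)\<^esub>}"
      using semilin_zero[OF semilin_ten[OF VN(1), of e]] span_sub[OF sub_trivial[OF vsp_base_change[OF VN(1), of e]]]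
      by simp
    finally show ?thesis .
  qed
  have binj: "inj_on ?b (carrier (base_change e (on (Sp X) N)))" using lin_inj_iff[OF b(1)] kb by simp
  obtain g where g: "lin (on (SpK X) NK) (base_change e (on (Sp X) N)) g" "\<forall>v\<in>N. g (jm X v) = ten e (on (Sp X) N) v"
    using scalar_ext_lift[OF j[unfolded K] semilin_ten[OF VN(1)]] by auto
  have bg: "?b (g w) = iota X w" if w: "w \<in> NK" for w
  proof (rule scalar_ext_lin_eq[OF j[unfolded K] lin_comp[OF g(1) b(1)] lin_restrict_dom[OF obj_iota(1)[OF X] sNK]])
    show "?b (g (jm X v)) = iota X (jm X v)" if "v \<in> carrier (on (Sp X) N)" for v
      using that g(2) b(2) iota_jm[OF X] sub_closed[OF s] by (simp add: ten_def pure_tensor_def)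
  qed (use w in simp)
  have ig: "iota K w = g w" if w: "w \<in> NK" for w
    unfolding K
  proof (rule the_equality)
    show "g w \<in> carrier (base_change e (on (Sp X) N)) \<and> ?b (g w) = iota X w"
      using bg[OF w] lin_closed[OF g(1)] w by simp
    show "z = g w" if "z \<in> carrier (base_change e (on (Sp X) N)) \<and> ?b z = iota X w" for z
      using inj_onD[OF binj] that bg[OF w] lin_closed[OF g(1)] w by simp
  qed
  have li: "lin (SpK K) (base_change e (Sp K)) (iota K)"
    unfolding K(1,3) by (rule lin_cong[OF g(1)]) (simp add: ig)
  have ij: "iota K (jm X v) = ten e (Sp K) v" if "v \<in> carrier (Sp K)" for v
    using that ig[of "jm X v"] jm_uk[OF X s, folded NK] g(2) by (simp add: K(1))
  have o1: "obj K" by (rule objI(1)[OF P F j li]) (rule ij)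
  have o2: "jm K v = jm X v" if "v \<in> carrier (Sp K)" for v
    by (rule objI(2)[OF P F j li _ that]) (rule ij)
  show "obj K" by (rule o1)
  show "carrier (Sp K) = kern (Sp X) (Sp Y) (fst T)" by (simp add: K N_def)
  show "mor K X (\<lambda>v. v) (\<lambda>w. w)"
  proof (rule morI)
    show "lin (Sp K) (Sp X) (\<lambda>v. v)" unfolding K by (rule incl)
    show "lin (SpK K) (SpK X) (\<lambda>w. w)" unfolding K by (rule lin_restrict_dom[OF lin_id[OF obj_vsp(2)[OF X]] sNK])
    show "jm K v = jm X v" if "v \<in> carrier (Sp K)" for v by (rule o2[OF that])
  qed (simp_all add: K)
  show "mstrict K X (\<lambda>w. w)" by (auto simp: mstrict_def K)
qed

text \<open>\<open>MF_coker\<close> evaluates \<open>iota\<close> at an arbitrary representative of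
  a coset. The choice does not matter, since the composite into K \<otimes> Q vanishes on the image
  of the map on \<open>V\<^sub>K\<close>. The last two claims choose representatives for another
  purpose: they embed the quotients, whose elements are sets, into the original carriers.\<close>

lemma MF_coker_props:
  assumes X: "obj X" and Y: "obj Y" and m: "mor X Y (fst T) (snd T)"
  defines "C \<equiv> MF_coker e X Y T"
  shows "obj C" "\<exists>q qK. mor Y C q qK \<and> q ` carrier (Sp Y) = carrier (Sp C) \<and> mstrict Y C qK \<and>
    kern (Sp Y) (Sp C) q = fst T ` carrier (Sp X)"
    "\<exists>f. inj_on f (carrier (Sp C)) \<and> f ` carrier (Sp C) \<subseteq> carrier (Sp Y)"
    "\<exists>f. inj_on f (carrier (SpK C)) \<and> f ` carrier (SpK C) \<subseteq> carrier (SpK Y)"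
proof -
  define I where "I = fst T ` carrier (Sp X)"
  define IK where "IK = snd T ` carrier (SpK X)"
  define Q where "Q = quot_module (Sp Y) I"
  define QK where "QK = quot_module (SpK Y) IK"
  define q where "q = (\<lambda>v. I +>\<^bsub>Sp Y\<^esub> v)"
  define qK where "qK = (\<lambda>w. IK +>\<^bsub>SpK Y\<^esub> w)"
  have C: "Sp C = Q" "Phi C = (\<lambda>A. Phi Y ` A)" "SpK C = QK" "Fil C = (\<lambda>i. qK ` Fil Y i)"
    "iota C = (\<lambda>A. base_change_map e (Sp Y) Q q (iota Y (SOME w. w \<in> A)))"
    by (simp_all add: C_def MF_coker_def Let_def I_def IK_def Q_def QK_def q_def qK_def)
  note st = stab_kern(2)[OF X Y m stab_carrier[OF X], folded I_def]
  note s = stab_sub[OF st]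
  have IK: "IK = uk Y I" unfolding IK_def I_def by (rule mor_kernK(2)[OF X Y m])
  note sK = sub_uk[OF Y s, folded IK]
  note p = quot_module_proj[OF s, folded Q_def q_def]
  note pK = quot_module_proj[OF sK, folded QK_def qK_def]
  note V = obj_vsp[OF Y]
  \<comment> \<open>\<open>MF_coker\<close> applies the Frobenius to a coset element by element;
    stability of \<open>I\<close> makes the result a whole coset.\<close>
  have phi_q: "Phi Y ` q x = q (Phi Y x)" if x: "x \<in> carrier (Sp Y)" for x
  proof -
    have "Phi Y ` q x = (\<lambda>n. Phi Y n \<oplus>\<^bsub>Sp Y\<^esub> Phi Y x) ` I"
      unfolding q_def a_r_coset_def' image_UN
      using obj_phi_props(4)[OF Y sub_closed[OF s] x] by (auto simp: image_iff)
    also have "\<dots> = (\<lambda>n. n \<oplus>\<^bsub>Sp Y\<^esub> Phi Y x) ` Phi Y ` I" by (simp add: image_image)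
    also have "\<dots> = q (Phi Y x)" unfolding stab_phi[OF st] q_def a_r_coset_def' by auto
    finally show ?thesis .
  qed
  have P: "phi_module \<sigma> (Sp C) (Phi C)"
    unfolding C by (rule phi_module_quot[OF obj_phi[OF Y] p(2,3)]) (simp_all add: phi_q p(4) stab_phi[OF st])
  have F: "filtered_module (SpK C) (Fil C)"
    unfolding C by (rule filtered_module_image[OF obj_fil[OF Y] pK(2,3)])
  define j where "j A = qK (jm Y (SOME v. v \<in> A))" for A
  have someq: "(SOME v. v \<in> q x) \<in> carrier (Sp Y) \<and> q (SOME v. v \<in> q x) = q x" if x: "x \<in> carrier (Sp Y)" for x
  proof -
    have c: "q x \<in> carrier Q" by (rule lin_closed[OF p(2) x])
    have "(SOME v. v \<in> q x) \<in> q x" using p(7)[OF c] by (meson all_not_in_conv someI_ex)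
    then show ?thesis by (rule p(6)[OF c])
  qed
  have someqK: "(SOME v. v \<in> qK x) \<in> carrier (SpK Y) \<and> qK (SOME v. v \<in> qK x) = qK x" if x: "x \<in> carrier (SpK Y)" for x
  proof -
    have c: "qK x \<in> carrier QK" by (rule lin_closed[OF pK(2) x])
    have "(SOME v. v \<in> qK x) \<in> qK x" using pK(7)[OF c] by (meson all_not_in_conv someI_ex)
    then show ?thesis by (rule pK(6)[OF c])
  qed
  have qzero: "q x = \<zero>\<^bsub>Q\<^esub>" if "x \<in> I" for x using that p(4) by (auto simp: kern_def)
  have qKzero: "qK x = \<zero>\<^bsub>QK\<^esub>" if "x \<in> IK" for x using that pK(4) by (auto simp: kern_def)
  have jq: "j (q x) = qK (jm Y x)" if x: "x \<in> carrier (Sp Y)" for x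
  proof -
    let ?y = "SOME v. v \<in> q x"
    have y: "?y \<in> carrier (Sp Y)" "q ?y = q x" using someq[OF x] by auto
    have yx: "?y \<ominus>\<^bsub>Sp Y\<^esub> x \<in> I" using p(5)[OF y(1) x] y(2) by simp
    note yx' = sub_closed[OF s yx]
    have "jm Y ?y = jm Y x \<oplus>\<^bsub>SpK Y\<^esub> jm Y (?y \<ominus>\<^bsub>Sp Y\<^esub> x)"
      using semilin_add[OF jm_semilin[OF Y] x yx'] vminus_add_cancel[OF V(1) y(1) x] by simp
    then have "qK (jm Y ?y) = qK (jm Y x) \<oplus>\<^bsub>QK\<^esub> qK (jm Y (?y \<ominus>\<^bsub>Sp Y\<^esub> x))"
      using lin_add[OF pK(2) jm_closed[OF Y x] jm_closed[OF Y yx']] by simp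
    also have "qK (jm Y (?y \<ominus>\<^bsub>Sp Y\<^esub> x)) = \<zero>\<^bsub>QK\<^esub>"
      by (rule qKzero) (use jm_uk[OF Y s yx] in \<open>simp add: IK\<close>)
    finally show ?thesis
      unfolding j_def using vadd_zero_right[OF pK(1)] lin_closed[OF pK(2) jm_closed[OF Y x]] by simp
  qed
  have j: "scalar_ext e (Sp C) (SpK C) j"
    unfolding C
    by (rule scalar_ext_quot[OF jm_scalar_ext[OF Y] p(2,3) pK(2,3)]) (simp_all add: p(4) pK(4) IK uk_def jq)
  let ?h = "base_change_map e (Sp Y) Q q"
  note h = base_change_map_props[OF p(2) e obj_fd(1)[OF Y]]
  note hi = lin_comp[OF obj_iota(1)[OF Y] h(1)]
  have hi0: "?h (iota Y w) = \<zero>\<^bsub>base_change e Q\<^esub>" if w: "w \<in> IK" for w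
  proof (rule lin_eq_on_span[OF hi lin_zero_map[OF V(2) vsp_base_change[OF p(1)]] jm_image[OF Y s]])
    show "w \<in> vspan (SpK Y) (jm Y ` I)" using w by (simp add: IK uk_def)
    show "?h (iota Y x) = \<zero>\<^bsub>base_change e Q\<^esub>" if "x \<in> jm Y ` I" for x
      using that sub_closed[OF s] iota_jm[OF Y] h(2) qzero semilin_zero[OF semilin_ten[OF p(1), of e]] by auto
  qed
  have iq: "iota C (qK w) = ?h (iota Y w)" if w: "w \<in> carrier (SpK Y)" for w
  proof -
    let ?y = "SOME v. v \<in> qK w"
    have y: "?y \<in> carrier (SpK Y)" "qK ?y = qK w" using someqK[OF w] by auto
    have yx: "?y \<ominus>\<^bsub>SpK Y\<^esub> w \<in> IK" using pK(5)[OF y(1) w] y(2) by simp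
    have "?h (iota Y ?y) = ?h (iota Y w) \<oplus>\<^bsub>base_change e Q\<^esub> ?h (iota Y (?y \<ominus>\<^bsub>SpK Y\<^esub> w))"
      using lin_add[OF hi w sub_closed[OF sK yx]] vminus_add_cancel[OF V(2) y(1) w] by simp
    then show ?thesis
      using hi0[OF yx] vadd_zero_right[OF vsp_base_change[OF p(1)] lin_closed[OF hi w]] by (simp add: C)
  qed
  have li: "lin (SpK C) (base_change e (Sp C)) (iota C)"
  proof -
    have rep: "\<exists>x\<in>carrier (SpK Y). A = qK x" if "A \<in> carrier QK" for A using that pK(3) by blast
    show ?thesis unfolding C(1,3)
    proof (rule linI[OF pK(1) vsp_base_change[OF p(1)]])
      show "iota C A \<in> carrier (base_change e Q)" if "A \<in> carrier QK" for A
        using rep[OF that] iq lin_closed[OF hi] by auto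
      show "iota C (A \<oplus>\<^bsub>QK\<^esub> B) = iota C A \<oplus>\<^bsub>base_change e Q\<^esub> iota C B"
        if A: "A \<in> carrier QK" and B: "B \<in> carrier QK" for A B
      proof -
        obtain x y where "x \<in> carrier (SpK Y)" "A = qK x" "y \<in> carrier (SpK Y)" "B = qK y"
          using rep[OF A] rep[OF B] by blast
        then show ?thesis
          by (simp add: lin_add[OF pK(2), symmetric] iq vadd_closed[OF V(2)] lin_add[OF hi])
      qed
      show "iota C (c \<odot>\<^bsub>QK\<^esub> A) = c \<odot>\<^bsub>base_change e Q\<^esub> iota C A" if A: "A \<in> carrier QK" for c A
      proof -
        obtain x where "x \<in> carrier (SpK Y)" "A = qK x" using rep[OF A] by blast
        then show ?thesis
          by (simp add: lin_smult[OF pK(2), symmetric] iq vsmult_closed[OF V(2)] lin_smult[OF hi])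
      qed
    qed
  qed
  have ij: "iota C (j A) = ten e (Sp C) A" if A: "A \<in> carrier (Sp C)" for A
  proof -
    obtain x where x: "x \<in> carrier (Sp Y)" "A = q x" using A p(3) unfolding C by blast
    show ?thesis unfolding x(2) jq[OF x(1)] iq[OF jm_closed[OF Y x(1)]] iota_jm[OF Y x(1)] h(2)[OF x(1)] C(1) ..
  qed
  have o1: "obj C" by (rule objI(1)[OF P F j li]) (rule ij)
  have o2: "jm C A = j A" if "A \<in> carrier (Sp C)" for A
    by (rule objI(2)[OF P F j li _ that]) (rule ij)
  show "obj C" by (rule o1)
  have mq: "mor Y C q qK"
  proof (rule morI)
    show "lin (Sp Y) (Sp C) q" "lin (SpK Y) (SpK C) qK" unfolding C by (rule p(2) pK(2))+
    show "q (Phi Y v) = Phi C (q v)" if "v \<in> carrier (Sp Y)" for v using phi_q[OF that] by (simp add: C)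
    show "qK (jm Y v) = jm C (q v)" if "v \<in> carrier (Sp Y)" for v
      using o2[of "q v"] lin_closed[OF p(2) that] jq[OF that] by (simp add: C)
  qed (simp add: C)
  have "mstrict Y C qK"
    using sub_subset[OF fm_sub[OF obj_fil[OF Y]]] by (auto simp: mstrict_def C)
  then show "\<exists>q qK. mor Y C q qK \<and> q ` carrier (Sp Y) = carrier (Sp C) \<and> mstrict Y C qK \<and>
    kern (Sp Y) (Sp C) q = fst T ` carrier (Sp X)"
    using mq p(3,4) by (intro exI[of _ q] exI[of _ qK]) (simp add: C I_def)
  show "\<exists>f. inj_on f (carrier (Sp C)) \<and> f ` carrier (Sp C) \<subseteq> carrier (Sp Y)"
  proof (intro exI conjI)
    have *: "(SOME v. v \<in> A) \<in> carrier (Sp Y) \<and> q (SOME v. v \<in> A) = A" if A: "A \<in> carrier Q" for A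
    proof -
      obtain x where "x \<in> carrier (Sp Y)" "A = q x" using A p(3) by blast
      then show ?thesis using someq[of x] by simp
    qed
    show "inj_on (\<lambda>A. SOME v. v \<in> A) (carrier (Sp C))" unfolding C
      by (rule inj_on_inverseI[of _ q], rule conjunct2[OF *])
    show "(\<lambda>A. SOME v. v \<in> A) ` carrier (Sp C) \<subseteq> carrier (Sp Y)" unfolding C
      by (rule image_subsetI, rule conjunct1[OF *])
  qed
  show "\<exists>f. inj_on f (carrier (SpK C)) \<and> f ` carrier (SpK C) \<subseteq> carrier (SpK Y)"
  proof (intro exI conjI)
    have *: "(SOME v. v \<in> A) \<in> carrier (SpK Y) \<and> qK (SOME v. v \<in> A) = A" if A: "A \<in> carrier QK" for A
    proof -
      obtain x where "x \<in> carrier (SpK Y)" "A = qK x" using A pK(3) by blast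
      then show ?thesis using someqK[of x] by simp
    qed
    show "inj_on (\<lambda>A. SOME v. v \<in> A) (carrier (SpK C))" unfolding C
      by (rule inj_on_inverseI[of _ qK], rule conjunct2[OF *])
    show "(\<lambda>A. SOME v. v \<in> A) ` carrier (SpK C) \<subseteq> carrier (SpK Y)" unfolding C
      by (rule image_subsetI, rule conjunct1[OF *])
  qed
qed

lemma wa_strict_ker_coker:
  assumes T: "T \<in> MF_hom e X Y" and wX: "wa X" and wY: "wa Y"
  shows "strict_hom X Y T" "wa (MF_ker e X Y T)" "wa (MF_coker e X Y T)"
proof -
  note X = wa_obj[OF wX] and Y = wa_obj[OF wY]
  note m = hom_mor[OF X Y T]
  note w = wa_mor[OF wX wY m]
  show "strict_hom X Y T" using w(1) by (simp add: mstrict_def strict_hom_def)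
  note k = MF_ker_props[OF X Y m] and c = MF_coker_props[OF X Y m]
  show "wa (MF_ker e X Y T)"
    by (rule wa_embed[OF wX k(1,3) _ k(4)]) (use w(2) k(2) in \<open>auto simp: inj_on_def\<close>)
  obtain q qK where q: "mor Y (MF_coker e X Y T) q qK" "q ` carrier (Sp Y) = carrier (Sp (MF_coker e X Y T))"
    "mstrict Y (MF_coker e X Y T) qK" "kern (Sp Y) (Sp (MF_coker e X Y T)) q = fst T ` carrier (Sp X)"
    using c(2) by blast
  show "wa (MF_coker e X Y T)"
    by (rule wa_quot[OF wY c(1) q(1,2,3)]) (simp add: q(4) w(3))
qed

lemma wa_short_exact:
  assumes "MF_short_exact \<sigma> e X' X X'' S T"
  shows "wa X' \<and> wa X \<longrightarrow> wa X''" "wa X' \<and> wa X'' \<longrightarrow> wa X" "wa X \<and> wa X'' \<longrightarrow> wa X'"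
proof -
  have o: "obj X'" "obj X" "obj X''" and h: "S \<in> MF_hom e X' X" "T \<in> MF_hom e X X''"
    and inj: "inj_on (fst S) (carrier (Sp X'))" and surj: "fst T ` carrier (Sp X) = carrier (Sp X'')"
    and ex: "fst S ` carrier (Sp X') = kern (Sp X) (Sp X'') (fst T)"
    and s: "mstrict X' X (snd S)" "mstrict X X'' (snd T)"
    using assms unfolding MF_short_exact_def MF_simps linear_short_exact_def kern_def mstrict_def strict_hom_def
    by simp_all
  note m = hom_mor[OF o(1,2) h(1)] hom_mor[OF o(2,3) h(2)]
  have d1: "dl X' (carrier (Sp X')) = dl X (kern (Sp X) (Sp X'') (fst T))"
    using dl_embed[OF o(1,2) m(1) inj s(1) stab_carrier[OF o(1)]] ex by simp
  note d2 = dl_quot_carrier[OF o(2,3) m(2) surj s(2)]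
  show "wa X' \<and> wa X \<longrightarrow> wa X''"
    using wa_quot[OF _ o(3) m(2) surj s(2)] d1 wa_zero[of X'] by auto
  show "wa X' \<and> wa X'' \<longrightarrow> wa X"
    using wa_ext[OF o(2) _ _ m(1) inj s(1) m(2) surj s(2) ex] by blast
  show "wa X \<and> wa X'' \<longrightarrow> wa X'"
    using wa_embed[OF _ o(1) m(1) inj s(1)] d2 wa_zero[of X] wa_zero[of X''] ex by auto
qed

end

text \<open>Quotients and direct sums live on other carrier types and are moved back into the given types
  along injections. For direct sums such injections exist because the base fields are infinite.\<close>

definition timg :: "('a, 'v) module \<Rightarrow> ('v \<Rightarrow> 'u) \<Rightarrow> ('a, 'u) module" where
  "timg V f = (let g = inv_into (carrier V) f in
    \<lparr>carrier = f ` carrier V, mult = (\<lambda>_ _. f \<zero>\<^bsub>V\<^esub>), one = f \<zero>\<^bsub>V\<^esub>, zero = f \<zero>\<^bsub>V\<^esub>,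
     add = (\<lambda>x y. f (g x \<oplus>\<^bsub>V\<^esub> g y)), smult = (\<lambda>c x. f (c \<odot>\<^bsub>V\<^esub> g x))\<rparr>)"

lemma timg_lin:
  fixes V :: "('a::field, 'v) module"
  assumes V: "vsp V" and f: "inj_on f (carrier V)"
  shows "lin V (timg V f) f" "f ` carrier V = carrier (timg V f)" "kern V (timg V f) f = {\<zero>\<^bsub>V\<^esub>}"
proof -
  show im: "f ` carrier V = carrier (timg V f)" by (simp add: timg_def Let_def)
  show l: "lin V (timg V f) f"
    by (rule vsp_of_surj(2)[OF V im]) (simp_all add: timg_def Let_def inv_into_f_f[OF f])
  show "kern V (timg V f) f = {\<zero>\<^bsub>V\<^esub>}" using lin_inj_iff[OF l] f by simp
qed

context mf_base
begin

text \<open>The copy is treated as the quotient of \<open>X\<close> by 0, so the results on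
  quotients supply its Frobenius, its filtration and its scalar extension.\<close>

lemma transport:
  fixes X :: "('s, 'v, 'K, 'w) filt_phi" and f :: "'v \<Rightarrow> 'v2" and g :: "'w \<Rightarrow> 'w2"
  assumes X: "obj X" and f: "inj_on f (carrier (Sp X))" and g: "inj_on g (carrier (SpK X))"
  shows "\<exists>Y :: ('s, 'v2, 'K, 'w2) filt_phi. obj Y \<and> mor X Y f g \<and> f ` carrier (Sp X) = carrier (Sp Y) \<and> mstrict X Y g"
proof -
  note t = timg_lin[OF obj_vsp(1)[OF X] f] and tK = timg_lin[OF obj_vsp(2)[OF X] g]
  define \<psi> where "\<psi> y = f (Phi X (inv_into (carrier (Sp X)) f y))" for y
  define j where "j y = g (jm X (inv_into (carrier (Sp X)) f y))" for y
  have \<psi>: "\<psi> (f x) = f (Phi X x)" "j (f x) = g (jm X x)" if "x \<in> carrier (Sp X)" for x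
    using that f by (simp_all add: \<psi>_def j_def)
  have z: "Phi X \<zero>\<^bsub>Sp X\<^esub> = \<zero>\<^bsub>Sp X\<^esub>" using mor_phi[OF mor_zero[OF X X] vzero_closed[OF obj_vsp(1)[OF X]]] by simp
  have P: "phi_module \<sigma> (timg (Sp X) f) \<psi>"
    by (rule phi_module_quot[OF obj_phi[OF X] t(1,2)]) (simp_all add: \<psi> t(3) z)
  have F: "filtered_module (timg (SpK X) g) (\<lambda>i. g ` Fil X i)"
    by (rule filtered_module_image[OF obj_fil[OF X] tK(1,2)])
  have "kern (SpK X) (timg (SpK X) g) g = vspan (SpK X) (jm X ` kern (Sp X) (timg (Sp X) f) f)"
    using uk_trivial[OF X] by (simp add: t(3) tK(3) uk_def)
  from scalar_ext_quot[OF jm_scalar_ext[OF X] t(1,2) tK(1,2) this, of j]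
  have S: "scalar_ext e (timg (Sp X) f) (timg (SpK X) g) j" using \<psi> by simp
  define Y where "Y = mk (timg (Sp X) f) \<psi> (timg (SpK X) g) (\<lambda>i. g ` Fil X i) j"
  note o = mk_obj[OF P F S, folded Y_def]
  have "mor X Y f g"
  proof (rule morI)
    show "g (jm X v) = jm Y (f v)" if "v \<in> carrier (Sp X)" for v
      using o(2)[of "f v"] \<psi>(2)[OF that] lin_closed[OF t(1) that] by simp
  qed (simp_all add: Y_def t tK \<psi>)
  moreover have "mstrict X Y g"
    using sub_subset[OF fm_sub[OF obj_fil[OF X]]] by (auto simp: mstrict_def Y_def)
  ultimately show ?thesis using o(1) t(2) by (intro exI[of _ Y]) (simp add: Y_def)
qed

lemma wa_transport:
  assumes w: "wa X" and Y: "obj Y" and m: "mor X Y f g" and b: "inj_on f (carrier (Sp X))" "f ` carrier (Sp X) = carrier (Sp Y)"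
    and s: "mstrict X Y g"
  shows "wa Y"
proof (rule wa_quot[OF w Y m b(2) s])
  have "kern (Sp X) (Sp Y) f = {\<zero>\<^bsub>Sp X\<^esub>}" using lin_inj_iff[OF mor_lin[OF m]] b(1) by simp
  then show "dl X (kern (Sp X) (Sp Y) f) = 0" using dl_trivial[OF wa_obj[OF w]] by simp
qed

text \<open>A bijective morphism need not be invertible in the category; strictness is what makes
  the inverse respect the filtrations.\<close>

lemma mor_inv:
  assumes X: "obj X" and Y: "obj Y" and m: "mor X Y f g" and b: "inj_on f (carrier (Sp X))" "f ` carrier (Sp X) = carrier (Sp Y)"
    and s: "mstrict X Y g"
  shows "mor Y X (inv_into (carrier (Sp X)) f) (inv_into (carrier (SpK X)) g)"
proof -
  note injK = mor_injK[OF X Y m b(1)] and surjK = mor_surjK[OF X Y m b(2)]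
  have rep: "\<exists>x\<in>carrier (Sp X). y = f x" if "y \<in> carrier (Sp Y)" for y using that b(2) by blast
  show ?thesis
  proof (rule morI)
    show "lin (Sp Y) (Sp X) (inv_into (carrier (Sp X)) f)"
      by (rule lin_inv_into[OF mor_lin[OF m]]) (use b in \<open>simp add: bij_betw_def\<close>)
    show "lin (SpK Y) (SpK X) (inv_into (carrier (SpK X)) g)"
      by (rule lin_inv_into[OF mor_linK[OF m]]) (use injK surjK in \<open>simp add: bij_betw_def\<close>)
    show "inv_into (carrier (Sp X)) f (Phi Y y) = Phi X (inv_into (carrier (Sp X)) f y)"
      and "inv_into (carrier (SpK X)) g (jm Y y) = jm X (inv_into (carrier (Sp X)) f y)"
      if "y \<in> carrier (Sp Y)" for y
      using rep[OF that] b(1) injK obj_phi_props(1)[OF X] jm_closed[OF X]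
      by (auto simp: mor_phi[OF m, symmetric] mor_jm[OF m, symmetric])
    show "inv_into (carrier (SpK X)) g ` Fil Y i \<subseteq> Fil X i" for i
    proof -
      have "Fil Y i \<subseteq> g ` Fil X i"
        using s surjK sub_subset[OF fm_sub[OF obj_fil[OF Y]], of i] by (auto simp: mstrict_def)
      then show ?thesis
        using injK sub_subset[OF fm_sub[OF obj_fil[OF X]], of i] by (auto simp: subset_iff image_iff)
    qed
  qed
qed

end

section \<open>Direct sums of vector spaces\<close>

lemma direct_sum_simps:
  "carrier (direct_sum V W) = carrier V \<times> carrier W" "\<zero>\<^bsub>direct_sum V W\<^esub> = (\<zero>\<^bsub>V\<^esub>, \<zero>\<^bsub>W\<^esub>)"
  "(x, y) \<oplus>\<^bsub>direct_sum V W\<^esub> (x', y') = (x \<oplus>\<^bsub>V\<^esub> x', y \<oplus>\<^bsub>W\<^esub> y')"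
  "c \<odot>\<^bsub>direct_sum V W\<^esub> (x, y) = (c \<odot>\<^bsub>V\<^esub> x, c \<odot>\<^bsub>W\<^esub> y)"
  by (simp_all add: direct_sum_def)

context
  fixes V :: "('a::field, 'v) module" and W :: "('a, 'w) module"
  assumes V: "vsp V" and W: "vsp W"
begin

lemma vsp_direct_sum: "vsp (direct_sum V W)"
  by (rule direct_sum_is_vs[OF V W])

lemma lin_direct_sum:
  "lin (direct_sum V W) V fst" "lin (direct_sum V W) W snd"
  "lin V (direct_sum V W) (\<lambda>x. (x, \<zero>\<^bsub>W\<^esub>))" "lin W (direct_sum V W) (\<lambda>y. (\<zero>\<^bsub>V\<^esub>, y))"
  using V W vsp_direct_sum by (auto intro!: linI simp: direct_sum_simps vsp_simps)

lemma span_direct_sum: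
  assumes A: "A \<subseteq> carrier V" "vspan V A = carrier V" and B: "B \<subseteq> carrier W" "vspan W B = carrier W"
    and S: "(\<lambda>x. (x, \<zero>\<^bsub>W\<^esub>)) ` A \<subseteq> S" "(\<lambda>y. (\<zero>\<^bsub>V\<^esub>, y)) ` B \<subseteq> S" "S \<subseteq> carrier (direct_sum V W)"
  shows "vspan (direct_sum V W) S = carrier (direct_sum V W)"
proof
  note s = sub_span[OF vsp_direct_sum S(3)]
  show "vspan (direct_sum V W) S \<subseteq> carrier (direct_sum V W)" by (rule sub_subset[OF s])
  have 1: "(x, \<zero>\<^bsub>W\<^esub>) \<in> vspan (direct_sum V W) S" if "x \<in> carrier V" for x
    using span_image[OF lin_direct_sum(3) A(1)] span_mono[OF vsp_direct_sum S(1,3)] A(2) that by auto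
  have 2: "(\<zero>\<^bsub>V\<^esub>, y) \<in> vspan (direct_sum V W) S" if "y \<in> carrier W" for y
    using span_image[OF lin_direct_sum(4) B(1)] span_mono[OF vsp_direct_sum S(2,3)] B(2) that by auto
  show "carrier (direct_sum V W) \<subseteq> vspan (direct_sum V W) S"
  proof
    fix z assume "z \<in> carrier (direct_sum V W)"
    then obtain x y where z: "z = (x, y)" "x \<in> carrier V" "y \<in> carrier W" by (auto simp: direct_sum_simps)
    have "z = (x, \<zero>\<^bsub>W\<^esub>) \<oplus>\<^bsub>direct_sum V W\<^esub> (\<zero>\<^bsub>V\<^esub>, y)"
      using z by (simp add: direct_sum_simps vsp_simps[OF V] vsp_simps[OF W])
    then show "z \<in> vspan (direct_sum V W) S" using sub_add[OF s 1[OF z(2)] 2[OF z(3)]] by simp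
  qed
qed

lemma fd_direct_sum: assumes "fd V" "fd W" shows "fd (direct_sum V W)" "vdim (direct_sum V W) = vdim V + vdim W"
proof -
  obtain A where A: "finite A" "vbasis V A" using fd_basis[OF V assms(1)] .
  obtain B where B: "finite B" "vbasis W B" using fd_basis[OF W assms(2)] .
  note bA = basis_props[OF V A(2)] and bB = basis_props[OF W B(2)]
  let ?S = "(\<lambda>x. (x, \<zero>\<^bsub>W\<^esub>)) ` A \<union> (\<lambda>y. (\<zero>\<^bsub>V\<^esub>, y)) ` B"
  have S: "?S \<subseteq> carrier (direct_sum V W)"
    using bA(1) bB(1) vzero_closed[OF V] vzero_closed[OF W] by (auto simp: direct_sum_simps)
  have "vspan (direct_sum V W) ?S = carrier (direct_sum V W)"
    by (rule span_direct_sum[OF bA(1,2) bB(1,2) _ _ S]) auto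
  then show f: "fd (direct_sum V W)"
    unfolding vectorspace.fin_dim_def[OF vsp_direct_sum]
    using A(1) B(1) S by (intro exI[of _ ?S]) auto
  have k: "kern (direct_sum V W) W snd = (\<lambda>x. (x, \<zero>\<^bsub>W\<^esub>)) ` carrier V"
    using vzero_closed[OF W] by (auto simp: kern_def direct_sum_simps)
  have i: "snd ` carrier (direct_sum V W) = carrier W"
    using vzero_closed[OF V] by (force simp: direct_sum_simps)
  have "vdim (on (direct_sum V W) ((\<lambda>x. (x, \<zero>\<^bsub>W\<^esub>)) ` carrier V)) = vdim V"
    using vdim_inj[OF lin_direct_sum(3) assms(1) sub_carrier[OF V]] by (simp add: inj_on_def)
  then show "vdim (direct_sum V W) = vdim V + vdim W"
    using rank_nullity(1)[OF lin_direct_sum(2) f] by (simp add: k i)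
qed

end

text \<open>If \<open>V\<close> is zero, the second projection will do. Otherwise a nonzero vector
  has infinitely many multiples, so the type \<open>'v\<close> is infinite and therefore equipotent
  to its square.\<close>

lemma inj_prod_exists:
  fixes V W :: "('a::field, 'v) module"
  assumes inf: "infinite (UNIV :: 'a set)" and V: "vsp V" and W: "vsp W"
  shows "\<exists>f :: 'v \<times> 'v \<Rightarrow> 'v. inj_on f (carrier V \<times> carrier W)"
proof (cases "carrier V = {\<zero>\<^bsub>V\<^esub>}")
  case True
  then show ?thesis by (intro exI[of _ snd]) (auto simp: inj_on_def)
next
  case False
  then obtain x where x: "x \<in> carrier V" "x \<noteq> \<zero>\<^bsub>V\<^esub>" using vzero_closed[OF V] by blast
  have "inj (\<lambda>c. c \<odot>\<^bsub>V\<^esub> x)"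
  proof (rule injI, rule ccontr)
    fix c d assume eq: "c \<odot>\<^bsub>V\<^esub> x = d \<odot>\<^bsub>V\<^esub> x" and ne: "c \<noteq> d"
    have "(c - d) \<odot>\<^bsub>V\<^esub> x = c \<odot>\<^bsub>V\<^esub> x \<oplus>\<^bsub>V\<^esub> (-1) \<odot>\<^bsub>V\<^esub> (d \<odot>\<^bsub>V\<^esub> x)"
      using vadd_smult[OF V x(1), of c "- d"] by (simp add: vsmult_smult[OF V x(1)])
    also have "\<dots> = \<zero>\<^bsub>V\<^esub>"
      unfolding eq using vneg_right[OF V] vneg_eq_smult[OF V] vsmult_closed[OF V x(1)] by metis
    finally have "(1 / (c - d)) \<odot>\<^bsub>V\<^esub> ((c - d) \<odot>\<^bsub>V\<^esub> x) = \<zero>\<^bsub>V\<^esub>" by (simp add: vsmult_zero_right[OF V])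
    then show False using x ne by (simp add: vsmult_smult[OF V x(1)] vsmult_one[OF V x(1)])
  qed
  then have "infinite (range (\<lambda>c. c \<odot>\<^bsub>V\<^esub> x))" using inf finite_imageD by blast
  then have "infinite (UNIV :: 'v set)" using finite_subset[OF subset_UNIV] by blast
  from card_of_Times_same_infinite[OF this] obtain f :: "'v \<times> 'v \<Rightarrow> 'v" where "bij_betw f (UNIV \<times> UNIV) UNIV"
    using card_of_ordIso[of "UNIV \<times> UNIV :: ('v \<times> 'v) set" "UNIV :: 'v set"] by auto
  then show ?thesis by (intro exI[of _ f]) (auto simp: bij_betw_def intro: inj_on_subset)
qed

context mf_base
begin

interpretation \<sigma>: field_hom \<sigma> by (rule \<sigma>)
interpretation e: field_hom e by (rule e)

text \<open>Besides the structure maps the conclusion records strictness of the first injection and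
  of the second projection, which exhibit \<open>D\<close> as an extension of \<open>B\<close> by
  \<open>A\<close>, and the formula by which the two idempotents of the biproduct add up to the
  identity.\<close>

lemma direct_sum_obj:
  assumes A: "obj A" and B: "obj B"
  shows "\<exists>D. obj D \<and> carrier (Sp D) = carrier (Sp A) \<times> carrier (Sp B) \<and>
    carrier (SpK D) = carrier (SpK A) \<times> carrier (SpK B) \<and>
    mor A D (\<lambda>x. (x, \<zero>\<^bsub>Sp B\<^esub>)) (\<lambda>x. (x, \<zero>\<^bsub>SpK B\<^esub>)) \<and> mor B D (\<lambda>y. (\<zero>\<^bsub>Sp A\<^esub>, y)) (\<lambda>y. (\<zero>\<^bsub>SpK A\<^esub>, y)) \<and>
    mor D A fst fst \<and> mor D B snd snd \<and> mstrict A D (\<lambda>x. (x, \<zero>\<^bsub>SpK B\<^esub>)) \<and> mstrict D B snd \<and>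
    (\<forall>x\<in>carrier (Sp A). \<forall>y\<in>carrier (Sp B). (x, \<zero>\<^bsub>Sp B\<^esub>) \<oplus>\<^bsub>Sp D\<^esub> (\<zero>\<^bsub>Sp A\<^esub>, y) = (x, y))"
proof -
  note vA = obj_vsp[OF A] and vB = obj_vsp[OF B]
  let ?V = "direct_sum (Sp A) (Sp B)" and ?W = "direct_sum (SpK A) (SpK B)"
  let ?F = "\<lambda>i. Fil A i \<times> Fil B i"
  note z = vzero_closed[OF vA(1)] vzero_closed[OF vA(2)] vzero_closed[OF vB(1)] vzero_closed[OF vB(2)]
  have zz: "Phi X \<zero>\<^bsub>Sp X\<^esub> = \<zero>\<^bsub>Sp X\<^esub>" "jm X \<zero>\<^bsub>Sp X\<^esub> = \<zero>\<^bsub>SpK X\<^esub>" if X: "obj X" for X :: "('s, 'x, 'K, 'y) filt_phi"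
    using mor_phi[OF mor_zero[OF X X] vzero_closed[OF obj_vsp(1)[OF X]]] semilin_zero[OF jm_semilin[OF X]] by simp_all
  have P: "phi_module \<sigma> ?V (map_prod (Phi A) (Phi B))"
    unfolding phi_module_def
  proof (intro conjI ballI allI)
    show "vsp ?V" by (rule vsp_direct_sum[OF vA(1) vB(1)])
    show "fd ?V" by (rule fd_direct_sum(1)[OF vA(1) vB(1) obj_fd(1)[OF A] obj_fd(1)[OF B]])
    show "bij_betw (map_prod (Phi A) (Phi B)) (carrier ?V) (carrier ?V)"
      unfolding direct_sum_simps using obj_phi_props(2,3)[OF A] obj_phi_props(2,3)[OF B]
      by (intro bij_betw_map_prod) (simp_all add: bij_betw_def)
  qed (auto simp: direct_sum_simps obj_phi_props[OF A] obj_phi_props[OF B])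
  have F: "filtered_module ?W ?F"
  proof (rule filtered_moduleI[OF vsp_direct_sum[OF vA(2) vB(2)] fd_direct_sum(1)[OF vA(2) vB(2) obj_fd(2)[OF A] obj_fd(2)[OF B]]])
    note fA = obj_fil[OF A] and fB = obj_fil[OF B]
    show "sub (?F i) ?W" for i
      using fm_sub[OF fA, of i] fm_sub[OF fB, of i]
      by (intro subI[OF vsp_direct_sum[OF vA(2) vB(2)]]) (auto simp: direct_sum_simps sub_iff)
    show "?F j \<subseteq> ?F i" if "i < j" for i j
      using fm_anti[OF fA less_imp_le[OF that]] fm_anti[OF fB less_imp_le[OF that]] by (rule Sigma_mono)
    show "(\<Union>i. ?F i) = carrier ?W"
    proof
      show "(\<Union>i. ?F i) \<subseteq> carrier ?W"
        using sub_subset[OF fm_sub[OF fA]] sub_subset[OF fm_sub[OF fB]] by (auto simp: direct_sum_simps)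
      obtain a b where "Fil A a = carrier (SpK A)" "Fil B b = carrier (SpK B)"
        using fm_left_end[OF fA] fm_left_end[OF fB] by blast
      then have "carrier ?W \<subseteq> ?F (min a b)"
        using fm_anti[OF fA, of "min a b" a] fm_anti[OF fB, of "min a b" b] by (auto simp: direct_sum_simps)
      then show "carrier ?W \<subseteq> (\<Union>i. ?F i)" by blast
    qed
    have dist: "(\<Inter>i\<in>I. ?F i) = (\<Inter>i\<in>I. Fil A i) \<times> (\<Inter>i\<in>I. Fil B i)" if "I \<noteq> {}" for I
      using that by blast
    show "(\<Inter>i. ?F i) = {\<zero>\<^bsub>?W\<^esub>}"
      using dist[of UNIV] by (simp add: fm_Inter[OF fA] fm_Inter[OF fB] direct_sum_simps)
    show "?F i = (\<Inter>j\<in>{..<i}. ?F j)" for i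
    proof -
      have "i - 1 \<in> {..<i}" by simp
      then have "{..<i} \<noteq> {}" by blast
      from dist[OF this] show ?thesis by (simp only: fm_left[OF fA, of i, symmetric] fm_left[OF fB, of i, symmetric])
    qed
  qed
  have S: "scalar_ext e ?V ?W (map_prod (jm A) (jm B))"
    unfolding scalar_ext_def
  proof (intro conjI)
    show "semilin e ?V ?W (map_prod (jm A) (jm B))"
      using semilin_add[OF jm_semilin[OF A]] semilin_add[OF jm_semilin[OF B]] semilin_smult[OF jm_semilin[OF A]]
        semilin_smult[OF jm_semilin[OF B]] jm_closed[OF A] jm_closed[OF B]
      by (intro semilinI vsp_direct_sum vA vB) (auto simp: direct_sum_simps)
    show "fd ?V" "fd ?W" using fd_direct_sum(1) vA vB obj_fd[OF A] obj_fd[OF B] by auto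
    show "vdim ?W = vdim ?V"
      using fd_direct_sum(2)[OF vA(1) vB(1) obj_fd(1)[OF A] obj_fd(1)[OF B]]
        fd_direct_sum(2)[OF vA(2) vB(2) obj_fd(2)[OF A] obj_fd(2)[OF B]]
        scalar_ext_dim[OF jm_scalar_ext[OF A]] scalar_ext_dim[OF jm_scalar_ext[OF B]] by simp
    show "vspan ?W (map_prod (jm A) (jm B) ` carrier ?V) = carrier ?W"
    proof (rule span_direct_sum[OF vA(2) vB(2) _ scalar_ext_span[OF jm_scalar_ext[OF A]] _ scalar_ext_span[OF jm_scalar_ext[OF B]]])
      show "jm A ` carrier (Sp A) \<subseteq> carrier (SpK A)" "jm B ` carrier (Sp B) \<subseteq> carrier (SpK B)"
        using jm_closed[OF A] jm_closed[OF B] by auto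
      show "map_prod (jm A) (jm B) ` carrier ?V \<subseteq> carrier ?W"
        using jm_closed[OF A] jm_closed[OF B] by (auto simp: direct_sum_simps)
      show "(\<lambda>x. (x, \<zero>\<^bsub>SpK B\<^esub>)) ` jm A ` carrier (Sp A) \<subseteq> map_prod (jm A) (jm B) ` carrier ?V"
        using z zz[OF B] by (force simp: direct_sum_simps image_iff)
      show "(\<lambda>y. (\<zero>\<^bsub>SpK A\<^esub>, y)) ` jm B ` carrier (Sp B) \<subseteq> map_prod (jm A) (jm B) ` carrier ?V"
        using z zz[OF A] by (force simp: direct_sum_simps image_iff)
    qed
  qed
  define D where "D = mk ?V (map_prod (Phi A) (Phi B)) ?W ?F (map_prod (jm A) (jm B))"
  note o = mk_obj[OF P F S, folded D_def]
  have D: "Sp D = ?V" "Phi D = map_prod (Phi A) (Phi B)" "SpK D = ?W" "Fil D = ?F" by (simp_all add: D_def)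
  have jD: "jm D (x, y) = (jm A x, jm B y)" if "x \<in> carrier (Sp A)" "y \<in> carrier (Sp B)" for x y
    using o(2)[of "(x, y)"] that by (simp add: direct_sum_simps)
  note f0 = sub_zero[OF fm_sub[OF obj_fil[OF A]]] sub_zero[OF fm_sub[OF obj_fil[OF B]]]
  show ?thesis
  proof (intro exI[of _ D] conjI ballI)
    show "obj D" by (rule o(1))
    show "mor A D (\<lambda>x. (x, \<zero>\<^bsub>Sp B\<^esub>)) (\<lambda>x. (x, \<zero>\<^bsub>SpK B\<^esub>))"
      by (rule morI) (use lin_direct_sum(3)[OF vA(1) vB(1)] lin_direct_sum(3)[OF vA(2) vB(2)] zz[OF B] jD z f0 in \<open>auto simp: D\<close>)
    show "mor B D (\<lambda>y. (\<zero>\<^bsub>Sp A\<^esub>, y)) (\<lambda>y. (\<zero>\<^bsub>SpK A\<^esub>, y))"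
      by (rule morI) (use lin_direct_sum(4)[OF vA(1) vB(1)] lin_direct_sum(4)[OF vA(2) vB(2)] zz[OF A] jD z f0 in \<open>auto simp: D\<close>)
    show "mor D A fst fst"
      by (rule morI) (use lin_direct_sum(1)[OF vA(1) vB(1)] lin_direct_sum(1)[OF vA(2) vB(2)] jD in \<open>auto simp: D direct_sum_simps\<close>)
    show "mor D B snd snd"
      by (rule morI) (use lin_direct_sum(2)[OF vA(1) vB(1)] lin_direct_sum(2)[OF vA(2) vB(2)] jD in \<open>auto simp: D direct_sum_simps\<close>)
    show "mstrict A D (\<lambda>x. (x, \<zero>\<^bsub>SpK B\<^esub>))"
      using f0 by (auto simp: mstrict_def D intro: sub_closed[OF fm_sub[OF obj_fil[OF A]]])
    show "mstrict D B snd"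
      unfolding mstrict_def D direct_sum_simps
    proof
      fix i
      have "snd ` (Fil A i \<times> Fil B i) = Fil B i" using f0 by force
      moreover have "snd ` (carrier (SpK A) \<times> carrier (SpK B)) = carrier (SpK B)" using z by force
      ultimately show "snd ` (Fil A i \<times> Fil B i) = snd ` (carrier (SpK A) \<times> carrier (SpK B)) \<inter> Fil B i"
        using sub_subset[OF fm_sub[OF obj_fil[OF B]]] by blast
    qed
    show "carrier (Sp D) = carrier (Sp A) \<times> carrier (Sp B)" "carrier (SpK D) = carrier (SpK A) \<times> carrier (SpK B)"
      by (simp_all add: D direct_sum_simps)
    show "(x, \<zero>\<^bsub>Sp B\<^esub>) \<oplus>\<^bsub>Sp D\<^esub> (\<zero>\<^bsub>Sp A\<^esub>, y) = (x, y)" if "x \<in> carrier (Sp A)" "y \<in> carrier (Sp B)" for x y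
      using that by (simp add: D direct_sum_simps vsp_simps[OF vA(1)] vsp_simps[OF vB(1)])
  qed
qed

subsection \<open>The additive structure\<close>

definition comp where
  "comp X g f = (compose (carrier (Sp X)) (fst g) (fst f), compose (carrier (SpK X)) (snd g) (snd f))"

definition madd where
  "madd X Y f g = (\<lambda>v\<in>carrier (Sp X). fst f v \<oplus>\<^bsub>Sp Y\<^esub> fst g v, \<lambda>w\<in>carrier (SpK X). snd f w \<oplus>\<^bsub>SpK Y\<^esub> snd g w)"

definition mzero where
  "mzero X Y = rmor X (\<lambda>v. \<zero>\<^bsub>Sp Y\<^esub>) (\<lambda>w. \<zero>\<^bsub>SpK Y\<^esub>)"

definition mneg where
  "mneg X Y f = rmor X (\<lambda>v. (-1) \<odot>\<^bsub>Sp Y\<^esub> fst f v) (\<lambda>w. (-1) \<odot>\<^bsub>SpK Y\<^esub> snd f w)"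

lemma fst_hom_simps:
  "v \<in> carrier (Sp X) \<Longrightarrow> fst (comp X g f) v = fst g (fst f v)"
  "v \<in> carrier (Sp X) \<Longrightarrow> fst (madd X Y f g) v = fst f v \<oplus>\<^bsub>Sp Y\<^esub> fst g v"
  "v \<in> carrier (Sp X) \<Longrightarrow> fst (mzero X Y) v = \<zero>\<^bsub>Sp Y\<^esub>"
  "v \<in> carrier (Sp X) \<Longrightarrow> fst (mneg X Y f) v = (-1) \<odot>\<^bsub>Sp Y\<^esub> fst f v"
  "v \<in> carrier (Sp X) \<Longrightarrow> fst (rmor X T TK) v = T v"
  by (simp_all add: comp_def madd_def mzero_def mneg_def rmor_def compose_def)

context
  fixes X Y :: "('s, 'v, 'K, 'w) filt_phi"
  assumes X: "obj X" and Y: "obj Y"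
begin

lemma comp_hom: "obj Z \<Longrightarrow> f \<in> MF_hom e X Y \<Longrightarrow> g \<in> MF_hom e Y Z \<Longrightarrow> comp X g f \<in> MF_hom e X Z"
  using rmor_hom[OF X _ mor_comp[OF hom_mor[OF X Y] hom_mor[OF Y]], of Z f g]
  by (simp add: comp_def rmor_def compose_def)

lemma madd_hom:
  assumes f: "f \<in> MF_hom e X Y" and g: "g \<in> MF_hom e X Y"
  shows "madd X Y f g \<in> MF_hom e X Y"
proof -
  note m = hom_mor[OF X Y f] hom_mor[OF X Y g]
  note V = obj_vsp[OF Y]
  have "mor X Y (\<lambda>v. fst f v \<oplus>\<^bsub>Sp Y\<^esub> fst g v) (\<lambda>w. snd f w \<oplus>\<^bsub>SpK Y\<^esub> snd g w)"
  proof (rule morI)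
    show "lin (Sp X) (Sp Y) (\<lambda>v. fst f v \<oplus>\<^bsub>Sp Y\<^esub> fst g v)"
      using mor_lin[OF m(1)] mor_lin[OF m(2)]
      by (intro linI obj_vsp X Y) (simp_all add: lin_closed vsp_closed[OF V(1)] lin_add lin_smult vsp_ac[OF V(1)] vsmult_add[OF V(1)])
    show "lin (SpK X) (SpK Y) (\<lambda>v. snd f v \<oplus>\<^bsub>SpK Y\<^esub> snd g v)"
      using mor_linK[OF m(1)] mor_linK[OF m(2)]
      by (intro linI obj_vsp X Y) (simp_all add: lin_closed vsp_closed[OF V(2)] lin_add lin_smult vsp_ac[OF V(2)] vsmult_add[OF V(2)])
    show "fst f (Phi X v) \<oplus>\<^bsub>Sp Y\<^esub> fst g (Phi X v) = Phi Y (fst f v \<oplus>\<^bsub>Sp Y\<^esub> fst g v)"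
      "snd f (jm X v) \<oplus>\<^bsub>SpK Y\<^esub> snd g (jm X v) = jm Y (fst f v \<oplus>\<^bsub>Sp Y\<^esub> fst g v)"
      if "v \<in> carrier (Sp X)" for v
      using that by (simp_all add: mor_phi[OF m(1)] mor_phi[OF m(2)] mor_jm[OF m(1)] mor_jm[OF m(2)]
          obj_phi_props(4)[OF Y] semilin_add[OF jm_semilin[OF Y]] lin_closed[OF mor_lin[OF m(1)]] lin_closed[OF mor_lin[OF m(2)]])
    show "(\<lambda>w. snd f w \<oplus>\<^bsub>SpK Y\<^esub> snd g w) ` Fil X i \<subseteq> Fil Y i" for i
      using mor_fil[OF m(1), of i] mor_fil[OF m(2), of i] sub_add[OF fm_sub[OF obj_fil[OF Y]], of _ i] by (auto simp: image_subset_iff)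
  qed
  from rmor_hom[OF X Y this] show ?thesis by (simp add: madd_def rmor_def)
qed

lemma mzero_hom: "mzero X Y \<in> MF_hom e X Y"
  unfolding mzero_def by (rule rmor_hom[OF X Y mor_zero[OF X Y]])

lemma mneg_hom:
  assumes f: "f \<in> MF_hom e X Y" shows "mneg X Y f \<in> MF_hom e X Y"
proof -
  note m = hom_mor[OF X Y f]
  note V = obj_vsp[OF Y]
  have "mor X Y (\<lambda>v. (-1) \<odot>\<^bsub>Sp Y\<^esub> fst f v) (\<lambda>w. (-1) \<odot>\<^bsub>SpK Y\<^esub> snd f w)"
  proof (rule morI)
    show "lin (Sp X) (Sp Y) (\<lambda>v. (-1) \<odot>\<^bsub>Sp Y\<^esub> fst f v)"
      using mor_lin[OF m]
      by (intro linI obj_vsp X Y) (simp_all add: lin_closed vsp_closed[OF V(1)] lin_add lin_smult vsmult_smult[OF V(1)] vsmult_add[OF V(1)])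
    show "lin (SpK X) (SpK Y) (\<lambda>w. (-1) \<odot>\<^bsub>SpK Y\<^esub> snd f w)"
      using mor_linK[OF m]
      by (intro linI obj_vsp X Y) (simp_all add: lin_closed vsp_closed[OF V(2)] lin_add lin_smult vsmult_smult[OF V(2)] vsmult_add[OF V(2)])
    show "(-1) \<odot>\<^bsub>Sp Y\<^esub> fst f (Phi X v) = Phi Y ((-1) \<odot>\<^bsub>Sp Y\<^esub> fst f v)"
      "(-1) \<odot>\<^bsub>SpK Y\<^esub> snd f (jm X v) = jm Y ((-1) \<odot>\<^bsub>Sp Y\<^esub> fst f v)"
      if "v \<in> carrier (Sp X)" for v
      using that by (simp_all add: mor_phi[OF m] mor_jm[OF m] obj_phi_props(5)[OF Y] semilin_smult[OF jm_semilin[OF Y]]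
          lin_closed[OF mor_lin[OF m]] \<sigma>.hom_uminus e.hom_uminus)
    show "(\<lambda>w. (-1) \<odot>\<^bsub>SpK Y\<^esub> snd f w) ` Fil X i \<subseteq> Fil Y i" for i
      using mor_fil[OF m, of i] sub_smult[OF fm_sub[OF obj_fil[OF Y]], of _ i] by (auto simp: image_subset_iff)
  qed
  from rmor_hom[OF X Y this] show ?thesis by (simp add: mneg_def)
qed

lemma hom_closed: "f \<in> MF_hom e X Y \<Longrightarrow> v \<in> carrier (Sp X) \<Longrightarrow> fst f v \<in> carrier (Sp Y)"
  by (rule lin_closed[OF mor_lin[OF hom_mor[OF X Y]]])

lemma hom_add: "f \<in> MF_hom e X Y \<Longrightarrow> u \<in> carrier (Sp X) \<Longrightarrow> v \<in> carrier (Sp X) \<Longrightarrow>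
    fst f (u \<oplus>\<^bsub>Sp X\<^esub> v) = fst f u \<oplus>\<^bsub>Sp Y\<^esub> fst f v"
  by (rule lin_add[OF mor_lin[OF hom_mor[OF X Y]]])

text \<open>By \<open>hom_eqI'\<close> each law only has to be checked on first components, where it
  is an identity in the target space.\<close>

lemma hom_comm_group: "comm_group \<lparr>carrier = MF_hom e X Y, mult = madd X Y, one = mzero X Y\<rparr>"
proof (rule comm_groupI)
  note V = obj_vsp(1)[OF Y]
  fix f g h
  assume "f \<in> carrier \<lparr>carrier = MF_hom e X Y, mult = madd X Y, one = mzero X Y\<rparr>"
  then have f: "f \<in> MF_hom e X Y" by simp
  show "\<one>\<^bsub>\<lparr>carrier = MF_hom e X Y, mult = madd X Y, one = mzero X Y\<rparr>\<^esub> \<otimes>\<^bsub>\<lparr>carrier = MF_hom e X Y, mult = madd X Y, one = mzero X Y\<rparr>\<^esub> f = f"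
    using f by (auto intro!: hom_eqI'[OF X Y] madd_hom mzero_hom simp: fst_hom_simps hom_closed vsp_simps[OF V])
  show "\<exists>y\<in>carrier \<lparr>carrier = MF_hom e X Y, mult = madd X Y, one = mzero X Y\<rparr>.
     y \<otimes>\<^bsub>\<lparr>carrier = MF_hom e X Y, mult = madd X Y, one = mzero X Y\<rparr>\<^esub> f = \<one>\<^bsub>\<lparr>carrier = MF_hom e X Y, mult = madd X Y, one = mzero X Y\<rparr>\<^esub>"
  proof (rule bexI[of _ "mneg X Y f"])
    have "madd X Y (mneg X Y f) f = mzero X Y"
      using vneg_left[OF V] vneg_eq_smult[OF V] hom_closed[OF f]
      by (intro hom_eqI'[OF X Y] madd_hom mneg_hom mzero_hom f) (simp add: fst_hom_simps)
    then show "mneg X Y f \<otimes>\<^bsub>\<lparr>carrier = MF_hom e X Y, mult = madd X Y, one = mzero X Y\<rparr>\<^esub> f = \<one>\<^bsub>\<lparr>carrier = MF_hom e X Y, mult = madd X Y, one = mzero X Y\<rparr>\<^esub>" by simp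
  qed (simp add: mneg_hom[OF f])
  assume "g \<in> carrier \<lparr>carrier = MF_hom e X Y, mult = madd X Y, one = mzero X Y\<rparr>"
  then have g: "g \<in> MF_hom e X Y" by simp
  show "f \<otimes>\<^bsub>\<lparr>carrier = MF_hom e X Y, mult = madd X Y, one = mzero X Y\<rparr>\<^esub> g \<in> carrier \<lparr>carrier = MF_hom e X Y, mult = madd X Y, one = mzero X Y\<rparr>"
    using madd_hom[OF f g] by simp
  have "madd X Y f g = madd X Y g f"
    by (intro hom_eqI'[OF X Y] madd_hom f g) (simp add: fst_hom_simps vadd_comm[OF V] hom_closed[OF f] hom_closed[OF g])
  then show "f \<otimes>\<^bsub>\<lparr>carrier = MF_hom e X Y, mult = madd X Y, one = mzero X Y\<rparr>\<^esub> g = g \<otimes>\<^bsub>\<lparr>carrier = MF_hom e X Y, mult = madd X Y, one = mzero X Y\<rparr>\<^esub> f" by simp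
  assume "h \<in> carrier \<lparr>carrier = MF_hom e X Y, mult = madd X Y, one = mzero X Y\<rparr>"
  then have h: "h \<in> MF_hom e X Y" by simp
  have "madd X Y (madd X Y f g) h = madd X Y f (madd X Y g h)"
    by (intro hom_eqI'[OF X Y] madd_hom f g h)
      (simp add: fst_hom_simps vadd_assoc[OF V] hom_closed[OF f] hom_closed[OF g] hom_closed[OF h])
  then show "(f \<otimes>\<^bsub>\<lparr>carrier = MF_hom e X Y, mult = madd X Y, one = mzero X Y\<rparr>\<^esub> g) \<otimes>\<^bsub>\<lparr>carrier = MF_hom e X Y, mult = madd X Y, one = mzero X Y\<rparr>\<^esub> h =
    f \<otimes>\<^bsub>\<lparr>carrier = MF_hom e X Y, mult = madd X Y, one = mzero X Y\<rparr>\<^esub> (g \<otimes>\<^bsub>\<lparr>carrier = MF_hom e X Y, mult = madd X Y, one = mzero X Y\<rparr>\<^esub> h)" by simp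
qed (simp add: mzero_hom)

end

lemma preadditive_MF:
  fixes P :: "('s, 'v, 'K, 'w) filt_phi \<Rightarrow> bool"
  shows "preadditive (full_subcategory (MF \<sigma> e) P) madd mzero"
  unfolding preadditive_def category_def MF_simps comp_def[symmetric]
proof (intro conjI ballI)
  fix A assume "A \<in> {X. obj X \<and> P X}"
  then have A: "obj A" by simp
  have ide: "(\<lambda>v\<in>carrier (Sp A). v, \<lambda>w\<in>carrier (SpK A). w) = rmor A (\<lambda>v. v) (\<lambda>w. w)" by (simp add: rmor_def)
  have ideA: "rmor A (\<lambda>v. v) (\<lambda>w. w) \<in> MF_hom e A A" by (rule rmor_hom[OF A A mor_id[OF A]])
  then show "(\<lambda>v\<in>carrier (Sp A). v, \<lambda>w\<in>carrier (SpK A). w) \<in> MF_hom e A A" by (simp add: ide)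
  fix B assume "B \<in> {X. obj X \<and> P X}"
  then have B: "obj B" by simp
  have ideB: "rmor B (\<lambda>v. v) (\<lambda>w. w) \<in> MF_hom e B B" by (rule rmor_hom[OF B B mor_id[OF B]])
  show "comm_group \<lparr>carrier = MF_hom e A B, mult = madd A B, one = mzero A B\<rparr>" by (rule hom_comm_group[OF A B])
  {
    fix f assume f: "f \<in> MF_hom e A B"
    show "comp A f (\<lambda>v\<in>carrier (Sp A). v, \<lambda>w\<in>carrier (SpK A). w) = f" unfolding ide
      by (intro hom_eqI'[OF A B] comp_hom[OF A A B] ideA f) (simp add: fst_hom_simps)
    show "comp A (\<lambda>v\<in>carrier (Sp B). v, \<lambda>w\<in>carrier (SpK B). w) f = f"
      using hom_eqI'[OF A B comp_hom[OF A B B f ideB] f] hom_closed[OF A B f]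
      by (simp add: fst_hom_simps rmor_def)
  }
  fix D assume "D \<in> {X. obj X \<and> P X}"
  then have D: "obj D" by simp
  {
    fix f f' g assume h: "f \<in> MF_hom e A B" "f' \<in> MF_hom e A B" "g \<in> MF_hom e B D"
    show "comp A g (madd A B f f') = madd A D (comp A g f) (comp A g f')"
      by (intro hom_eqI'[OF A D] comp_hom[OF A B D] madd_hom[OF A B] madd_hom[OF A D] h)
        (simp add: fst_hom_simps hom_closed[OF A B] h hom_add[OF B D])
  }
  {
    fix f g g' assume h: "f \<in> MF_hom e A B" "g \<in> MF_hom e B D" "g' \<in> MF_hom e B D"
    show "comp A (madd B D g g') f = madd A D (comp A g f) (comp A g' f)"
      by (intro hom_eqI'[OF A D] comp_hom[OF A B D] madd_hom[OF B D] madd_hom[OF A D] h)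
        (simp add: fst_hom_simps hom_closed[OF A B] h)
  }
  fix f g assume f: "f \<in> MF_hom e A B"
  show "comp A g f \<in> MF_hom e A D" if g: "g \<in> MF_hom e B D" by (rule comp_hom[OF A B D f g])
next
  fix A B D E f g h assume "A \<in> {X. obj X \<and> P X}" "B \<in> {X. obj X \<and> P X}" "D \<in> {X. obj X \<and> P X}" "E \<in> {X. obj X \<and> P X}"
    and h: "f \<in> MF_hom e A B" "g \<in> MF_hom e B D" "h \<in> MF_hom e D E"
  then have o: "obj A" "obj B" "obj D" "obj E" by simp_all
  show "comp A h (comp A g f) = comp A (comp B h g) f"
    by (intro hom_eqI'[OF o(1,4)] comp_hom[OF o(1,3,4)] comp_hom[OF o(1,2,3)] comp_hom[OF o(1,2,4)] comp_hom[OF o(2,3,4)] h)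
      (simp add: fst_hom_simps hom_closed[OF o(1,2)] h)
qed

end

section \<open>The abelian category of weakly admissible modules\<close>

definition triv :: "'v \<Rightarrow> ('a, 'v) module" where
  "triv x = \<lparr>carrier = {x}, mult = (\<lambda>_ _. x), one = x, zero = x, add = (\<lambda>_ _. x), smult = (\<lambda>_ _. x)\<rparr>"

lemma vsp_triv: "vsp (triv x :: ('a::field, 'v) module)"
  by (rule vspI) (auto simp: triv_def)

lemma triv_dim: "fd (triv x :: ('a::field, 'v) module)" "vdim (triv x :: ('a::field, 'v) module) = 0"
proof -
  let ?V = "triv x :: ('a, 'v) module"
  interpret vectorspace class_ring ?V by (rule vsp_triv)
  have "on ?V {\<zero>\<^bsub>?V\<^esub>} = ?V" by (simp add: triv_def)
  moreover have "vdim (on ?V {\<zero>\<^bsub>?V\<^esub>}) = 0" by (rule vdim_trivial) (rule vsp_triv)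
  ultimately show "vdim ?V = 0" by (simp only:)
  have "span {} = carrier ?V" using span_empty by (simp add: triv_def)
  then show "fd ?V" unfolding fin_dim_def by (intro exI[of _ "{}"]) simp
qed

context mf_base
begin

interpretation \<sigma>: field_hom \<sigma> by (rule \<sigma>)

text \<open>The carrier types are arbitrary, so the zero spaces are placed on one unspecified
  element of each. The only stable subspace is 0, and its \<delta> vanishes.\<close>

lemma zero_obj:
  "\<exists>Z :: ('s, 'v, 'K, 'w) filt_phi. wa Z \<and> carrier (Sp Z) = {\<zero>\<^bsub>Sp Z\<^esub>}"
proof -
  define V :: "('s, 'v) module" where "V = triv undefined"
  define W :: "('K, 'w) module" where "W = triv undefined"
  have V: "vsp V" "fd V" "vdim V = 0" "carrier V = {\<zero>\<^bsub>V\<^esub>}"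
    unfolding V_def by (simp_all add: vsp_triv triv_dim) (simp add: triv_def)
  have W: "vsp W" "fd W" "vdim W = 0" "carrier W = {\<zero>\<^bsub>W\<^esub>}"
    unfolding W_def by (simp_all add: vsp_triv triv_dim) (simp add: triv_def)
  have P: "phi_module \<sigma> V (\<lambda>v. v)"
    unfolding phi_module_def using V by (auto simp: bij_betw_def vsp_simps[OF V(1)])
  have F: "filtered_module W (\<lambda>_. carrier W)"
  proof (rule filtered_moduleI[OF W(1,2)])
    show "carrier W = (\<Inter>j\<in>{..<i}. carrier W)" for i :: real
    proof -
      have "i - 1 \<in> {..<i}" by simp
      then show ?thesis by blast
    qed
  qed (use W sub_carrier[OF W(1)] in auto)
  have S: "scalar_ext e V W (\<lambda>_. \<zero>\<^bsub>W\<^esub>)"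
    unfolding scalar_ext_def using V W span_sub[OF sub_carrier[OF W(1)]]
    by (auto intro!: semilinI simp: vsp_simps[OF W(1)])
  define Z where "Z = mk V (\<lambda>v. v) W (\<lambda>_. carrier W) (\<lambda>_. \<zero>\<^bsub>W\<^esub>)"
  have o: "obj Z" unfolding Z_def by (rule mk_obj(1)[OF P F S])
  have c: "carrier (Sp Z) = {\<zero>\<^bsub>Sp Z\<^esub>}" using V(4) by (simp add: Z_def)
  have d: "dl Z U = 0" if "stab Z U" for U
  proof -
    have "U = {\<zero>\<^bsub>Sp Z\<^esub>}"
      using sub_subset[OF stab_sub[OF that]] sub_zero[OF stab_sub[OF that]] c by blast
    then show ?thesis by (simp only: dl_trivial[OF o])
  qed
  have "wa Z" unfolding wa_iff
  proof (intro conjI allI impI)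
    show "obj Z" by (rule o)
    show "dl Z (carrier (Sp Z)) = 0" by (rule d[OF stab_carrier[OF o]])
    show "0 \<le> dl Z U" if "stab Z U" for U by (rule eq_refl[OF d[OF that, symmetric]])
  qed
  then show ?thesis using c by blast
qed

lemma zero_obj_is_zero:
  fixes Z :: "('s, 'v, 'K, 'w) filt_phi"
  assumes Z: "wa Z" "carrier (Sp Z) = {\<zero>\<^bsub>Sp Z\<^esub>}"
  shows "zero_object (full_subcategory (MF \<sigma> e) wa) Z"
  unfolding zero_object_def MF_simps
proof (intro conjI ballI)
  note oZ = wa_obj[OF Z(1)]
  show "Z \<in> {X. obj X \<and> wa X}" using oZ Z by simp
  fix A :: "('s, 'v, 'K, 'w) filt_phi"
  assume "A \<in> {X. obj X \<and> wa X}"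
  then have A: "obj A" by simp
  show "\<exists>!f. f \<in> MF_hom e A Z"
  proof (rule ex1I[of _ "mzero A Z"])
    show "mzero A Z \<in> MF_hom e A Z" by (rule mzero_hom[OF A oZ])
    show "f = mzero A Z" if f: "f \<in> MF_hom e A Z" for f
      by (rule hom_eqI'[OF A oZ f mzero_hom[OF A oZ]])
        (use hom_closed[OF A oZ f] Z(2) in \<open>simp add: fst_hom_simps\<close>)
  qed
  show "\<exists>!f. f \<in> MF_hom e Z A"
  proof (rule ex1I[of _ "mzero Z A"])
    show "mzero Z A \<in> MF_hom e Z A" by (rule mzero_hom[OF oZ A])
    show "f = mzero Z A" if f: "f \<in> MF_hom e Z A" for f
      by (rule hom_eqI'[OF oZ A f mzero_hom[OF oZ A]])
        (use lin_zero[OF mor_lin[OF hom_mor[OF oZ A f]]] Z(2) in \<open>simp add: fst_hom_simps\<close>)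
  qed
qed

section \<open>Factorisation through strict injections and strict surjections\<close>

lemma lin_factor_inj:
  assumes i: "lin V W i" and inj: "inj_on i (carrier V)" and g: "lin X W g"
    and h: "\<And>v. v \<in> carrier X \<Longrightarrow> h v \<in> carrier V" "\<And>v. v \<in> carrier X \<Longrightarrow> i (h v) = g v"
  shows "lin X V h"
proof (rule linI)
  note V = lin_dom[OF i] and X = lin_dom[OF g]
  show "vsp X" "vsp V" by (rule X, rule V)
  show "h v \<in> carrier V" if "v \<in> carrier X" for v by (rule h(1)[OF that])
  show "h (v \<oplus>\<^bsub>X\<^esub> w) = h v \<oplus>\<^bsub>V\<^esub> h w" if "v \<in> carrier X" "w \<in> carrier X" for v w
    by (rule inj_onD[OF inj])
      (simp_all add: that h vsp_closed[OF X] vsp_closed[OF V] lin_add[OF i] lin_add[OF g])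
  show "h (c \<odot>\<^bsub>X\<^esub> v) = c \<odot>\<^bsub>V\<^esub> h v" if "v \<in> carrier X" for c v
    by (rule inj_onD[OF inj])
      (simp_all add: that h vsp_closed[OF X] vsp_closed[OF V] lin_smult[OF i] lin_smult[OF g])
qed

text \<open>Injectivity forces the factor on the underlying spaces. The inclusion of images passes
  from V to \<open>V\<^sub>K\<close> because images commute with base change, and strictness of
  \<open>i\<close> makes the factor respect the filtrations.\<close>

lemma factor_inj:
  assumes N: "obj N" and A: "obj A" and X: "obj X" and i: "i \<in> MF_hom e N A" and inj: "inj_on (fst i) (carrier (Sp N))"
    and s: "mstrict N A (snd i)" and g: "g \<in> MF_hom e X A" and im: "fst g ` carrier (Sp X) \<subseteq> fst i ` carrier (Sp N)"
  shows "\<exists>h\<in>MF_hom e X N. comp X i h = g"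
proof -
  note mi = hom_mor[OF N A i] and mg = hom_mor[OF X A g]
  note injK = mor_injK[OF N A mi inj]
  have imK: "snd g ` carrier (SpK X) \<subseteq> snd i ` carrier (SpK N)"
    unfolding mor_kernK(2)[OF X A mg] mor_kernK(2)[OF N A mi]
    by (rule uk_mono[OF A sub_image[OF mor_lin[OF mg] sub_carrier[OF obj_vsp(1)[OF X]]]
      sub_image[OF mor_lin[OF mi] sub_carrier[OF obj_vsp(1)[OF N]]] im])
  define h where "h v = inv_into (carrier (Sp N)) (fst i) (fst g v)" for v
  define hK where "hK w = inv_into (carrier (SpK N)) (snd i) (snd g w)" for w
  have h: "h v \<in> carrier (Sp N)" "fst i (h v) = fst g v" if "v \<in> carrier (Sp X)" for v
    using im that unfolding h_def by (auto intro!: inv_into_into f_inv_into_f)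
  have hK: "hK w \<in> carrier (SpK N)" "snd i (hK w) = snd g w" if "w \<in> carrier (SpK X)" for w
    using imK that unfolding hK_def by (auto intro!: inv_into_into f_inv_into_f)
  note il = mor_lin[OF mi] and gl = mor_lin[OF mg] and ilK = mor_linK[OF mi] and glK = mor_linK[OF mg]
  have "mor X N h hK"
  proof (rule morI)
    show "lin (Sp X) (Sp N) h"
      by (rule lin_factor_inj[OF il inj gl h])
    show "lin (SpK X) (SpK N) hK"
      by (rule lin_factor_inj[OF ilK injK glK hK])
    fix v assume v: "v \<in> carrier (Sp X)"
    show "h (Phi X v) = Phi N (h v)"
      by (rule inj_onD[OF inj]) (use v in \<open>simp_all add: h obj_phi_props(1)[OF X] obj_phi_props(1)[OF N] mor_phi[OF mi] mor_phi[OF mg]\<close>)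
    show "hK (jm X v) = jm N (h v)"
      by (rule inj_onD[OF injK]) (use v in \<open>simp_all add: h hK jm_closed[OF X] jm_closed[OF N] mor_jm[OF mi] mor_jm[OF mg]\<close>)
  next
    show "hK ` Fil X k \<subseteq> Fil N k" for k
    proof
      fix y assume "y \<in> hK ` Fil X k"
      then obtain w where w: "w \<in> Fil X k" "y = hK w" by blast
      have wX: "w \<in> carrier (SpK X)" by (rule sub_closed[OF fm_sub[OF obj_fil[OF X]] w(1)])
      have "snd g w \<in> Fil A k" using mor_fil[OF mg, of k] w(1) by blast
      then have "snd g w \<in> snd i ` Fil N k" using s imK wX unfolding mstrict_def by blast
      then obtain n where n: "n \<in> Fil N k" "snd g w = snd i n" by blast
      have "hK w = n"
        by (rule inj_onD[OF injK]) (use hK[OF wX] n sub_closed[OF fm_sub[OF obj_fil[OF N]]] in auto)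
      then show "y \<in> Fil N k" using n w by simp
    qed
  qed
  from rmor_hom[OF X N this] have r: "rmor X h hK \<in> MF_hom e X N" .
  have "comp X i (rmor X h hK) = g"
    by (rule hom_eqI'[OF X A comp_hom[OF X N A r i] g]) (simp add: fst_hom_simps h)
  then show ?thesis using r by blast
qed

lemma lin_factor_surj:
  assumes q: "lin V W q" and surj: "q ` carrier V = carrier W" and g: "lin V X g"
    and h: "\<And>v. v \<in> carrier V \<Longrightarrow> h (q v) = g v"
  shows "lin W X h"
proof (rule linI)
  note V = lin_dom[OF q]
  have rep: "\<exists>v\<in>carrier V. w = q v" if "w \<in> carrier W" for w
    using that unfolding surj[symmetric] by blast
  show "vsp W" "vsp X" by (rule lin_cod[OF q], rule lin_cod[OF g])
  show "h w \<in> carrier X" if w: "w \<in> carrier W" for w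
  proof -
    obtain v where "v \<in> carrier V" "w = q v" using rep[OF w] by blast
    then show ?thesis by (simp add: h lin_closed[OF g])
  qed
  show "h (w \<oplus>\<^bsub>W\<^esub> w') = h w \<oplus>\<^bsub>X\<^esub> h w'" if w: "w \<in> carrier W" "w' \<in> carrier W" for w w'
  proof -
    obtain v v' where "v \<in> carrier V" "w = q v" "v' \<in> carrier V" "w' = q v'"
      using rep[OF w(1)] rep[OF w(2)] by blast
    then show ?thesis by (simp add: h lin_add[OF g] lin_add[OF q, symmetric] vsp_closed[OF V])
  qed
  show "h (c \<odot>\<^bsub>W\<^esub> w) = c \<odot>\<^bsub>X\<^esub> h w" if w: "w \<in> carrier W" for c w
  proof -
    obtain v where "v \<in> carrier V" "w = q v" using rep[OF w] by blast
    then show ?thesis by (simp add: h lin_smult[OF g] lin_smult[OF q, symmetric] vsp_closed[OF V])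
  qed
qed

lemma mstrict_surj:
  assumes Y: "obj Y" and s: "mstrict X Y T" and surj: "T ` carrier (SpK X) = carrier (SpK Y)"
  shows "T ` Fil X i = Fil Y i"
  using s sub_subset[OF fm_sub[OF obj_fil[OF Y]], of i] by (simp add: mstrict_def surj Int_absorb1)

text \<open>The value of \<open>h\<close> at a point is that of \<open>g\<close> at any preimage, by
  the inclusion of kernels, which also holds over K. Strictness of \<open>q\<close> supplies a
  preimage in the same filtration step.\<close>

lemma factor_surj:
  assumes B: "obj B" and Q: "obj Q" and X: "obj X" and q: "q \<in> MF_hom e B Q" and surj: "fst q ` carrier (Sp B) = carrier (Sp Q)"
    and s: "mstrict B Q (snd q)" and g: "g \<in> MF_hom e B X"
    and ker: "kern (Sp B) (Sp Q) (fst q) \<subseteq> kern (Sp B) (Sp X) (fst g)"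
  shows "\<exists>h\<in>MF_hom e Q X. comp B h q = g"
proof -
  note mq = hom_mor[OF B Q q] and mg = hom_mor[OF B X g]
  note surjK = mor_surjK[OF B Q mq surj]
  note ql = mor_lin[OF mq] and gl = mor_lin[OF mg] and qlK = mor_linK[OF mq] and glK = mor_linK[OF mg]
  have kerK: "kern (SpK B) (SpK Q) (snd q) \<subseteq> kern (SpK B) (SpK X) (snd g)"
    unfolding mor_kernK(1)[OF B Q mq] mor_kernK(1)[OF B X mg]
    by (rule uk_mono[OF B sub_kern[OF ql] sub_kern[OF gl] ker])
  define h where "h y = fst g (inv_into (carrier (Sp B)) (fst q) y)" for y
  define hK where "hK y = snd g (inv_into (carrier (SpK B)) (snd q) y)" for y
  have h: "h (fst q x) = fst g x" if x: "x \<in> carrier (Sp B)" for x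
  proof -
    let ?y = "inv_into (carrier (Sp B)) (fst q) (fst q x)"
    have y: "?y \<in> carrier (Sp B)" "fst q ?y = fst q x" using x by (auto intro!: inv_into_into f_inv_into_f)
    then have "?y \<ominus>\<^bsub>Sp B\<^esub> x \<in> kern (Sp B) (Sp X) (fst g)" using ker kern_minus_iff[OF ql y(1) x] by blast
    then show ?thesis using kern_minus_iff[OF gl y(1) x] by (simp add: h_def)
  qed
  have hK: "hK (snd q x) = snd g x" if x: "x \<in> carrier (SpK B)" for x
  proof -
    let ?y = "inv_into (carrier (SpK B)) (snd q) (snd q x)"
    have y: "?y \<in> carrier (SpK B)" "snd q ?y = snd q x" using x by (auto intro!: inv_into_into f_inv_into_f)
    then have "?y \<ominus>\<^bsub>SpK B\<^esub> x \<in> kern (SpK B) (SpK X) (snd g)" using kerK kern_minus_iff[OF qlK y(1) x] by blast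
    then show ?thesis using kern_minus_iff[OF glK y(1) x] by (simp add: hK_def)
  qed
  have rep: "\<exists>x\<in>carrier (Sp B). y = fst q x" if "y \<in> carrier (Sp Q)" for y
    using that unfolding surj[symmetric] by blast
  have "mor Q X h hK"
  proof (rule morI)
    show "lin (Sp Q) (Sp X) h"
      by (rule lin_factor_surj[OF ql surj gl h])
    show "lin (SpK Q) (SpK X) hK"
      by (rule lin_factor_surj[OF qlK surjK glK hK])
    fix v assume "v \<in> carrier (Sp Q)"
    then obtain x where x: "x \<in> carrier (Sp B)" "v = fst q x" using rep by blast
    show "h (Phi Q v) = Phi X (h v)"
      using x by (simp add: h mor_phi[OF mq, symmetric] mor_phi[OF mg] obj_phi_props(1)[OF B])
    show "hK (jm Q v) = jm X (h v)"
      using x by (simp add: h hK mor_jm[OF mq, symmetric] mor_jm[OF mg] jm_closed[OF B])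
  next
    show "hK ` Fil Q k \<subseteq> Fil X k" for k
    proof
      fix y assume "y \<in> hK ` Fil Q k"
      then obtain w where w: "w \<in> Fil Q k" "y = hK w" by blast
      have "w \<in> carrier (SpK Q)" by (rule sub_closed[OF fm_sub[OF obj_fil[OF Q]] w(1)])
      then have "w \<in> snd q ` Fil B k" using mstrict_surj[OF Q s surjK] w(1) by simp
      then obtain b where b: "b \<in> Fil B k" "w = snd q b" by blast
      have "y = snd g b" using w b hK[OF sub_closed[OF fm_sub[OF obj_fil[OF B]] b(1)]] by simp
      then show "y \<in> Fil X k" using mor_fil[OF mg, of k] b(1) by blast
    qed
  qed
  from rmor_hom[OF Q X this] have r: "rmor Q h hK \<in> MF_hom e Q X" .
  have "comp B (rmor Q h hK) q = g"
    by (rule hom_eqI'[OF B X comp_hom[OF B Q X q r] g]) (simp add: fst_hom_simps h hom_closed[OF B Q q])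
  then show ?thesis using r by blast
qed

section \<open>Linear criteria for kernels and cokernels\<close>

lemma is_kernelI:
  assumes A: "obj A" and B: "obj B" and N: "wa N" and f: "f \<in> MF_hom e A B" and i: "i \<in> MF_hom e N A"
    and inj: "inj_on (fst i) (carrier (Sp N))" and s: "mstrict N A (snd i)"
    and ex: "fst i ` carrier (Sp N) = kern (Sp A) (Sp B) (fst f)"
  shows "is_kernel (full_subcategory (MF \<sigma> e) wa) mzero A B f N i"
  unfolding is_kernel_def MF_simps comp_def[symmetric]
proof (intro conjI ballI impI)
  note oN = wa_obj[OF N]
  show "N \<in> {X. obj X \<and> wa X}" using N oN by simp
  show "i \<in> MF_hom e N A" by (rule i)
  show "comp N f i = mzero N B"
    by (rule hom_eqI'[OF oN B comp_hom[OF oN A B i f] mzero_hom[OF oN B]])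
      (use ex in \<open>auto simp: fst_hom_simps kern_def\<close>)
  fix X g assume "X \<in> {X. obj X \<and> wa X}" and g: "g \<in> MF_hom e X A" and z: "comp X f g = mzero X B"
  then have X: "obj X" by simp
  have "fst g v \<in> kern (Sp A) (Sp B) (fst f)" if v: "v \<in> carrier (Sp X)" for v
  proof -
    have "fst (comp X f g) v = fst (mzero X B) v" using z by simp
    then show ?thesis using v hom_closed[OF X A g] by (simp add: fst_hom_simps kern_def)
  qed
  then have im: "fst g ` carrier (Sp X) \<subseteq> fst i ` carrier (Sp N)" unfolding ex by blast
  obtain h where h: "h \<in> MF_hom e X N" "comp X i h = g"
    using factor_inj[OF oN A X i inj s g im] by blast
  show "\<exists>!h. h \<in> MF_hom e X N \<and> comp X i h = g"
  proof (rule ex1I[of _ h])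
    fix h' assume h': "h' \<in> MF_hom e X N \<and> comp X i h' = g"
    show "h' = h"
    proof (rule hom_eqI'[OF X oN])
      fix v assume v: "v \<in> carrier (Sp X)"
      have "fst (comp X i h') v = fst (comp X i h) v" by (simp only: h(2) conjunct2[OF h'])
      then have "fst i (fst h' v) = fst i (fst h v)" by (simp only: fst_hom_simps(1)[OF v])
      then show "fst h' v = fst h v"
        by (rule inj_onD[OF inj]) (rule hom_closed[OF X oN conjunct1[OF h'] v], rule hom_closed[OF X oN h(1) v])
    qed (use h h' in auto)
  qed (use h in simp)
qed

lemma is_cokernelI:
  assumes A: "obj A" and B: "obj B" and Q: "wa Q" and f: "f \<in> MF_hom e A B" and q: "q \<in> MF_hom e B Q"
    and surj: "fst q ` carrier (Sp B) = carrier (Sp Q)" and s: "mstrict B Q (snd q)"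
    and ex: "kern (Sp B) (Sp Q) (fst q) = fst f ` carrier (Sp A)"
  shows "is_cokernel (full_subcategory (MF \<sigma> e) wa) mzero A B f Q q"
  unfolding is_cokernel_def MF_simps comp_def[symmetric]
proof (intro conjI ballI impI)
  note oQ = wa_obj[OF Q]
  show "Q \<in> {X. obj X \<and> wa X}" using Q oQ by simp
  show "q \<in> MF_hom e B Q" by (rule q)
  show "comp A q f = mzero A Q"
  proof (rule hom_eqI'[OF A oQ comp_hom[OF A B oQ f q] mzero_hom[OF A oQ]])
    fix v assume v: "v \<in> carrier (Sp A)"
    then have "fst f v \<in> kern (Sp B) (Sp Q) (fst q)" unfolding ex by blast
    then show "fst (comp A q f) v = fst (mzero A Q) v" using v by (simp add: fst_hom_simps kern_def)
  qed
  fix X g assume "X \<in> {X. obj X \<and> wa X}" and g: "g \<in> MF_hom e B X" and z: "comp A g f = mzero A X"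
  then have X: "obj X" by simp
  have "fst f v \<in> kern (Sp B) (Sp X) (fst g)" if v: "v \<in> carrier (Sp A)" for v
  proof -
    have "fst (comp A g f) v = fst (mzero A X) v" using z by simp
    then show ?thesis using v hom_closed[OF A B f] by (simp add: fst_hom_simps kern_def)
  qed
  then have ker: "kern (Sp B) (Sp Q) (fst q) \<subseteq> kern (Sp B) (Sp X) (fst g)" unfolding ex by blast
  obtain h where h: "h \<in> MF_hom e Q X" "comp B h q = g"
    using factor_surj[OF B oQ X q surj s g ker] by blast
  show "\<exists>!h. h \<in> MF_hom e Q X \<and> comp B h q = g"
  proof (rule ex1I[of _ h])
    fix h' assume h': "h' \<in> MF_hom e Q X \<and> comp B h' q = g"
    show "h' = h"
    proof (rule hom_eqI'[OF oQ X])
      fix v assume "v \<in> carrier (Sp Q)"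
      then obtain x where x: "x \<in> carrier (Sp B)" "v = fst q x" using surj by blast
      have "fst (comp B h' q) x = fst (comp B h q) x" by (simp only: h(2) conjunct2[OF h'])
      then show "fst h' v = fst h v" by (simp only: fst_hom_simps(1)[OF x(1)] x(2))
    qed (use h h' in auto)
  qed (use h in simp)
qed

text \<open>The last conjunct pins the kernel down as a restriction, so that
  \<open>restr_kern_wa\<close> can provide the test object required by
  \<open>monomorphism_inj\<close>.\<close>

lemma kernel_exists:
  assumes wA: "wa A" and wB: "wa B" and f: "f \<in> MF_hom e A B"
  shows "\<exists>N i. wa N \<and> i \<in> MF_hom e N A \<and> inj_on (fst i) (carrier (Sp N)) \<and> mstrict N A (snd i) \<and>
    fst i ` carrier (Sp N) = kern (Sp A) (Sp B) (fst f) \<and> N = restr A (kern (Sp A) (Sp B) (fst f))"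
proof -
  note A = wa_obj[OF wA] and B = wa_obj[OF wB]
  note m = hom_mor[OF A B f]
  let ?N = "kern (Sp A) (Sp B) (fst f)"
  have "carrier (Sp A) \<inter> ?N = ?N" by (auto simp: kern_def)
  then have st: "stab A ?N" using stab_kern(1)[OF A B m stab_carrier[OF A]] by simp
  note o = restr_obj(1)[OF A st] and rm = restr_mor[OF A st]
  have c: "carrier (Sp (restr A ?N)) = ?N" by (simp add: restr_def)
  have s: "mstrict (restr A ?N) A (\<lambda>w. w)" by (auto simp: mstrict_def restr_def)
  have w: "wa (restr A ?N)"
    by (rule wa_embed[OF wA o rm _ s]) (use wa_mor(2)[OF wA wB m] c in \<open>auto simp: inj_on_def\<close>)
  let ?i = "rmor (restr A ?N) (\<lambda>v. v) (\<lambda>w. w)"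
  have "mstrict (restr A ?N) A (snd ?i)"
  proof -
    have "snd ?i ` S = S" if "S \<subseteq> carrier (SpK (restr A ?N))" for S
      using that by (auto simp: rmor_def image_iff subset_iff)
    from this[OF sub_subset[OF fm_sub[OF obj_fil[OF o]]]] this[OF order_refl]
    show ?thesis using s by (simp add: mstrict_def)
  qed
  moreover have "inj_on (fst ?i) (carrier (Sp (restr A ?N)))" "fst ?i ` carrier (Sp (restr A ?N)) = ?N"
    using c by (simp_all add: rmor_def)
  ultimately show ?thesis
    using w rmor_hom[OF o A rm] by blast
qed

lemma restr_kern_wa:
  assumes wA: "wa A" and wB: "wa B" and f: "f \<in> MF_hom e A B"
  shows "wa (restr A (kern (Sp A) (Sp B) (fst f)))"
  using kernel_exists[OF assms] by blast

text \<open>\<open>MF_coker\<close> lives on the carrier types \<open>'v set\<close> and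
  \<open>'w set\<close>, outside the category at hand. It is copied back along a choice of
  representatives.\<close>

lemma cokernel_exists:
  fixes A B :: "('s, 'v, 'K, 'w) filt_phi"
  assumes wA: "wa A" and wB: "wa B" and f: "f \<in> MF_hom e A B"
  shows "\<exists>(Q :: ('s, 'v, 'K, 'w) filt_phi) q. wa Q \<and> q \<in> MF_hom e B Q \<and> fst q ` carrier (Sp B) = carrier (Sp Q) \<and>
    mstrict B Q (snd q) \<and> kern (Sp B) (Sp Q) (fst q) = fst f ` carrier (Sp A)"
proof -
  note A = wa_obj[OF wA] and B = wa_obj[OF wB]
  note m = hom_mor[OF A B f]
  define C where "C = MF_coker e A B f"
  note c = MF_coker_props[OF A B m, folded C_def]
  have wC: "wa C" unfolding C_def by (rule wa_strict_ker_coker(3)[OF f wA wB])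
  obtain q qK where q: "mor B C q qK" "q ` carrier (Sp B) = carrier (Sp C)" "mstrict B C qK"
    "kern (Sp B) (Sp C) q = fst f ` carrier (Sp A)" using c(2) by blast
  obtain t :: "'v set \<Rightarrow> 'v" where t: "inj_on t (carrier (Sp C))" using c(3) by blast
  obtain tK :: "'w set \<Rightarrow> 'w" where tK: "inj_on tK (carrier (SpK C))" using c(4) by blast
  obtain Q where Q: "obj Q" "mor C Q t tK" "t ` carrier (Sp C) = carrier (Sp Q)" "mstrict C Q tK"
    using transport[OF c(1) t tK] by blast
  have wQ: "wa Q" by (rule wa_transport[OF wC Q(1,2) t Q(3,4)])
  note mm = mor_comp[OF q(1) Q(2)]
  let ?p = "rmor B (\<lambda>v. t (q v)) (\<lambda>w. tK (qK w))"
  have cl: "Fil B i \<subseteq> carrier (SpK B)" for i by (rule sub_subset[OF fm_sub[OF obj_fil[OF B]]])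
  note surjK = mor_surjK[OF B c(1) q(1,2)] and surjK' = mor_surjK[OF c(1) Q(1,2,3)]
  have surj: "fst ?p ` carrier (Sp B) = carrier (Sp Q)"
    unfolding Q(3)[symmetric] q(2)[symmetric] image_image by (simp add: rmor_def)
  \<comment> \<open>For surjections strictness means that each filtration step maps onto the
    corresponding one, a property stable under composition.\<close>
  have "mstrict B Q (snd ?p)"
    unfolding mstrict_def
  proof
    fix i
    have "qK ` Fil B i = Fil C i" by (rule mstrict_surj[OF c(1) q(3) surjK])
    moreover have "tK ` Fil C i = Fil Q i" by (rule mstrict_surj[OF Q(1,4) surjK'])
    moreover have "snd ?p ` Fil B i = tK ` qK ` Fil B i"
      unfolding image_image by (rule image_cong) (use cl[of i] in \<open>auto simp: rmor_def\<close>)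
    moreover have "snd ?p ` carrier (SpK B) = carrier (SpK Q)"
      by (rule mor_surjK[OF B Q(1) hom_mor[OF B Q(1) rmor_hom[OF B Q(1) mm]] surj])
    ultimately show "snd ?p ` Fil B i = snd ?p ` carrier (SpK B) \<inter> Fil Q i"
      using sub_subset[OF fm_sub[OF obj_fil[OF Q(1)]], of i] by (simp add: Int_absorb1)
  qed
  moreover note surj
  moreover have "kern (Sp B) (Sp Q) (fst ?p) = fst f ` carrier (Sp A)"
  proof -
    have "t x = \<zero>\<^bsub>Sp Q\<^esub> \<longleftrightarrow> x = \<zero>\<^bsub>Sp C\<^esub>" if "x \<in> carrier (Sp C)" for x
      using inj_onD[OF t _ that vzero_closed[OF obj_vsp(1)[OF c(1)]]] lin_zero[OF mor_lin[OF Q(2)]] by metis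
    then have "kern (Sp B) (Sp Q) (fst ?p) = kern (Sp B) (Sp C) q"
      using lin_closed[OF mor_lin[OF q(1)]] by (auto simp: kern_def rmor_def)
    then show ?thesis using q(4) by simp
  qed
  ultimately show ?thesis using wQ rmor_hom[OF B Q(1) mm] by blast
qed

text \<open>The direct sum is weakly admissible as an extension of \<open>B\<close> by
  \<open>A\<close>. It lives on product types; after copying it into the given types, injections are
  composed with the copying map and projections with its inverse.\<close>

lemma biproduct_exists:
  fixes A B :: "('s, 'v, 'K, 'w) filt_phi"
  assumes inf: "infinite (UNIV :: 's set)" "infinite (UNIV :: 'K set)" and wA: "wa A" and wB: "wa B"
  shows "\<exists>P i1 i2 p1 p2. biproduct (full_subcategory (MF \<sigma> e) wa) madd A B P i1 i2 p1 p2"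
proof -
  note A = wa_obj[OF wA] and B = wa_obj[OF wB]
  obtain D where D: "obj D" "carrier (Sp D) = carrier (Sp A) \<times> carrier (Sp B)"
    "carrier (SpK D) = carrier (SpK A) \<times> carrier (SpK B)"
    "mor A D (\<lambda>x. (x, \<zero>\<^bsub>Sp B\<^esub>)) (\<lambda>x. (x, \<zero>\<^bsub>SpK B\<^esub>))" "mor B D (\<lambda>y. (\<zero>\<^bsub>Sp A\<^esub>, y)) (\<lambda>y. (\<zero>\<^bsub>SpK A\<^esub>, y))"
    "mor D A fst fst" "mor D B snd snd" "mstrict A D (\<lambda>x. (x, \<zero>\<^bsub>SpK B\<^esub>))" "mstrict D B snd"
    "\<And>x y. x \<in> carrier (Sp A) \<Longrightarrow> y \<in> carrier (Sp B) \<Longrightarrow> (x, \<zero>\<^bsub>Sp B\<^esub>) \<oplus>\<^bsub>Sp D\<^esub> (\<zero>\<^bsub>Sp A\<^esub>, y) = (x, y)"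
    using direct_sum_obj[OF A B] by metis
  have z: "\<zero>\<^bsub>Sp A\<^esub> \<in> carrier (Sp A)" "\<zero>\<^bsub>Sp B\<^esub> \<in> carrier (Sp B)"
    by (rule vzero_closed[OF obj_vsp(1)[OF A]], rule vzero_closed[OF obj_vsp(1)[OF B]])
  have wD: "wa D"
    by (rule wa_ext[OF D(1) wA wB D(4) _ D(8) D(7) _ D(9)]) (use z D(2) in \<open>auto simp: inj_on_def kern_def image_iff\<close>)
  obtain f :: "'v \<times> 'v \<Rightarrow> 'v" where f: "inj_on f (carrier (Sp D))"
    using inj_prod_exists[OF inf(1) obj_vsp(1)[OF A] obj_vsp(1)[OF B]] D(2) by auto
  obtain fK :: "'w \<times> 'w \<Rightarrow> 'w" where fK: "inj_on fK (carrier (SpK D))"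
    using inj_prod_exists[OF inf(2) obj_vsp(2)[OF A] obj_vsp(2)[OF B]] D(3) by auto
  obtain P where P: "obj P" "mor D P f fK" "f ` carrier (Sp D) = carrier (Sp P)" "mstrict D P fK"
    using transport[OF D(1) f fK] by blast
  have wP: "wa P" by (rule wa_transport[OF wD P(1,2) f P(3,4)])
  note inv = mor_inv[OF D(1) P(1,2) f P(3,4)]
  let ?g = "inv_into (carrier (Sp D)) f" and ?gK = "inv_into (carrier (SpK D)) fK"
  have gf: "?g (f x) = x" if "x \<in> carrier (Sp D)" for x using f that by simp
  have gf': "?g (f (a, b)) = (a, b)" if "a \<in> carrier (Sp A)" "b \<in> carrier (Sp B)" for a b
    by (rule gf) (simp add: D(2) that)
  define i1 where "i1 = rmor A (\<lambda>x. f (x, \<zero>\<^bsub>Sp B\<^esub>)) (\<lambda>x. fK (x, \<zero>\<^bsub>SpK B\<^esub>))"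
  define i2 where "i2 = rmor B (\<lambda>y. f (\<zero>\<^bsub>Sp A\<^esub>, y)) (\<lambda>y. fK (\<zero>\<^bsub>SpK A\<^esub>, y))"
  define p1 where "p1 = rmor P (\<lambda>v. fst (?g v)) (\<lambda>w. fst (?gK w))"
  define p2 where "p2 = rmor P (\<lambda>v. snd (?g v)) (\<lambda>w. snd (?gK w))"
  have h: "i1 \<in> MF_hom e A P" "i2 \<in> MF_hom e B P" "p1 \<in> MF_hom e P A" "p2 \<in> MF_hom e P B"
    unfolding i1_def i2_def p1_def p2_def
    by (rule rmor_hom[OF A P(1) mor_comp[OF D(4) P(2)]], rule rmor_hom[OF B P(1) mor_comp[OF D(5) P(2)]],
        rule rmor_hom[OF P(1) A mor_comp[OF inv D(6)]], rule rmor_hom[OF P(1) B mor_comp[OF inv D(7)]])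
  have ide: "(\<lambda>v\<in>carrier (Sp X). v, \<lambda>w\<in>carrier (SpK X). w) = rmor X (\<lambda>v. v) (\<lambda>w. w)" for X :: "('s, 'v, 'K, 'w) filt_phi"
    by (simp add: rmor_def)
  note ideh = rmor_hom[OF A A mor_id[OF A]] rmor_hom[OF B B mor_id[OF B]] rmor_hom[OF P(1) P(1) mor_id[OF P(1)]]
  have fcl: "f x \<in> carrier (Sp P)" if "x \<in> carrier (Sp D)" for x using P(3) that by blast
  have fcl': "f (a, b) \<in> carrier (Sp P)" if "a \<in> carrier (Sp A)" "b \<in> carrier (Sp B)" for a b
    by (rule fcl) (simp add: D(2) that)
  have "comp A p1 i1 = rmor A (\<lambda>v. v) (\<lambda>w. w)"
    by (rule hom_eqI'[OF A A comp_hom[OF A P(1) A h(1,3)] ideh(1)])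
      (use z in \<open>simp add: fst_hom_simps i1_def p1_def fcl' gf'\<close>)
  moreover have "comp B p2 i2 = rmor B (\<lambda>v. v) (\<lambda>w. w)"
    by (rule hom_eqI'[OF B B comp_hom[OF B P(1) B h(2,4)] ideh(2)])
      (use z in \<open>simp add: fst_hom_simps i2_def p2_def fcl' gf'\<close>)
  moreover have "madd P P (comp P i1 p1) (comp P i2 p2) = rmor P (\<lambda>v. v) (\<lambda>w. w)"
  proof (rule hom_eqI'[OF P(1) P(1) madd_hom[OF P(1) P(1) comp_hom[OF P(1) A P(1) h(3,1)] comp_hom[OF P(1) B P(1) h(4,2)]] ideh(3)])
    fix v assume v: "v \<in> carrier (Sp P)"
    then obtain x where x: "x \<in> carrier (Sp D)" "v = f x" using P(3) by blast
    obtain a b where ab: "x = (a, b)" "a \<in> carrier (Sp A)" "b \<in> carrier (Sp B)" using x(1) D(2) by auto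
    have "f (a, \<zero>\<^bsub>Sp B\<^esub>) \<oplus>\<^bsub>Sp P\<^esub> f (\<zero>\<^bsub>Sp A\<^esub>, b) = f (a, b)"
      using lin_add[OF mor_lin[OF P(2)], of "(a, \<zero>\<^bsub>Sp B\<^esub>)" "(\<zero>\<^bsub>Sp A\<^esub>, b)"] ab z D(2,10) by simp
    then show "fst (madd P P (comp P i1 p1) (comp P i2 p2)) v = fst (rmor P (\<lambda>v. v) (\<lambda>w. w)) v"
      using v x ab gf[OF x(1)] by (simp add: fst_hom_simps i1_def i2_def p1_def p2_def)
  qed
  ultimately have "biproduct (full_subcategory (MF \<sigma> e) wa) madd A B P i1 i2 p1 p2"
    unfolding biproduct_def MF_simps comp_def[symmetric] ide using h P(1) wP by simp
  then show ?thesis by blast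
qed

theorem abelian_wa:
  assumes inf: "infinite (UNIV :: 's set)" "infinite (UNIV :: 'K set)"
  shows "abelian_category (full_subcategory
    (MF \<sigma> e :: (('s, 'v, 'K, 'w) filt_phi, ('v \<Rightarrow> 'v) \<times> ('w \<Rightarrow> 'w)) cat) wa)"
    (is "abelian_category ?C")
proof -
  have Obj: "A \<in> Obj ?C \<longleftrightarrow> wa A" for A using wa_obj by (auto simp: MF_simps)
  have Hom: "Hom ?C = MF_hom e" by (simp add: MF_simps)
  have kers: "\<exists>N i. is_kernel ?C mzero A B f N i" "\<exists>Q q. is_cokernel ?C mzero A B f Q q"
    if w: "wa A" "wa B" and f: "f \<in> MF_hom e A B" for A B f
  proof -
    note o = wa_obj[OF w(1)] wa_obj[OF w(2)]
    show "\<exists>N i. is_kernel ?C mzero A B f N i"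
      using kernel_exists[OF w f] is_kernelI[OF o _ f] by metis
    show "\<exists>Q q. is_cokernel ?C mzero A B f Q q"
      using cokernel_exists[OF w f] is_cokernelI[OF o _ f] by metis
  qed
  \<comment> \<open>A monomorphism is injective because its kernel is a weakly admissible test
    object, and it is strict because both ends are weakly admissible. So it is a kernel of its
    cokernel.\<close>
  have mono: "\<exists>D\<in>Obj ?C. \<exists>g\<in>MF_hom e B D. is_kernel ?C mzero B D g A f"
    if w: "wa A" "wa B" and f: "monomorphism ?C A B f" for A B f
  proof -
    note A = wa_obj[OF w(1)] and B = wa_obj[OF w(2)]
    have fh: "f \<in> MF_hom e A B" using f by (simp add: monomorphism_def Hom)
    have inj: "inj_on (fst f) (carrier (Sp A))"
      by (rule monomorphism_inj[OF A B f restr_kern_wa[OF w fh]])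
    obtain Q :: "('s, 'v, 'K, 'w) filt_phi" and q where Q: "wa Q" "q \<in> MF_hom e B Q"
      "kern (Sp B) (Sp Q) (fst q) = fst f ` carrier (Sp A)"
      using cokernel_exists[OF w fh] by blast
    have "is_kernel ?C mzero B Q q A f"
      by (rule is_kernelI[OF B wa_obj[OF Q(1)] w(1) Q(2) fh inj wa_mor(1)[OF w hom_mor[OF A B fh]] Q(3)[symmetric]])
    then show ?thesis using Q(1,2) Obj by blast
  qed
  \<comment> \<open>The cokernel map \<open>q\<close> and the zero map agree after composition with
    \<open>f\<close>, so \<open>q\<close> is zero. As its kernel is the image of \<open>f\<close>,
    that image is everything, and \<open>f\<close> is a strict surjection, hence a cokernel of its
    kernel.\<close>
  have epi: "\<exists>D\<in>Obj ?C. \<exists>g\<in>MF_hom e D A. is_cokernel ?C mzero D A g B f"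
    if w: "wa A" "wa B" and f: "epimorphism ?C A B f" for A B f
  proof -
    note A = wa_obj[OF w(1)] and B = wa_obj[OF w(2)]
    have fh: "f \<in> MF_hom e A B" using f by (simp add: epimorphism_def Hom)
    obtain Q :: "('s, 'v, 'K, 'w) filt_phi" and q where Q: "wa Q" "q \<in> MF_hom e B Q"
      "kern (Sp B) (Sp Q) (fst q) = fst f ` carrier (Sp A)"
      using cokernel_exists[OF w fh] by blast
    note oQ = wa_obj[OF Q(1)]
    have "comp A q f = comp A (mzero B Q) f"
    proof (rule hom_eqI'[OF A oQ comp_hom[OF A B oQ fh Q(2)] comp_hom[OF A B oQ fh mzero_hom[OF B oQ]]])
      fix v assume v: "v \<in> carrier (Sp A)"
      then have "fst f v \<in> kern (Sp B) (Sp Q) (fst q)" unfolding Q(3) by blast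
      then show "fst (comp A q f) v = fst (comp A (mzero B Q) f) v"
        using v by (simp add: fst_hom_simps kern_def)
    qed
    moreover have "\<forall>X\<in>Obj ?C. \<forall>g\<in>MF_hom e B X. \<forall>h\<in>MF_hom e B X. comp A g f = comp A h f \<longrightarrow> g = h"
      using f unfolding epimorphism_def MF_simps comp_def by blast
    ultimately have "q = mzero B Q" using Q(1,2) mzero_hom[OF B oQ] Obj by blast
    then have "kern (Sp B) (Sp Q) (fst q) = carrier (Sp B)" by (auto simp: kern_def fst_hom_simps)
    then have surj: "fst f ` carrier (Sp A) = carrier (Sp B)" using Q(3) by simp
    obtain N i where N: "wa N" "i \<in> MF_hom e N A" "fst i ` carrier (Sp N) = kern (Sp A) (Sp B) (fst f)"
      using kernel_exists[OF w fh] by blast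
    have "is_cokernel ?C mzero N A i B f"
      by (rule is_cokernelI[OF wa_obj[OF N(1)] A w(2) N(2) fh surj wa_mor(1)[OF w hom_mor[OF A B fh]] N(3)[symmetric]])
    then show ?thesis using N(1,2) Obj by blast
  qed
  obtain Z :: "('s, 'v, 'K, 'w) filt_phi" where Z: "wa Z" "carrier (Sp Z) = {\<zero>\<^bsub>Sp Z\<^esub>}"
    using zero_obj by (elim exE conjE) assumption

  show ?thesis
    unfolding abelian_category_def
  proof (intro exI[of _ madd] exI[of _ mzero] conjI ballI allI impI)
    show "preadditive ?C madd mzero" by (rule preadditive_MF)
    show "\<exists>Z. zero_object ?C Z" by (rule exI, rule zero_obj_is_zero[OF Z])
    fix A B assume "A \<in> Obj ?C" "B \<in> Obj ?C"
    then have w: "wa A" "wa B" by (simp_all only: Obj)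
    show "\<exists>P i1 i2 p1 p2. biproduct ?C madd A B P i1 i2 p1 p2" by (rule biproduct_exists[OF inf w])
    show "\<exists>N i. is_kernel ?C mzero A B f N i" "\<exists>Q q. is_cokernel ?C mzero A B f Q q"
      if "f \<in> Hom ?C A B" for f
      using kers[OF w] that by (simp_all only: Hom)
    show "\<exists>D\<in>Obj ?C. \<exists>g\<in>Hom ?C B D. is_kernel ?C mzero B D g A f" if "monomorphism ?C A B f" for f
      using mono[OF w that] by (simp only: Hom)
    show "\<exists>D\<in>Obj ?C. \<exists>g\<in>Hom ?C D A. is_cokernel ?C mzero D A g B f" if "epimorphism ?C A B f" for f
      using epi[OF w that] by (simp only: Hom)
  qed
qed

end

text \<open>The powers of \<open>p\<close> have pairwise different valuations, so they are pairwise
  different, and the embedding of \<open>K\<^sub>*\<close> carries infinitude over to K.\<close>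

lemma (in padic_base) infinite_fields: "infinite (UNIV :: 's set)" "infinite (UNIV :: 'K set)"
proof -
  have inj: "inj (\<lambda>n. pp ^ n)"
    by (rule injI) (metis mult.right_neutral of_nat_eq_iff pp v_power)
  show "infinite (UNIV :: 's set)"
    using range_inj_infinite[OF inj] finite_subset[OF subset_UNIV] by blast
  then show "infinite (UNIV :: 'K set)"
  proof -
    interpret emb: field_hom emb by (rule emb_hom)
    have "inj emb" using emb.inj_f by simp
    then have "infinite (range emb)" using \<open>infinite (UNIV :: 's set)\<close> finite_imageD by blast
    then show ?thesis using finite_subset[OF subset_UNIV] by blast
  qed
qed

theorem theorem1p13:
  fixes p :: nat
    and W :: "'k0::field set"
    and red :: "'k0 \<Rightarrow> 'k::field"
    and emb0 :: "'k0 \<Rightarrow> 's::field"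
    and \<sigma> :: "'s \<Rightarrow> 's"
    and emb :: "'s \<Rightarrow> 'K::field"
    and ord :: "'K \<Rightarrow> real"
  assumes "padic_base p W red emb0 \<sigma> emb ord"
  shows
    "(\<forall>(V' :: ('s, 'v, 'K, 'w) filt_phi) V V'' S T.
        MF_short_exact \<sigma> emb V' V V'' S T \<longrightarrow>
          (weakly_admissible \<sigma> emb ord V' \<and> weakly_admissible \<sigma> emb ord V
             \<longrightarrow> weakly_admissible \<sigma> emb ord V'') \<and>
          (weakly_admissible \<sigma> emb ord V' \<and> weakly_admissible \<sigma> emb ord V''
             \<longrightarrow> weakly_admissible \<sigma> emb ord V) \<and>
          (weakly_admissible \<sigma> emb ord V \<and> weakly_admissible \<sigma> emb ord V''
             \<longrightarrow> weakly_admissible \<sigma> emb ord V')) \<and>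
     (\<forall>(V' :: ('s, 'v, 'K, 'w) filt_phi) V. \<forall>T \<in> Hom (MF \<sigma> emb) V' V.
        weakly_admissible \<sigma> emb ord V' \<and> weakly_admissible \<sigma> emb ord V \<longrightarrow>
          strict_hom V' V T \<and>
          weakly_admissible \<sigma> emb ord (MF_ker emb V' V T) \<and>
          weakly_admissible \<sigma> emb ord (MF_coker emb V' V T)) \<and>
     abelian_category (full_subcategory
       (MF \<sigma> emb :: (('s, 'v, 'K, 'w) filt_phi, ('v \<Rightarrow> 'v) \<times> ('w \<Rightarrow> 'w)) cat)
       (weakly_admissible \<sigma> emb ord))"
proof -
  interpret base: padic_base p W red emb0 \<sigma> emb ord by (rule assms)
  interpret mf_base \<sigma> emb ord
    by (intro mf_base.intro mf_base_axioms.intro base.norm_inv_v base.emb_hom)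
  show ?thesis
  proof (intro conjI)
    show "abelian_category (full_subcategory
       (MF \<sigma> emb :: (('s, 'v, 'K, 'w) filt_phi, ('v \<Rightarrow> 'v) \<times> ('w \<Rightarrow> 'w)) cat) wa)"
      by (rule abelian_wa[OF base.infinite_fields])
  next
    show "\<forall>(V' :: ('s, 'v, 'K, 'w) filt_phi) V V'' S T. MF_short_exact \<sigma> emb V' V V'' S T \<longrightarrow>
        (wa V' \<and> wa V \<longrightarrow> wa V'') \<and> (wa V' \<and> wa V'' \<longrightarrow> wa V) \<and> (wa V \<and> wa V'' \<longrightarrow> wa V')"
      by (rule allI)+ (rule impI, (intro conjI; erule wa_short_exact))
    show "\<forall>(V' :: ('s, 'v, 'K, 'w) filt_phi) V. \<forall>T\<in>Hom (MF \<sigma> emb) V' V. wa V' \<and> wa V \<longrightarrow>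
        strict_hom V' V T \<and> wa (MF_ker emb V' V T) \<and> wa (MF_coker emb V' V T)"
      unfolding MF_simps
      by (intro allI ballI impI, elim conjE) (intro conjI wa_strict_ker_coker)
  qed
qed

end
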